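(* Let $r\ge1$. Suppose that the $m$-stage Runge--Kutta method with coefficients $(a_{ij}),(b_i),(c_i)$ satisfies Assumption (P5) (stated in the context) and the collocation relations $$\sum_{i=1}^mb_ic_i^{l-1}=\frac1l,\quad l=1,\dots,p,\qquad \sum_{j=1}^ma_{ij}c_j^{l-1}=\frac{c_i^l}{l},\quad l=1,\dots,m,\ i=1,\dots,m,$$ for some integer $p\ge m$, and let $k=\min(p,m+1)$. Assume that $|u_0|\le\alpha$ and that the maximum principle $|u(x,t)|\le\alpha$ for all $(x,t)\in\Omega\times(0,T]$ holds, and assume that the starting values $u_h^l\in S_h^r$, $l=0,\dots,k-1$, are given and $$|u_h^l(x_j)|\le\alpha,\quad j=0,\dots,Mr,\quad l=0,\dots,k-1.$$ Then the fully discrete solution $u_h^n$ of the cut-off Runge--Kutta scheme described in the context satisfies $$|u_h^n(x_j)|\le\alpha,\quad j=0,\dots,Mr,\quad n=k,\dots,N,$$ and for $n=k,\dots,N$ $$\|u(t_n)-u_h^n\|_{L^2(\Omega)}\le C(\tau^k+h^{r+1})+C\sum_{l=0}^{k-1}\|u(t_l)-u_h^l\|_{L^2(\Omega)},$$ provided that $u\in C^{k+1}([0,T];H^1(\Omega))\cap C^1([0,T];H^{2r+2}(\Omega))$, $f$ is locally Lipschitz continuous, and $f(u)\in C^k([0,T];H^1(\Omega))\cap C([0,T];H^{2r+2}(\Omega))$. Here $C$ is a constant independent of $\tau$ and $h$.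
   Context: Allen--Cahn equation: $\Omega=[a,b]$, $T>0$, and $u$ solves $u_t=\Delta u+f(u)$ in $\Omega\times(0,T)$, $u(\cdot,0)=u_0$ in $\Omega$, with homogeneous Neumann condition $\partial_{\mathbf n}u=0$ on $\partial\Omega\times(0,T)$, where $f=-F'$ and $F$ is a double-well potential with two wells at $\pm\alpha$, $\alpha>0$ known. Space discretization: $a=x_0<x_1<\dots<x_{Mr}=b$ with uniform mesh size $h=x_{ir}-x_{(i-1)r}=(b-a)/M$, and $I_i=[x_{(i-1)r},x_{ir}]$. $S_h^r=\{v\in H^1(\Omega):v|_{I_i}\in P_r,\ i=1,\dots,M\}$, with $P_r$ the polynomials of degree $\le r$. For each $i$, $x_{(i-1)r+j}$ and $\omega_j$, $j=0,\dots,r$, are the points and weights of the $(r+1)$-point Gauss--Lobatto quadrature on $I_i$, and $(f,g)_h=\sum_{i=1}^M\sum_{j=0}^r\omega_jf(x_{(i-1)r+j})g(x_{(i-1)r+j})$. $\Pi_h:C(\overline\Omega)\to S_h^r$ is Lagrange interpolation at the nodes $x_0,\dots,x_{Mr}$. The discrete Laplacian $-\Delta_h:S_h^r\to S_h^r$ is defined by $(-\Delta_hv_h,w_h)_h=(\nabla v_h,\nabla w_h)$ for all $v_h,w_h\in S_h^r$, with $(\cdot,\cdot)$ the $L^2(\Omega)$ inner product. Time grid: $\tau=T/N$, $t_n=n\tau$. For given $n\ge k$, $L_\ell$, $\ell=1,\dots,k$, are the Lagrange basis polynomials of degree $k-1$ in time with $L_\ell(t_{n-i})=\delta_{i\ell}$,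 $i,\ell=1,\dots,k$. The Runge--Kutta method has coefficients $A=(a_{ij})_{i,j=1}^m$, weights $b_i$ and distinct quadrature points $c_i\in[0,1]$; $t_{ni}=t_{n-1}+c_i\tau$. Assumption (P5) (algebraic stability): (a) the matrix $A=(a_{ij})$ is invertible; (b) $b_i>0$ for $i=1,\dots,m$; (c) the symmetric matrix $\mathcal M\in\mathbb{R}^{m\times m}$ with entries $m_{ij}=b_ia_{ij}+b_ja_{ji}-b_ib_j$ is positive semidefinite. Cut-off Runge--Kutta scheme: for $n\ge k$, given $u_h^{n-k},\dots,u_h^{n-1}\in S_h^r$, find $\hat u_h^n\in S_h^r$ such that $$\dot u_h^{ni}=\Delta_hu_h^{ni}+\sum_{\ell=1}^kL_\ell(t_{n-1}+c_i\tau)\Pi_hf(u_h^{n-\ell}),\quad u_h^{ni}=u_h^{n-1}+\tau\sum_{j=1}^ma_{ij}\dot u_h^{nj},\quad i=1,\dots,m,$$ $$\hat u_h^n=u_h^{n-1}+\tau\sum_{i=1}^mb_i\dot u_h^{ni},$$ and then $u_h^n\in S_h^r$ is defined by $u_h^n(x_j)=\min(\max(\hat u_h^n(x_j),-\alpha),\alpha)$, $j=0,\dots,Mr$. *)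

theory Defs
  imports "HOL-Analysis.Analysis" "HOL-Computational_Algebra.Polynomial"
begin

text \<open>
  Functions on the space interval \<open>[a, b]\<close> have type \<open>real \<Rightarrow> real\<close>; their values outside
  \<open>[a, b]\<close> never matter. Space-time functions take the time argument first, so that \<open>u t\<close> is
  the function \<open>u(\<cdot>, t)\<close>.
\<close>

section \<open>Sobolev spaces on an interval\<close>

definition L2_space :: "real \<Rightarrow> real \<Rightarrow> (real \<Rightarrow> real) set" where
  "L2_space a b = {v \<in> borel_measurable (lebesgue_on {a..b}).
     integrable (lebesgue_on {a..b}) (\<lambda>x. (v x)\<^sup>2)}"

definition L2_inner :: "real \<Rightarrow> real \<Rightarrow> (real \<Rightarrow> real) \<Rightarrow> (real \<Rightarrow> real) \<Rightarrow> real" where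
  "L2_inner a b v w = (LINT x|lebesgue_on {a..b}. v x * w x)"

definition L2_norm :: "real \<Rightarrow> real \<Rightarrow> (real \<Rightarrow> real) \<Rightarrow> real" where
  "L2_norm a b v = sqrt (L2_inner a b v v)"

text \<open>The space of smooth functions with compact support in the open interval \<open>(a, b)\<close>.\<close>

definition test_function :: "real \<Rightarrow> real \<Rightarrow> (real \<Rightarrow> real) \<Rightarrow> bool" where
  "test_function a b \<phi> \<longleftrightarrow>
     (\<forall>n. (deriv ^^ n) \<phi> differentiable_on UNIV) \<and>
     (\<exists>c d. a < c \<and> c \<le> d \<and> d < b \<and> (\<forall>x. x \<notin> {c..d} \<longrightarrow> \<phi> x = 0))"

definition has_weak_deriv ::
  "real \<Rightarrow> real \<Rightarrow> nat \<Rightarrow> (real \<Rightarrow> real) \<Rightarrow> (real \<Rightarrow> real) \<Rightarrow> bool" where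
  "has_weak_deriv a b n v w \<longleftrightarrow> w \<in> L2_space a b \<and>
     (\<forall>\<phi>. test_function a b \<phi> \<longrightarrow>
        L2_inner a b v ((deriv ^^ n) \<phi>) = (- 1) ^ n * L2_inner a b w \<phi>)"

definition sobolev_space :: "real \<Rightarrow> real \<Rightarrow> nat \<Rightarrow> (real \<Rightarrow> real) set" where
  "sobolev_space a b s = {v \<in> L2_space a b. \<forall>n\<le>s. \<exists>w. has_weak_deriv a b n v w}"

text \<open>The weak derivative is unique up to a null set, so the choice is immaterial in integrals.\<close>

definition weak_deriv :: "real \<Rightarrow> real \<Rightarrow> nat \<Rightarrow> (real \<Rightarrow> real) \<Rightarrow> real \<Rightarrow> real" where
  "weak_deriv a b n v = (SOME w. has_weak_deriv a b n v w)"

definition sobolev_norm :: "real \<Rightarrow> real \<Rightarrow> nat \<Rightarrow> (real \<Rightarrow> real) \<Rightarrow> real" where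
  "sobolev_norm a b s v = sqrt (\<Sum>n\<le>s. (L2_norm a b (weak_deriv a b n v))\<^sup>2)"

text \<open>
  The space \<open>C\<^sup>j([0, T]; H\<^sup>s(a, b))\<close>: \<open>D i\<close> is the \<open>i\<close>-th time derivative, i.e. the limit
  of difference quotients in the norm of \<open>H\<^sup>s\<close> (one-sided at \<open>0\<close> and \<open>T\<close>), and \<open>D j\<close> is
  continuous. Continuity of the lower derivatives follows from their differentiability.
\<close>

definition Ck_sobolev ::
  "real \<Rightarrow> real \<Rightarrow> real \<Rightarrow> nat \<Rightarrow> nat \<Rightarrow> (real \<Rightarrow> real \<Rightarrow> real) \<Rightarrow> bool" where
  "Ck_sobolev a b T j s v \<longleftrightarrow>
     (\<exists>D :: nat \<Rightarrow> real \<Rightarrow> real \<Rightarrow> real.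
        (\<forall>t\<in>{0..T}. D 0 t = v t) \<and>
        (\<forall>i\<le>j. \<forall>t\<in>{0..T}. D i t \<in> sobolev_space a b s) \<and>
        (\<forall>i<j. \<forall>t\<in>{0..T}.
           ((\<lambda>\<sigma>. sobolev_norm a b s
               (\<lambda>x. (D i \<sigma> x - D i t x) / (\<sigma> - t) - D (Suc i) t x)) \<longlongrightarrow> 0)
             (at t within {0..T})) \<and>
        (\<forall>t\<in>{0..T}.
           ((\<lambda>\<sigma>. sobolev_norm a b s (\<lambda>x. D j \<sigma> x - D j t x)) \<longlongrightarrow> 0)
             (at t within {0..T})))"

section \<open>The Allen--Cahn equation\<close>

text \<open>The global minimum of a double-well potential is attained exactly at its two wells.\<close>

definition double_well :: "real \<Rightarrow> (real \<Rightarrow> real) \<Rightarrow> bool" where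
  "double_well \<alpha> F \<longleftrightarrow> {s. is_arg_min F (\<lambda>_. True) s} = {- \<alpha>, \<alpha>}"

text \<open>
  Joint continuity fixes the representative of \<open>u t\<close>, so that point values, in particular those
  at the initial time and on the boundary, are meaningful.
\<close>

definition allen_cahn_solution ::
  "real \<Rightarrow> real \<Rightarrow> real \<Rightarrow> (real \<Rightarrow> real) \<Rightarrow> (real \<Rightarrow> real) \<Rightarrow> (real \<Rightarrow> real \<Rightarrow> real) \<Rightarrow> bool" where
  "allen_cahn_solution a b T f u0 u \<longleftrightarrow>
     continuous_on ({0..T} \<times> {a..b}) (\<lambda>(t, x). u t x) \<and>
     (\<forall>t\<in>{0<..<T}. \<forall>x\<in>{a<..<b}.
        u t differentiable (at x) \<and> deriv (u t) differentiable (at x) \<and>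
        ((\<lambda>s. u s x) has_real_derivative deriv (deriv (u t)) x + f (u t x)) (at t)) \<and>
     (\<forall>x\<in>{a..b}. u 0 x = u0 x) \<and>
     (\<forall>t\<in>{0<..<T}. \<forall>x\<in>{a, b}. (u t has_real_derivative 0) (at x within {a..b}))"

definition locally_lipschitz :: "(real \<Rightarrow> real) \<Rightarrow> bool" where
  "locally_lipschitz f \<longleftrightarrow> (\<forall>s. \<exists>\<epsilon>>0. \<exists>L. L-lipschitz_on (cball s \<epsilon>) f)"

section \<open>Space discretization\<close>

text \<open>
  The \<open>(r+1)\<close>-point Gauss--Lobatto rule on \<open>[lo, hi]\<close>: both end points are prescribed nodes, and
  the remaining nodes and the weights give the maximal degree of exactness \<open>2r - 1\<close>.
\<close>

definition gauss_lobatto ::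
  "nat \<Rightarrow> real \<Rightarrow> real \<Rightarrow> (nat \<Rightarrow> real) \<Rightarrow> (nat \<Rightarrow> real) \<Rightarrow> bool" where
  "gauss_lobatto r lo hi y \<omega> \<longleftrightarrow>
     strict_mono_on {0..r} y \<and> y 0 = lo \<and> y r = hi \<and>
     (\<forall>q :: real poly. degree q \<le> 2 * r - 1 \<longrightarrow>
        (\<Sum>j=0..r. \<omega> j * poly q (y j)) = (LINT s|lebesgue_on {lo..hi}. poly q s))"

definition gauss_lobatto_mesh ::
  "real \<Rightarrow> real \<Rightarrow> nat \<Rightarrow> nat \<Rightarrow> (nat \<Rightarrow> real) \<Rightarrow> (nat \<Rightarrow> real) \<Rightarrow> bool" where
  "gauss_lobatto_mesh a b r M x \<omega> \<longleftrightarrow>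
     x 0 = a \<and> x (M * r) = b \<and> strict_mono_on {0..M * r} x \<and>
     (\<forall>i\<in>{1..M}. x (i * r) - x ((i - 1) * r) = (b - a) / real M) \<and>
     (\<forall>i\<in>{1..M}. gauss_lobatto r (x ((i - 1) * r)) (x (i * r)) (\<lambda>j. x ((i - 1) * r + j)) \<omega>)"

definition discrete_inner ::
  "nat \<Rightarrow> nat \<Rightarrow> (nat \<Rightarrow> real) \<Rightarrow> (nat \<Rightarrow> real) \<Rightarrow> (real \<Rightarrow> real) \<Rightarrow> (real \<Rightarrow> real) \<Rightarrow> real" where
  "discrete_inner r M x \<omega> v w =
     (\<Sum>i=1..M. \<Sum>j=0..r. \<omega> j * v (x ((i - 1) * r + j)) * w (x ((i - 1) * r + j)))"

definition fe_space ::
  "real \<Rightarrow> real \<Rightarrow> nat \<Rightarrow> nat \<Rightarrow> (nat \<Rightarrow> real) \<Rightarrow> (real \<Rightarrow> real) set" where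
  "fe_space a b r M x = {v \<in> sobolev_space a b 1.
     \<forall>i\<in>{1..M}. \<exists>q :: real poly. degree q \<le> r \<and>
       (\<forall>y\<in>{x ((i - 1) * r)..x (i * r)}. v y = poly q y)}"

text \<open>
  The elements selected in the next two definitions are unique as functions on \<open>[a, b]\<close>; only
  their irrelevant values outside \<open>[a, b]\<close> depend on the choice.
\<close>

definition lagrange_interp ::
  "real \<Rightarrow> real \<Rightarrow> nat \<Rightarrow> nat \<Rightarrow> (nat \<Rightarrow> real) \<Rightarrow> (real \<Rightarrow> real) \<Rightarrow> real \<Rightarrow> real" where
  "lagrange_interp a b r M x g =
     (SOME v. v \<in> fe_space a b r M x \<and> (\<forall>j\<le>M * r. v (x j) = g (x j)))"

definition discrete_laplacian ::
  "real \<Rightarrow> real \<Rightarrow> nat \<Rightarrow> nat \<Rightarrow> (nat \<Rightarrow> real) \<Rightarrow> (nat \<Rightarrow> real) \<Rightarrow> (real \<Rightarrow> real) \<Rightarrow> real \<Rightarrow> real" where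
  "discrete_laplacian a b r M x \<omega> v =
     (SOME z. z \<in> fe_space a b r M x \<and>
        (\<forall>w\<in>fe_space a b r M x.
           discrete_inner r M x \<omega> (\<lambda>y. - z y) w =
             L2_inner a b (weak_deriv a b 1 v) (weak_deriv a b 1 w)))"

section \<open>Runge--Kutta methods and the cut-off scheme\<close>

definition algebraically_stable :: "real^'m^'m \<Rightarrow> real^'m \<Rightarrow> bool" where
  "algebraically_stable A \<beta> \<longleftrightarrow>
     invertible A \<and> (\<forall>i. \<beta> $ i > 0) \<and>
     (\<forall>v. 0 \<le> v \<bullet>
        ((\<chi> i j. \<beta> $ i * A $ i $ j + \<beta> $ j * A $ j $ i - \<beta> $ i * \<beta> $ j) *v v))"

definition collocation_relations :: "nat \<Rightarrow> real^'m^'m \<Rightarrow> real^'m \<Rightarrow> real^'m \<Rightarrow> bool" where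
  "collocation_relations p A \<beta> c \<longleftrightarrow>
     (\<forall>l\<in>{1..p}. (\<Sum>i\<in>UNIV. \<beta> $ i * (c $ i) ^ (l - 1)) = 1 / real l) \<and>
     (\<forall>l\<in>{1..CARD('m)}. \<forall>i.
        (\<Sum>j\<in>UNIV. A $ i $ j * (c $ j) ^ (l - 1)) = (c $ i) ^ l / real l)"

text \<open>The Lagrange basis polynomial \<open>L\<^sub>\<ell>\<close> for the time nodes \<open>(n - i)\<tau>\<close>, \<open>i = 1, \<dots>, k\<close>.\<close>

definition lagrange_basis :: "nat \<Rightarrow> real \<Rightarrow> nat \<Rightarrow> nat \<Rightarrow> real \<Rightarrow> real" where
  "lagrange_basis k \<tau> n l s =
     (\<Prod>i\<in>{1..k} - {l}.
        (s - real (n - i) * \<tau>) / (real (n - l) * \<tau> - real (n - i) * \<tau>))"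

text \<open>
  In the following definition \<open>V i\<close> and \<open>W i\<close> are the stage value \<open>u\<^sub>h\<^sup>n\<^sup>i\<close> and its
  derivative; \<open>z\<close> is the solution before the cut-off.
\<close>

definition cutoff_rk_scheme ::
  "real \<Rightarrow> real \<Rightarrow> nat \<Rightarrow> nat \<Rightarrow> (nat \<Rightarrow> real) \<Rightarrow> (nat \<Rightarrow> real) \<Rightarrow> real \<Rightarrow> (real \<Rightarrow> real) \<Rightarrow>
   real^'m^'m \<Rightarrow> real^'m \<Rightarrow> real^'m \<Rightarrow> nat \<Rightarrow> real \<Rightarrow> nat \<Rightarrow> (nat \<Rightarrow> real \<Rightarrow> real) \<Rightarrow> bool" where
  "cutoff_rk_scheme a b r M x \<omega> \<alpha> f A \<beta> c k \<tau> N U \<longleftrightarrow>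
     (\<forall>n\<in>{k..N}. \<exists>(V :: 'm \<Rightarrow> real \<Rightarrow> real) (W :: 'm \<Rightarrow> real \<Rightarrow> real) z.
        (\<forall>i. V i \<in> fe_space a b r M x \<and> W i \<in> fe_space a b r M x) \<and>
        z \<in> fe_space a b r M x \<and>
        (\<forall>i. \<forall>y\<in>{a..b}. W i y = discrete_laplacian a b r M x \<omega> (V i) y +
           (\<Sum>l=1..k. lagrange_basis k \<tau> n l (real (n - 1) * \<tau> + c $ i * \<tau>) *
              lagrange_interp a b r M x (\<lambda>s. f (U (n - l) s)) y)) \<and>
        (\<forall>i. \<forall>y\<in>{a..b}. V i y = U (n - 1) y + \<tau> * (\<Sum>j\<in>UNIV. A $ i $ j * W j y)) \<and>
        (\<forall>y\<in>{a..b}. z y = U (n - 1) y + \<tau> * (\<Sum>i\<in>UNIV. \<beta> $ i * W i y)) \<and>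
        U n \<in> fe_space a b r M x \<and>
        (\<forall>j\<le>M * r. U n (x j) = min (max (z (x j)) (- \<alpha>)) \<alpha>))"

end

theory Submission
  imports Defs
begin

text \<open>
  The error is split through the nodal interpolant of the exact solution. Since that interpolant
  takes values in \<open>[-\<alpha>, \<alpha>]\<close> at the nodes, the cut-off does not increase the nodal error, hence
  neither the error in the discrete norm. For the uncut step, algebraic stability gives the energy
  inequality
  \<open>\<parallel>e\<^sup>n\<parallel>\<^sup>2 \<le> \<parallel>e\<^sup>n\<^sup>-\<^sup>1\<parallel>\<^sup>2 + 2\<tau> \<Sum>\<^sub>i b\<^sub>i (\<partial>e\<^sub>i, e\<^sub>i - \<eta>\<^sub>i)\<close>
  already at each node. Testing the stage equation with \<open>e\<^sub>i - \<eta>\<^sub>i\<close> produces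
  \<open>-\<parallel>\<nabla>e\<^sub>i\<parallel>\<^sup>2\<close>, which absorbs the stage defects \<open>\<eta>\<^sub>i\<close> in \<open>H\<^sup>1\<close> (this is why the low stage order
  suffices) and the spatial truncation error, which is of order \<open>h\<^sup>r\<^sup>+\<^sup>1\<close> only when tested against
  \<open>H\<^sup>1\<close> functions. The stages themselves are controlled by Poincare's inequality, because testing
  with the constant \<open>1\<close> bounds their means. A discrete Gronwall argument concludes. The regularity of
  the solution enters through one-dimensional Sobolev embeddings, which turn the weak derivatives
  into classical ones except for the last.
\<close>

section \<open>Weak derivatives on an interval\<close>

text \<open>The data are weak: Sobolev membership is tested against smooth functions, weak
  derivatives are chosen up to null sets, and time derivatives are limits in Sobolev norms. Bounded
  linear functionals (a point value of a continuous representative, or an inner product with a fixed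
  function) turn them into real functions of time, and scalar Taylor expansion then yields all
  defects in time. The second obstacle is uniformity: the constant must be fixed before the mesh.
  Gauss--Lobatto rules are therefore shown to be unique up to affine maps, so that the mesh
  constants come from one rule on [0, 1]. The orders in time match as follows. The stage relations
  are used up to degree \<open>k - 1\<close>, which leaves defects of order
  \<open>\<tau> ^ k\<close>; the weights are used up to degree \<open>k\<close>. In the squared
  energy a stage defect enters as \<open>\<tau> * (\<tau> ^ k)^2\<close> per step, so about
  \<open>1 / \<tau>\<close> steps still give order \<open>\<tau> ^ k\<close> in the norm. The
  nonlinearity is extrapolated from earlier values, so the recursion is explicit and the Gronwall
  argument does not restrict \<tau>.\<close>

lemma smooth_coinduct:
  fixes S :: "(real \<Rightarrow> real) set"
  assumes "f \<in> S" and S: "\<And>g. g \<in> S \<Longrightarrow> \<exists>g'\<in>S. \<forall>x. (g has_real_derivative g' x) (at x)"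
  shows "(deriv ^^ n) f differentiable_on UNIV"
proof -
  have D: "deriv g \<in> S \<and> g differentiable_on UNIV" if g: "g \<in> S" for g
  proof -
    obtain g' where g': "g' \<in> S" "\<forall>x. (g has_real_derivative g' x) (at x)" using S[OF g] by blast
    then have "deriv g = g'" by (auto intro: DERIV_imp_deriv)
    then show ?thesis using g' by (auto simp: differentiable_on_def real_differentiable_def)
  qed
  have "(deriv ^^ n) f \<in> S"
    by (induction n) (use \<open>f \<in> S\<close> D in auto)
  then show ?thesis using D by blast
qed

text \<open>A polynomial factor in \<open>1 / x\<close> makes the family around
  \<open>exp (- (1 / x))\<close> closed under differentiation: in the variable
  \<open>y = 1 / x\<close> the derivative replaces \<open>p\<close> by
  \<open>y^2 * (p - p')\<close>.\<close>

definition bump_base :: "real poly \<Rightarrow> real \<Rightarrow> real" where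
  "bump_base p x = (if x > 0 then poly p (1 / x) * exp (- (1 / x)) else 0)"

lemma poly_exp_tendsto_0: "((\<lambda>y. poly p y * exp (- y)) \<longlongrightarrow> (0::real)) at_top"
proof -
  have "((\<lambda>y::real. \<Sum>i\<le>degree p. coeff p i * (y ^ i / exp y)) \<longlongrightarrow> (\<Sum>i\<le>degree p. coeff p i * 0)) at_top"
    by (intro tendsto_sum tendsto_mult tendsto_const tendsto_power_div_exp_0)
  moreover have "(\<Sum>i\<le>degree p. coeff p i * (y ^ i / exp y)) = poly p y * exp (- y)" for y :: real
    by (simp add: poly_altdef sum_distrib_right exp_minus divide_inverse mult.assoc)
  ultimately show ?thesis by simp
qed

lemma bump_base_tendsto_0: "(bump_base p \<longlongrightarrow> 0) (at 0)"
proof (subst filterlim_at_split, intro conjI)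
  have "\<forall>\<^sub>F x in at_left (0::real). bump_base p x = 0"
    by (auto simp: eventually_at_filter bump_base_def)
  then show "(bump_base p \<longlongrightarrow> 0) (at_left 0)" by (rule tendsto_eventually)
  have "((\<lambda>x. poly p (inverse x) * exp (- inverse x)) \<longlongrightarrow> 0) (at_right 0)"
    using poly_exp_tendsto_0 filterlim_inverse_at_top_right by (rule filterlim_compose)
  moreover have "\<forall>\<^sub>F x in at_right (0::real). poly p (inverse x) * exp (- inverse x) = bump_base p x"
    by (auto simp: eventually_at_filter bump_base_def divide_simps)
  ultimately show "(bump_base p \<longlongrightarrow> 0) (at_right 0)"
    by (rule Lim_transform_eventually)
qed

lemma bump_base_deriv:
  "(bump_base p has_real_derivative bump_base ([:0, 0, 1:] * (p - pderiv p)) x) (at x)"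
proof -
  consider "x > 0" | "x < 0" | "x = 0" by linarith
  then show ?thesis
  proof cases
    case 1
    have "((\<lambda>x. poly p (1 / x) * exp (- (1 / x))) has_real_derivative
       bump_base ([:0, 0, 1:] * (p - pderiv p)) x) (at x)"
      using 1
      by (auto intro!: derivative_eq_intros poly_DERIV[THEN DERIV_chain2]
        simp: bump_base_def field_simps power2_eq_square)
    moreover have "\<forall>\<^sub>F y in nhds x. y > 0" using 1 by (rule order_tendstoD[OF filterlim_ident])
    then have "\<forall>\<^sub>F y in nhds x. poly p (1 / y) * exp (- (1 / y)) = bump_base p y"
      by eventually_elim (auto simp: bump_base_def)
    ultimately show ?thesis by (subst (asm) DERIV_cong_ev) (auto simp: )
  next
    case 2
    have "\<forall>\<^sub>F y in nhds x. y < 0" using 2 by (rule order_tendstoD[OF filterlim_ident])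
    then have "\<forall>\<^sub>F y in nhds x. 0 = bump_base p y"
      by eventually_elim (auto simp: bump_base_def)
    moreover have "((\<lambda>x. 0) has_real_derivative bump_base ([:0, 0, 1:] * (p - pderiv p)) x) (at x)"
      using 2 by (auto simp: bump_base_def)
    ultimately show ?thesis by (subst (asm) DERIV_cong_ev) auto
  next
    case 3
    \<comment> \<open>Dividing by \<open>y\<close> multiplies the polynomial in \<open>1 / y\<close>
      by its variable, so the derivative at 0 is one more instance of
      \<open>bump_base_tendsto_0\<close>.\<close>
    have "(bump_base p y - bump_base p 0) / y = bump_base (pCons 0 p) y" for y
      by (auto simp: bump_base_def)
    moreover have "bump_base ([:0, 0, 1:] * (p - pderiv p)) 0 = 0" by (simp add: bump_base_def)
    ultimately show ?thesis using bump_base_tendsto_0[of "pCons 0 p"] 3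
      unfolding has_field_derivative_iff by simp
  qed
qed

text \<open>Affine arguments and products serve for two-sided cut-offs; sums come in through the
  product rule. Closure under derivatives then gives smoothness by \<open>smooth_coinduct\<close>,
  without any formula for higher derivatives.\<close>

inductive_set bumps :: "(real \<Rightarrow> real) set" where
  base: "(\<lambda>x. bump_base p (s * x + t)) \<in> bumps"
| add: "f \<in> bumps \<Longrightarrow> g \<in> bumps \<Longrightarrow> (\<lambda>x. f x + g x) \<in> bumps"
| mult: "f \<in> bumps \<Longrightarrow> g \<in> bumps \<Longrightarrow> (\<lambda>x. f x * g x) \<in> bumps"

lemma bumps_deriv:
  "g \<in> bumps \<Longrightarrow> \<exists>g'\<in>bumps. \<forall>x. (g has_real_derivative g' x) (at x)"
proof (induction rule: bumps.induct)
  case (base p s t)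
  let ?q = "smult s ([:0, 0, 1:] * (p - pderiv p))"
  have "((\<lambda>x. bump_base p (s * x + t)) has_real_derivative bump_base ?q (s * x + t)) (at x)" for x
    by (rule DERIV_cong[OF DERIV_chain2[OF bump_base_deriv]])
      (auto intro!: derivative_eq_intros simp: bump_base_def)
  then show ?case using bumps.base[of ?q s t]
    by (intro bexI[where x="\<lambda>x. bump_base ?q (s * x + t)"]) auto
next
  case (add f g)
  then obtain f' g' where *: "f' \<in> bumps" "\<forall>x. (f has_real_derivative f' x) (at x)"
     "g' \<in> bumps" "\<forall>x. (g has_real_derivative g' x) (at x)" by blast
  show ?case
    by (rule bexI[where x="\<lambda>x. f' x + g' x"]) (use * in \<open>auto intro!: derivative_eq_intros bumps.intros\<close>)
next
  case (mult f g)
  then obtain f' g' where *: "f' \<in> bumps" "\<forall>x. (f has_real_derivative f' x) (at x)"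
     "g' \<in> bumps" "\<forall>x. (g has_real_derivative g' x) (at x)" by blast
  have "((\<lambda>x. f x * g x) has_real_derivative (f x * g' x + f' x * g x)) (at x)" for x
    using * by (auto intro!: derivative_eq_intros)
  moreover have "(\<lambda>x. f x * g' x + f' x * g x) \<in> bumps" using * mult by (intro bumps.intros)
  ultimately show ?case by (intro bexI[where x="\<lambda>x. f x * g' x + f' x * g x"]) auto
qed

text \<open>As \<open>n\<close> grows these functions tend to the indicator of the open interval
  from \<open>c\<close> to \<open>d\<close>. For \<open>n <= 0\<close> the two factors are never
  positive together, so the product is the zero function; this covers the index 0 of the
  sequence.\<close>

lemma test_function_bump:
  assumes "a < c" "c < d" "d < b"
  shows "test_function a b (\<lambda>x. bump_base 1 (n * (x - c)) * bump_base 1 (n * (d - x)))"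
proof (cases "n > 0")
  case True
  have "(\<lambda>x. bump_base 1 (n * x + (- n * c)) * bump_base 1 ((- n) * x + n * d)) \<in> bumps"
    by (intro bumps.intros)
  then have "(\<lambda>x. bump_base 1 (n * (x - c)) * bump_base 1 (n * (d - x))) \<in> bumps"
    by (simp add: algebra_simps)
  then have "(deriv ^^ m) (\<lambda>x. bump_base 1 (n * (x - c)) * bump_base 1 (n * (d - x))) differentiable_on UNIV" for m
    by (rule smooth_coinduct) (rule bumps_deriv)
  moreover have "bump_base 1 (n * (x - c)) * bump_base 1 (n * (d - x)) = 0" if "x \<notin> {c..d}" for x
    using that True by (auto simp: bump_base_def zero_less_mult_iff)
  ultimately show ?thesis using assms unfolding test_function_def
    by (intro conjI allI exI[where x=c] exI[where x=d]) auto
next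
  case False
  have z: "(\<lambda>x. bump_base 1 (n * (x - c)) * bump_base 1 (n * (d - x))) = (\<lambda>x. 0)"
    using False assms by (auto simp: bump_base_def fun_eq_iff zero_less_mult_iff)
  have "(deriv ^^ m) (\<lambda>x::real. 0::real) differentiable_on UNIV" for m
    by (rule smooth_coinduct[where S="{\<lambda>x. 0}"]) (auto intro!: derivative_eq_intros)
  then show ?thesis using assms unfolding z test_function_def
    by (intro conjI allI exI[where x=c] exI[where x=d]) auto
qed

section \<open>The fundamental lemma of the calculus of variations\<close>

lemma AE_lebesgue_on_interval:
  assumes "negligible N" "\<And>x. x \<in> {a..b::real} - N \<Longrightarrow> P x"
  shows "AE x in lebesgue_on {a..b}. P x"
proof -
  have "AE x in lebesgue. x \<notin> N" using assms(1) by (simp add: AE_not_in negligible_iff_null_sets)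
  then have "AE x in lebesgue. x \<in> {a..b} \<longrightarrow> P x" using assms(2) by (auto elim!: eventually_mono)
  then show ?thesis by (simp add: AE_restrict_space_iff)
qed

lemma integral_lebesgue_on_restrict:
  fixes z :: "real \<Rightarrow> real"
  assumes z: "integrable (lebesgue_on {a..b}) z" and "a \<le> c" "d \<le> b"
  shows "(LINT x|lebesgue_on {a..b}. (if x \<in> {c..d} then z x else 0)) = integral {c..d} z"
    and "integrable (lebesgue_on {c..d}) z"
proof -
  show i: "integrable (lebesgue_on {c..d}) z"
    using integrable_subinterval[OF z] assms by simp
  have "{c..d} \<inter> {a..b} = {c..d}" using assms by auto
  then have "(LINT x|lebesgue_on {a..b}. (if x \<in> {c..d} then z x else 0)) = (LINT x|lebesgue_on {c..d}. z x)"
    by (subst Lebesgue_Measure.integral_restrict_Int) auto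
  also have "\<dots> = integral {c..d} z" using i by (intro lebesgue_integral_eq_integral) auto
  finally show "(LINT x|lebesgue_on {a..b}. (if x \<in> {c..d} then z x else 0)) = integral {c..d} z" .
qed

lemma ident_measurable_lebesgue_on [measurable]: "(\<lambda>x. x) \<in> borel_measurable (lebesgue_on S)"
  using id_borel_measurable_lebesgue_on[of S] by (simp add: id_def)

lemma bump_limit: "(\<lambda>n. bump_base 1 (real n * x)) \<longlonglongrightarrow> (if x > 0 then 1 else 0)"
proof (cases "x > 0")
  case True
  have "(\<lambda>n. exp (- (inverse x * (1 / real n)))) \<longlonglongrightarrow> exp (- (inverse x * 0))"
    by (intro tendsto_intros lim_1_over_n)
  moreover have "\<forall>\<^sub>F n in sequentially. exp (- (inverse x * (1 / real n))) = bump_base 1 (real n * x)"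
    using eventually_gt_at_top[of 0] by eventually_elim (use True in \<open>auto simp: bump_base_def divide_simps\<close>)
  ultimately show ?thesis using True by (simp add: tendsto_cong)
next
  case False
  then have "bump_base 1 (real n * x) = 0" for n by (auto simp: bump_base_def zero_less_mult_iff)
  then show ?thesis using False by simp
qed

lemma bump_base_1_bounds: "0 \<le> bump_base 1 x" "bump_base 1 x \<le> 1"
  by (auto simp: bump_base_def)

lemma continuous_bump_base: "continuous_on S (bump_base p)"
  using bump_base_deriv by (meson DERIV_isCont continuous_at_imp_continuous_on)

text \<open>Dominated convergence along products of bumps, which are bounded by 1 and converge to
  the indicator of the open interval; the two end points form a null set.\<close>

lemma orthogonal_imp_integral_0:
  assumes z: "integrable (lebesgue_on {a..b}) z"
    and 0: "\<And>\<phi>. test_function a b \<phi> \<Longrightarrow> (LINT x|lebesgue_on {a..b}. z x * \<phi> x) = 0"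
    and cd: "a < c" "c < d" "d < b"
  shows "integral {c..d} z = 0"
proof -
  let ?\<psi> = "\<lambda>n x. bump_base 1 (real n * (x - c)) * bump_base 1 (real n * (d - x))"
  have zm: "z \<in> borel_measurable (lebesgue_on {a..b})" using z by simp
  have "(\<lambda>n. LINT x|lebesgue_on {a..b}. z x * ?\<psi> n x) \<longlonglongrightarrow>
        (LINT x|lebesgue_on {a..b}. z x * ((if x - c > 0 then 1 else 0) * (if d - x > 0 then 1 else 0)))"
  proof (rule integral_dominated_convergence[where w="\<lambda>x. \<bar>z x\<bar>"])
    show "(\<lambda>x. z x * ((if x - c > 0 then 1 else 0) * (if d - x > 0 then 1 else 0))) \<in> borel_measurable (lebesgue_on {a..b})"
      using zm by measurable
    have "continuous_on {a..b} (?\<psi> n)" for n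
      by (intro continuous_intros continuous_on_compose2[OF continuous_bump_base[of UNIV]]) auto
    then have "?\<psi> n \<in> borel_measurable (lebesgue_on {a..b})" for n
      by (intro continuous_imp_measurable_on_sets_lebesgue) auto
    then show "(\<lambda>x. z x * ?\<psi> n x) \<in> borel_measurable (lebesgue_on {a..b})" for n
      using zm by (rule borel_measurable_times[rotated])
    show "integrable (lebesgue_on {a..b}) (\<lambda>x. \<bar>z x\<bar>)" using z by simp
    show "AE x in lebesgue_on {a..b}. (\<lambda>n. z x * ?\<psi> n x) \<longlonglongrightarrow>
        z x * ((if x - c > 0 then 1 else 0) * (if d - x > 0 then 1 else 0))"
      by (rule AE_I2) (rule tendsto_mult[OF tendsto_const tendsto_mult[OF bump_limit bump_limit]])
    have "\<bar>?\<psi> n x\<bar> \<le> 1" for n x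
      using mult_mono[OF bump_base_1_bounds(2) bump_base_1_bounds(2), of "real n * (x - c)" "real n * (d - x)"]
        bump_base_1_bounds(1) by (auto simp: abs_mult mult.commute)
    then have "\<bar>z x\<bar> * \<bar>?\<psi> n x\<bar> \<le> \<bar>z x\<bar>" for n x by (rule mult_left_le) simp
    then show "AE x in lebesgue_on {a..b}. norm (z x * ?\<psi> n x) \<le> \<bar>z x\<bar>" for n
      unfolding real_norm_def abs_mult[of "z _"] by (rule AE_I2)
  qed
  moreover have "(LINT x|lebesgue_on {a..b}. z x * ?\<psi> n x) = 0" for n
    by (rule 0) (rule test_function_bump[OF cd])
  ultimately have "(\<lambda>n. 0) \<longlonglongrightarrow> (LINT x|lebesgue_on {a..b}. z x * ((if x - c > 0 then 1 else 0) * (if d - x > 0 then 1 else 0)))"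
    by (simp only:)
  then have "(LINT x|lebesgue_on {a..b}. z x * ((if x - c > 0 then 1 else 0) * (if d - x > 0 then 1 else 0))) = 0"
    by (rule LIMSEQ_unique[OF _ tendsto_const])
  moreover have "(LINT x|lebesgue_on {a..b}. z x * ((if x - c > 0 then 1 else 0) * (if d - x > 0 then 1 else 0)))
     = (LINT x|lebesgue_on {a..b}. (if x \<in> {c..d} then z x else 0))"
  proof (rule integral_cong_AE)
    show "(\<lambda>x. z x * ((if x - c > 0 then 1 else 0) * (if d - x > 0 then 1 else 0))) \<in> borel_measurable (lebesgue_on {a..b})"
      using zm by measurable
    show "(\<lambda>x. if x \<in> {c..d} then z x else 0) \<in> borel_measurable (lebesgue_on {a..b})"
      using zm by measurable
    show "AE x in lebesgue_on {a..b}. z x * ((if x - c > 0 then 1 else 0) * (if d - x > 0 then 1 else 0)) =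
        ((if x \<in> {c..d} then z x else 0))"
      by (rule AE_lebesgue_on_interval[where N="{c, d}"]) auto
  qed
  ultimately show ?thesis using integral_lebesgue_on_restrict(1)[OF z, of c d] cd by simp
qed

text \<open>Lebesgue differentiation: off a null set \<open>z x\<close> is the limit of the means of
  \<open>z\<close> over intervals from \<open>x\<close> to \<open>x + h\<close>, and these means
  vanish.\<close>

lemma subintervals_0_imp_AE_0:
  fixes z :: "real \<Rightarrow> real"
  assumes z: "integrable (lebesgue_on {a..b}) z"
    and 0: "\<And>c d. a < c \<Longrightarrow> c < d \<Longrightarrow> d < b \<Longrightarrow> integral {c..d} z = 0"
  shows "AE x in lebesgue_on {a..b}. z x = 0"
proof -
  define Z where "Z x = (if x \<in> {a..b} then z x else 0)" for x
  have "z absolutely_integrable_on {a..b}" using z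
    unfolding set_integrable_def by (subst (asm) integrable_restrict_space) auto
  then have "Z absolutely_integrable_on UNIV"
    unfolding Z_def by (subst absolutely_integrable_restrict_UNIV)
  then have "Z integrable_on cbox c d" for c d
    by (meson integrable_on_subcbox subset_UNIV set_lebesgue_integral_eq_integral(1))
  then obtain N where N: "negligible N"
    "\<And>x e. x \<notin> N \<Longrightarrow> 0 < e \<Longrightarrow>
      \<exists>d>0. \<forall>h. 0 < h \<and> h < d \<longrightarrow> norm (integral (cbox x (x + h *\<^sub>R One)) Z /\<^sub>R h ^ DIM(real) - Z x) < e"
    using integrable_ccontinuous_explicit[of Z] by blast
  show ?thesis
  proof (rule AE_lebesgue_on_interval)
    show "negligible (N \<union> {a, b})" using N by auto
    fix x assume x: "x \<in> {a..b} - (N \<union> {a, b})"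
    show "z x = 0"
    proof (rule ccontr)
      assume "z x \<noteq> 0"
      then have "Z x \<noteq> 0" using x by (auto simp: Z_def)
      then obtain d where d: "d > 0" "\<And>h. 0 < h \<and> h < d \<Longrightarrow> norm (integral (cbox x (x + h *\<^sub>R One)) Z /\<^sub>R h ^ DIM(real) - Z x) < \<bar>Z x\<bar>"
        using N(2)[of x "\<bar>Z x\<bar>"] x by auto
      \<comment> \<open>Half the minimum keeps \<open>h < d\<close> and \<open>x + h < b\<close>
        strict, so that the hypothesis on inner subintervals applies.\<close>
      define h where "h = min d (b - x) / 2"
      have h: "0 < h" "h < d" "x + h < b" "a < x" using x d by (auto simp: h_def min_def field_simps)
      have "integral {x..x + h} Z = integral {x..x + h} z"
        by (rule Henstock_Kurzweil_Integration.integral_cong) (use h in \<open>auto simp: Z_def\<close>)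
      also have "\<dots> = 0" using h by (intro 0) auto
      finally show False using d(2)[of h] h by simp
    qed
  qed
qed

lemma fundamental_lemma:
  fixes z :: "real \<Rightarrow> real"
  assumes z: "integrable (lebesgue_on {a..b}) z"
    and 0: "\<And>\<phi>. test_function a b \<phi> \<Longrightarrow> (LINT x|lebesgue_on {a..b}. z x * \<phi> x) = 0"
  shows "AE x in lebesgue_on {a..b}. z x = 0"
  by (rule subintervals_0_imp_AE_0[OF z orthogonal_imp_integral_0[OF z 0]])

subsection \<open>Square-integrable functions\<close>

lemma L2_integrable_mult:
  assumes "v \<in> L2_space a b" "w \<in> L2_space a b"
  shows "integrable (lebesgue_on {a..b}) (\<lambda>x. v x * w x)"
proof (rule Bochner_Integration.integrable_bound)
  show "integrable (lebesgue_on {a..b}) (\<lambda>x. (v x)\<^sup>2 + (w x)\<^sup>2)"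
    using assms by (auto simp: L2_space_def)
  show "(\<lambda>x. v x * w x) \<in> borel_measurable (lebesgue_on {a..b})"
    using assms by (auto simp: L2_space_def)
  have "norm (s * t) \<le> norm (s\<^sup>2 + t\<^sup>2)" for s t :: real
  proof -
    have "0 \<le> (\<bar>s\<bar> - \<bar>t\<bar>)\<^sup>2" by simp
    then have "2 * (\<bar>s\<bar> * \<bar>t\<bar>) \<le> s\<^sup>2 + t\<^sup>2" by (simp add: power2_eq_square algebra_simps)
    moreover have "0 \<le> \<bar>s\<bar> * \<bar>t\<bar>" by simp
    ultimately have "\<bar>s\<bar> * \<bar>t\<bar> \<le> s\<^sup>2 + t\<^sup>2" by linarith
    then show ?thesis by (simp add: abs_mult)
  qed
  then show "AE x in lebesgue_on {a..b}. norm (v x * w x) \<le> norm ((v x)\<^sup>2 + (w x)\<^sup>2)" by simp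
qed

lemma bounded_L2:
  assumes "v \<in> borel_measurable (lebesgue_on {a..b})" "\<And>x. x \<in> {a..b} \<Longrightarrow> \<bar>v x\<bar> \<le> B"
  shows "v \<in> L2_space a b"
proof -
  have "integrable (lebesgue_on {a..b}) (\<lambda>x. (v x)\<^sup>2)"
  proof (rule Bochner_Integration.integrable_bound)
    show "integrable (lebesgue_on {a..b}) (\<lambda>x. B\<^sup>2)"
      by (rule continuous_imp_integrable_real) (rule continuous_on_const)
    show "(\<lambda>x. (v x)\<^sup>2) \<in> borel_measurable (lebesgue_on {a..b})" using assms by measurable
    show "AE x in lebesgue_on {a..b}. norm ((v x)\<^sup>2) \<le> norm (B\<^sup>2)"
    proof (rule AE_I2)
      fix x assume "x \<in> space (lebesgue_on {a..b})"
      then have "x \<in> {a..b}" by simp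
      then show "norm ((v x)\<^sup>2) \<le> norm (B\<^sup>2)"
        using assms(2)[of x] abs_le_square_iff[of "v x" B] by auto
    qed
  qed
  then show ?thesis using assms by (simp add: L2_space_def)
qed

lemma continuous_L2: "continuous_on {a..b} v \<Longrightarrow> v \<in> L2_space a b"
proof -
  assume c: "continuous_on {a..b} v"
  then have "bounded (v ` {a..b})" by (intro compact_imp_bounded compact_continuous_image) auto
  then obtain B where "\<forall>x\<in>{a..b}. \<bar>v x\<bar> \<le> B" by (auto simp: bounded_iff)
  then show ?thesis using c
    by (intro bounded_L2[of v a b B] continuous_imp_measurable_on_sets_lebesgue) auto
qed

lemma L2_integrable: "v \<in> L2_space a b \<Longrightarrow> integrable (lebesgue_on {a..b}) v"
  using L2_integrable_mult[of v a b "\<lambda>x. 1"] continuous_L2[of a b "\<lambda>x. 1"] by simp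

lemma L2_linear:
  assumes "v \<in> L2_space a b" "w \<in> L2_space a b"
  shows "(\<lambda>x. s * v x + t * w x) \<in> L2_space a b"
proof -
  have "integrable (lebesgue_on {a..b}) (\<lambda>x. s\<^sup>2 * (v x)\<^sup>2 + 2 * s * t * (v x * w x) + t\<^sup>2 * (w x)\<^sup>2)"
    using L2_integrable_mult[OF assms] assms by (auto simp: L2_space_def)
  then have "integrable (lebesgue_on {a..b}) (\<lambda>x. (s * v x + t * w x)\<^sup>2)"
    by (simp add: power2_eq_square algebra_simps)
  then show ?thesis using assms by (auto simp: L2_space_def)
qed

lemma L2_add: "v \<in> L2_space a b \<Longrightarrow> w \<in> L2_space a b \<Longrightarrow> (\<lambda>x. v x + w x) \<in> L2_space a b"
  using L2_linear[of v a b w 1 1] by simp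

lemma L2_diff: "v \<in> L2_space a b \<Longrightarrow> w \<in> L2_space a b \<Longrightarrow> (\<lambda>x. v x - w x) \<in> L2_space a b"
  using L2_linear[of v a b w 1 "-1"] by simp

lemma L2_abs: "v \<in> L2_space a b \<Longrightarrow> (\<lambda>x. \<bar>v x\<bar>) \<in> L2_space a b"
  by (auto simp: L2_space_def)

lemma L2_subinterval:
  assumes "v \<in> L2_space a b" "a \<le> c" "d \<le> b"
  shows "v \<in> L2_space c d"
proof -
  have i: "integrable (lebesgue_on {c..d}) (\<lambda>x. (v x)\<^sup>2)" "integrable (lebesgue_on {c..d}) v"
    using assms L2_integrable[OF assms(1)]
    by (auto intro!: integral_lebesgue_on_restrict(2)[of a b] simp: L2_space_def)
  then show ?thesis by (simp add: L2_space_def)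
qed

lemma L2_inner_eq_integral:
  assumes "v \<in> L2_space a b" "w \<in> L2_space a b"
  shows "L2_inner a b v w = integral {a..b} (\<lambda>x. v x * w x)"
  unfolding L2_inner_def by (rule lebesgue_integral_eq_integral[OF L2_integrable_mult[OF assms]]) simp

lemma L2_inner_linear:
  assumes "v \<in> L2_space a b" "w \<in> L2_space a b" "z \<in> L2_space a b"
  shows "L2_inner a b (\<lambda>x. s * v x + t * w x) z = s * L2_inner a b v z + t * L2_inner a b w z"
  unfolding L2_inner_def using L2_integrable_mult[OF assms(1,3)] L2_integrable_mult[OF assms(2,3)]
  by (simp add: distrib_right mult.assoc)

lemma L2_inner_commute: "L2_inner a b v w = L2_inner a b w v"
  by (simp add: L2_inner_def mult.commute)

lemma L2_inner_self_nonneg: "0 \<le> L2_inner a b v v"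
  unfolding L2_inner_def by (rule Bochner_Integration.integral_nonneg_AE) simp

lemma L2_norm_nonneg: "0 \<le> L2_norm a b v"
  by (simp add: L2_norm_def L2_inner_self_nonneg)

lemma L2_norm_power2: "(L2_norm a b v)\<^sup>2 = L2_inner a b v v"
  by (simp add: L2_norm_def L2_inner_self_nonneg)

text \<open>The common core of Cauchy--Schwarz for the L2 inner product and for the discrete one.
  Only semidefiniteness is used, hence the separate case \<open>r = 0\<close>.\<close>

lemma discriminant_bound:
  fixes p q r :: real
  assumes "\<And>t. 0 \<le> p + 2 * t * q + t\<^sup>2 * r" "0 \<le> p" "0 \<le> r"
  shows "\<bar>q\<bar> \<le> sqrt p * sqrt r"
proof -
  have "q\<^sup>2 \<le> p * r"
  proof (cases "r = 0")
    case True
    have "q = 0"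
    proof (rule ccontr)
      assume "q \<noteq> 0"
      \<comment> \<open>For \<open>r = 0\<close> this \<open>t\<close> gives the expression
        \<open>p + 2 * t * q\<close> the value -1.\<close>
      then show False using assms(1)[of "- (p + 1) / (2 * q)"] True by (simp add: field_simps)
    qed
    then show ?thesis using True by simp
  next
    case False
    then have "0 < r" using assms by simp
    have "0 \<le> r * (p + 2 * (- q / r) * q + (- q / r)\<^sup>2 * r)"
      using assms(1)[of "- q / r"] assms(3) by (rule mult_nonneg_nonneg[rotated])
    also have "\<dots> = p * r - q\<^sup>2" using \<open>0 < r\<close> by (simp add: field_simps power2_eq_square)
    finally show ?thesis by simp
  qed
  then have "sqrt (q\<^sup>2) \<le> sqrt (p * r)" by (rule real_sqrt_le_mono)
  then show ?thesis by (simp add: real_sqrt_mult)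
qed

lemma L2_Cauchy_Schwarz:
  assumes "v \<in> L2_space a b" "w \<in> L2_space a b"
  shows "\<bar>L2_inner a b v w\<bar> \<le> L2_norm a b v * L2_norm a b w"
  unfolding L2_norm_def
proof (rule discriminant_bound)
  fix t
  have "L2_inner a b (\<lambda>x. 1 * v x + t * w x) (\<lambda>x. 1 * v x + t * w x) =
    L2_inner a b v v + 2 * t * L2_inner a b v w + t\<^sup>2 * L2_inner a b w w"
    using L2_inner_linear[OF assms L2_linear[OF assms], of 1 t 1 t]
      L2_inner_linear[OF assms assms(1), of 1 t] L2_inner_linear[OF assms assms(2), of 1 t]
    by (simp add: L2_inner_commute[of a b v "\<lambda>x. v x + t * w x"] L2_inner_commute[of a b w "\<lambda>x. v x + t * w x"]
         L2_inner_commute[of a b w v] distrib_left power2_eq_square)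
  then show "0 \<le> L2_inner a b v v + 2 * t * L2_inner a b v w + t\<^sup>2 * L2_inner a b w w"
    using L2_inner_self_nonneg[of a b "\<lambda>x. 1 * v x + t * w x"] by simp
qed (auto intro: L2_inner_self_nonneg)

lemma L2_norm_triangle:
  assumes "v \<in> L2_space a b" "w \<in> L2_space a b"
  shows "L2_norm a b (\<lambda>x. v x + w x) \<le> L2_norm a b v + L2_norm a b w"
proof (rule power2_le_imp_le)
  have "(L2_norm a b (\<lambda>x. v x + w x))\<^sup>2 = L2_inner a b v v + 2 * L2_inner a b v w + L2_inner a b w w"
    using L2_inner_linear[OF assms L2_add[OF assms], of 1 1]
      L2_inner_linear[OF assms assms(1), of 1 1] L2_inner_linear[OF assms assms(2), of 1 1]
    by (simp add: L2_norm_power2 L2_inner_commute[of a b v "\<lambda>x. v x + w x"] L2_inner_commute[of a b w "\<lambda>x. v x + w x"]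
         L2_inner_commute[of a b w v])
  also have "\<dots> \<le> (L2_norm a b v)\<^sup>2 + 2 * (L2_norm a b v * L2_norm a b w) + (L2_norm a b w)\<^sup>2"
    using L2_Cauchy_Schwarz[OF assms] by (simp add: L2_norm_power2)
  also have "\<dots> = (L2_norm a b v + L2_norm a b w)\<^sup>2" by (simp add: power2_eq_square algebra_simps)
  finally show "(L2_norm a b (\<lambda>x. v x + w x))\<^sup>2 \<le> (L2_norm a b v + L2_norm a b w)\<^sup>2" .
qed (simp add: L2_norm_nonneg)

lemma L2_norm_scale: "L2_norm a b (\<lambda>x. c * v x) = \<bar>c\<bar> * L2_norm a b v"
proof -
  have "L2_inner a b (\<lambda>x. c * v x) (\<lambda>x. c * v x) = c\<^sup>2 * L2_inner a b v v"
  proof -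
    have eq: "(\<lambda>x. (c * v x) * (c * v x)) = (\<lambda>x. c\<^sup>2 * (v x * v x))"
      by (simp add: power2_eq_square fun_eq_iff ac_simps)
    show ?thesis unfolding L2_inner_def eq by simp
  qed
  then show ?thesis by (simp add: L2_norm_def real_sqrt_mult)
qed

lemma L2_inner_cong_AE:
  assumes "AE x in lebesgue_on {a..b}. v x = v' x" "AE x in lebesgue_on {a..b}. w x = w' x"
    "v \<in> L2_space a b" "v' \<in> L2_space a b" "w \<in> L2_space a b" "w' \<in> L2_space a b"
  shows "L2_inner a b v w = L2_inner a b v' w'"
  unfolding L2_inner_def
proof (rule integral_cong_AE)
  show "AE x in lebesgue_on {a..b}. v x * w x = v' x * w' x"
    using assms(1,2) by eventually_elim simp
qed (use assms in \<open>auto simp: L2_space_def\<close>)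

lemma L2_norm_cong_AE:
  assumes "AE x in lebesgue_on {a..b}. v x = v' x" "v \<in> L2_space a b" "v' \<in> L2_space a b"
  shows "L2_norm a b v = L2_norm a b v'"
  unfolding L2_norm_def using L2_inner_cong_AE[OF assms(1,1,2,3,2,3)] by simp

lemma abs_integral_L2_le:
  assumes v: "v \<in> L2_space a b" and cd: "a \<le> c" "c \<le> d" "d \<le> b"
  shows "(integral {c..d} (\<lambda>x. \<bar>v x\<bar>))\<^sup>2 \<le> (d - c) * integral {c..d} (\<lambda>x. (v x)\<^sup>2)"
    and "\<bar>integral {c..d} v\<bar> \<le> integral {c..d} (\<lambda>x. \<bar>v x\<bar>)"
    and "v integrable_on {c..d}" "(\<lambda>x. \<bar>v x\<bar>) integrable_on {c..d}" "(\<lambda>x. (v x)\<^sup>2) integrable_on {c..d}"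
proof -
  have v': "v \<in> L2_space c d" "(\<lambda>x. \<bar>v x\<bar>) \<in> L2_space c d" using L2_subinterval[OF v] L2_abs cd by auto
  have one: "(\<lambda>x. 1) \<in> L2_space c d" by (rule continuous_L2) (rule continuous_on_const)
  show i: "v integrable_on {c..d}" "(\<lambda>x. \<bar>v x\<bar>) integrable_on {c..d}" "(\<lambda>x. (v x)\<^sup>2) integrable_on {c..d}"
  proof -
    have "integrable (lebesgue_on {c..d}) (\<lambda>x. (v x)\<^sup>2)" using v'(1) by (simp add: L2_space_def)
    then show "(\<lambda>x. (v x)\<^sup>2) integrable_on {c..d}" by (rule integrable_on_lebesgue_on) simp
    show "v integrable_on {c..d}" "(\<lambda>x. \<bar>v x\<bar>) integrable_on {c..d}"
      using v'[THEN L2_integrable, THEN integrable_on_lebesgue_on] by simp_all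
  qed
  have "(L2_inner c d (\<lambda>x. \<bar>v x\<bar>) (\<lambda>x. 1))\<^sup>2 \<le> (L2_norm c d (\<lambda>x. \<bar>v x\<bar>) * L2_norm c d (\<lambda>x. 1))\<^sup>2"
    using L2_Cauchy_Schwarz[OF v'(2) one] by (metis abs_ge_zero power2_abs power_mono)
  also have "\<dots> = L2_inner c d (\<lambda>x. \<bar>v x\<bar>) (\<lambda>x. \<bar>v x\<bar>) * L2_inner c d (\<lambda>x. 1) (\<lambda>x. 1)"
    by (simp add: power_mult_distrib L2_norm_power2)
  finally show "(integral {c..d} (\<lambda>x. \<bar>v x\<bar>))\<^sup>2 \<le> (d - c) * integral {c..d} (\<lambda>x. (v x)\<^sup>2)"
    using cd by (simp add: L2_inner_eq_integral v' one power2_eq_square mult.commute)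
  show "\<bar>integral {c..d} v\<bar> \<le> integral {c..d} (\<lambda>x. \<bar>v x\<bar>)"
    using integral_norm_bound_integral[OF i(1,2)] by simp
qed

subsection \<open>Test functions and integration by parts\<close>

lemma test_function_has_deriv:
  assumes "test_function a b \<phi>"
  shows "((deriv ^^ n) \<phi> has_real_derivative (deriv ^^ Suc n) \<phi> x) (at x)"
proof -
  have "(deriv ^^ n) \<phi> differentiable (at x)"
    using assms by (auto simp: test_function_def differentiable_on_def)
  then obtain D where "((deriv ^^ n) \<phi> has_real_derivative D) (at x)"
    by (auto simp: real_differentiable_def)
  then show ?thesis using DERIV_imp_deriv by fastforce
qed

lemma test_function_continuous:
  "test_function a b \<phi> \<Longrightarrow> continuous_on S ((deriv ^^ n) \<phi>)"
  using test_function_has_deriv by (meson DERIV_isCont continuous_at_imp_continuous_on)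

lemma test_function_L2: "test_function a b \<phi> \<Longrightarrow> (deriv ^^ n) \<phi> \<in> L2_space c d"
  by (intro continuous_L2 test_function_continuous)

lemma test_function_deriv:
  assumes "test_function a b \<phi>"
  shows "test_function a b (deriv \<phi>)"
proof -
  obtain c d where cd: "a < c" "c \<le> d" "d < b" "\<And>x. x \<notin> {c..d} \<Longrightarrow> \<phi> x = 0"
    using assms by (auto simp: test_function_def)
  have "deriv \<phi> x = 0" if "x \<notin> {c..d}" for x
  proof -
    have "open (- {c..d})" "x \<in> - {c..d}" using that by (auto intro: open_Compl)
    then have "\<forall>\<^sub>F y in nhds x. y \<in> - {c..d}" by (rule eventually_nhds_in_open)
    then have "\<forall>\<^sub>F y in nhds x. \<phi> y = 0" by eventually_elim (use cd in auto)
    then have "deriv \<phi> x = deriv (\<lambda>y. 0) x" by (intro deriv_cong_ev) auto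
    then show ?thesis by simp
  qed
  moreover have "(deriv ^^ n) (deriv \<phi>) differentiable_on UNIV" for n
  proof -
    have "(deriv ^^ n) (deriv \<phi>) = (deriv ^^ Suc n) \<phi>" by (simp add: funpow_swap1)
    then show ?thesis using assms unfolding test_function_def by metis
  qed
  ultimately show ?thesis using cd(1-3) unfolding test_function_def by blast
qed

lemma test_function_boundary:
  assumes "test_function a b \<phi>" shows "\<phi> a = 0" "\<phi> b = 0"
  using assms by (force simp: test_function_def)+

text \<open>Fubini over the triangle \<open>y <= x\<close>: integrating \<open>deriv \<phi>\<close>
  over \<open>x\<close> first gives \<open>- \<phi> y\<close>, because \<open>\<phi>\<close>
  vanishes at \<open>b\<close>.\<close>

lemma indefinite_integral_by_parts:
  fixes w :: "real \<Rightarrow> real"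
  assumes w: "integrable (lebesgue_on {a..b}) w" and \<phi>: "test_function a b \<phi>"
  shows "(LINT x|lebesgue_on {a..b}. integral {a..x} w * deriv \<phi> x) = - (LINT x|lebesgue_on {a..b}. w x * \<phi> x)"
proof -
  let ?M = "lebesgue_on {a..b}"
  interpret M: finite_measure ?M by (rule finite_measure_lebesgue_on) simp
  interpret pair_sigma_finite ?M ?M ..
  have d: "(\<phi> has_real_derivative deriv \<phi> x) (at x)" for x
    using test_function_has_deriv[OF \<phi>, of 0] by simp
  have dc: "continuous_on S (deriv \<phi>)" for S using test_function_continuous[OF \<phi>, of _ 1] by simp
  have dm[measurable]: "deriv \<phi> \<in> borel_measurable ?M"
    by (intro continuous_imp_measurable_on_sets_lebesgue dc) simp
  have di: "integrable ?M (deriv \<phi>)" by (intro continuous_imp_integrable_real dc)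
  have wm[measurable]: "w \<in> borel_measurable ?M" using w by simp
  \<comment> \<open>The integrand without the restriction to the triangle. It has product form, so
    its integrability is immediate, and it dominates \<open>f\<close>.\<close>
  define g where "g = (\<lambda>(x, y). w y * deriv \<phi> x)"
  define f where "f = (\<lambda>x y. if y \<le> x then w y * deriv \<phi> x else 0)"
  have gm: "g \<in> borel_measurable (?M \<Otimes>\<^sub>M ?M)" unfolding g_def by measurable
  have gi: "integrable (?M \<Otimes>\<^sub>M ?M) g"
  proof (rule Fubini_integrable[OF gm])
    have "(\<lambda>x. LINT y|?M. norm (g (x, y))) = (\<lambda>x. (LINT y|?M. \<bar>w y\<bar>) * \<bar>deriv \<phi> x\<bar>)"
      by (simp add: g_def abs_mult)
    then show "integrable ?M (\<lambda>x. LINT y|?M. norm (g (x, y)))" using di by simp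
    show "AE x in ?M. integrable ?M (\<lambda>y. g (x, y))" using w by (simp add: g_def)
  qed
  have "integrable (?M \<Otimes>\<^sub>M ?M) (case_prod f)"
  proof (rule Bochner_Integration.integrable_bound[OF gi])
    show "case_prod f \<in> borel_measurable (?M \<Otimes>\<^sub>M ?M)" unfolding f_def by measurable
    show "AE p in ?M \<Otimes>\<^sub>M ?M. norm (case_prod f p) \<le> norm (g p)"
      by (auto simp: f_def g_def)
  qed
  then have F: "(LINT y|?M. (LINT x|?M. f x y)) = (LINT x|?M. (LINT y|?M. f x y))"
    by (rule Fubini_integral)
  have "(LINT x|?M. f x y) = - (w y * \<phi> y)" if y: "y \<in> {a..b}" for y
  proof -
    have "(LINT x|?M. f x y) = (LINT x|?M. (if x \<in> {y..b} then w y * deriv \<phi> x else 0))"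
      by (rule Bochner_Integration.integral_cong) (auto simp: f_def)
    also have "\<dots> = integral {y..b} (\<lambda>x. w y * deriv \<phi> x)"
      by (rule integral_lebesgue_on_restrict) (use di y in auto)
    also have "\<dots> = w y * integral {y..b} (deriv \<phi>)" by simp
    also have "integral {y..b} (deriv \<phi>) = \<phi> b - \<phi> y"
      by (rule integral_unique, rule fundamental_theorem_of_calculus)
        (use y d in \<open>auto simp flip: has_real_derivative_iff_has_vector_derivative intro: has_field_derivative_at_within\<close>)
    finally show ?thesis using test_function_boundary[OF \<phi>] by simp
  qed
  then have L: "(LINT y|?M. (LINT x|?M. f x y)) = (LINT y|?M. - (w y * \<phi> y))"
    by (intro Bochner_Integration.integral_cong) auto
  have "(LINT y|?M. f x y) = integral {a..x} w * deriv \<phi> x" if x: "x \<in> {a..b}" for x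
  proof -
    have "(LINT y|?M. f x y) = (LINT y|?M. (if y \<in> {a..x} then w y * deriv \<phi> x else 0))"
      by (rule Bochner_Integration.integral_cong) (auto simp: f_def)
    also have "\<dots> = integral {a..x} (\<lambda>y. w y * deriv \<phi> x)"
      by (rule integral_lebesgue_on_restrict) (use w x in auto)
    finally show ?thesis by simp
  qed
  then have "(LINT x|?M. (LINT y|?M. f x y)) = (LINT x|?M. integral {a..x} w * deriv \<phi> x)"
    by (intro Bochner_Integration.integral_cong) auto
  then show ?thesis using F L by simp
qed

lemma continuous_indefinite_integral:
  fixes w :: "real \<Rightarrow> real"
  assumes "w \<in> L2_space a b" shows "continuous_on {a..b} (\<lambda>x. integral {a..x} w)"
  using assms by (intro indefinite_integral_continuous_1 integrable_on_lebesgue_on L2_integrable) auto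

text \<open>In one dimension \<open>H^1\<close> consists of primitives of square-integrable
  functions; this is the easy half. The constant drops out because derivatives of test functions
  have mean zero.\<close>

lemma weak_deriv_of_integral:
  assumes w: "w \<in> L2_space a b" and v: "\<And>x. x \<in> {a..b} \<Longrightarrow> v x = c + integral {a..x} w"
  shows "has_weak_deriv a b 1 v w" and "continuous_on {a..b} v" "v \<in> L2_space a b"
proof -
  have "continuous_on {a..b} (\<lambda>x. c + integral {a..x} w)"
    by (intro continuous_intros continuous_indefinite_integral w)
  then show vc: "continuous_on {a..b} v" using v by (metis (no_types, lifting) continuous_on_cong)
  then show "v \<in> L2_space a b" by (rule continuous_L2)
  have "L2_inner a b v (deriv \<phi>) = - L2_inner a b w \<phi>" if \<phi>: "test_function a b \<phi>" for \<phi>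
  proof -
    have dc: "continuous_on {a..b} (deriv \<phi>)" using test_function_continuous[OF \<phi>, of _ 1] by simp
    have d: "(\<phi> has_real_derivative deriv \<phi> x) (at x)" for x
      using test_function_has_deriv[OF \<phi>, of 0] by simp
    have ab: "a < b" using \<phi> by (auto simp: test_function_def)
    have di: "integrable (lebesgue_on {a..b}) (deriv \<phi>)" by (rule continuous_imp_integrable_real[OF dc])
    have "(LINT x|lebesgue_on {a..b}. deriv \<phi> x) = integral {a..b} (deriv \<phi>)"
      by (rule lebesgue_integral_eq_integral[OF di]) simp
    also have "\<dots> = \<phi> b - \<phi> a"
      by (rule integral_unique, rule fundamental_theorem_of_calculus)
        (use ab d in \<open>auto simp flip: has_real_derivative_iff_has_vector_derivative intro: has_field_derivative_at_within\<close>)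
    finally have 0: "(LINT x|lebesgue_on {a..b}. deriv \<phi> x) = 0"
      using test_function_boundary[OF \<phi>] by simp
    have i: "integrable (lebesgue_on {a..b}) (\<lambda>x. integral {a..x} w * deriv \<phi> x)"
      by (intro continuous_imp_integrable_real continuous_intros dc continuous_indefinite_integral w)
    have "L2_inner a b v (deriv \<phi>) = (LINT x|lebesgue_on {a..b}. c * deriv \<phi> x + integral {a..x} w * deriv \<phi> x)"
      unfolding L2_inner_def by (rule Bochner_Integration.integral_cong) (auto simp: v distrib_right)
    also have "\<dots> = - L2_inner a b w \<phi>"
      using indefinite_integral_by_parts[OF L2_integrable[OF w] \<phi>] i di 0 by (simp add: L2_inner_def)
    finally show ?thesis .
  qed
  then show "has_weak_deriv a b 1 v w" using w by (simp add: has_weak_deriv_def)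
qed

lemma weak_deriv_unique:
  assumes "has_weak_deriv a b n v w" "has_weak_deriv a b n v w'"
  shows "AE x in lebesgue_on {a..b}. w x = w' x"
proof -
  have w: "w \<in> L2_space a b" "w' \<in> L2_space a b" using assms by (auto simp: has_weak_deriv_def)
  have "AE x in lebesgue_on {a..b}. w x - w' x = 0"
  proof (rule fundamental_lemma)
    show "integrable (lebesgue_on {a..b}) (\<lambda>x. w x - w' x)" by (rule L2_integrable[OF L2_diff[OF w]])
    fix \<phi> assume \<phi>: "test_function a b \<phi>"
    have "(- 1) ^ n * L2_inner a b w \<phi> = (- 1) ^ n * L2_inner a b w' \<phi>"
      using assms \<phi> by (auto simp: has_weak_deriv_def)
    then have "L2_inner a b w \<phi> = L2_inner a b w' \<phi>" by simp
    then show "(LINT x|lebesgue_on {a..b}. (w x - w' x) * \<phi> x) = 0"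
      using L2_inner_linear[OF w test_function_L2[OF \<phi>, of 0, simplified], of 1 "-1"]
      by (simp add: L2_inner_def)
  qed
  then show ?thesis by simp
qed

text \<open>A smooth function with compact support has a primitive with compact support as soon as
  its mean is zero. The shape \<open>\<psi> x + s * \<theta> x\<close> is the one produced by the Du
  Bois-Reymond argument.\<close>

lemma test_function_antideriv:
  assumes \<psi>: "test_function a b \<psi>" and \<theta>: "test_function a b \<theta>" and "a < b"
    and 0: "integral {a..b} (\<lambda>x. \<psi> x + s * \<theta> x) = 0"
  obtains \<phi> where "test_function a b \<phi>" "deriv \<phi> = (\<lambda>x. \<psi> x + s * \<theta> x)"
proof -
  define \<eta> where "\<eta> x = \<psi> x + s * \<theta> x" for x
  define \<phi> where "\<phi> x = integral {a..x} \<eta>" for x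
  obtain c d where c: "a < c" "c \<le> d" "d < b" "\<And>x. x \<notin> {c..d} \<Longrightarrow> \<psi> x = 0"
    using \<psi> by (auto simp: test_function_def)
  obtain c' d' where c': "a < c'" "c' \<le> d'" "d' < b" "\<And>x. x \<notin> {c'..d'} \<Longrightarrow> \<theta> x = 0"
    using \<theta> by (auto simp: test_function_def)
  have \<eta>0: "\<eta> x = 0" if "x \<notin> {min c c'..max d d'}" for x
  proof -
    have "x \<notin> {c..d}" "x \<notin> {c'..d'}" using that by (auto simp: min_def max_def split: if_splits)
    then show ?thesis using c(4) c'(4) by (simp add: \<eta>_def)
  qed
  have \<eta>c: "continuous_on S \<eta>" for S
    unfolding \<eta>_def using test_function_continuous[OF \<psi>, of _ 0] test_function_continuous[OF \<theta>, of _ 0]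
    by (auto intro!: continuous_intros)
  have \<eta>i: "\<eta> integrable_on {x..y}" for x y by (rule integrable_continuous_real[OF \<eta>c])
  have \<phi>0: "\<phi> x = 0" if "x \<notin> {min c c'..max d d'}" for x
  proof (cases "x < min c c'")
    case True
    have "\<phi> x = integral {a..x} (\<lambda>x. 0)" unfolding \<phi>_def
      by (rule Henstock_Kurzweil_Integration.integral_cong) (use True in \<open>auto intro!: \<eta>0\<close>)
    then show ?thesis by simp
  next
    case False
    then have x: "x > max d d'" using that by auto
    have z: "integral {y..z} \<eta> = 0" if "y > max d d'" for y z
    proof -
      have "integral {y..z} \<eta> = integral {y..z} (\<lambda>x. 0)"
        by (rule Henstock_Kurzweil_Integration.integral_cong) (use that in \<open>auto intro!: \<eta>0\<close>)
      then show ?thesis by simp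
    qed
    \<comment> \<open>To the right of the support the primitive equals the total integral, up to a
      piece on which \<open>\<eta>\<close> vanishes.\<close>
    have b0: "integral {a..b} \<eta> = 0" using 0 by (simp add: \<eta>_def[abs_def])
    show ?thesis
    proof (cases "x \<le> b")
      case True
      then have "integral {a..x} \<eta> + integral {x..b} \<eta> = integral {a..b} \<eta>"
        using x c by (intro Henstock_Kurzweil_Integration.integral_combine \<eta>i) auto
      then show ?thesis using z[OF x] b0 by (simp add: \<phi>_def)
    next
      case False
      then have "integral {a..b} \<eta> + integral {b..x} \<eta> = integral {a..x} \<eta>"
        using x c by (intro Henstock_Kurzweil_Integration.integral_combine \<eta>i) auto
      then show ?thesis using z[of b x] c c' b0 by (simp add: \<phi>_def)
    qed
  qed
  have D: "(\<phi> has_real_derivative \<eta> x) (at x)" for x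
  proof (cases "x > a")
    case True
    have "(\<phi> has_real_derivative \<eta> x) (at x within {a..x + 1})"
      unfolding \<phi>_def by (rule integral_has_real_derivative[OF \<eta>c]) (use True in auto)
    moreover have "at x within {a..x + 1} = at x" using True by (intro at_within_interior) simp
    ultimately show ?thesis by (simp only:)
  next
    case False
    then have "\<forall>\<^sub>F y in nhds x. y < min c c'" using c c' by (intro order_tendstoD[OF filterlim_ident]) auto
    then have e: "\<forall>\<^sub>F y in nhds x. \<phi> y = 0" by eventually_elim (rule \<phi>0, auto simp: min_def split: if_splits)
    have "\<eta> x = 0" using False c c' by (intro \<eta>0) auto
    then show ?thesis unfolding DERIV_cong_ev[OF refl e refl] by simp
  qed
  then have d: "deriv \<phi> = \<eta>" by (auto intro: DERIV_imp_deriv)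
  have sm: "(deriv ^^ n) \<eta> differentiable_on UNIV" for n
  proof (rule smooth_coinduct)
    let ?S = "{\<lambda>x. f x + s * g x | f g. test_function a b f \<and> test_function a b g}"
    show "\<eta> \<in> ?S" using \<psi> \<theta> by (auto simp: \<eta>_def[abs_def])
    fix h assume "h \<in> ?S"
    then obtain f g where h: "h = (\<lambda>x. f x + s * g x)" "test_function a b f" "test_function a b g" by blast
    have "(h has_real_derivative deriv f x + s * deriv g x) (at x)" for x
      unfolding h(1) using test_function_has_deriv[OF h(2), of 0 x] test_function_has_deriv[OF h(3), of 0 x]
      by (auto intro!: derivative_eq_intros)
    then show "\<exists>g'\<in>?S. \<forall>x. (h has_real_derivative g' x) (at x)"
      using test_function_deriv[OF h(2)] test_function_deriv[OF h(3)]
      by (intro bexI[where x="\<lambda>x. deriv f x + s * deriv g x"]) auto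
  qed
  have "(deriv ^^ n) \<phi> differentiable_on UNIV" for n
  proof (cases n)
    case 0
    then show ?thesis using D by (auto simp: differentiable_on_def real_differentiable_def)
  next
    case (Suc k)
    have "(deriv ^^ n) \<phi> = (deriv ^^ k) \<eta>" by (simp add: Suc funpow_swap1 d)
    then show ?thesis using sm by simp
  qed
  then have "test_function a b \<phi>" using \<phi>0 c c' unfolding test_function_def
    by (intro conjI allI exI[where x="min c c'"] exI[where x="max d d'"]) auto
  then show ?thesis using that d by (simp add: \<eta>_def[abs_def])
qed

text \<open>Du Bois-Reymond: subtracting a multiple of a fixed test function turns any test function
  into a derivative of a test function.\<close>

lemma weak_deriv_imp_integral:
  assumes v: "v \<in> L2_space a b" and w: "has_weak_deriv a b 1 v w" and ab: "a < b"
  obtains c where "AE x in lebesgue_on {a..b}. v x = c + integral {a..x} w"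
proof -
  define W where "W x = integral {a..x} w" for x
  have w2: "w \<in> L2_space a b" using w by (simp add: has_weak_deriv_def)
  have W: "has_weak_deriv a b 1 W w" "W \<in> L2_space a b"
    by (rule weak_deriv_of_integral(1)[OF w2, where c=0] weak_deriv_of_integral(3)[OF w2, where c=0], simp add: W_def)+
  \<comment> \<open>A fixed bump on the middle third of the interval; its integral \<open>I\<close>
    is positive and serves as the normalization.\<close>
  define \<theta> where "\<theta> = (\<lambda>x. bump_base 1 (1 * (x - (2 * a + b) / 3)) * bump_base 1 (1 * ((a + 2 * b) / 3 - x)))"
  have \<theta>: "test_function a b \<theta>" unfolding \<theta>_def by (rule test_function_bump) (use ab in auto)
  have tc: "continuous_on S \<phi>" if "test_function a b \<phi>" for \<phi> S
    using test_function_continuous[OF that, of _ 0] by simp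
  define I where "I = integral {a..b} \<theta>"
  have "I > 0"
  proof -
    have nn: "\<theta> x \<ge> 0" for x by (simp add: \<theta>_def bump_base_1_bounds)
    have "I \<noteq> 0"
    proof
      assume "I = 0"
      then have "(\<theta> has_integral 0) (cbox a b)"
        unfolding I_def using integrable_integral[OF integrable_continuous_real[OF tc[OF \<theta>]]] by (metis interval_cbox)
      then have "\<theta> ((a + b) / 2) = 0"
        by (rule has_integral_0_cbox_imp_0[rotated 2]) (use ab tc[OF \<theta>] nn in \<open>auto simp: content_eq_0\<close>)
      then show False using ab by (simp add: \<theta>_def bump_base_def split: if_splits)
    qed
    moreover have "I \<ge> 0" unfolding I_def
      by (rule Henstock_Kurzweil_Integration.integral_nonneg)
        (use nn tc[OF \<theta>] in \<open>auto intro: integrable_continuous_real\<close>)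
    ultimately show ?thesis by simp
  qed
  \<comment> \<open>The value is forced: \<open>v - W\<close> and the constant \<open>c\<close> must
    have the same inner product with \<open>\<theta>\<close>.\<close>
  define c where "c = L2_inner a b (\<lambda>x. v x - W x) \<theta> / I"
  have one: "(\<lambda>x. c) \<in> L2_space a b" by (rule continuous_L2) (rule continuous_on_const)
  have z: "(\<lambda>x. v x - W x) \<in> L2_space a b" by (rule L2_diff[OF v W(2)])
  have "AE x in lebesgue_on {a..b}. (v x - W x) - c = 0"
  proof (rule fundamental_lemma)
    show "integrable (lebesgue_on {a..b}) (\<lambda>x. (v x - W x) - c)"
      by (rule L2_integrable[OF L2_diff[OF z one]])
    fix \<psi> assume \<psi>: "test_function a b \<psi>"
    define \<kappa> where "\<kappa> = integral {a..b} \<psi>"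
    \<comment> \<open>Removing the multiple \<open>\<kappa> / I\<close> of \<open>\<theta>\<close>
      leaves mean zero, so the rest is the derivative of a test function, and \<open>v - W\<close>
      is orthogonal to it.\<close>
    have "integral {a..b} (\<lambda>x. \<psi> x + (- \<kappa> / I) * \<theta> x) = 0"
      using tc[OF \<psi>] tc[OF \<theta>] \<open>I > 0\<close>
      by (subst Henstock_Kurzweil_Integration.integral_add)
        (auto intro!: integrable_continuous_real continuous_intros simp: \<kappa>_def I_def[symmetric])
    then obtain \<phi> where \<phi>: "test_function a b \<phi>" "deriv \<phi> = (\<lambda>x. \<psi> x + (- \<kappa> / I) * \<theta> x)"
      using test_function_antideriv[OF \<psi> \<theta> ab] by blast
    have L: "\<psi> \<in> L2_space a b" "\<theta> \<in> L2_space a b" "deriv \<phi> \<in> L2_space a b"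
      using test_function_L2[OF \<psi>, of 0] test_function_L2[OF \<theta>, of 0] test_function_L2[OF \<phi>(1), of 1] by auto
    have "L2_inner a b v (deriv \<phi>) = L2_inner a b W (deriv \<phi>)"
      using w W(1) \<phi>(1) by (simp add: has_weak_deriv_def)
    then have "L2_inner a b (\<lambda>x. v x - W x) (deriv \<phi>) = 0"
      using L2_inner_linear[OF v W(2) L(3), of 1 "-1"] by simp
    then have "L2_inner a b (\<lambda>x. 1 * \<psi> x + (- \<kappa> / I) * \<theta> x) (\<lambda>x. v x - W x) = 0"
      unfolding \<phi>(2) by (subst L2_inner_commute) simp
    then have "L2_inner a b \<psi> (\<lambda>x. v x - W x) = \<kappa> / I * L2_inner a b \<theta> (\<lambda>x. v x - W x)"
      by (subst (asm) L2_inner_linear[OF L(1,2) z]) simp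
    then have 1: "L2_inner a b (\<lambda>x. v x - W x) \<psi> = c * \<kappa>"
      by (simp add: c_def L2_inner_commute[of a b \<theta>] L2_inner_commute[of a b \<psi>])
    have "L2_inner a b (\<lambda>x. c) \<psi> = c * \<kappa>"
      unfolding \<kappa>_def by (subst L2_inner_eq_integral[OF one L(1)]) simp
    with 1 have "L2_inner a b (\<lambda>x. v x - W x - c) \<psi> = 0"
      using L2_inner_linear[OF z one L(1), of 1 "-1"] by simp
    then show "(LINT x|lebesgue_on {a..b}. (v x - W x - c) * \<psi> x) = 0"
      by (simp only: L2_inner_def)
  qed
  then show ?thesis by (intro that[of c]) (auto elim!: eventually_mono simp: W_def)
qed

subsection \<open>The continuous representatives of the weak derivatives\<close>

lemma AE_subinterval:
  assumes "AE x in lebesgue_on {a..b::real}. P x" "a \<le> c" "d \<le> b"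
  shows "AE x in lebesgue_on {c..d}. P x"
proof -
  have "AE x in lebesgue. x \<in> {a..b} \<longrightarrow> P x" using assms(1) by (simp add: AE_restrict_space_iff)
  then have "AE x in lebesgue. x \<in> {c..d} \<longrightarrow> P x" by eventually_elim (use assms in auto)
  then show ?thesis by (simp add: AE_restrict_space_iff)
qed

lemma integral_cong_AE_L2:
  assumes "AE x in lebesgue_on {a..b}. v x = w x" "v \<in> L2_space a b" "w \<in> L2_space a b" "a \<le> c" "d \<le> b"
  shows "integral {c..d} v = integral {c..d} w"
proof -
  have L: "v \<in> L2_space c d" "w \<in> L2_space c d" using assms L2_subinterval by auto
  have "(LINT x|lebesgue_on {c..d}. v x) = (LINT x|lebesgue_on {c..d}. w x)"
    using AE_subinterval[OF assms(1,4,5)] L by (intro integral_cong_AE) (auto simp: L2_space_def)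
  then show ?thesis using L[THEN L2_integrable] by (simp add: lebesgue_integral_eq_integral)
qed

lemma abs_integral_le_L2_norm:
  assumes v: "v \<in> L2_space a b" and "a \<le> c" "c \<le> d" "d \<le> b"
  shows "\<bar>integral {c..d} v\<bar> \<le> sqrt (b - a) * L2_norm a b v"
proof (rule power2_le_imp_le)
  note I = abs_integral_L2_le[OF v assms(2-4)]
  have I': "(\<lambda>x. (v x)\<^sup>2) integrable_on {a..b}" using abs_integral_L2_le(5)[OF v, of a b] assms by simp
  have le: "integral {c..d} (\<lambda>x. (v x)\<^sup>2) \<le> integral {a..b} (\<lambda>x. (v x)\<^sup>2)"
    by (rule integral_subset_le) (use assms I I' in auto)
  have "\<bar>integral {c..d} v\<bar>\<^sup>2 \<le> (integral {c..d} (\<lambda>x. \<bar>v x\<bar>))\<^sup>2"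
    using I(2) by (intro power_mono) auto
  also have "\<dots> \<le> (d - c) * integral {c..d} (\<lambda>x. (v x)\<^sup>2)" by (rule I(1))
  also have "\<dots> \<le> (b - a) * integral {a..b} (\<lambda>x. (v x)\<^sup>2)"
    using assms le by (intro mult_mono Henstock_Kurzweil_Integration.integral_nonneg I(5)) auto
  also have "\<dots> = (sqrt (b - a) * L2_norm a b v)\<^sup>2"
    using assms by (simp add: power_mult_distrib L2_norm_power2 L2_inner_eq_integral[OF v v] power2_eq_square[of "v _"])
  finally show "\<bar>integral {c..d} v\<bar>\<^sup>2 \<le> (sqrt (b - a) * L2_norm a b v)\<^sup>2" .
  show "0 \<le> sqrt (b - a) * L2_norm a b v" using assms by (simp add: L2_norm_nonneg)
qed

lemma continuous_AE_eq_imp_eq: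
  fixes f g :: "real \<Rightarrow> real"
  assumes "continuous_on {a..b} f" "continuous_on {a..b} g" "AE x in lebesgue_on {a..b}. f x = g x" "a < b" "x \<in> {a..b}"
  shows "f x = g x"
proof -
  have c: "continuous_on {a..b} (\<lambda>x. \<bar>f x - g x\<bar>)" using assms by (intro continuous_intros)
  have z: "(\<lambda>x. 0) \<in> L2_space a b" by (rule continuous_L2) (rule continuous_on_const)
  have "integral {a..b} (\<lambda>x. \<bar>f x - g x\<bar>) = integral {a..b} (\<lambda>x. 0)"
    by (rule integral_cong_AE_L2[OF _ continuous_L2[OF c] z]) (use assms(3) in auto)
  then have "((\<lambda>x. \<bar>f x - g x\<bar>) has_integral 0) (cbox a b)"
    using integrable_integral[OF integrable_continuous_real[OF c]] by simp
  then have "\<bar>f x - g x\<bar> = 0"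
    by (rule has_integral_0_cbox_imp_0[rotated 2]) (use assms c in \<open>auto simp: content_eq_0\<close>)
  then show ?thesis by simp
qed

lemma weak_deriv:
  assumes "v \<in> sobolev_space a b s" "n \<le> s"
  shows "has_weak_deriv a b n v (weak_deriv a b n v)" "weak_deriv a b n v \<in> L2_space a b"
proof -
  have "\<exists>w. has_weak_deriv a b n v w" using assms by (auto simp: sobolev_space_def)
  then show "has_weak_deriv a b n v (weak_deriv a b n v)" unfolding weak_deriv_def by (rule someI_ex)
  then show "weak_deriv a b n v \<in> L2_space a b" by (simp add: has_weak_deriv_def)
qed

lemma sobolev_space_L2: "v \<in> sobolev_space a b s \<Longrightarrow> v \<in> L2_space a b"
  by (simp add: sobolev_space_def)

lemma weak_deriv_0:
  assumes "v \<in> L2_space a b"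
  shows "AE x in lebesgue_on {a..b}. weak_deriv a b 0 v x = v x"
proof (rule weak_deriv_unique)
  show h: "has_weak_deriv a b 0 v v" using assms by (simp add: has_weak_deriv_def)
  then show "has_weak_deriv a b 0 v (weak_deriv a b 0 v)" unfolding weak_deriv_def by (rule someI[where P="has_weak_deriv a b 0 v"])
qed

lemma weak_deriv_Suc:
  assumes v: "v \<in> sobolev_space a b s" and "n < s"
  shows "has_weak_deriv a b 1 (weak_deriv a b n v) (weak_deriv a b (Suc n) v)"
  unfolding has_weak_deriv_def
proof (intro conjI allI impI)
  show "weak_deriv a b (Suc n) v \<in> L2_space a b" using weak_deriv(2)[OF v, of "Suc n"] assms by simp
  fix \<phi> assume \<phi>: "test_function a b \<phi>"
  have "L2_inner a b v ((deriv ^^ n) (deriv \<phi>)) = (- 1) ^ n * L2_inner a b (weak_deriv a b n v) (deriv \<phi>)"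
    using weak_deriv(1)[OF v, of n] test_function_deriv[OF \<phi>] assms by (auto simp: has_weak_deriv_def)
  moreover have "L2_inner a b v ((deriv ^^ Suc n) \<phi>) = (- 1) ^ Suc n * L2_inner a b (weak_deriv a b (Suc n) v) \<phi>"
    using weak_deriv(1)[OF v, of "Suc n"] \<phi> assms by (auto simp: has_weak_deriv_def)
  moreover have "(deriv ^^ Suc n) \<phi> = (deriv ^^ n) (deriv \<phi>)" by (simp add: funpow_swap1)
  ultimately have "(- 1) ^ n * L2_inner a b (weak_deriv a b n v) (deriv \<phi>) = (- 1) ^ n * - L2_inner a b (weak_deriv a b (Suc n) v) \<phi>"
    by simp
  then show "L2_inner a b (weak_deriv a b n v) ((deriv ^^ 1) \<phi>) = (- 1) ^ 1 * L2_inner a b (weak_deriv a b (Suc n) v) \<phi>"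
    by (subst (asm) mult_cancel_left) simp
qed

text \<open>For \<open>v\<close> in \<open>H\<^sup>s\<close> and \<open>n < s\<close> this is the continuous representative of the \<open>n\<close>-th weak derivative.\<close>

definition cderiv :: "real \<Rightarrow> real \<Rightarrow> nat \<Rightarrow> (real \<Rightarrow> real) \<Rightarrow> real \<Rightarrow> real" where
  "cderiv a b n v x =
    (integral {a..b} (weak_deriv a b n v) - integral {a..b} (\<lambda>y. integral {a..y} (weak_deriv a b (Suc n) v))) / (b - a)
     + integral {a..x} (weak_deriv a b (Suc n) v)"

context
  fixes a b :: real and v :: "real \<Rightarrow> real" and s :: nat
  assumes ab: "a < b" and v: "v \<in> sobolev_space a b s"
begin

lemma cderiv_continuous: "n < s \<Longrightarrow> continuous_on {a..b} (cderiv a b n v)"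
  unfolding cderiv_def
  by (intro continuous_intros continuous_indefinite_integral weak_deriv(2)[OF v]) simp

text \<open>Integrating the Du Bois-Reymond representation over the whole interval determines its
  constant, and this is the fraction in \<open>cderiv\<close>. With an explicit formula instead of a
  chosen representative, pointwise bounds can be read off.\<close>

lemma cderiv_AE:
  assumes n: "n < s"
  shows "AE x in lebesgue_on {a..b}. cderiv a b n v x = weak_deriv a b n v x"
proof -
  have L: "weak_deriv a b n v \<in> L2_space a b" "weak_deriv a b (Suc n) v \<in> L2_space a b"
    using weak_deriv(2)[OF v] n by auto
  obtain c where c: "AE x in lebesgue_on {a..b}. weak_deriv a b n v x = c + integral {a..x} (weak_deriv a b (Suc n) v)"
    using weak_deriv_imp_integral[OF L(1) weak_deriv_Suc[OF v n] ab] by blast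
  note ci = continuous_indefinite_integral[OF L(2)]
  have "continuous_on {a..b} (\<lambda>x. c + integral {a..x} (weak_deriv a b (Suc n) v))"
    by (intro continuous_intros ci)
  then have "integral {a..b} (weak_deriv a b n v) = integral {a..b} (\<lambda>x. c + integral {a..x} (weak_deriv a b (Suc n) v))"
    by (intro integral_cong_AE_L2[OF c L(1)] continuous_L2) auto
  also have "\<dots> = c * (b - a) + integral {a..b} (\<lambda>x. integral {a..x} (weak_deriv a b (Suc n) v))"
    using ab by (subst Henstock_Kurzweil_Integration.integral_add) (auto intro!: integrable_continuous_real ci)
  finally have "c = (integral {a..b} (weak_deriv a b n v) - integral {a..b} (\<lambda>y. integral {a..y} (weak_deriv a b (Suc n) v))) / (b - a)"
    using ab by (simp add: field_simps)
  then show ?thesis using c by (auto simp: cderiv_def elim!: eventually_mono)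
qed

lemma cderiv_L2: "n < s \<Longrightarrow> cderiv a b n v \<in> L2_space a b"
  by (rule continuous_L2[OF cderiv_continuous])

lemma weak_deriv_has_integral:
  assumes n: "n < s" and xy: "a \<le> x" "x \<le> y" "y \<le> b"
  shows "(weak_deriv a b (Suc n) v has_integral cderiv a b n v y - cderiv a b n v x) {x..y}"
proof -
  have L: "weak_deriv a b (Suc n) v \<in> L2_space a b" using weak_deriv(2)[OF v] n by auto
  have i: "weak_deriv a b (Suc n) v integrable_on {c..d}" if "a \<le> c" "d \<le> b" for c d
    using abs_integral_L2_le(3)[OF L, of c d] that
    by (cases "c \<le> d") (auto simp: integrable_on_empty)
  have "integral {a..x} (weak_deriv a b (Suc n) v) + integral {x..y} (weak_deriv a b (Suc n) v) = integral {a..y} (weak_deriv a b (Suc n) v)"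
    using xy by (intro Henstock_Kurzweil_Integration.integral_combine i) auto
  then have "cderiv a b n v y - cderiv a b n v x = integral {x..y} (weak_deriv a b (Suc n) v)"
    by (simp add: cderiv_def)
  then show ?thesis using integrable_integral[OF i[of x y]] xy by simp
qed

lemma cderiv_has_integral:
  assumes n: "Suc n < s" and xy: "a \<le> x" "x \<le> y" "y \<le> b"
  shows "(cderiv a b (Suc n) v has_integral cderiv a b n v y - cderiv a b n v x) {x..y}"
proof -
  have "integral {x..y} (cderiv a b (Suc n) v) = integral {x..y} (weak_deriv a b (Suc n) v)"
    using n xy by (intro integral_cong_AE_L2[OF cderiv_AE] cderiv_L2 weak_deriv(2)[OF v]) auto
  also have "\<dots> = cderiv a b n v y - cderiv a b n v x"
    using weak_deriv_has_integral[of n x y] n xy by (intro integral_unique) auto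
  finally have eq: "integral {x..y} (cderiv a b (Suc n) v) = cderiv a b n v y - cderiv a b n v x" .
  have "cderiv a b (Suc n) v integrable_on {x..y}"
    by (rule integrable_continuous_real[OF continuous_on_subset[OF cderiv_continuous[OF n]]]) (use xy in auto)
  then show ?thesis using eq integrable_integral by fastforce
qed

lemma cderiv_has_derivative:
  assumes n: "Suc n < s" and x: "x \<in> {a..b}"
  shows "(cderiv a b n v has_real_derivative cderiv a b (Suc n) v x) (at x within {a..b})"
proof -
  have eq: "cderiv a b n v y = cderiv a b n v a + integral {a..y} (cderiv a b (Suc n) v)" if "y \<in> {a..b}" for y
    using cderiv_has_integral[OF n, of a y] that by (simp add: integral_unique)
  have "((\<lambda>x. cderiv a b n v a + integral {a..x} (cderiv a b (Suc n) v)) has_real_derivative cderiv a b (Suc n) v x) (at x within {a..b})"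
    using integral_has_real_derivative[OF cderiv_continuous[OF n] x] by (auto intro!: derivative_eq_intros)
  then show ?thesis unfolding has_field_derivative_def
    by (rule has_derivative_transform[OF x, rotated]) (rule eq)
qed

lemma cderiv_0:
  assumes "0 < s" "continuous_on {a..b} v" "x \<in> {a..b}"
  shows "cderiv a b 0 v x = v x"
proof (rule continuous_AE_eq_imp_eq[OF cderiv_continuous assms(2) _ ab assms(3)])
  show "AE x in lebesgue_on {a..b}. cderiv a b 0 v x = v x"
    using cderiv_AE[OF assms(1)] weak_deriv_0[OF sobolev_space_L2[OF v]] by eventually_elim simp
qed (use assms in simp)

lemma weak_deriv_norm_le: "n \<le> s \<Longrightarrow> L2_norm a b (weak_deriv a b n v) \<le> sobolev_norm a b s v"
  unfolding sobolev_norm_def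
  by (rule real_le_rsqrt) (rule member_le_sum[where f="\<lambda>n. (L2_norm a b (weak_deriv a b n v))\<^sup>2"], auto)

text \<open>The one-dimensional Sobolev embedding. In the constant, \<open>1 / (b - a)\<close> comes
  from the mean of the weak derivative, and the 2 from the primitive of the next one and from the
  mean of that primitive.\<close>

lemma cderiv_bound:
  assumes n: "n < s" and x: "x \<in> {a..b}"
  shows "\<bar>cderiv a b n v x\<bar> \<le> (sqrt (b - a) * (2 + 1 / (b - a))) * sobolev_norm a b s v"
proof -
  let ?N = "sobolev_norm a b s v"
  have L: "weak_deriv a b n v \<in> L2_space a b" "weak_deriv a b (Suc n) v \<in> L2_space a b"
    using weak_deriv(2)[OF v] n by auto
  have le: "L2_norm a b (weak_deriv a b n v) \<le> ?N" "L2_norm a b (weak_deriv a b (Suc n) v) \<le> ?N"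
    using weak_deriv_norm_le n by auto
  have 1: "\<bar>integral {a..b} (weak_deriv a b n v)\<bar> \<le> sqrt (b - a) * ?N"
    by (rule order_trans[OF abs_integral_le_L2_norm[OF L(1)] mult_left_mono[OF le(1)]]) (use ab in auto)
  have 2: "\<bar>integral {a..y} (weak_deriv a b (Suc n) v)\<bar> \<le> sqrt (b - a) * ?N" if "y \<in> {a..b}" for y
    by (rule order_trans[OF abs_integral_le_L2_norm[OF L(2)] mult_left_mono[OF le(2)]]) (use ab that in auto)
  have "norm (integral {a..b} (\<lambda>y. integral {a..y} (weak_deriv a b (Suc n) v))) \<le> integral {a..b} (\<lambda>y. sqrt (b - a) * ?N)"
    by (rule integral_norm_bound_integral)
      (use 2 in \<open>auto intro!: integrable_continuous_real continuous_indefinite_integral L\<close>)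
  then have 3: "\<bar>integral {a..b} (\<lambda>y. integral {a..y} (weak_deriv a b (Suc n) v))\<bar> \<le> (b - a) * (sqrt (b - a) * ?N)"
    using ab by (simp add: mult_ac)
  have "\<bar>cderiv a b n v x\<bar> \<le> (sqrt (b - a) * ?N + (b - a) * (sqrt (b - a) * ?N)) / (b - a) + sqrt (b - a) * ?N"
    unfolding cderiv_def
    by (rule order_trans[OF abs_triangle_ineq add_mono[OF _ 2[OF x]]])
      (use 1 3 ab in \<open>simp add: abs_divide divide_right_mono order_trans[OF abs_triangle_ineq4]\<close>)
  also have "\<dots> = (sqrt (b - a) * (2 + 1 / (b - a))) * ?N" using ab by (simp add: field_simps)
  finally show ?thesis .
qed

end

subsection \<open>Linear structure of the Sobolev spaces\<close>

lemma has_weak_deriv_linear: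
  assumes "has_weak_deriv a b n v p" "has_weak_deriv a b n w q" "v \<in> L2_space a b" "w \<in> L2_space a b"
  shows "has_weak_deriv a b n (\<lambda>x. s * v x + t * w x) (\<lambda>x. s * p x + t * q x)"
  unfolding has_weak_deriv_def
proof (intro conjI allI impI)
  have pq: "p \<in> L2_space a b" "q \<in> L2_space a b" using assms by (auto simp: has_weak_deriv_def)
  then show "(\<lambda>x. s * p x + t * q x) \<in> L2_space a b" by (rule L2_linear)
  fix \<phi> assume \<phi>: "test_function a b \<phi>"
  have \<phi>0: "\<phi> \<in> L2_space a b" using test_function_L2[OF \<phi>, of 0] by simp
  show "L2_inner a b (\<lambda>x. s * v x + t * w x) ((deriv ^^ n) \<phi>) = (- 1) ^ n * L2_inner a b (\<lambda>x. s * p x + t * q x) \<phi>"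
    using assms(1,2) \<phi> unfolding L2_inner_linear[OF assms(3,4) test_function_L2[OF \<phi>]] L2_inner_linear[OF pq \<phi>0]
    by (auto simp: has_weak_deriv_def distrib_left)
qed

lemma sobolev_space_linear:
  assumes "v \<in> sobolev_space a b m" "w \<in> sobolev_space a b m"
  shows "(\<lambda>x. s * v x + t * w x) \<in> sobolev_space a b m"
  using assms has_weak_deriv_linear unfolding sobolev_space_def by (auto intro: L2_linear) metis

lemma weak_deriv_linear:
  assumes v: "v \<in> sobolev_space a b m" and w: "w \<in> sobolev_space a b m" and n: "n \<le> m"
  shows "AE x in lebesgue_on {a..b}. weak_deriv a b n (\<lambda>x. s * v x + t * w x) x = s * weak_deriv a b n v x + t * weak_deriv a b n w x"
  by (rule weak_deriv_unique[OF weak_deriv(1)[OF sobolev_space_linear[OF v w] n]])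
    (intro has_weak_deriv_linear weak_deriv(1)[OF v n] weak_deriv(1)[OF w n] sobolev_space_L2[OF v] sobolev_space_L2[OF w])

lemma cderiv_linear:
  assumes v: "v \<in> sobolev_space a b m" and w: "w \<in> sobolev_space a b m" and n: "n < m"
    and ab: "a < b" and x: "x \<in> {a..b}"
  shows "cderiv a b n (\<lambda>x. s * v x + t * w x) x = s * cderiv a b n v x + t * cderiv a b n w x"
proof (rule continuous_AE_eq_imp_eq[OF _ _ _ ab x])
  note vw = sobolev_space_linear[OF v w, of s t]
  show "continuous_on {a..b} (cderiv a b n (\<lambda>x. s * v x + t * w x))" by (rule cderiv_continuous[OF ab vw n])
  show "continuous_on {a..b} (\<lambda>x. s * cderiv a b n v x + t * cderiv a b n w x)"
    by (intro continuous_intros cderiv_continuous[OF ab v n] cderiv_continuous[OF ab w n])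
  show "AE x in lebesgue_on {a..b}. cderiv a b n (\<lambda>x. s * v x + t * w x) x = s * cderiv a b n v x + t * cderiv a b n w x"
    using cderiv_AE[OF ab vw n] cderiv_AE[OF ab v n] cderiv_AE[OF ab w n] weak_deriv_linear[OF v w less_imp_le[OF n], of s t]
    by eventually_elim simp
qed

lemma sobolev_norm_nonneg: "0 \<le> sobolev_norm a b s v"
  by (simp add: sobolev_norm_def sum_nonneg)

lemma sobolev_norm_linear:
  assumes v: "v \<in> sobolev_space a b m" and w: "w \<in> sobolev_space a b m"
  shows "sobolev_norm a b m (\<lambda>x. s * v x + t * w x) \<le> \<bar>s\<bar> * sobolev_norm a b m v + \<bar>t\<bar> * sobolev_norm a b m w"
proof -
  have 1: "L2_norm a b (weak_deriv a b n (\<lambda>x. s * v x + t * w x)) \<le>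
     \<bar>s\<bar> * L2_norm a b (weak_deriv a b n v) + \<bar>t\<bar> * L2_norm a b (weak_deriv a b n w)" if n: "n \<le> m" for n
  proof -
    have L: "weak_deriv a b n v \<in> L2_space a b" "weak_deriv a b n w \<in> L2_space a b"
      using weak_deriv(2) v w n by auto
    have S: "(\<lambda>x. c * f x) \<in> L2_space a b" if "f \<in> L2_space a b" for c f
      using L2_linear[OF that that, of c 0] by simp
    have "L2_norm a b (weak_deriv a b n (\<lambda>x. s * v x + t * w x)) = L2_norm a b (\<lambda>x. s * weak_deriv a b n v x + t * weak_deriv a b n w x)"
      by (intro L2_norm_cong_AE weak_deriv_linear[OF v w n] weak_deriv(2)[OF sobolev_space_linear[OF v w] n] L2_linear L)
    also have "\<dots> \<le> L2_norm a b (\<lambda>x. s * weak_deriv a b n v x) + L2_norm a b (\<lambda>x. t * weak_deriv a b n w x)"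
      by (intro L2_norm_triangle S L)
    finally show ?thesis by (simp add: L2_norm_scale)
  qed
  have "sobolev_norm a b m (\<lambda>x. s * v x + t * w x) \<le>
     L2_set (\<lambda>n. \<bar>s\<bar> * L2_norm a b (weak_deriv a b n v) + \<bar>t\<bar> * L2_norm a b (weak_deriv a b n w)) {..m}"
    unfolding sobolev_norm_def L2_set_def
    by (intro real_sqrt_le_mono sum_mono power_mono 1) (auto simp: L2_norm_nonneg)
  also have "\<dots> \<le> L2_set (\<lambda>n. \<bar>s\<bar> * L2_norm a b (weak_deriv a b n v)) {..m} + L2_set (\<lambda>n. \<bar>t\<bar> * L2_norm a b (weak_deriv a b n w)) {..m}"
    by (rule L2_set_triangle_ineq)
  also have "\<dots> = \<bar>s\<bar> * sobolev_norm a b m v + \<bar>t\<bar> * sobolev_norm a b m w"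
    by (simp add: sobolev_norm_def L2_set_def power_mult_distrib real_sqrt_mult flip: sum_distrib_left)
  finally show ?thesis .
qed

subsection \<open>Differentiation in time\<close>

text \<open>A bounded linear functional commutes with differentiation in the Sobolev norm. Through
  it, scalar calculus in time becomes available for point values and for inner products.\<close>

lemma sobolev_functional_deriv:
  fixes \<Phi> :: "(real \<Rightarrow> real) \<Rightarrow> real"
  assumes lin: "\<And>v w s t. v \<in> sobolev_space a b m \<Longrightarrow> w \<in> sobolev_space a b m \<Longrightarrow> \<Phi> (\<lambda>x. s * v x + t * w x) = s * \<Phi> v + t * \<Phi> w"
    and bnd: "\<And>v. v \<in> sobolev_space a b m \<Longrightarrow> \<bar>\<Phi> v\<bar> \<le> C * sobolev_norm a b m v"
    and D: "\<And>t. t \<in> {0..T} \<Longrightarrow> D t \<in> sobolev_space a b m" and E: "E \<in> sobolev_space a b m"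
    and lim: "((\<lambda>\<sigma>. sobolev_norm a b m (\<lambda>x. (D \<sigma> x - D t x) / (\<sigma> - t) - E x)) \<longlongrightarrow> 0) (at t within {0..T})"
    and t: "t \<in> {0..T}"
  shows "((\<lambda>t. \<Phi> (D t)) has_real_derivative \<Phi> E) (at t within {0..T})"
  unfolding has_field_derivative_iff
proof (rule Lim_transform)
  let ?q = "\<lambda>\<sigma> x. (D \<sigma> x - D t x) / (\<sigma> - t) - E x"
  show "((\<lambda>\<sigma>. \<Phi> E) \<longlongrightarrow> \<Phi> E) (at t within {0..T})" by simp
  have "((\<lambda>\<sigma>. C * sobolev_norm a b m (?q \<sigma>)) \<longlongrightarrow> 0) (at t within {0..T})"
    using tendsto_mult_right_zero[OF lim] .
  then show "((\<lambda>\<sigma>. (\<Phi> (D \<sigma>) - \<Phi> (D t)) / (\<sigma> - t) - \<Phi> E) \<longlongrightarrow> 0) (at t within {0..T})"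
  proof (rule Lim_null_comparison[rotated])
    show "\<forall>\<^sub>F \<sigma> in at t within {0..T}. norm ((\<Phi> (D \<sigma>) - \<Phi> (D t)) / (\<sigma> - t) - \<Phi> E) \<le> C * sobolev_norm a b m (?q \<sigma>)"
      unfolding eventually_at_filter
    proof (intro always_eventually allI impI)
      fix \<sigma> assume \<sigma>: "\<sigma> \<noteq> t" "\<sigma> \<in> {0..T}"
      \<comment> \<open>The difference and the quotient are written as linear combinations with
        explicit coefficients, so that they match the linearity hypothesis.\<close>
      let ?d = "\<lambda>x. 1 * D \<sigma> x + (- 1) * D t x"
      let ?r = "\<lambda>x. 1 / (\<sigma> - t) * ?d x + (- 1) * E x"
      have d: "?d \<in> sobolev_space a b m" by (rule sobolev_space_linear[OF D[OF \<sigma>(2)] D[OF t]])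
      then have "?r \<in> sobolev_space a b m" by (rule sobolev_space_linear[OF _ E])
      then have "\<bar>\<Phi> ?r\<bar> \<le> C * sobolev_norm a b m ?r" by (rule bnd)
      moreover have "\<Phi> ?r = 1 / (\<sigma> - t) * (1 * \<Phi> (D \<sigma>) + (- 1) * \<Phi> (D t)) + (- 1) * \<Phi> E"
        by (simp only: lin[OF d E] lin[OF D[OF \<sigma>(2)] D[OF t]])
      moreover have "?r = ?q \<sigma>" by (simp add: fun_eq_iff)
      ultimately show "norm ((\<Phi> (D \<sigma>) - \<Phi> (D t)) / (\<sigma> - t) - \<Phi> E) \<le> C * sobolev_norm a b m (?q \<sigma>)"
        by simp
    qed
  qed
qed

lemma sobolev_norm_bounded:
  fixes D :: "real \<Rightarrow> real \<Rightarrow> real"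
  assumes D: "\<And>t. t \<in> {0..T} \<Longrightarrow> D t \<in> sobolev_space a b m"
    and lim: "\<And>t. t \<in> {0..T} \<Longrightarrow> ((\<lambda>\<sigma>. sobolev_norm a b m (\<lambda>x. D \<sigma> x - D t x)) \<longlongrightarrow> 0) (at t within {0..T})"
  obtains G where "G > 0" "\<And>t. t \<in> {0..T} \<Longrightarrow> sobolev_norm a b m (D t) \<le> G"
proof -
  have "continuous_on {0..T} (\<lambda>t. sobolev_norm a b m (D t))"
    unfolding continuous_on_def
  proof
    fix t assume t: "t \<in> {0..T}"
    show "((\<lambda>t. sobolev_norm a b m (D t)) \<longlongrightarrow> sobolev_norm a b m (D t)) (at t within {0..T})"
    proof (rule Lim_transform[OF tendsto_const], rule Lim_null_comparison[OF _ lim[OF t]])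
      show "\<forall>\<^sub>F \<sigma> in at t within {0..T}. norm (sobolev_norm a b m (D \<sigma>) - sobolev_norm a b m (D t)) \<le> sobolev_norm a b m (\<lambda>x. D \<sigma> x - D t x)"
        unfolding eventually_at_filter
      proof (intro always_eventually allI impI)
        fix \<sigma> assume \<sigma>: "\<sigma> \<noteq> t" "\<sigma> \<in> {0..T}"
        let ?d = "\<lambda>x. 1 * D \<sigma> x + (- 1) * D t x"
        have d: "?d \<in> sobolev_space a b m" by (rule sobolev_space_linear[OF D[OF \<sigma>(2)] D[OF t]])
        show "norm (sobolev_norm a b m (D \<sigma>) - sobolev_norm a b m (D t)) \<le> sobolev_norm a b m (\<lambda>x. D \<sigma> x - D t x)"
          using sobolev_norm_linear[OF d D[OF t], of 1 1] sobolev_norm_linear[OF d D[OF \<sigma>(2)], of "-1" 1]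
          by (simp add: abs_le_iff)
      qed
    qed
  qed
  then have "bounded ((\<lambda>t. sobolev_norm a b m (D t)) ` {0..T})"
    by (intro compact_imp_bounded compact_continuous_image) auto
  then obtain G where G: "G > 0" "\<forall>t\<in>{0..T}. \<bar>sobolev_norm a b m (D t)\<bar> \<le> G"
    by (auto simp: bounded_pos)
  show ?thesis by (rule that[OF G(1)]) (use G(2) in force)
qed

lemma sobolev_differentiable_imp_continuous:
  assumes D: "\<And>t. t \<in> {0..T} \<Longrightarrow> D t \<in> sobolev_space a b m" and E: "E \<in> sobolev_space a b m"
    and lim: "((\<lambda>\<sigma>. sobolev_norm a b m (\<lambda>x. (D \<sigma> x - D t x) / (\<sigma> - t) - E x)) \<longlongrightarrow> 0) (at t within {0..T})"
    and t: "t \<in> {0..T}"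
  shows "((\<lambda>\<sigma>. sobolev_norm a b m (\<lambda>x. D \<sigma> x - D t x)) \<longlongrightarrow> 0) (at t within {0..T})"
proof (rule Lim_null_comparison)
  let ?q = "\<lambda>\<sigma> x. (D \<sigma> x - D t x) / (\<sigma> - t) - E x"
  have "((\<lambda>\<sigma>. \<bar>\<sigma> - t\<bar> * sobolev_norm a b m (?q \<sigma>) + \<bar>\<sigma> - t\<bar> * sobolev_norm a b m E) \<longlongrightarrow> \<bar>t - t\<bar> * 0 + \<bar>t - t\<bar> * sobolev_norm a b m E) (at t within {0..T})"
    by (intro tendsto_intros lim)
  then show "((\<lambda>\<sigma>. \<bar>\<sigma> - t\<bar> * sobolev_norm a b m (?q \<sigma>) + \<bar>\<sigma> - t\<bar> * sobolev_norm a b m E) \<longlongrightarrow> 0) (at t within {0..T})"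
    by simp
  show "\<forall>\<^sub>F \<sigma> in at t within {0..T}. norm (sobolev_norm a b m (\<lambda>x. D \<sigma> x - D t x)) \<le> \<bar>\<sigma> - t\<bar> * sobolev_norm a b m (?q \<sigma>) + \<bar>\<sigma> - t\<bar> * sobolev_norm a b m E"
    unfolding eventually_at_filter
  proof (intro always_eventually allI impI)
    fix \<sigma> assume \<sigma>: "\<sigma> \<noteq> t" "\<sigma> \<in> {0..T}"
    let ?d = "\<lambda>x. 1 * D \<sigma> x + (- 1) * D t x"
    let ?r = "\<lambda>x. 1 / (\<sigma> - t) * ?d x + (- 1) * E x"
    have d: "?d \<in> sobolev_space a b m" by (rule sobolev_space_linear[OF D[OF \<sigma>(2)] D[OF t]])
    then have r: "?r \<in> sobolev_space a b m" by (rule sobolev_space_linear[OF _ E])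
    have rq: "?r = ?q \<sigma>" by (simp add: fun_eq_iff)
    have "sobolev_norm a b m (\<lambda>x. (\<sigma> - t) * ?q \<sigma> x + (\<sigma> - t) * E x) \<le> \<bar>\<sigma> - t\<bar> * sobolev_norm a b m (?q \<sigma>) + \<bar>\<sigma> - t\<bar> * sobolev_norm a b m E"
      by (rule sobolev_norm_linear) (use r[unfolded rq] E in auto)
    moreover have "(\<lambda>x. (\<sigma> - t) * ?q \<sigma> x + (\<sigma> - t) * E x) = (\<lambda>x. D \<sigma> x - D t x)"
      using \<sigma> by (simp add: fun_eq_iff field_simps)
    ultimately show "norm (sobolev_norm a b m (\<lambda>x. D \<sigma> x - D t x)) \<le> \<bar>\<sigma> - t\<bar> * sobolev_norm a b m (?q \<sigma>) + \<bar>\<sigma> - t\<bar> * sobolev_norm a b m E"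
      by (simp add: sobolev_norm_nonneg)
  qed
qed

section \<open>Polynomial interpolation and Gauss--Lobatto quadrature\<close>

lemma poly_integral_eq:
  "(LINT s|lebesgue_on {lo..hi}. poly q s) = integral {lo..hi} (poly q)" for lo hi :: real
  by (intro lebesgue_integral_eq_integral continuous_imp_integrable_real continuous_intros) auto

lemma poly_integrable: "poly q integrable_on {lo..hi}" for lo hi :: real
  by (intro integrable_continuous_real continuous_intros)

lemma poly_FTC:
  fixes lo hi :: real
  assumes "lo \<le> hi"
  shows "(poly (pderiv q) has_integral poly q hi - poly q lo) {lo..hi}"
  using assms
  by (intro fundamental_theorem_of_calculus)
    (auto simp flip: has_real_derivative_iff_has_vector_derivative intro: poly_DERIV has_field_derivative_at_within)

lemma pderiv_sum_set: "pderiv (\<Sum>i\<in>A. f i) = (\<Sum>i\<in>A. pderiv (f i :: real poly))"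
  by (induction A rule: infinite_finite_induct) (auto simp: pderiv_add)

lemma poly_antideriv:
  fixes p :: "real poly"
  obtains R where "pderiv R = p" "degree R \<le> Suc (degree p)" "poly R x0 = v"
proof -
  define R0 where "R0 = (\<Sum>i\<le>degree p. monom (coeff p i / real (Suc i)) (Suc i))"
  have "pderiv R0 = (\<Sum>i\<le>degree p. monom (coeff p i) i)"
    unfolding R0_def by (simp add: pderiv_sum_set pderiv_monom del: of_nat_Suc)
  then have d: "pderiv R0 = p" by (simp add: poly_as_sum_of_monoms)
  have deg: "degree R0 \<le> Suc (degree p)"
    unfolding R0_def by (intro degree_sum_le) (auto intro: order_trans[OF degree_monom_le])
  show ?thesis
  proof (rule that[of "R0 + [:v - poly R0 x0:]"])
    show "degree (R0 + [:v - poly R0 x0:]) \<le> Suc (degree p)" by (intro degree_add_le deg) simp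
  qed (use d in \<open>auto simp: pderiv_add pderiv_pCons\<close>)
qed

definition lagrange_poly :: "'i set \<Rightarrow> ('i \<Rightarrow> real) \<Rightarrow> 'i \<Rightarrow> real poly" where
  "lagrange_poly J y j = (\<Prod>i\<in>J - {j}. smult (1 / (y j - y i)) [:- y i, 1:])"

lemma poly_lagrange_poly: "poly (lagrange_poly J y j) s = (\<Prod>i\<in>J - {j}. (s - y i) / (y j - y i))"
  unfolding lagrange_poly_def poly_prod by (rule prod.cong) (auto simp: diff_divide_distrib)

lemma degree_lagrange_poly:
  assumes "finite J" "j \<in> J" shows "degree (lagrange_poly J y j) \<le> card J - 1"
proof -
  have "degree (lagrange_poly J y j) \<le> (\<Sum>i\<in>J - {j}. degree (smult (1 / (y j - y i)) [:- y i, 1:]))"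
    unfolding lagrange_poly_def
    using degree_prod_sum_le[of "J - {j}" "\<lambda>i. smult (1 / (y j - y i)) [:- y i, 1:]"] assms by (simp only: comp_def finite_Diff)
  also have "\<dots> \<le> (\<Sum>i\<in>J - {j}. 1)" by (intro sum_mono) (auto intro: order_trans[OF degree_smult_le])
  finally show ?thesis using assms by simp
qed

lemma lagrange_poly_node:
  assumes "finite J" "inj_on y J" "j \<in> J" "l \<in> J"
  shows "poly (lagrange_poly J y j) (y l) = (if l = j then 1 else 0)"
proof (cases "l = j")
  case True
  have "(y j - y i) / (y j - y i) = 1" if "i \<in> J - {j}" for i
    using that assms by (auto dest: inj_onD)
  then show ?thesis using True by (simp add: poly_lagrange_poly)
next
  case False
  then have "(\<Prod>i\<in>J - {j}. (y l - y i) / (y j - y i)) = 0" using assms by (intro prod_zero) auto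
  then show ?thesis using False by (simp add: poly_lagrange_poly)
qed

lemma poly_eqI_nodes:
  fixes p q :: "real poly"
  assumes "finite J" "inj_on y J" "degree p < card J" "degree q < card J" "\<And>j. j \<in> J \<Longrightarrow> poly p (y j) = poly q (y j)"
  shows "p = q"
proof (rule poly_eqI_degree[of "y ` J"])
  show "card (y ` J) > degree p" "card (y ` J) > degree q" using assms by (auto simp: card_image)
qed (use assms in auto)

lemma interpolation_exists:
  assumes "finite J" "inj_on y J" "J \<noteq> {}"
  obtains q :: "real poly" where "degree q \<le> card J - 1" "\<And>j. j \<in> J \<Longrightarrow> poly q (y j) = g j"
    "q = (\<Sum>j\<in>J. smult (g j) (lagrange_poly J y j))"
proof (rule that)
  let ?q = "\<Sum>j\<in>J. smult (g j) (lagrange_poly J y j)"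
  show "degree ?q \<le> card J - 1"
    using assms by (intro degree_sum_le order_trans[OF degree_smult_le degree_lagrange_poly]) auto
  show "poly ?q (y j) = g j" if "j \<in> J" for j
  proof -
    have "poly ?q (y j) = (\<Sum>i\<in>J. if j = i then g i else 0)"
      unfolding poly_sum by (rule sum.cong) (use assms that in \<open>auto simp: lagrange_poly_node\<close>)
    then show ?thesis using that assms by simp
  qed
qed simp

lemma lagrange_reproduction:
  assumes J: "finite J" "inj_on y J" and p: "degree p < card J"
  shows "p = (\<Sum>j\<in>J. smult (poly p (y j)) (lagrange_poly J y j))"
proof -
  have "J \<noteq> {}" using p by auto
  from interpolation_exists[OF J this, of "\<lambda>j. poly p (y j)"]
  obtain q where q: "degree q \<le> card J - 1" "\<And>j. j \<in> J \<Longrightarrow> poly q (y j) = poly p (y j)"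
    "q = (\<Sum>j\<in>J. smult (poly p (y j)) (lagrange_poly J y j))"
    by blast
  have "q = p" by (rule poly_eqI_nodes[OF J]) (use q p in auto)
  then show ?thesis using q(3) by simp
qed

text \<open>Only the integral relations between successive \<open>g n\<close> are used, so that the last \<open>g\<close> may be
  the primitive of a merely square-integrable function.\<close>

lemma taylor_poly:
  fixes g :: "nat \<Rightarrow> real \<Rightarrow> real"
  assumes "lo \<le> hi"
    and "\<And>n x. n < m \<Longrightarrow> x \<in> {lo..hi} \<Longrightarrow> (g (Suc n) has_integral g n x - g n lo) {lo..x}"
    and "\<And>x. x \<in> {lo..hi} \<Longrightarrow> \<bar>g m x - g m lo\<bar> \<le> \<kappa>"
  shows "\<exists>P. degree P \<le> m \<and> (\<forall>n\<le>m. \<forall>x\<in>{lo..hi}. \<bar>g n x - poly ((pderiv ^^ n) P) x\<bar> \<le> \<kappa> * (hi - lo) ^ (m - n))"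
  using assms(2,3)
proof (induction m arbitrary: g)
  case 0
  then show ?case by (intro exI[of _ "[:g 0 lo:]"]) auto
next
  case (Suc m)
  have "\<exists>P. degree P \<le> m \<and> (\<forall>n\<le>m. \<forall>x\<in>{lo..hi}. \<bar>g (Suc n) x - poly ((pderiv ^^ n) P) x\<bar> \<le> \<kappa> * (hi - lo) ^ (m - n))"
    using Suc.prems by (intro Suc.IH[of "\<lambda>n. g (Suc n)"]) auto
  then obtain P where P: "degree P \<le> m" "\<And>n x. n \<le> m \<Longrightarrow> x \<in> {lo..hi} \<Longrightarrow> \<bar>g (Suc n) x - poly ((pderiv ^^ n) P) x\<bar> \<le> \<kappa> * (hi - lo) ^ (m - n)"
    by blast
  \<comment> \<open>The first derivative is approximated by induction and then integrated. The
    primitive is normalized at \<open>lo\<close>, where its error vanishes; integration costs one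
    factor \<open>hi - lo\<close>.\<close>
  obtain R where R: "pderiv R = P" "degree R \<le> Suc (degree P)" "poly R lo = g 0 lo" by (rule poly_antideriv)
  have "0 \<le> \<kappa>" using Suc.prems(2)[of lo] assms(1) by simp
  have "\<bar>g n x - poly ((pderiv ^^ n) R) x\<bar> \<le> \<kappa> * (hi - lo) ^ (Suc m - n)" if "n \<le> Suc m" and x: "x \<in> {lo..hi}" for n x
  proof (cases n)
    case (Suc n')
    then show ?thesis using P(2)[of n' x] that by (simp add: funpow_swap1 R(1))
  next
    case 0
    have "((\<lambda>s. g (Suc 0) s - poly P s) has_integral (g 0 x - g 0 lo) - (poly R x - poly R lo)) {lo..x}"
      using Suc.prems(1)[of 0 x] poly_FTC[of lo x R] x by (intro has_integral_diff) (auto simp: R)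
    then have "norm ((g 0 x - g 0 lo) - (poly R x - poly R lo)) \<le> (\<kappa> * (hi - lo) ^ m) * measure lborel {lo..x}"
      by (rule has_integral_bound_real[where S="{}", rotated 2]) (use P(2)[of 0] x \<open>0 \<le> \<kappa>\<close> assms(1) in auto)
    then have "\<bar>g 0 x - poly R x\<bar> \<le> (\<kappa> * (hi - lo) ^ m) * (x - lo)" using R(3) x by simp
    also have "\<dots> \<le> (\<kappa> * (hi - lo) ^ m) * (hi - lo)"
      using x \<open>0 \<le> \<kappa>\<close> by (intro mult_left_mono) auto
    finally show ?thesis using 0 by (simp add: mult_ac)
  qed
  moreover have "degree R \<le> Suc m" using R P by simp
  ultimately show ?case by blast
qed

lemma poly_nonneg_integral_0:
  fixes lo hi :: real
  assumes "lo < hi" "\<And>s. s \<in> {lo..hi} \<Longrightarrow> 0 \<le> poly q s" "integral {lo..hi} (poly q) = 0"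
  shows "q = 0"
proof -
  have "(poly q has_integral 0) (cbox lo hi)" using integrable_integral[OF poly_integrable[of q lo hi]] assms by simp
  then have "poly q s = 0" if "s \<in> {lo..hi}" for s
    by (rule has_integral_0_cbox_imp_0[rotated 2]) (use assms that in \<open>auto intro!: continuous_intros\<close>)
  then have "{lo..hi} \<subseteq> {s. poly q s = 0}" by auto
  then have "infinite {s. poly q s = 0}" using infinite_Icc[OF assms(1)] finite_subset by blast
  then show ?thesis using poly_roots_finite by blast
qed

lemma poly_nonneg_integral_pos:
  fixes lo hi :: real
  assumes "lo < hi" "\<And>s. s \<in> {lo..hi} \<Longrightarrow> 0 \<le> poly q s" "q \<noteq> 0"
  shows "integral {lo..hi} (poly q) > 0"
proof -
  have "integral {lo..hi} (poly q) \<ge> 0"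
    by (rule Henstock_Kurzweil_Integration.integral_nonneg[OF poly_integrable]) (use assms in auto)
  moreover have "integral {lo..hi} (poly q) \<noteq> 0" using poly_nonneg_integral_0[OF assms(1,2)] assms(3) by blast
  ultimately show ?thesis by simp
qed

section \<open>Gauss--Lobatto rules: positive weights, uniqueness, and constants from the reference
  interval\<close>

lemma gauss_lobattoD:
  assumes "gauss_lobatto r lo hi y \<omega>"
  shows "y 0 = lo" "y r = hi" "inj_on y {0..r}" "\<And>i j. i < j \<Longrightarrow> j \<le> r \<Longrightarrow> y i < y j"
    "\<And>j. j \<le> r \<Longrightarrow> y j \<in> {lo..hi}"
    "\<And>q. degree q \<le> 2 * r - 1 \<Longrightarrow> (\<Sum>j=0..r. \<omega> j * poly q (y j)) = integral {lo..hi} (poly q)"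
proof -
  have m: "strict_mono_on {0..r} y" using assms by (simp add: gauss_lobatto_def)
  show 0: "y 0 = lo" "y r = hi" using assms by (auto simp: gauss_lobatto_def)
  show "inj_on y {0..r}" using m by (rule strict_mono_on_imp_inj_on)
  show l: "y i < y j" if "i < j" "j \<le> r" for i j using strict_mono_onD[OF m, of i j] that by auto
  show "y j \<in> {lo..hi}" if "j \<le> r" for j
    using l[of 0 j] l[of j r] that 0 by (cases "j = 0"; cases "j = r") (auto simp: less_imp_le)
  show "(\<Sum>j=0..r. \<omega> j * poly q (y j)) = integral {lo..hi} (poly q)" if "degree q \<le> 2 * r - 1" for q
    using assms that by (simp add: gauss_lobatto_def poly_integral_eq)
qed

text \<open>The rule is exact for a polynomial that is nonnegative on the interval and vanishes at
  every node except \<open>y j\<close>. Factors at interior nodes are squared to fix the sign; at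
  the end points simple factors suffice, since they do not change sign inside.\<close>

lemma gauss_lobatto_weight_pos:
  assumes GL: "gauss_lobatto r lo hi y \<omega>" and r: "r \<ge> 1" and j: "j \<le> r"
  shows "\<omega> j > 0"
proof -
  note G = gauss_lobattoD[OF GL]
  have lohi: "lo < hi" using G(4)[of 0 r] G(1,2) r by simp
  define q1 where "q1 = (\<Prod>i\<in>{1..<r} - {j}. [:- y i, 1:] ^ 2)"
  define q2 where "q2 = (if j \<noteq> 0 then [:- lo, 1:] else 1)"
  define q3 where "q3 = (if j \<noteq> r then [:hi, - 1:] else 1)"
  define q where "q = q1 * q2 * q3"
  have "degree q1 \<le> (\<Sum>i\<in>{1..<r} - {j}. degree ([:- y i, 1:] ^ 2))"
    unfolding q1_def using degree_prod_sum_le[of "{1..<r} - {j}"] by (simp add: comp_def)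
  also have "\<dots> \<le> (\<Sum>i\<in>{1..<r} - {j}. 2)"
    by (intro sum_mono order_trans[OF degree_power_le]) simp
  finally have d1: "degree q1 \<le> 2 * card ({1..<r} - {j})" by simp
  have d2: "degree q2 \<le> (if j \<noteq> 0 then 1 else 0)" "degree q3 \<le> (if j \<noteq> r then 1 else 0)"
    by (auto simp: q2_def q3_def)
  have c: "card ({1..<r} - {j}) = (if j = 0 \<or> j = r then r - 1 else r - 2)"
    using j by (auto simp: card_Diff_singleton_if)
  have "degree q \<le> degree q1 + degree q2 + degree q3"
    unfolding q_def by (intro order_trans[OF degree_mult_le] add_mono degree_mult_le) simp
  \<comment> \<open>An interior \<open>j\<close> gives degree \<open>2 * (r - 2) + 2\<close>, an end
    point gives \<open>2 * (r - 1) + 1\<close>.\<close>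
  also have "\<dots> \<le> 2 * r - 1" using d1 d2 c j r by (auto split: if_splits)
  finally have dq: "degree q \<le> 2 * r - 1" .
  have pq: "poly q s = (\<Prod>i\<in>{1..<r} - {j}. (s - y i)\<^sup>2) * (if j \<noteq> 0 then s - lo else 1) * (if j \<noteq> r then hi - s else 1)" for s
    by (simp add: q_def q1_def q2_def q3_def poly_prod)
  have nonneg: "0 \<le> poly q s" if "s \<in> {lo..hi}" for s
    unfolding pq using that by (intro mult_nonneg_nonneg prod_nonneg) auto
  have qj: "poly q (y j) > 0"
    unfolding pq
  proof (intro mult_pos_pos prod_pos)
    show "0 < (y j - y i)\<^sup>2" if "i \<in> {1..<r} - {j}" for i
      using that G(4)[of i j] G(4)[of j i] j by (cases "i < j") auto
    show "0 < (if j \<noteq> 0 then y j - lo else 1)" using G(4)[of 0 j] G(1) j by auto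
    show "0 < (if j \<noteq> r then hi - y j else 1)" using G(4)[of j r] G(2) j by auto
  qed
  have q0: "poly q (y i) = 0" if i: "i \<le> r" "i \<noteq> j" for i
  proof -
    consider "i = 0" | "i = r" | "i \<in> {1..<r} - {j}" using i by force
    then show ?thesis unfolding pq using i G(1,2) by cases (auto simp: prod_zero_iff)
  qed
  have "(\<Sum>i=0..r. \<omega> i * poly q (y i)) = (\<Sum>i=0..r. if i = j then \<omega> j * poly q (y j) else 0)"
    by (rule sum.cong) (auto simp: q0)
  also have "\<dots> = \<omega> j * poly q (y j)" using j by simp
  finally have "\<omega> j * poly q (y j) = integral {lo..hi} (poly q)" using G(6)[OF dq] by simp
  moreover have "integral {lo..hi} (poly q) > 0"
    by (rule poly_nonneg_integral_pos[OF lohi nonneg]) (use qj in auto)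
  ultimately show ?thesis using qj by (metis zero_less_mult_pos2)
qed

text \<open>The polynomial of the interior nodes is the monic polynomial of degree
  \<open>r - 1\<close> that is orthogonal to all lower degrees for the weight
  \<open>s * (1 - s)\<close>. Two such polynomials differ by a polynomial of lower degree, which is
  then orthogonal to itself.\<close>

lemma gauss_lobatto_unit_nodes_unique:
  assumes Y: "gauss_lobatto r 0 1 y \<omega>" and Z: "gauss_lobatto r 0 1 z \<nu>" and r: "r \<ge> 1"
  shows "y ` {0..r} = z ` {0..r}"
proof -
  define P where "P y = (\<Prod>i\<in>{1..<r}. [:- y i, 1:])" for y :: "nat \<Rightarrow> real"
  define B :: "real poly" where "B = [:0, 1, -1:]"
  have pB: "poly B s = s * (1 - s)" for s by (simp add: B_def algebra_simps)
  have dP: "degree (P y) = r - 1" "coeff (P y) (r - 1) = 1" for y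
  proof -
    show d: "degree (P y) = r - 1" unfolding P_def by (subst degree_prod_eq_sum_degree) auto
    have "lead_coeff (P y) = 1" unfolding P_def lead_coeff_prod by simp
    then show "coeff (P y) (r - 1) = 1" using d by simp
  qed
  have P0: "poly (P y) s = 0 \<longleftrightarrow> s \<in> y ` {1..<r}" for y s
    by (auto simp: P_def poly_prod)
  have "P y = P z"
  proof (rule ccontr)
    assume ne: "P y \<noteq> P z"
    let ?d = "P y - P z"
    have "degree ?d \<le> r - 1" using dP[of y] dP[of z] by (intro degree_diff_le) auto
    moreover have "degree ?d \<noteq> r - 1"
    proof
      assume "degree ?d = r - 1"
      then have "lead_coeff ?d = coeff (P y) (r - 1) - coeff (P z) (r - 1)" by (simp only: coeff_diff)
      then have "lead_coeff ?d = 0" using dP(2) by simp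
      then show False using ne by (simp only: leading_coeff_0_iff right_minus_eq)
    qed
    ultimately have dd: "degree ?d < r - 1" by simp
    \<comment> \<open>The integrand vanishes at every node of \<open>v\<close>: \<open>B\<close> at
      the end points, \<open>P v\<close> inside. Its degree is at most
      \<open>2 + (r - 1) + (r - 2)\<close>, so the rule integrates it exactly.\<close>
    have I: "integral {0..1} (poly (B * P v * ?d)) = 0" if v: "gauss_lobatto r 0 1 v \<mu>" for v \<mu>
    proof -
      note G = gauss_lobattoD[OF v]
      have "degree (B * P v * ?d) \<le> degree B + degree (P v) + degree ?d"
        by (intro order_trans[OF degree_mult_le] add_mono degree_mult_le) simp
      also have "\<dots> \<le> 2 * r - 1" using dP[of v] dd by (simp add: B_def)
      finally have "integral {0..1} (poly (B * P v * ?d)) = (\<Sum>j=0..r. \<mu> j * poly (B * P v * ?d) (v j))"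
        by (rule G(6)[symmetric])
      also have "\<dots> = 0"
      proof (rule sum.neutral, rule ballI)
        fix j assume "j \<in> {0..r}"
        then consider "j = 0" | "j = r" | "j \<in> {1..<r}" by force
        then have "poly B (v j) = 0 \<or> poly (P v) (v j) = 0"
          using G(1,2) by cases (auto simp: pB P0)
        then show "\<mu> j * poly (B * P v * ?d) (v j) = 0" by auto
      qed
      finally show ?thesis .
    qed
    have "integral {0..1} (poly (B * ?d * ?d)) = integral {0..1} (\<lambda>s. poly (B * P y * ?d) s - poly (B * P z * ?d) s)"
      by (rule Henstock_Kurzweil_Integration.integral_cong) (simp add: algebra_simps)
    also have "\<dots> = 0"
      by (subst Henstock_Kurzweil_Integration.integral_diff) (auto intro: poly_integrable simp only: I[OF Y] I[OF Z])
    finally have "B * ?d * ?d = 0"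
    proof (rule poly_nonneg_integral_0[rotated 2])
      fix s :: real assume "s \<in> {0..1}"
      then have "0 \<le> (s * (1 - s)) * (poly ?d s)\<^sup>2" by simp
      then show "0 \<le> poly (B * ?d * ?d) s" by (simp add: pB power2_eq_square mult.assoc)
    qed simp
    moreover have "B \<noteq> 0" by (simp add: B_def)
    ultimately show False using ne by simp
  qed
  then have "y ` {1..<r} = z ` {1..<r}" using P0[of y] P0[of z] by auto
  moreover have "v ` {0..r} = insert 0 (insert 1 (v ` {1..<r}))" if "gauss_lobatto r 0 1 v \<mu>" for v \<mu>
  proof -
    have "{0..r} = insert 0 (insert r {1..<r})" using r by auto
    then show ?thesis using gauss_lobattoD(1,2)[OF that] by simp
  qed
  ultimately show ?thesis using Y Z by metis
qed

text \<open>A finite set has only one sorted enumeration without repetition, so equal node sets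
  force equal node sequences.\<close>

lemma strict_mono_on_image_eq:
  fixes y z :: "nat \<Rightarrow> real"
  assumes y: "\<And>i j. i < j \<Longrightarrow> j \<le> r \<Longrightarrow> y i < y j" and z: "\<And>i j. i < j \<Longrightarrow> j \<le> r \<Longrightarrow> z i < z j"
    and im: "y ` {0..r} = z ` {0..r}" and j: "j \<le> r"
  shows "y j = z j"
proof -
  have s: "sorted (map v [0..<Suc r])" "distinct (map v [0..<Suc r])"
    if v: "\<And>i j. i < j \<Longrightarrow> j \<le> r \<Longrightarrow> v i < v j" for v :: "nat \<Rightarrow> real"
  proof -
    have "sorted_wrt (<) (map v [0..<Suc r])"
      unfolding sorted_wrt_map sorted_wrt_iff_nth_less using v by (simp del: upt_Suc)
    then show "sorted (map v [0..<Suc r])" "distinct (map v [0..<Suc r])"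
      by (simp_all only: strict_sorted_iff)
  qed
  have "map y [0..<Suc r] = map z [0..<Suc r]"
    by (rule sorted_distinct_set_unique[OF s[OF y] s[OF z]])
      (use im in \<open>auto simp: atLeastLessThanSuc_atLeastAtMost simp del: upt_Suc\<close>)
  then have "map y [0..<Suc r] ! j = map z [0..<Suc r] ! j" by (rule arg_cong)
  then show ?thesis using j by (simp del: upt_Suc)
qed

lemma gauss_lobatto_weight_eq:
  assumes GL: "gauss_lobatto r lo hi y \<omega>" and r: "r \<ge> 1" and j: "j \<le> r"
  shows "\<omega> j = integral {lo..hi} (poly (lagrange_poly {0..r} y j))"
proof -
  note G = gauss_lobattoD[OF GL]
  have "degree (lagrange_poly {0..r} y j) \<le> 2 * r - 1"
    using degree_lagrange_poly[of "{0..r}" j y] j r by simp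
  then have "integral {lo..hi} (poly (lagrange_poly {0..r} y j)) = (\<Sum>i=0..r. \<omega> i * poly (lagrange_poly {0..r} y j) (y i))"
    using G(6) by simp
  also have "\<dots> = (\<Sum>i=0..r. if i = j then \<omega> i else 0)"
    by (rule sum.cong) (use G(3) j in \<open>auto simp: lagrange_poly_node\<close>)
  finally show ?thesis using j by simp
qed

lemma gauss_lobatto_unit_unique:
  assumes Y: "gauss_lobatto r 0 1 y \<omega>" and Z: "gauss_lobatto r 0 1 z \<nu>" and r: "r \<ge> 1" and j: "j \<le> r"
  shows "y j = z j" "\<omega> j = \<nu> j"
proof -
  have eq: "y j = z j" if "j \<le> r" for j
    by (rule strict_mono_on_image_eq[OF gauss_lobattoD(4)[OF Y] gauss_lobattoD(4)[OF Z] gauss_lobatto_unit_nodes_unique[OF Y Z r] that])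
  then show "y j = z j" using j .
  have "lagrange_poly {0..r} y j = lagrange_poly {0..r} z j"
    unfolding lagrange_poly_def by (rule prod.cong) (use eq j in auto)
  then show "\<omega> j = \<nu> j" using gauss_lobatto_weight_eq[OF Y r j] gauss_lobatto_weight_eq[OF Z r j] by simp
qed

lemma gauss_lobatto_scale:
  assumes GL: "gauss_lobatto r lo hi y \<omega>" and lohi: "lo < hi"
  shows "gauss_lobatto r 0 1 (\<lambda>j. (y j - lo) / (hi - lo)) (\<lambda>j. \<omega> j / (hi - lo))"
  unfolding gauss_lobatto_def
proof (intro conjI allI impI)
  note G = gauss_lobattoD[OF GL]
  show "strict_mono_on {0..r} (\<lambda>j. (y j - lo) / (hi - lo))"
    by (rule strict_mono_onI) (use G(4) lohi in \<open>auto intro!: divide_strict_right_mono\<close>)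
  show "(y 0 - lo) / (hi - lo) = 0" "(y r - lo) / (hi - lo) = 1" using G(1,2) lohi by auto
  fix q :: "real poly" assume q: "degree q \<le> 2 * r - 1"
  let ?H = "hi - lo"
  define L where "L = [:- lo / ?H, 1 / ?H:]"
  \<comment> \<open>The substitution is carried out on primitives: \<open>?H\<close> times
    \<open>R\<close> composed with \<open>L\<close> is a primitive of \<open>q\<close> composed with
    \<open>L\<close>.\<close>
  obtain R where R: "pderiv R = q" by (rule poly_antideriv)
  have pL: "poly L s = (s - lo) / ?H" for s by (simp add: L_def diff_divide_distrib)
  have dL: "degree L = 1" "pderiv L = [:1 / ?H:]" using lohi by (auto simp: L_def pderiv_pCons)
  have "degree (pcompose q L) \<le> 2 * r - 1" using q by (simp add: dL degree_pcompose)
  then have "(\<Sum>j=0..r. \<omega> j * poly (pcompose q L) (y j)) = integral {lo..hi} (poly (pcompose q L))"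
    by (rule G(6))
  also have "\<dots> = ?H * poly R 1 - ?H * poly R 0"
  proof (rule integral_unique)
    have "poly (pcompose q L) = poly (pderiv (smult ?H (pcompose R L)))"
      using lohi by (simp add: fun_eq_iff pderiv_smult pderiv_pcompose R dL)
    then show "(poly (pcompose q L) has_integral ?H * poly R 1 - ?H * poly R 0) {lo..hi}"
      using poly_FTC[of lo hi "smult ?H (pcompose R L)"] lohi by (simp add: poly_pcompose pL)
  qed
  also have "\<dots> = ?H * integral {0..1} (poly q)"
    using poly_FTC[of 0 1 R] R by (simp add: integral_unique algebra_simps)
  finally have "(\<Sum>j=0..r. \<omega> j * poly q ((y j - lo) / ?H)) = ?H * integral {0..1} (poly q)"
    by (simp add: poly_pcompose pL)
  then show "(\<Sum>j=0..r. \<omega> j / ?H * poly q ((y j - lo) / ?H)) = (LINT s|lebesgue_on {0..1}. poly q s)"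
    using lohi by (simp add: poly_integral_eq sum_divide_distrib[symmetric])
qed

lemma pcompose_affine:
  fixes q :: "real poly"
  assumes "H \<noteq> 0"
  shows "poly (pcompose q [:lo, H:]) s = poly q (lo + H * s)"
    and "poly (pderiv (pcompose q [:lo, H:])) s = H * poly (pderiv q) (lo + H * s)"
    and "degree (pcompose q [:lo, H:]) = degree q"
  using assms by (auto simp: poly_pcompose pderiv_pcompose pderiv_pCons degree_pcompose mult.commute)

lemma poly_bounded_on: "\<exists>B\<ge>0. \<forall>s\<in>{lo..hi}. \<bar>poly p s\<bar> \<le> B" for lo hi :: real
proof -
  have "bounded (poly p ` {lo..hi})"
    by (intro compact_imp_bounded compact_continuous_image continuous_intros) auto
  then obtain B where "B > 0" "\<forall>s\<in>{lo..hi}. \<bar>poly p s\<bar> \<le> B" by (auto simp: bounded_pos)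
  then show ?thesis by (intro exI[of _ B]) auto
qed

text \<open>By uniqueness and scaling every rule is an affine image of a single rule on [0, 1],
  which makes the constants independent of the interval. \<open>c\<close> is the least reference
  weight; \<open>\<Lambda>\<close> majorizes the Lebesgue constant of the nodes and its analogue for
  derivatives.\<close>

lemma gauss_lobatto_constants:
  assumes r: "r \<ge> 1"
  obtains c \<Lambda> :: real where "c > 0" "\<Lambda> \<ge> 1"
    "\<And>lo hi y \<omega> j. lo < hi \<Longrightarrow> gauss_lobatto r lo hi y \<omega> \<Longrightarrow> j \<le> r \<Longrightarrow> c * (hi - lo) \<le> \<omega> j"
    "\<And>lo hi y \<omega> q B s. lo < hi \<Longrightarrow> gauss_lobatto r lo hi y \<omega> \<Longrightarrow> degree q \<le> r \<Longrightarrow>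
       (\<And>j. j \<le> r \<Longrightarrow> \<bar>poly q (y j)\<bar> \<le> B) \<Longrightarrow> s \<in> {lo..hi} \<Longrightarrow>
       \<bar>poly q s\<bar> \<le> \<Lambda> * B \<and> \<bar>poly (pderiv q) s\<bar> \<le> \<Lambda> * B / (hi - lo)"
proof (cases "\<exists>y \<omega>. gauss_lobatto r 0 1 y \<omega>")
  case False
  \<comment> \<open>Without a rule on [0, 1], scaling excludes a rule on any interval, and both
    bounds hold vacuously.\<close>
  then have "\<not> gauss_lobatto r lo hi y \<omega>" if "lo < hi" for lo hi y \<omega>
    using gauss_lobatto_scale that by blast
  then show ?thesis by (intro that[of 1 1]) auto
next
  case True
  then obtain z \<nu> where Z: "gauss_lobatto r 0 1 z \<nu>" by blast
  note G = gauss_lobattoD[OF Z]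
  define c where "c = Min (\<nu> ` {0..r})"
  have c: "c > 0" "\<And>j. j \<le> r \<Longrightarrow> c \<le> \<nu> j"
    using gauss_lobatto_weight_pos[OF Z r] by (auto simp: c_def)
  let ?l = "lagrange_poly {0..r} z"
  obtain B1 where B1: "\<And>j. B1 j \<ge> 0" "\<And>j s. s \<in> {0..1} \<Longrightarrow> \<bar>poly (?l j) s\<bar> \<le> B1 j"
    using poly_bounded_on[of 0 1 "?l _"] by metis
  obtain B2 where B2: "\<And>j. B2 j \<ge> 0" "\<And>j s. s \<in> {0..1} \<Longrightarrow> \<bar>poly (pderiv (?l j)) s\<bar> \<le> B2 j"
    using poly_bounded_on[of 0 1 "pderiv (?l _)"] by metis
  define \<Lambda> where "\<Lambda> = 1 + (\<Sum>j=0..r. B1 j) + (\<Sum>j=0..r. B2 j)"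
  have \<Lambda>: "\<Lambda> \<ge> 1" "(\<Sum>j=0..r. B1 j) \<le> \<Lambda>" "(\<Sum>j=0..r. B2 j) \<le> \<Lambda>"
    using sum_nonneg[of "{0..r}" B1] sum_nonneg[of "{0..r}" B2] B1 B2 by (auto simp: \<Lambda>_def)
  show ?thesis
  proof (rule that[OF c(1) \<Lambda>(1)])
    fix lo hi y \<omega> j assume *: "lo < hi" "gauss_lobatto r lo hi y \<omega>" "j \<le> (r :: nat)"
    have "\<omega> j / (hi - lo) = \<nu> j"
      by (rule gauss_lobatto_unit_unique(2)[OF gauss_lobatto_scale[OF *(2,1)] Z r *(3)])
    then have "\<omega> j = \<nu> j * (hi - lo)" using * by (simp add: field_simps)
    then show "c * (hi - lo) \<le> \<omega> j" using c(2)[OF *(3)] * by simp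
  next
    fix lo hi y \<omega> q B s
    assume *: "lo < hi" "gauss_lobatto r lo hi y \<omega>" "degree q \<le> r"
      and B: "\<And>j. j \<le> r \<Longrightarrow> \<bar>poly q (y j)\<bar> \<le> B" and s: "s \<in> {lo..hi}"
    let ?H = "hi - lo"
    have H: "?H > 0" using * by simp
    define t where "t = (s - lo) / ?H"
    have t: "t \<in> {0..1}" "lo + ?H * t = s" using s H by (auto simp: t_def)
    have y: "lo + ?H * z j = y j" if "j \<le> r" for j
    proof -
      have "(y j - lo) / ?H = z j"
        by (rule gauss_lobatto_unit_unique(1)[OF gauss_lobatto_scale[OF *(2,1)] Z r that])
      then show ?thesis using H by (simp add: field_simps)
    qed
    define p where "p = pcompose q [:lo, ?H:]"
    have p: "p = (\<Sum>j=0..r. smult (poly p (z j)) (?l j))"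
      by (rule lagrange_reproduction) (use G(3) * H in \<open>auto simp: p_def pcompose_affine\<close>)
    have pz: "\<bar>poly p (z j)\<bar> \<le> B" if "j \<le> r" for j
      using B[OF that] y[OF that] H by (simp add: p_def pcompose_affine)
    have "\<bar>poly p t\<bar> = \<bar>\<Sum>j=0..r. poly p (z j) * poly (?l j) t\<bar>"
      by (subst p) (simp add: poly_sum)
    also have "\<dots> \<le> (\<Sum>j=0..r. B * B1 j)"
      by (rule order_trans[OF sum_abs sum_mono])
        (use pz B1 t in \<open>auto simp: abs_mult intro!: mult_mono order_trans[OF abs_ge_zero pz[of 0]]\<close>)
    also have "\<dots> \<le> \<Lambda> * B"
      using mult_left_mono[OF \<Lambda>(2), of B] order_trans[OF abs_ge_zero pz[of 0]]
      by (simp add: sum_distrib_left mult.commute)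
    finally have 1: "\<bar>poly q s\<bar> \<le> \<Lambda> * B" using H t by (simp add: p_def pcompose_affine)
    have "pderiv p = (\<Sum>j=0..r. smult (poly p (z j)) (pderiv (?l j)))"
      by (subst p) (simp add: pderiv_sum_set pderiv_smult)
    then have "\<bar>poly (pderiv p) t\<bar> = \<bar>\<Sum>j=0..r. poly p (z j) * poly (pderiv (?l j)) t\<bar>"
      by (simp add: poly_sum)
    also have "\<dots> \<le> (\<Sum>j=0..r. B * B2 j)"
      by (rule order_trans[OF sum_abs sum_mono])
        (use pz B2 t in \<open>auto simp: abs_mult intro!: mult_mono order_trans[OF abs_ge_zero pz[of 0]]\<close>)
    also have "\<dots> \<le> \<Lambda> * B"
      using mult_left_mono[OF \<Lambda>(3), of B] order_trans[OF abs_ge_zero pz[of 0]]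
      by (simp add: sum_distrib_left mult.commute)
    finally have "\<bar>?H * poly (pderiv q) s\<bar> \<le> \<Lambda> * B" using H t by (simp add: p_def pcompose_affine)
    then have "\<bar>poly (pderiv q) s\<bar> \<le> \<Lambda> * B / ?H" using H by (simp add: abs_mult field_simps)
    with 1 show "\<bar>poly q s\<bar> \<le> \<Lambda> * B \<and> \<bar>poly (pderiv q) s\<bar> \<le> \<Lambda> * B / (hi - lo)" by simp
  qed
qed

lemma poly_lipschitz:
  fixes q :: "real poly"
  assumes "\<And>s. s \<in> {lo..hi} \<Longrightarrow> \<bar>poly (pderiv q) s\<bar> \<le> L" "s \<in> {lo..hi}" "t \<in> {lo..hi}"
  shows "\<bar>poly q s - poly q t\<bar> \<le> L * \<bar>s - t\<bar>"
proof -
  have "norm (poly q s - poly q t) \<le> L * norm (s - t)"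
    by (rule field_differentiable_bound[where S="{lo..hi}" and f'="poly (pderiv q)"])
      (use assms in \<open>auto intro: poly_DERIV has_field_derivative_at_within\<close>)
  then show ?thesis by simp
qed

text \<open>The derivative bound keeps \<open>|q|\<close> above \<open>S / 2\<close> within distance
  \<open>(hi - lo) / (2 * \<Lambda>)\<close> of \<open>m\<close>. In the factor 8, a 4 comes from
  squaring the half and a 2 from this distance.\<close>

lemma sup_le_L2_of_derivative_bound:
  fixes q :: "real poly"
  assumes lohi: "lo < hi" and \<Lambda>: "\<Lambda> \<ge> 1"
    and d: "\<And>s. s \<in> {lo..hi} \<Longrightarrow> \<bar>poly (pderiv q) s\<bar> \<le> \<Lambda> * S / (hi - lo)"
    and m: "m \<in> {lo..hi}" "\<bar>poly q m\<bar> = S"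
  shows "S\<^sup>2 * (hi - lo) \<le> 8 * \<Lambda> * integral {lo..hi} (\<lambda>s. (poly q s)\<^sup>2)"
proof -
  define \<delta> where "\<delta> = (hi - lo) / (2 * \<Lambda>)"
  have S: "0 \<le> S" using m by auto
  have "2 * \<delta> = (hi - lo) / \<Lambda>" using \<Lambda> by (simp add: \<delta>_def field_simps)
  also have "\<dots> \<le> (hi - lo) / 1" using lohi \<Lambda> by (intro divide_left_mono) auto
  finally have \<delta>: "0 < \<delta>" "2 * \<delta> \<le> hi - lo" using lohi \<Lambda> by (auto simp: \<delta>_def)
  \<comment> \<open>An interval of length \<open>\<delta>\<close> on the side of \<open>m\<close>
    where it fits; \<open>2 * \<delta> <= hi - lo\<close> guarantees that one side works.\<close>
  define l where "l = (if m + \<delta> \<le> hi then m else m - \<delta>)"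
  have l: "lo \<le> l" "l + \<delta> \<le> hi" "\<And>s. s \<in> {l..l + \<delta>} \<Longrightarrow> \<bar>s - m\<bar> \<le> \<delta>"
    using m \<delta> by (auto simp: l_def split: if_splits)
  have sq: "(S / 2)\<^sup>2 \<le> (poly q s)\<^sup>2" if s: "s \<in> {l..l + \<delta>}" for s
  proof -
    have "\<bar>poly q s - poly q m\<bar> \<le> \<Lambda> * S / (hi - lo) * \<bar>s - m\<bar>"
      by (rule poly_lipschitz[OF d]) (use s l m in auto)
    also have "\<dots> \<le> \<Lambda> * S / (hi - lo) * \<delta>"
      using l(3)[OF s] S \<Lambda> lohi by (intro mult_left_mono) auto
    also have "\<dots> = S / 2" using \<Lambda> lohi by (simp add: \<delta>_def)
    finally have "S / 2 \<le> \<bar>poly q s\<bar>" using m(2) by linarith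
    then have "(S / 2)\<^sup>2 \<le> \<bar>poly q s\<bar>\<^sup>2" using S by (intro power_mono) auto
    then show ?thesis by simp
  qed
  have ii: "(\<lambda>s. (poly q s)\<^sup>2) integrable_on {x..y}" for x y
    by (intro integrable_continuous_real continuous_intros)
  have "\<delta> * (S / 2)\<^sup>2 = integral {l..l + \<delta>} (\<lambda>s. (S / 2)\<^sup>2)" using \<delta> by simp
  also have "\<dots> \<le> integral {l..l + \<delta>} (\<lambda>s. (poly q s)\<^sup>2)"
    by (rule integral_le) (use ii sq in auto)
  also have "\<dots> \<le> integral {lo..hi} (\<lambda>s. (poly q s)\<^sup>2)"
    by (rule integral_subset_le) (use l ii in auto)
  finally have "(8 * \<Lambda>) * (\<delta> * (S / 2)\<^sup>2) \<le> (8 * \<Lambda>) * integral {lo..hi} (\<lambda>s. (poly q s)\<^sup>2)"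
    using \<Lambda> by (intro mult_left_mono) auto
  moreover have "(8 * \<Lambda>) * (\<delta> * (S / 2)\<^sup>2) = S\<^sup>2 * (hi - lo)"
    using \<Lambda> by (simp add: \<delta>_def power2_eq_square)
  ultimately show ?thesis by simp
qed

section \<open>The finite element space\<close>

text \<open>Both constants are fixed before any mesh, so that every bound proved in the extension
  \<open>lobatto_mesh\<close> is uniform in \<open>M\<close>.\<close>

locale lobatto =
  fixes r :: nat and c \<Lambda> :: real
  assumes r: "r \<ge> 1" and c: "c > 0" and \<Lambda>: "\<Lambda> \<ge> 1"
    and weight_ge: "\<And>lo hi y \<omega> j. lo < hi \<Longrightarrow> gauss_lobatto r lo hi y \<omega> \<Longrightarrow> j \<le> r \<Longrightarrow> c * (hi - lo) \<le> \<omega> j"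
    and interp_bound: "\<And>lo hi y \<omega> q B s. lo < hi \<Longrightarrow> gauss_lobatto r lo hi y \<omega> \<Longrightarrow> degree q \<le> r \<Longrightarrow>
       (\<And>j. j \<le> r \<Longrightarrow> \<bar>poly q (y j)\<bar> \<le> B) \<Longrightarrow> s \<in> {lo..hi} \<Longrightarrow>
       \<bar>poly q s\<bar> \<le> \<Lambda> * B \<and> \<bar>poly (pderiv q) s\<bar> \<le> \<Lambda> * B / (hi - lo)"

locale lobatto_mesh = lobatto +
  fixes a b :: real and M :: nat and x \<omega> :: "nat \<Rightarrow> real"
  assumes ab: "a < b" and M: "M \<ge> 1" and mesh: "gauss_lobatto_mesh a b r M x \<omega>"
begin

definition H :: real where "H = (b - a) / real M"
definition lo :: "nat \<Rightarrow> real" where "lo i = x ((i - 1) * r)"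
definition hi :: "nat \<Rightarrow> real" where "hi i = x (i * r)"
definition node :: "nat \<Rightarrow> nat \<Rightarrow> real" where "node i j = x ((i - 1) * r + j)"

abbreviation "S \<equiv> fe_space a b r M x"
abbreviation "ip \<equiv> discrete_inner r M x \<omega>"
abbreviation "gr v w \<equiv> L2_inner a b (weak_deriv a b 1 v) (weak_deriv a b 1 w)"

lemma H_pos: "H > 0" using ab M by (simp add: H_def)

lemma MH: "real M * H = b - a" using M by (simp add: H_def)

lemma x_ends: "x 0 = a" "x (M * r) = b" using mesh by (auto simp: gauss_lobatto_mesh_def)

lemma x_less: "i < j \<Longrightarrow> j \<le> M * r \<Longrightarrow> x i < x j"
  using mesh by (auto simp: gauss_lobatto_mesh_def intro: strict_mono_onD)

lemma x_le: "i \<le> j \<Longrightarrow> j \<le> M * r \<Longrightarrow> x i \<le> x j"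
  using x_less[of i j] by (cases "i = j") (auto simp: less_imp_le)

lemma x_in: "j \<le> M * r \<Longrightarrow> x j \<in> {a..b}"
  using x_le[of 0 j] x_le[of j "M * r"] x_ends by auto

lemma index_le: "i \<in> {1..M} \<Longrightarrow> j \<le> r \<Longrightarrow> (i - 1) * r + j \<le> M * r"
proof -
  assume i: "i \<in> {1..M}" and j: "j \<le> r"
  have "(i - 1) * r + j \<le> (i - 1) * r + r" using j by simp
  also have "\<dots> = i * r" using i by (cases i) auto
  also have "\<dots> \<le> M * r" using i by simp
  finally show ?thesis .
qed

lemma index_exists:
  assumes "J \<le> M * r"
  obtains i j where "i \<in> {1..M}" "j \<le> r" "J = (i - 1) * r + j"
proof (cases "J = 0")
  case True
  then show ?thesis using that[of 1 0] M by auto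
next
  case False
  \<comment> \<open>Using \<open>J - 1\<close> sends a shared node to the element on its left, with
    local index between 1 and \<open>r\<close>; only \<open>J = 0\<close> gets the local index
    0.\<close>
  define i where "i = (J - 1) div r"
  have "J - 1 < M * r" using False assms by simp
  then have "i < M" unfolding i_def using r by (simp add: less_mult_imp_div_less)
  moreover have "J = i * r + ((J - 1) mod r + 1)"
    unfolding i_def using False div_mult_mod_eq[of "J - 1" r] by linarith
  moreover have "(J - 1) mod r + 1 \<le> r" using r by (simp add: Suc_leI)
  ultimately show ?thesis using that[of "Suc i" "(J - 1) mod r + 1"] by auto
qed

lemma element_GL: "i \<in> {1..M} \<Longrightarrow> gauss_lobatto r (lo i) (hi i) (node i) \<omega>"
  using mesh unfolding gauss_lobatto_mesh_def lo_def hi_def node_def[abs_def] by blast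

lemma element_size: "i \<in> {1..M} \<Longrightarrow> hi i - lo i = H"
  using mesh unfolding gauss_lobatto_mesh_def lo_def hi_def H_def by blast

lemma element_less: "i \<in> {1..M} \<Longrightarrow> lo i < hi i"
  using element_size[of i] H_pos by simp

lemma element_bounds: "i \<in> {1..M} \<Longrightarrow> a \<le> lo i" "i \<in> {1..M} \<Longrightarrow> hi i \<le> b"
  using x_in[OF index_le[of i 0]] x_in[OF index_le[of i r]] unfolding lo_def hi_def
  by (auto simp: add_mult_distrib2) (cases i, auto simp: add.commute)

lemma element_chain: "lo 1 = a" "hi M = b" "lo (Suc i) = hi i"
  using x_ends by (auto simp: lo_def hi_def)

lemma node_in: "i \<in> {1..M} \<Longrightarrow> j \<le> r \<Longrightarrow> node i j \<in> {lo i..hi i}"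
  by (rule gauss_lobattoD(5)[OF element_GL])

lemma node_ends: "i \<in> {1..M} \<Longrightarrow> node i 0 = lo i" "i \<in> {1..M} \<Longrightarrow> node i r = hi i"
  by (rule gauss_lobattoD(1)[OF element_GL] gauss_lobattoD(2)[OF element_GL], assumption)+

lemma node_inj: "i \<in> {1..M} \<Longrightarrow> inj_on (node i) {0..r}"
  by (rule gauss_lobattoD(3)[OF element_GL])

lemma quadrature: "i \<in> {1..M} \<Longrightarrow> degree q \<le> 2 * r - 1 \<Longrightarrow>
    (\<Sum>j=0..r. \<omega> j * poly q (node i j)) = integral {lo i..hi i} (poly q)"
  by (rule gauss_lobattoD(6)[OF element_GL])

lemma weight: "j \<le> r \<Longrightarrow> c * H \<le> \<omega> j" "j \<le> r \<Longrightarrow> 0 < \<omega> j"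
proof -
  assume j: "j \<le> r"
  have 1: "1 \<in> {1..M}" using M by simp
  show "c * H \<le> \<omega> j" using weight_ge[OF element_less[OF 1] element_GL[OF 1] j] element_size[OF 1] by simp
  then show "0 < \<omega> j" using c H_pos by (meson less_le_trans mult_pos_pos)
qed

lemma weight_sum: "(\<Sum>j=0..r. \<omega> j) = H"
proof -
  have 1: "1 \<in> {1..M}" using M by simp
  have "(\<Sum>j=0..r. \<omega> j * poly 1 (node 1 j)) = integral {lo 1..hi 1} (poly 1)"
    by (rule quadrature[OF 1]) simp
  moreover have "poly 1 = (\<lambda>s::real. 1::real)" by auto
  ultimately show ?thesis using element_size[OF 1] element_less[OF 1] by simp
qed

lemma in_element:
  assumes "y \<in> {a..b}"
  obtains i where "i \<in> {1..M}" "y \<in> {lo i..hi i}"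
proof -
  define i where "i = (LEAST i. 1 \<le> i \<and> y \<le> hi i)"
  have ex: "1 \<le> M \<and> y \<le> hi M" using M assms element_chain by simp
  have i: "1 \<le> i \<and> y \<le> hi i" unfolding i_def by (rule LeastI) (rule ex)
  have iM: "i \<le> M" unfolding i_def by (rule Least_le) (rule ex)
  have "lo i \<le> y"
  proof (cases "i = 1")
    case True
    then show ?thesis using element_chain assms by simp
  next
    case False
    then have "i - 1 < (LEAST i. 1 \<le> i \<and> y \<le> hi i)" using i unfolding i_def[symmetric] by linarith
    then have "\<not> (1 \<le> i - 1 \<and> y \<le> hi (i - 1))" by (rule not_less_Least)
    moreover have "lo i = hi (i - 1)" using element_chain(3)[of "i - 1"] i by simp
    ultimately show ?thesis using False i by auto
  qed
  then show ?thesis using that i iM by auto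
qed

lemma integral_elements:
  fixes f :: "real \<Rightarrow> real"
  assumes f: "f integrable_on {a..b}"
  shows "integral {a..b} f = (\<Sum>i=1..M. integral {lo i..hi i} f)"
    and "i \<in> {1..M} \<Longrightarrow> f integrable_on {lo i..hi i}"
proof -
  have sub: "f integrable_on {s..t}" if "a \<le> s" "t \<le> b" for s t
    by (rule integrable_on_subinterval[OF f]) (use that in auto)
  show "i \<in> {1..M} \<Longrightarrow> f integrable_on {lo i..hi i}" using sub element_bounds by auto
  have "n \<le> M \<Longrightarrow> integral {a..hi n} f = (\<Sum>i=1..n. integral {lo i..hi i} f)" if "n \<ge> 1" for n
    using that
  proof (induction n rule: nat_induct_at_least)
    case base
    then show ?case using element_chain by simp
  next
    case (Suc n)
    have n: "n \<in> {1..M}" "Suc n \<in> {1..M}" using Suc by auto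
    have "integral {a..hi n} f + integral {hi n..hi (Suc n)} f = integral {a..hi (Suc n)} f"
      using element_less[OF n(1)] element_less[OF n(2)] element_bounds[OF n(1)] element_bounds[OF n(2)] element_chain(3)[of n]
      by (intro Henstock_Kurzweil_Integration.integral_combine sub) auto
    then show ?case using Suc n element_chain(3)[of n] by simp
  qed
  from this[of M] show "integral {a..b} f = (\<Sum>i=1..M. integral {lo i..hi i} f)"
    using M element_chain by simp
qed

definition piecewise :: "(real \<Rightarrow> real) \<Rightarrow> bool" where
  "piecewise v \<longleftrightarrow> (\<forall>i\<in>{1..M}. \<exists>q. degree q \<le> r \<and> (\<forall>y\<in>{lo i..hi i}. v y = poly q y))"

definition piece :: "(real \<Rightarrow> real) \<Rightarrow> nat \<Rightarrow> real poly" where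
  "piece v i = (SOME q. degree q \<le> r \<and> (\<forall>y\<in>{lo i..hi i}. v y = poly q y))"

lemma piece:
  assumes "piecewise v" "i \<in> {1..M}"
  shows "degree (piece v i) \<le> r" "\<And>y. y \<in> {lo i..hi i} \<Longrightarrow> v y = poly (piece v i) y"
proof -
  have "\<exists>q. degree q \<le> r \<and> (\<forall>y\<in>{lo i..hi i}. v y = poly q y)" using assms by (auto simp: piecewise_def)
  then have "degree (piece v i) \<le> r \<and> (\<forall>y\<in>{lo i..hi i}. v y = poly (piece v i) y)"
    unfolding piece_def by (rule someI_ex)
  then show "degree (piece v i) \<le> r" "\<And>y. y \<in> {lo i..hi i} \<Longrightarrow> v y = poly (piece v i) y" by auto
qed

text \<open>The \<open>r + 1\<close> nodes of an element determine a polynomial of degree at most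
  \<open>r\<close>, so nodal values alone pin down the chosen piece.\<close>

lemma piece_unique:
  assumes i: "i \<in> {1..M}" and q: "degree q \<le> r" "\<And>j. j \<le> r \<Longrightarrow> v (node i j) = poly q (node i j)" and v: "piecewise v"
  shows "piece v i = q"
  by (rule poly_eqI_nodes[OF _ node_inj[OF i]])
    (use q piece[OF v i] node_in[OF i] in \<open>auto simp: le_imp_less_Suc\<close>)

lemma piecewise_linear:
  assumes "piecewise v" "piecewise w" shows "piecewise (\<lambda>y. s * v y + t * w y)"
  unfolding piecewise_def
proof
  fix i assume i: "i \<in> {1..M}"
  have "degree (smult s (piece v i) + smult t (piece w i)) \<le> r"
    using piece[OF assms(1) i] piece[OF assms(2) i]
    by (intro degree_add_le order_trans[OF degree_smult_le]) auto
  then show "\<exists>q. degree q \<le> r \<and> (\<forall>y\<in>{lo i..hi i}. s * v y + t * w y = poly q y)"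
    using piece[OF assms(1) i] piece[OF assms(2) i]
    by (intro exI[of _ "smult s (piece v i) + smult t (piece w i)"]) auto
qed

lemma piece_linear:
  assumes v: "piecewise v" and w: "piecewise w" and i: "i \<in> {1..M}"
  shows "piece (\<lambda>y. s * v y + t * w y) i = smult s (piece v i) + smult t (piece w i)"
proof (rule piece_unique[OF i _ _ piecewise_linear[OF v w]])
  show "degree (smult s (piece v i) + smult t (piece w i)) \<le> r"
    using piece[OF v i] piece[OF w i]
    by (intro degree_add_le order_trans[OF degree_smult_le]) auto
qed (use piece[OF v i] piece[OF w i] node_in[OF i] in auto)

lemma piecewise_continuous:
  assumes v: "piecewise v" shows "continuous_on {a..b} v"
proof -
  have e: "continuous_on {lo i..hi i} v" if "i \<in> {1..M}" for i
  proof -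
    have "continuous_on {lo i..hi i} (poly (piece v i))" by (intro continuous_intros)
    then show ?thesis using piece(2)[OF v that] by (subst continuous_on_cong[OF refl]) auto
  qed
  have "n \<le> M \<Longrightarrow> continuous_on {a..hi n} v" if "n \<ge> 1" for n
    using that
  proof (induction n rule: nat_induct_at_least)
    case base
    then show ?case using e[of 1] element_chain by simp
  next
    case (Suc n)
    have n: "n \<in> {1..M}" "Suc n \<in> {1..M}" using Suc by auto
    have "{a..hi (Suc n)} = {a..hi n} \<union> {lo (Suc n)..hi (Suc n)}"
      using element_less[OF n(1)] element_less[OF n(2)] element_bounds[OF n(1)] element_chain(3)[of n] by auto
    then show ?case using Suc e[OF n(2)] by (simp add: continuous_on_closed_Un)
  qed
  from this[of M] show ?thesis using M element_chain by simp
qed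

text \<open>The pieces are prescribed on closed elements, hence agree at common end points, and the
  function is continuous. Its classical derivative off the nodes is then a weak derivative.\<close>

lemma piecewise_sobolev:
  assumes v: "piecewise v" shows "v \<in> sobolev_space a b 1"
proof -
  let ?N = "x ` {..M * r}"
  have d: "(v has_real_derivative deriv v y) (at y)" "\<exists>i\<in>{1..M}. y \<in> {lo i..hi i} \<and> deriv v y = poly (pderiv (piece v i)) y"
    if y: "y \<in> {a<..<b} - ?N" for y
  proof -
    obtain i where i: "i \<in> {1..M}" "y \<in> {lo i..hi i}" using in_element[of y] y by auto
    have "lo i \<in> ?N" "hi i \<in> ?N" using index_le[OF i(1), of 0] i(1) by (auto simp: lo_def hi_def)
    then have "y \<in> {lo i<..<hi i}" using i y by (metis DiffD2 atLeastAtMost_iff greaterThanLessThan_iff order_le_less)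
    then have "\<forall>\<^sub>F z in nhds y. z \<in> {lo i<..<hi i}" by (intro eventually_nhds_in_open) auto
    then have ev: "\<forall>\<^sub>F z in nhds y. v z = poly (piece v i) z"
      by eventually_elim (rule piece(2)[OF v i(1)], auto)
    have "(v has_real_derivative poly (pderiv (piece v i)) y) (at y)"
      unfolding DERIV_cong_ev[OF refl ev refl] by (rule poly_DERIV)
    then show "(v has_real_derivative deriv v y) (at y)"
      "\<exists>i\<in>{1..M}. y \<in> {lo i..hi i} \<and> deriv v y = poly (pderiv (piece v i)) y"
      using i DERIV_imp_deriv by fastforce+
  qed
  have I: "(deriv v has_integral v y - v a) {a..y}" if y: "y \<in> {a..b}" for y
  proof (rule fundamental_theorem_of_calculus_interior_strong[of "?N"])
    show "continuous_on {a..y} v" using piecewise_continuous[OF v] y by (auto intro: continuous_on_subset)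
    show "(v has_vector_derivative deriv v z) (at z)" if "z \<in> {a<..<y} - ?N" for z
      using d(1)[of z] that y by (simp add: has_real_derivative_iff_has_vector_derivative)
  qed (use y in auto)
  define B where "B i = (SOME B. \<forall>y\<in>{lo i..hi i}. \<bar>poly (pderiv (piece v i)) y\<bar> \<le> B)" for i
  have B: "\<bar>poly (pderiv (piece v i)) y\<bar> \<le> B i" if "y \<in> {lo i..hi i}" for i y
  proof -
    have "\<exists>B. \<forall>y\<in>{lo i..hi i}. \<bar>poly (pderiv (piece v i)) y\<bar> \<le> B" using poly_bounded_on by blast
    then have "\<forall>y\<in>{lo i..hi i}. \<bar>poly (pderiv (piece v i)) y\<bar> \<le> B i" unfolding B_def by (rule someI_ex)
    then show ?thesis using that by blast
  qed
  have fin: "finite (insert a (insert b ?N))" by simp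
  \<comment> \<open>At nodes and end points nothing is known about \<open>deriv v\<close>; adding
    these finitely many values makes the bound hold on all of the interval.\<close>
  define K where "K = (\<Sum>i=1..M. \<bar>B i\<bar>) + (\<Sum>y\<in>insert a (insert b ?N). \<bar>deriv v y\<bar>)"
  have "\<bar>deriv v y\<bar> \<le> K" if y: "y \<in> {a..b}" for y
  proof (cases "y \<in> insert a (insert b ?N)")
    case True
    then have "\<bar>deriv v y\<bar> \<le> (\<Sum>y\<in>insert a (insert b ?N). \<bar>deriv v y\<bar>)"
      by (intro member_le_sum[OF _ _ fin]) auto
    then show ?thesis unfolding K_def by (simp add: add_increasing sum_nonneg)
  next
    case False
    then obtain i where i: "i \<in> {1..M}" "y \<in> {lo i..hi i}" "deriv v y = poly (pderiv (piece v i)) y"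
      using d(2)[of y] y by auto
    have "\<bar>deriv v y\<bar> \<le> \<bar>B i\<bar>" using B[OF i(2)] i(3) by simp
    also have "\<dots> \<le> (\<Sum>i=1..M. \<bar>B i\<bar>)" using i(1) by (intro member_le_sum) auto
    finally show ?thesis unfolding K_def by (simp add: add_increasing2 sum_nonneg)
  qed
  moreover have "deriv v \<in> borel_measurable (lebesgue_on {a..b})"
    using I[of b] ab by (intro integrable_imp_measurable) (auto simp: integrable_on_def)
  ultimately have L: "deriv v \<in> L2_space a b" by (intro bounded_L2)
  have "v y = v a + integral {a..y} (deriv v)" if "y \<in> {a..b}" for y
    using I[OF that] by (simp add: integral_unique)
  note W = weak_deriv_of_integral[OF L this]
  have "has_weak_deriv a b 0 v v" using W(3) by (simp add: has_weak_deriv_def)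
  then have "\<exists>w. has_weak_deriv a b n v w" if "n \<le> 1" for n
    using W(1) that by (cases "n = 0") (auto simp: le_Suc_eq)
  then show ?thesis using W(3) by (simp add: sobolev_space_def)
qed

lemma fe_iff: "v \<in> S \<longleftrightarrow> piecewise v"
  using piecewise_sobolev unfolding fe_space_def piecewise_def lo_def hi_def by blast

lemma fe_linear: "v \<in> S \<Longrightarrow> w \<in> S \<Longrightarrow> (\<lambda>y. s * v y + t * w y) \<in> S"
  by (simp add: fe_iff piecewise_linear)

lemma fe_const: "(\<lambda>y. s) \<in> S"
  unfolding fe_iff piecewise_def by (intro ballI exI[of _ "[:s:]"]) auto

lemma fe_sum: "(\<And>i. i \<in> I \<Longrightarrow> f i \<in> S) \<Longrightarrow> (\<lambda>y. \<Sum>i\<in>I. k i * f i y) \<in> S"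
proof (induction I rule: infinite_finite_induct)
  case (insert i I)
  then have "(\<lambda>y. k i * f i y + 1 * (\<Sum>i\<in>I. k i * f i y)) \<in> S" by (intro fe_linear) auto
  then show ?case using insert by simp
qed (auto intro: fe_const)

lemma fe_sobolev: "v \<in> S \<Longrightarrow> v \<in> sobolev_space a b 1" by (simp add: fe_space_def)

lemma fe_continuous: "v \<in> S \<Longrightarrow> continuous_on {a..b} v" by (simp add: fe_iff piecewise_continuous)

lemma fe_L2: "v \<in> S \<Longrightarrow> v \<in> L2_space a b" by (rule continuous_L2[OF fe_continuous])

text \<open>\<open>weak_deriv\<close> is a choice made on the whole interval. It is identified on an
  element because it and the polynomial derivative have the same integral over every inner
  subinterval.\<close>

lemma fe_weak_deriv:
  assumes v: "v \<in> S" and i: "i \<in> {1..M}"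
  shows "AE y in lebesgue_on {lo i..hi i}. weak_deriv a b 1 v y = poly (pderiv (piece v i)) y"
proof -
  have p: "piecewise v" using v fe_iff by simp
  have wL: "weak_deriv a b 1 v \<in> L2_space (lo i) (hi i)"
    by (rule L2_subinterval[OF weak_deriv(2)[OF fe_sobolev[OF v]]]) (use element_bounds[OF i] in auto)
  have pL: "poly (pderiv (piece v i)) \<in> L2_space (lo i) (hi i)" by (intro continuous_L2 continuous_intros)
  have "AE y in lebesgue_on {lo i..hi i}. weak_deriv a b 1 v y - poly (pderiv (piece v i)) y = 0"
  proof (rule subintervals_0_imp_AE_0[OF L2_integrable[OF L2_diff[OF wL pL]]])
    fix s t assume st: "lo i < s" "s < t" "t < hi i"
    have c0: "cderiv a b 0 v y = v y" if "y \<in> {s..t}" for y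
      by (rule cderiv_0[OF ab fe_sobolev[OF v] _ fe_continuous[OF v]])
        (use st that element_bounds[OF i] in auto)
    have "(weak_deriv a b 1 v has_integral v t - v s) {s..t}"
      using weak_deriv_has_integral[OF ab fe_sobolev[OF v], of 0 s t] c0 st element_bounds[OF i] by simp
    moreover have "(poly (pderiv (piece v i)) has_integral v t - v s) {s..t}"
      using poly_FTC[of s t "piece v i"] piece(2)[OF p i] st by simp
    ultimately have "((\<lambda>y. weak_deriv a b 1 v y - poly (pderiv (piece v i)) y) has_integral (v t - v s) - (v t - v s)) {s..t}"
      by (rule has_integral_diff)
    then show "integral {s..t} (\<lambda>y. weak_deriv a b 1 v y - poly (pderiv (piece v i)) y) = 0"
      by (simp add: integral_unique)
  qed
  then show ?thesis by simp
qed

lemma gr_eq: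
  assumes v: "v \<in> S" and w: "w \<in> S"
  shows "gr v w = (\<Sum>i=1..M. integral {lo i..hi i} (\<lambda>y. poly (pderiv (piece v i)) y * poly (pderiv (piece w i)) y))"
proof -
  have L: "weak_deriv a b 1 u \<in> L2_space a b" if "u \<in> S" for u using weak_deriv(2)[OF fe_sobolev[OF that]] by simp
  have int: "(\<lambda>y. weak_deriv a b 1 v y * weak_deriv a b 1 w y) integrable_on {a..b}"
    by (rule integrable_on_lebesgue_on[OF L2_integrable_mult[OF L[OF v] L[OF w]]]) simp
  have "gr v w = (\<Sum>i=1..M. integral {lo i..hi i} (\<lambda>y. weak_deriv a b 1 v y * weak_deriv a b 1 w y))"
    using L2_inner_eq_integral[OF L[OF v] L[OF w]] integral_elements(1)[OF int] by simp
  also have "\<dots> = (\<Sum>i=1..M. integral {lo i..hi i} (\<lambda>y. poly (pderiv (piece v i)) y * poly (pderiv (piece w i)) y))"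
  proof (rule sum.cong[OF refl])
    fix i assume i: "i \<in> {1..M}"
    have Li: "weak_deriv a b 1 u \<in> L2_space (lo i) (hi i)" if "u \<in> S" for u
      by (rule L2_subinterval[OF L[OF that]]) (use element_bounds[OF i] in auto)
    have pL: "poly q \<in> L2_space (lo i) (hi i)" for q by (intro continuous_L2 continuous_intros)
    show "integral {lo i..hi i} (\<lambda>y. weak_deriv a b 1 v y * weak_deriv a b 1 w y) =
       integral {lo i..hi i} (\<lambda>y. poly (pderiv (piece v i)) y * poly (pderiv (piece w i)) y)"
      using L2_inner_cong_AE[OF fe_weak_deriv[OF v i] fe_weak_deriv[OF w i] Li[OF v] pL Li[OF w] pL]
      by (simp only: L2_inner_eq_integral[OF Li[OF v] Li[OF w]] L2_inner_eq_integral[OF pL pL])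
  qed
  finally show ?thesis .
qed

lemma gr_commute: "gr v w = gr w v" by (rule L2_inner_commute)

lemma gr_linear:
  assumes v: "v \<in> S" and w: "w \<in> S" and z: "z \<in> S"
  shows "gr (\<lambda>y. s * v y + t * w y) z = s * gr v z + t * gr w z"
proof -
  have int: "(\<lambda>y. k * (poly p y * poly q y)) integrable_on {s..t}" for p q :: "real poly" and s t k
    by (intro integrable_continuous_real continuous_intros)
  have "gr (\<lambda>y. s * v y + t * w y) z = (\<Sum>i=1..M. s * integral {lo i..hi i} (\<lambda>y. poly (pderiv (piece v i)) y * poly (pderiv (piece z i)) y)
     + t * integral {lo i..hi i} (\<lambda>y. poly (pderiv (piece w i)) y * poly (pderiv (piece z i)) y))"
    unfolding gr_eq[OF fe_linear[OF v w] z]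
  proof (rule sum.cong[OF refl])
    fix i assume i: "i \<in> {1..M}"
    have "(\<lambda>y. poly (pderiv (piece (\<lambda>y. s * v y + t * w y) i)) y * poly (pderiv (piece z i)) y) =
      (\<lambda>y. s * (poly (pderiv (piece v i)) y * poly (pderiv (piece z i)) y) + t * (poly (pderiv (piece w i)) y * poly (pderiv (piece z i)) y))"
      using piece_linear[OF v[unfolded fe_iff] w[unfolded fe_iff] i, of s t]
      by (simp add: pderiv_add pderiv_smult algebra_simps fun_eq_iff)
    then show "integral {lo i..hi i} (\<lambda>y. poly (pderiv (piece (\<lambda>y. s * v y + t * w y) i)) y * poly (pderiv (piece z i)) y) =
      s * integral {lo i..hi i} (\<lambda>y. poly (pderiv (piece v i)) y * poly (pderiv (piece z i)) y)
     + t * integral {lo i..hi i} (\<lambda>y. poly (pderiv (piece w i)) y * poly (pderiv (piece z i)) y)"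
      by (simp only:) (subst Henstock_Kurzweil_Integration.integral_add, auto intro: int)
  qed
  then show ?thesis unfolding gr_eq[OF v z] gr_eq[OF w z] by (simp add: sum.distrib sum_distrib_left)
qed

lemma gr_const: "v \<in> S \<Longrightarrow> gr v (\<lambda>y. s) = 0"
proof -
  assume v: "v \<in> S"
  have "piece (\<lambda>y. s) i = [:s:]" if "i \<in> {1..M}" for i
    by (rule piece_unique[OF that]) (use fe_const[of s] fe_iff in auto)
  then show ?thesis unfolding gr_eq[OF v fe_const] by (intro sum.neutral) (auto simp: pderiv_pCons)
qed

lemma nodal_eq_imp_eq:
  assumes v: "v \<in> S" and w: "w \<in> S" and eq: "\<And>j. j \<le> M * r \<Longrightarrow> v (x j) = w (x j)"
  shows "i \<in> {1..M} \<Longrightarrow> piece v i = piece w i" "y \<in> {a..b} \<Longrightarrow> v y = w y"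
proof -
  note p = v[unfolded fe_iff] w[unfolded fe_iff]
  show pe: "piece v i = piece w i" if i: "i \<in> {1..M}" for i
    by (rule piece_unique[OF i piece(1)[OF p(2) i] _ p(1)])
      (use eq[OF index_le[OF i]] piece(2)[OF p(2) i node_in[OF i]] in \<open>auto simp: node_def\<close>)
  show "v y = w y" if y: "y \<in> {a..b}"
  proof -
    obtain i where i: "i \<in> {1..M}" "y \<in> {lo i..hi i}" using in_element[OF y] .
    then show ?thesis using piece(2)[OF p(1) i] piece(2)[OF p(2) i] pe[OF i(1)] by simp
  qed
qed

lemma gr_cong:
  assumes "v \<in> S" "w \<in> S" "\<And>j. j \<le> M * r \<Longrightarrow> v (x j) = w (x j)" "z \<in> S"
  shows "gr v z = gr w z"
  unfolding gr_eq[OF assms(1,4)] gr_eq[OF assms(2,4)]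
  by (rule sum.cong) (use nodal_eq_imp_eq(1)[OF assms(1-3)] in auto)

lemma interp_exists: "\<exists>v\<in>S. \<forall>j\<le>M * r. v (x j) = g (x j)"
proof -
  have "\<exists>q. degree q \<le> r \<and> (\<forall>j\<in>{0..r}. poly q (node i j) = g (node i j))" if i: "i \<in> {1..M}" for i
  proof (rule interpolation_exists[OF finite_atLeastAtMost node_inj[OF i], of "\<lambda>j. g (node i j)"])
    fix q assume "degree q \<le> card {0..r} - 1" "\<And>j. j \<in> {0..r} \<Longrightarrow> poly q (node i j) = g (node i j)"
    then show ?thesis by auto
  qed auto
  then have "\<exists>q. i \<in> {1..M} \<longrightarrow> degree q \<le> r \<and> (\<forall>j\<in>{0..r}. poly q (node i j) = g (node i j))" for i
    by (cases "i \<in> {1..M}") auto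
  then have "\<forall>i. \<exists>q. i \<in> {1..M} \<longrightarrow> degree q \<le> r \<and> (\<forall>j\<in>{0..r}. poly q (node i j) = g (node i j))" ..
  then obtain q where q': "\<forall>i. i \<in> {1..M} \<longrightarrow> degree (q i) \<le> r \<and> (\<forall>j\<in>{0..r}. poly (q i) (node i j) = g (node i j))"
    by (rule choice[THEN exE])
  then have q: "\<And>i. i \<in> {1..M} \<Longrightarrow> degree (q i) \<le> r"
    "\<And>i j. i \<in> {1..M} \<Longrightarrow> j \<le> r \<Longrightarrow> poly (q i) (node i j) = g (node i j)"
    by auto
  \<comment> \<open>The leftmost element that reaches up to \<open>y\<close> selects the local
    polynomial.\<close>
  define e where "e y = (LEAST i. 1 \<le> i \<and> y \<le> hi i)" for y
  define v where "v y = poly (q (e y)) y" for y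
  have v: "v y = poly (q i) y" if i: "i \<in> {1..M}" and y: "y \<in> {lo i..hi i}" for i y
  proof -
    have ei: "e y \<le> i" unfolding e_def by (rule Least_le) (use i y in auto)
    have e1: "1 \<le> e y \<and> y \<le> hi (e y)" unfolding e_def by (rule LeastI[of _ i]) (use i y in auto)
    show ?thesis
    proof (cases "e y = i")
      case True
      then show ?thesis by (simp add: v_def)
    next
      case False
      then have lt: "e y \<le> i - 1" "i \<ge> 2" using ei e1 by auto
      have "e y * r \<le> (i - 1) * r" using lt by simp
      then have "hi (e y) \<le> lo i" unfolding hi_def lo_def using index_le[OF i, of 0] by (intro x_le) auto
      then have yl: "y = lo i" "hi (e y) = lo i" using y e1 by auto
      have "e y * r = (i - 1) * r"
      proof (rule ccontr)
        assume "e y * r \<noteq> (i - 1) * r"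
        then have "e y * r < (i - 1) * r" using \<open>e y * r \<le> (i - 1) * r\<close> by simp
        then have "hi (e y) < lo i" unfolding hi_def lo_def using index_le[OF i, of 0] by (intro x_less) auto
        then show False using yl by simp
      qed
      then have ey: "e y = i - 1" using r by simp
      have i': "i - 1 \<in> {1..M}" using lt i by auto
      \<comment> \<open>At a common node both local polynomials take the value of \<open>g\<close>,
        so the selection does not matter.\<close>
      have "poly (q (i - 1)) y = g y" using q(2)[OF i', of r] node_ends(2)[OF i'] yl ey by simp
      moreover have "poly (q i) y = g y" using q(2)[OF i, of 0] node_ends(1)[OF i] yl by simp
      ultimately show ?thesis by (simp add: v_def ey)
    qed
  qed
  have "piecewise v" unfolding piecewise_def using q(1) v by blast
  moreover have "v (x j) = g (x j)" if J: "j \<le> M * r" for j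
  proof -
    obtain i k where ik: "i \<in> {1..M}" "k \<le> r" "j = (i - 1) * r + k" using index_exists[OF J] .
    then have "x j = node i k" by (simp add: node_def)
    then show ?thesis using v[OF ik(1) node_in[OF ik(1,2)]] q(2)[OF ik(1,2)] by simp
  qed
  ultimately show ?thesis using fe_iff by blast
qed

abbreviation "Ih \<equiv> lagrange_interp a b r M x"

lemma interp: "Ih g \<in> S" "j \<le> M * r \<Longrightarrow> Ih g (x j) = g (x j)"
proof -
  have "\<exists>v. v \<in> S \<and> (\<forall>j\<le>M * r. v (x j) = g (x j))" using interp_exists by blast
  then have "Ih g \<in> S \<and> (\<forall>j\<le>M * r. Ih g (x j) = g (x j))" unfolding lagrange_interp_def by (rule someI_ex)
  then show "Ih g \<in> S" "j \<le> M * r \<Longrightarrow> Ih g (x j) = g (x j)" by auto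
qed

lemma ip_eq: "ip v w = (\<Sum>i=1..M. \<Sum>j=0..r. \<omega> j * v (node i j) * w (node i j))"
  by (simp add: discrete_inner_def node_def)

lemma ip_commute: "ip v w = ip w v"
  by (simp add: ip_eq mult_ac)

lemma ip_linear: "ip (\<lambda>y. s * v y + t * w y) z = s * ip v z + t * ip w z"
  by (simp add: ip_eq sum.distrib sum_distrib_left algebra_simps)

lemma ip_sum: "ip (\<lambda>y. \<Sum>i\<in>I. k i * f i y) z = (\<Sum>i\<in>I. k i * ip (f i) z)"
  by (induction I rule: infinite_finite_induct) (auto simp: ip_eq sum.distrib sum_distrib_left algebra_simps)

lemma node_x: "i \<in> {1..M} \<Longrightarrow> j \<le> r \<Longrightarrow> \<exists>J\<le>M * r. node i j = x J"
  using index_le unfolding node_def by blast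

lemma ip_cong:
  assumes "\<And>j. j \<le> M * r \<Longrightarrow> v (x j) = v' (x j)" "\<And>j. j \<le> M * r \<Longrightarrow> w (x j) = w' (x j)"
  shows "ip v w = ip v' w'"
  unfolding ip_eq
proof (intro sum.cong refl)
  fix i j assume "i \<in> {1..M}" "j \<in> {0..r}"
  then obtain J where "J \<le> M * r" "node i j = x J" using node_x by auto
  then show "\<omega> j * v (node i j) * w (node i j) = \<omega> j * v' (node i j) * w' (node i j)" using assms by simp
qed

lemma ip_mono:
  assumes "\<And>j. j \<le> M * r \<Longrightarrow> v (x j) * w (x j) \<le> v' (x j) * w' (x j)"
  shows "ip v w \<le> ip v' w'"
  unfolding ip_eq
proof (intro sum_mono)
  fix i j assume ij: "i \<in> {1..M}" "j \<in> {0..r}"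
  then obtain J where "J \<le> M * r" "node i j = x J" using node_x by auto
  then have "v (node i j) * w (node i j) \<le> v' (node i j) * w' (node i j)" using assms by simp
  then show "\<omega> j * v (node i j) * w (node i j) \<le> \<omega> j * v' (node i j) * w' (node i j)"
    using weight(2)[of j] ij by (simp add: mult.assoc)
qed

lemma ip_nonneg: "0 \<le> ip v v"
  using ip_mono[of "\<lambda>y. 0" "\<lambda>y. 0" v v] by (simp add: ip_eq)

lemma ip_one: "ip (\<lambda>y. 1) (\<lambda>y. 1) = b - a"
  using MH by (simp add: ip_eq weight_sum)

lemma ip_Cauchy_Schwarz: "\<bar>ip v w\<bar> \<le> sqrt (ip v v) * sqrt (ip w w)"
proof (rule discriminant_bound)
  fix t
  have "ip (\<lambda>y. 1 * v y + t * w y) (\<lambda>y. 1 * v y + t * w y) = ip v v + 2 * t * ip v w + t\<^sup>2 * ip w w"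
    by (simp add: ip_eq sum.distrib sum_distrib_left algebra_simps power2_eq_square)
  then show "0 \<le> ip v v + 2 * t * ip v w + t\<^sup>2 * ip w w" using ip_nonneg by metis
qed (auto intro: ip_nonneg)

subsection \<open>The discrete Laplacian\<close>

definition basis :: "nat \<Rightarrow> real \<Rightarrow> real" where
  "basis J = Ih (\<lambda>y. if y = x J then 1 else 0)"

lemma x_inj: "i \<le> M * r \<Longrightarrow> j \<le> M * r \<Longrightarrow> x i = x j \<longleftrightarrow> i = j"
  using x_less[of i j] x_less[of j i] by (metis less_irrefl linorder_neqE_nat)

lemma basis: "basis J \<in> S" "i \<le> M * r \<Longrightarrow> J \<le> M * r \<Longrightarrow> basis J (x i) = (if i = J then 1 else 0)"
  unfolding basis_def using interp x_inj by auto

lemma basis_expansion: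
  assumes "i \<le> M * r" shows "(\<Sum>J\<le>M * r. w (x J) * basis J (x i)) = w (x i)"
proof -
  have "(\<Sum>J\<le>M * r. w (x J) * basis J (x i)) = (\<Sum>J\<le>M * r. if J = i then w (x J) else 0)"
    by (rule sum.cong) (use assms in \<open>auto simp: basis(2)\<close>)
  then show ?thesis using assms by simp
qed

lemma gr_sum:
  assumes "\<And>i. i \<in> I \<Longrightarrow> f i \<in> S" "z \<in> S" "finite I"
  shows "gr (\<lambda>y. \<Sum>i\<in>I. k i * f i y) z = (\<Sum>i\<in>I. k i * gr (f i) z)"
  using assms(3,1)
proof (induction I rule: finite_induct)
  case empty
  have "gr (\<lambda>y. 0) z = 0" by (rule trans[OF gr_commute gr_const[OF assms(2)]])
  then show ?case by simp
next
  case (insert i I)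
  have "gr (\<lambda>y. k i * f i y + 1 * (\<Sum>i\<in>I. k i * f i y)) z = k i * gr (f i) z + 1 * gr (\<lambda>y. \<Sum>i\<in>I. k i * f i y) z"
    by (intro gr_linear fe_sum assms(2)) (use insert in auto)
  then show ?case using insert by simp
qed

lemma mass_pos: assumes "J \<le> M * r" shows "ip (basis J) (\<lambda>y. 1) > 0"
proof -
  obtain i j where ij: "i \<in> {1..M}" "j \<le> r" "J = (i - 1) * r + j" using index_exists[OF assms] .
  have nn: "0 \<le> \<omega> l * basis J (node k l) * 1" if kl: "k \<in> {1..M}" "l \<in> {0..r}" for k l
  proof -
    obtain L where "L \<le> M * r" "node k l = x L" using node_x[OF kl(1), of l] kl(2) by auto
    then show ?thesis using basis(2)[OF _ assms] weight(2)[of l] kl by simp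
  qed
  have "0 < \<omega> j * basis J (node i j) * 1" using ij basis(2)[OF assms assms] weight(2) by (simp add: node_def)
  also have "\<dots> \<le> (\<Sum>j=0..r. \<omega> j * basis J (node i j) * 1)"
    by (rule member_le_sum[where f="\<lambda>j. \<omega> j * basis J (node i j) * 1"]) (use nn ij in auto)
  also have "\<dots> \<le> ip (basis J) (\<lambda>y. 1)" unfolding ip_eq
    by (rule member_le_sum[where f="\<lambda>i. \<Sum>j=0..r. \<omega> j * basis J (node i j) * 1"]) (use nn ij in \<open>auto intro!: sum_nonneg\<close>)
  finally show ?thesis .
qed

text \<open>Quadrature and interpolation share their nodes, so the nodal basis is orthogonal: the
  mass matrix is diagonal, with entries \<open>ip (basis J) (\<lambda>y. 1)\<close>.\<close>

lemma ip_basis: assumes "J \<le> M * r" shows "ip g (basis J) = g (x J) * ip (basis J) (\<lambda>y. 1)"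
proof -
  have "ip g (basis J) = ip (\<lambda>y. g (x J) * basis J y + 0 * 0) (\<lambda>y. 1)"
    unfolding ip_eq
  proof (intro sum.cong refl)
    fix i j assume ij: "i \<in> {1..M}" "j \<in> {0..r}"
    then obtain L where "L \<le> M * r" "node i j = x L" using node_x by auto
    then show "\<omega> j * g (node i j) * basis J (node i j) = \<omega> j * (g (x J) * basis J (node i j) + 0 * 0) * 1"
      using basis(2)[OF _ assms, of L] by auto
  qed
  then show ?thesis using ip_linear[of "g (x J)" "basis J" 0 "\<lambda>y. 0" "\<lambda>y. 1"] by simp
qed

abbreviation "Lap \<equiv> discrete_laplacian a b r M x \<omega>"

text \<open>The diagonal mass matrix is inverted entry by entry; this exhibits a witness for the
  choice in the definition.\<close>

lemma discrete_laplacian: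
  assumes v: "v \<in> S"
  shows "Lap v \<in> S" "w \<in> S \<Longrightarrow> ip (Lap v) w = - gr v w"
proof -
  have inv: "x (THE j. j \<le> M * r \<and> x j = x J) = x J \<and> (THE j. j \<le> M * r \<and> x j = x J) = J" if "J \<le> M * r" for J
  proof -
    have "(THE j. j \<le> M * r \<and> x j = x J) = J" by (rule the_equality) (use that x_inj in auto)
    then show ?thesis by simp
  qed
  \<comment> \<open>\<open>Ih\<close> interpolates functions of position, so the index of a node is
    recovered from its location by injectivity of \<open>x\<close>.\<close>
  define g where "g y = (let J = (THE j. j \<le> M * r \<and> x j = y) in - gr v (basis J) / ip (basis J) (\<lambda>y. 1))" for y
  have g: "g (x J) = - gr v (basis J) / ip (basis J) (\<lambda>y. 1)" if "J \<le> M * r" for J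
    using inv[OF that] by (simp add: g_def)
  have "ip (Ih g) w = - gr v w" if w: "w \<in> S" for w
  proof -
    let ?w = "\<lambda>y. \<Sum>J\<le>M * r. w (x J) * basis J y"
    have ws: "?w \<in> S" by (rule fe_sum) (rule basis)
    have "ip (Ih g) w = ip ?w (Ih g)"
      by (subst ip_commute, rule ip_cong) (auto simp: basis_expansion)
    also have "\<dots> = (\<Sum>J\<le>M * r. w (x J) * ip (basis J) (Ih g))" by (rule ip_sum)
    also have "\<dots> = (\<Sum>J\<le>M * r. w (x J) * - gr (basis J) v)"
    proof (intro sum.cong refl)
      fix J assume "J \<in> {..M * r}"
      then have J: "J \<le> M * r" by simp
      have "ip (basis J) (Ih g) = g (x J) * ip (basis J) (\<lambda>y. 1)"
        using ip_basis[OF J, of "Ih g"] interp(2)[OF J] by (simp add: ip_commute)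
      also have "\<dots> = - gr v (basis J)" using g[OF J] mass_pos[OF J] by simp
      also have "\<dots> = - gr (basis J) v" by (simp only: gr_commute[of v])
      finally show "w (x J) * ip (basis J) (Ih g) = w (x J) * - gr (basis J) v" by simp
    qed
    also have "\<dots> = - gr ?w v" using gr_sum[OF basis(1) v, of "{..M * r}" "\<lambda>J. w (x J)"] by (simp add: sum_negf)
    also have "gr ?w v = gr w v" by (rule gr_cong[OF ws w _ v]) (rule basis_expansion)
    finally show ?thesis by (simp only: gr_commute[of w])
  qed
  moreover have neg: "ip (\<lambda>y. - z y) w = - ip z w" for z w by (simp add: ip_eq sum_negf)
  ultimately have "\<exists>z. z \<in> S \<and> (\<forall>w\<in>S. ip (\<lambda>y. - z y) w = gr v w)"
    using interp(1) by (intro exI[of _ "Ih g"]) auto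
  then have "Lap v \<in> S \<and> (\<forall>w\<in>S. ip (\<lambda>y. - Lap v y) w = gr v w)"
    unfolding discrete_laplacian_def by (rule someI_ex)
  then show "Lap v \<in> S" "w \<in> S \<Longrightarrow> ip (Lap v) w = - gr v w" by (auto simp: neg)
qed

end

section \<open>Estimates on the finite element space\<close>

lemma sum_mult_le_sqrt:
  fixes f g :: "'i \<Rightarrow> real"
  assumes "\<And>i. i \<in> I \<Longrightarrow> 0 \<le> f i" "\<And>i. i \<in> I \<Longrightarrow> 0 \<le> g i"
    "(\<Sum>i\<in>I. (f i)\<^sup>2) \<le> F\<^sup>2" "(\<Sum>i\<in>I. (g i)\<^sup>2) \<le> G\<^sup>2" "0 \<le> F" "0 \<le> G"
  shows "(\<Sum>i\<in>I. f i * g i) \<le> F * G"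
proof -
  have "(\<Sum>i\<in>I. f i * g i) = (\<Sum>i\<in>I. \<bar>f i\<bar> * \<bar>g i\<bar>)" using assms(1,2) by (intro sum.cong) auto
  also have "\<dots> \<le> L2_set f I * L2_set g I" by (rule L2_set_mult_ineq)
  also have "\<dots> \<le> F * G"
    unfolding L2_set_def using assms(3-6)
    by (intro mult_mono real_le_lsqrt) (auto intro: sum_nonneg)
  finally show ?thesis .
qed

context lobatto_mesh
begin

definition nh :: "(real \<Rightarrow> real) \<Rightarrow> real" where "nh w = sqrt (ip w w)"
definition ng :: "(real \<Rightarrow> real) \<Rightarrow> real" where "ng w = sqrt (gr w w)"
definition energy :: "nat \<Rightarrow> (real \<Rightarrow> real) \<Rightarrow> real" where
  "energy i w = integral {lo i..hi i} (\<lambda>y. (poly (pderiv (piece w i)) y)\<^sup>2)"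

lemma nh_nonneg: "0 \<le> nh w" and ng_nonneg: "0 \<le> ng w"
  by (simp_all add: nh_def ng_def ip_nonneg L2_inner_self_nonneg)

lemma nh_power2: "(nh w)\<^sup>2 = ip w w" and ng_power2: "(ng w)\<^sup>2 = gr w w"
  by (simp_all add: nh_def ng_def ip_nonneg L2_inner_self_nonneg)

lemma ng_eq_L2: "ng w = L2_norm a b (weak_deriv a b 1 w)"
  by (simp add: ng_def L2_norm_def)

lemma gr_le: "v \<in> S \<Longrightarrow> w \<in> S \<Longrightarrow> \<bar>gr v w\<bar> \<le> ng v * ng w"
  unfolding ng_eq_L2 by (rule L2_Cauchy_Schwarz) (use weak_deriv(2)[OF fe_sobolev] in auto)

lemma ip_le: "\<bar>ip v w\<bar> \<le> nh v * nh w"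
  unfolding nh_def by (rule ip_Cauchy_Schwarz)

lemma energy_nonneg: "0 \<le> energy i w"
  unfolding energy_def
  by (rule Henstock_Kurzweil_Integration.integral_nonneg) (auto intro!: integrable_continuous_real continuous_intros)

lemma energy_sum: "w \<in> S \<Longrightarrow> (\<Sum>i=1..M. energy i w) = (ng w)\<^sup>2"
  unfolding ng_power2 energy_def by (subst gr_eq) (auto simp: power2_eq_square)

lemma poly_L2: "poly q \<in> L2_space s t"
  by (intro continuous_L2 continuous_intros)

lemma energy_bounds:
  assumes w: "w \<in> S" and i: "i \<in> {1..M}"
  shows "integral {lo i..hi i} (\<lambda>y. \<bar>poly (pderiv (piece w i)) y\<bar>) \<le> sqrt H * sqrt (energy i w)"
    and "y \<in> {lo i..hi i} \<Longrightarrow> \<bar>poly (piece w i) y - poly (piece w i) (lo i)\<bar> \<le> sqrt H * sqrt (energy i w)"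
proof -
  let ?d = "poly (pderiv (piece w i))"
  have le: "lo i \<le> hi i" using element_less[OF i] by simp
  have "(integral {lo i..hi i} (\<lambda>y. \<bar>?d y\<bar>))\<^sup>2 \<le> (hi i - lo i) * energy i w"
    unfolding energy_def by (rule abs_integral_L2_le(1)[OF poly_L2]) (use le in auto)
  also have "\<dots> = H * energy i w" using element_size[OF i] by simp
  finally have "integral {lo i..hi i} (\<lambda>y. \<bar>?d y\<bar>) \<le> sqrt (H * energy i w)" by (rule real_le_rsqrt)
  then show 1: "integral {lo i..hi i} (\<lambda>y. \<bar>?d y\<bar>) \<le> sqrt H * sqrt (energy i w)"
    by (simp add: real_sqrt_mult)
  show "\<bar>poly (piece w i) y - poly (piece w i) (lo i)\<bar> \<le> sqrt H * sqrt (energy i w)" if y: "y \<in> {lo i..hi i}"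
  proof -
    have int: "(\<lambda>y. \<bar>?d y\<bar>) integrable_on {s..t}" for s t
      by (intro integrable_continuous_real continuous_intros)
    have "poly (piece w i) y - poly (piece w i) (lo i) = integral {lo i..y} ?d"
      using poly_FTC[of "lo i" y "piece w i"] y by (simp add: integral_unique)
    moreover have "norm (integral {lo i..y} ?d) \<le> integral {lo i..y} (\<lambda>y. \<bar>?d y\<bar>)"
      by (rule integral_norm_bound_integral[OF poly_integrable int]) simp
    ultimately have "\<bar>poly (piece w i) y - poly (piece w i) (lo i)\<bar> \<le> integral {lo i..y} (\<lambda>y. \<bar>?d y\<bar>)"
      by simp
    also have "\<dots> \<le> integral {lo i..hi i} (\<lambda>y. \<bar>?d y\<bar>)"
      by (rule integral_subset_le) (use y int in auto)
    finally show ?thesis using 1 by simp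
  qed
qed

lemma fe_oscillation:
  assumes w: "w \<in> S" and "y \<in> {a..b}" "z \<in> {a..b}"
  shows "\<bar>w y - w z\<bar> \<le> sqrt (b - a) * ng w"
proof -
  have *: "\<bar>w t - w s\<bar> \<le> sqrt (b - a) * ng w" if st: "a \<le> s" "s \<le> t" "t \<le> b" for s t
  proof -
    have c0: "cderiv a b 0 w y = w y" if "y \<in> {a..b}" for y
      by (rule cderiv_0[OF ab fe_sobolev[OF w] _ fe_continuous[OF w] that]) simp
    have "w t - w s = integral {s..t} (weak_deriv a b 1 w)"
      using weak_deriv_has_integral[OF ab fe_sobolev[OF w], of 0 s t] c0[of s] c0[of t] st by (simp add: integral_unique)
    then show ?thesis unfolding ng_eq_L2
      using abs_integral_le_L2_norm[OF weak_deriv(2)[OF fe_sobolev[OF w], of 1] st] by simp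
  qed
  show ?thesis using *[of y z] *[of z y] assms by (cases "y \<le> z") (auto simp: abs_minus_commute)
qed

text \<open>The weights are positive with total \<open>b - a\<close>, so the discrete mean lies
  between the extreme nodal values, and every nodal value differs from it by at most the oscillation
  of \<open>w\<close>.\<close>

lemma poincare:
  assumes w: "w \<in> S"
  shows "nh w \<le> sqrt (2 / (b - a)) * \<bar>ip w (\<lambda>y. 1)\<bar> + sqrt 2 * (b - a) * ng w"
proof -
  let ?L = "b - a"
  define m where "m = ip w (\<lambda>y. 1) / ?L"
  have L: "?L > 0" using ab by simp
  define B where "B = sqrt ?L * ng w"
  have B: "0 \<le> B" using L ng_nonneg by (simp add: B_def)
  have osc: "\<bar>w (x j) - m\<bar> \<le> B" if j: "j \<le> M * r" for j
  proof -
    have const: "ip (\<lambda>y. s) (\<lambda>y. 1) = s * ?L" for s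
      using ip_linear[of s "\<lambda>y. 1" 0 "\<lambda>y. 1" "\<lambda>y. 1"] ip_one by simp
    have o: "\<bar>w (x l) - w (x j)\<bar> \<le> B" if "l \<le> M * r" for l
      unfolding B_def by (rule fe_oscillation[OF w x_in[OF that] x_in[OF j]])
    have "w (x l) \<le> w (x j) + B \<and> w (x j) - B \<le> w (x l)" if "l \<le> M * r" for l
      using o[OF that] by (auto simp: abs_le_iff)
    then have "ip w (\<lambda>y. 1) \<le> ip (\<lambda>y. w (x j) + B) (\<lambda>y. 1)" "ip (\<lambda>y. w (x j) - B) (\<lambda>y. 1) \<le> ip w (\<lambda>y. 1)"
      by (auto intro!: ip_mono)
    then have "m \<le> w (x j) + B" "w (x j) - B \<le> m"
      using L by (auto simp: const m_def divide_le_eq le_divide_eq)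
    then show ?thesis by (auto simp: abs_le_iff)
  qed
  have "nh w \<le> nh (\<lambda>y. \<bar>m\<bar> + B)"
    unfolding nh_def
  proof (intro real_sqrt_le_mono ip_mono)
    fix j assume "j \<le> M * r"
    then have "\<bar>w (x j)\<bar> \<le> \<bar>m\<bar> + B" using osc by fastforce
    then have "\<bar>w (x j)\<bar> * \<bar>w (x j)\<bar> \<le> (\<bar>m\<bar> + B) * (\<bar>m\<bar> + B)" using B by (intro mult_mono) auto
    then show "w (x j) * w (x j) \<le> (\<bar>m\<bar> + B) * (\<bar>m\<bar> + B)" by simp
  qed
  also have "\<dots> = sqrt ?L * (\<bar>m\<bar> + B)"
  proof -
    have "ip (\<lambda>y. \<bar>m\<bar> + B) (\<lambda>y. \<bar>m\<bar> + B) = (\<bar>m\<bar> + B)\<^sup>2 * ip (\<lambda>y. 1) (\<lambda>y. 1)"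
      by (simp add: ip_eq sum_distrib_left power2_eq_square mult_ac)
    then show ?thesis using B by (simp add: nh_def ip_one real_sqrt_mult)
  qed
  also have "\<dots> = sqrt (1 / ?L) * \<bar>ip w (\<lambda>y. 1)\<bar> + ?L * ng w"
  proof -
    have "sqrt (1 / ?L) = sqrt ?L / ?L"
      using L by (simp add: real_sqrt_divide sqrt_divide_self_eq inverse_eq_divide)
    moreover have "sqrt ?L * sqrt ?L = ?L" using L by simp
    ultimately show ?thesis using L by (simp add: m_def B_def abs_divide distrib_left mult.assoc[symmetric])
  qed
  \<comment> \<open>The factors \<open>sqrt 2\<close> merely enlarge the right-hand side.\<close>
  also have "\<dots> \<le> sqrt (2 / ?L) * \<bar>ip w (\<lambda>y. 1)\<bar> + sqrt 2 * ?L * ng w"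
    using L ng_nonneg[of w] by (intro add_mono mult_right_mono real_sqrt_le_mono divide_right_mono) auto
  finally show ?thesis .
qed

lemma L2_norm_elements:
  assumes "v \<in> L2_space a b"
  shows "(L2_norm a b v)\<^sup>2 = (\<Sum>i=1..M. integral {lo i..hi i} (\<lambda>y. (v y)\<^sup>2))"
proof -
  have "(\<lambda>y. (v y)\<^sup>2) integrable_on {a..b}"
    using integrable_on_lebesgue_on[OF L2_integrable_mult[OF assms assms]] by (simp add: power2_eq_square)
  from integral_elements(1)[OF this] show ?thesis
    unfolding L2_norm_power2 L2_inner_eq_integral[OF assms assms] by (simp add: power2_eq_square)
qed

lemma L2_norm_le_of_elements:
  assumes v: "v \<in> L2_space a b" and B: "\<And>i y. i \<in> {1..M} \<Longrightarrow> y \<in> {lo i..hi i} \<Longrightarrow> \<bar>v y\<bar> \<le> B i"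
  shows "(L2_norm a b v)\<^sup>2 \<le> (\<Sum>i=1..M. H * (B i)\<^sup>2)"
  unfolding L2_norm_elements[OF v]
proof (rule sum_mono)
  fix i assume i: "i \<in> {1..M}"
  have "integral {lo i..hi i} (\<lambda>y. (v y)\<^sup>2) \<le> integral {lo i..hi i} (\<lambda>y. (B i)\<^sup>2)"
  proof (rule integral_le)
    show "(\<lambda>y. (v y)\<^sup>2) integrable_on {lo i..hi i}"
      by (rule abs_integral_L2_le(5)[OF v]) (use element_bounds[OF i] element_less[OF i] in auto)
    show "(v y)\<^sup>2 \<le> (B i)\<^sup>2" if "y \<in> {lo i..hi i}" for y
      using power_mono[OF B[OF i that], of 2] by simp
  qed auto
  also have "\<dots> = H * (B i)\<^sup>2" using element_size[OF i] element_less[OF i] by simp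
  finally show "integral {lo i..hi i} (\<lambda>y. (v y)\<^sup>2) \<le> H * (B i)\<^sup>2" .
qed

text \<open>On an element \<open>\<Lambda>\<close> bounds all values by the nodal ones, and every
  weight is at least \<open>c * H\<close>. With \<open>nh_le_L2\<close> this makes the discrete norm
  and the L2 norm equivalent on \<open>S\<close>, uniformly in the mesh.\<close>

lemma L2_le_nh:
  assumes w: "w \<in> S" shows "L2_norm a b w \<le> \<Lambda> / sqrt c * nh w"
proof (rule power2_le_imp_le)
  define Q where "Q i = (\<Sum>j=0..r. \<omega> j * w (node i j) * w (node i j))" for i
  have wn: "0 \<le> \<omega> j * w (node i j) * w (node i j)" if "j \<le> r" for i j
    using weight(2)[OF that] by (simp add: mult.assoc)
  have Q0: "0 \<le> Q i" for i unfolding Q_def by (rule sum_nonneg) (use wn in auto)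
  have B: "\<bar>w y\<bar> \<le> \<Lambda> * sqrt (Q i / (c * H))" if i: "i \<in> {1..M}" and y: "y \<in> {lo i..hi i}" for i y
  proof -
    note p = piece[OF w[unfolded fe_iff] i]
    have "\<bar>poly (piece w i) (node i j)\<bar> \<le> sqrt (Q i / (c * H))" if j: "j \<le> r" for j
    proof (rule real_le_rsqrt)
      have "c * H * (w (node i j))\<^sup>2 \<le> \<omega> j * w (node i j) * w (node i j)"
        using mult_right_mono[OF weight(1)[OF j], of "(w (node i j))\<^sup>2"] by (simp add: power2_eq_square mult.assoc)
      also have "\<dots> \<le> Q i" unfolding Q_def
        by (rule member_le_sum[where f="\<lambda>j. \<omega> j * w (node i j) * w (node i j)"]) (use wn j in auto)
      finally have "(w (node i j))\<^sup>2 \<le> Q i / (c * H)"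
        using c H_pos by (simp add: field_simps)
      then show "\<bar>poly (piece w i) (node i j)\<bar>\<^sup>2 \<le> Q i / (c * H)" using p(2)[OF node_in[OF i j]] by simp
    qed
    from interp_bound[OF element_less[OF i] element_GL[OF i] p(1) this y] show ?thesis using p(2)[OF y] by simp
  qed
  have "(L2_norm a b w)\<^sup>2 \<le> (\<Sum>i=1..M. H * (\<Lambda> * sqrt (Q i / (c * H)))\<^sup>2)"
    by (rule L2_norm_le_of_elements[OF fe_L2[OF w] B])
  also have "\<dots> = (\<Sum>i=1..M. \<Lambda>\<^sup>2 / c * Q i)"
    by (rule sum.cong) (use Q0 c H_pos in \<open>auto simp: power_mult_distrib\<close>)
  also have "\<dots> = (\<Lambda> / sqrt c * nh w)\<^sup>2"
    using c by (simp add: power_mult_distrib power_divide nh_power2 ip_eq Q_def sum_distrib_left sum_divide_distrib)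
  finally show "(L2_norm a b w)\<^sup>2 \<le> (\<Lambda> / sqrt c * nh w)\<^sup>2" .
  show "0 \<le> \<Lambda> / sqrt c * nh w" using c \<Lambda> nh_nonneg by simp
qed

text \<open>An inverse estimate: a polynomial of bounded degree cannot drop quickly away from its
  largest nodal value, so that value is visible in the integral.\<close>

lemma nh_le_L2:
  assumes w: "w \<in> S" shows "nh w \<le> sqrt (8 * \<Lambda>) * L2_norm a b w"
proof (rule power2_le_imp_le)
  have "(nh w)\<^sup>2 \<le> (\<Sum>i=1..M. 8 * \<Lambda> * integral {lo i..hi i} (\<lambda>y. (w y)\<^sup>2))"
    unfolding nh_power2 ip_eq
  proof (rule sum_mono)
    fix i assume i: "i \<in> {1..M}"
    note p = piece[OF w[unfolded fe_iff] i]
    let ?q = "piece w i"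
    define T where "T = Max ((\<lambda>j. \<bar>poly ?q (node i j)\<bar>) ` {0..r})"
    have Tj: "\<bar>poly ?q (node i j)\<bar> \<le> T" if "j \<le> r" for j
      unfolding T_def by (rule Max_ge) (use that in auto)
    have "T \<in> (\<lambda>j. \<bar>poly ?q (node i j)\<bar>) ` {0..r}" unfolding T_def by (rule Max_in) auto
    then obtain m where m: "m \<le> r" "\<bar>poly ?q (node i m)\<bar> = T" by auto
    have "T\<^sup>2 * (hi i - lo i) \<le> 8 * \<Lambda> * integral {lo i..hi i} (\<lambda>s. (poly ?q s)\<^sup>2)"
      by (rule sup_le_L2_of_derivative_bound[OF element_less[OF i] \<Lambda> _ node_in[OF i m(1)] m(2)])
        (use interp_bound[OF element_less[OF i] element_GL[OF i] p(1) Tj] in auto)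
    also have "integral {lo i..hi i} (\<lambda>s. (poly ?q s)\<^sup>2) = integral {lo i..hi i} (\<lambda>y. (w y)\<^sup>2)"
      by (rule Henstock_Kurzweil_Integration.integral_cong) (simp add: p(2))
    finally have T: "H * T\<^sup>2 \<le> 8 * \<Lambda> * integral {lo i..hi i} (\<lambda>y. (w y)\<^sup>2)"
      using element_size[OF i] by (simp add: mult.commute)
    have "(\<Sum>j=0..r. \<omega> j * w (node i j) * w (node i j)) \<le> (\<Sum>j=0..r. \<omega> j * T\<^sup>2)"
    proof (rule sum_mono)
      fix j assume j: "j \<in> {0..r}"
      have "(w (node i j))\<^sup>2 \<le> T\<^sup>2"
        using power_mono[OF Tj, of j 2] p(2)[OF node_in[OF i]] j by simp
      then show "\<omega> j * w (node i j) * w (node i j) \<le> \<omega> j * T\<^sup>2"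
        using weight(2)[of j] j by (simp add: power2_eq_square mult.assoc)
    qed
    also have "\<dots> = H * T\<^sup>2" by (simp add: sum_distrib_right[symmetric] weight_sum)
    finally show "(\<Sum>j=0..r. \<omega> j * w (node i j) * w (node i j)) \<le> 8 * \<Lambda> * integral {lo i..hi i} (\<lambda>y. (w y)\<^sup>2)"
      using T by linarith
  qed
  also have "\<dots> = (sqrt (8 * \<Lambda>) * L2_norm a b w)\<^sup>2"
    using \<Lambda> by (simp add: power_mult_distrib L2_norm_elements[OF fe_L2[OF w]] sum_distrib_left)
  finally show "(nh w)\<^sup>2 \<le> (sqrt (8 * \<Lambda>) * L2_norm a b w)\<^sup>2" .
  show "0 \<le> sqrt (8 * \<Lambda>) * L2_norm a b w" using \<Lambda> L2_norm_nonneg by simp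
qed

text \<open>Cauchy--Schwarz on each element gains a factor \<open>H\<close> for the squares; the
  mesh estimates draw half a power of \<open>H\<close> from it.\<close>

lemma element_integral_square_sum:
  assumes k: "k \<in> L2_space a b"
  shows "(\<Sum>i=1..M. (integral {lo i..hi i} (\<lambda>y. \<bar>k y\<bar>))\<^sup>2) \<le> H * (L2_norm a b k)\<^sup>2"
proof -
  have "(\<Sum>i=1..M. (integral {lo i..hi i} (\<lambda>y. \<bar>k y\<bar>))\<^sup>2) \<le> (\<Sum>i=1..M. H * integral {lo i..hi i} (\<lambda>y. (k y)\<^sup>2))"
  proof (rule sum_mono)
    fix i assume i: "i \<in> {1..M}"
    show "(integral {lo i..hi i} (\<lambda>y. \<bar>k y\<bar>))\<^sup>2 \<le> H * integral {lo i..hi i} (\<lambda>y. (k y)\<^sup>2)"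
      using abs_integral_L2_le(1)[OF k, of "lo i" "hi i"] element_bounds[OF i] element_less[OF i] element_size[OF i] by simp
  qed
  also have "\<dots> = H * (L2_norm a b k)\<^sup>2" by (simp add: L2_norm_elements[OF k] sum_distrib_left)
  finally show ?thesis .
qed

text \<open>Up to a constant on each element, \<open>Ih g\<close> depends only on nodal increments
  of \<open>g\<close>, so it is enough that these are bounded by integrals of \<open>|k|\<close>.
  Applied to the stage defects, it bounds their interpolants in the gradient norm.\<close>

lemma interp_stability:
  assumes k: "k \<in> L2_space a b"
    and g: "\<And>s t. a \<le> s \<Longrightarrow> s \<le> t \<Longrightarrow> t \<le> b \<Longrightarrow> \<bar>g t - g s\<bar> \<le> integral {s..t} (\<lambda>y. \<bar>k y\<bar>)"
  shows "ng (Ih g) \<le> \<Lambda> * L2_norm a b k"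
proof (rule power2_le_imp_le)
  define \<kappa> where "\<kappa> i = integral {lo i..hi i} (\<lambda>y. \<bar>k y\<bar>)" for i
  have e: "energy i (Ih g) \<le> \<Lambda>\<^sup>2 / H * (\<kappa> i)\<^sup>2" if i: "i \<in> {1..M}" for i
  proof -
    have pw: "piecewise (Ih g)" using interp(1) fe_iff by simp
    note p = piece[OF pw i]
    \<comment> \<open>Subtracting the value at the left end leaves the derivative unchanged and
      turns the nodal values into increments.\<close>
    let ?q = "piece (Ih g) i - [:g (lo i):]"
    have pn: "poly (piece (Ih g) i) (node i j) = g (node i j)" if "j \<le> r" for j
      using p(2)[OF node_in[OF i that]] interp(2)[OF index_le[OF i that], of g] by (simp add: node_def)
    have dq: "degree ?q \<le> r" by (rule degree_diff_le) (use p in auto)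
    have nq: "\<bar>poly ?q (node i j)\<bar> \<le> \<kappa> i" if j: "j \<le> r" for j
    proof -
      have "\<bar>g (node i j) - g (lo i)\<bar> \<le> integral {lo i..node i j} (\<lambda>y. \<bar>k y\<bar>)"
        using node_in[OF i j] element_bounds[OF i] by (intro g) auto
      also have "\<dots> \<le> \<kappa> i" unfolding \<kappa>_def
        by (rule integral_subset_le)
          (use node_in[OF i j] element_bounds[OF i] element_less[OF i] in \<open>auto intro!: abs_integral_L2_le(4)[OF k]\<close>)
      finally show ?thesis by (simp add: pn[OF j])
    qed
    have "\<bar>poly (pderiv (piece (Ih g) i)) y\<bar> \<le> \<Lambda> * \<kappa> i / H" if "y \<in> {lo i..hi i}" for y
      using interp_bound[OF element_less[OF i] element_GL[OF i] dq nq that] element_size[OF i]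
      by (simp add: pderiv_diff pderiv_pCons)
    then have sq: "(poly (pderiv (piece (Ih g) i)) y)\<^sup>2 \<le> (\<Lambda> * \<kappa> i / H)\<^sup>2" if "y \<in> {lo i..hi i}" for y
      using power_mono[of "\<bar>poly (pderiv (piece (Ih g) i)) y\<bar>" _ 2] that by fastforce
    have "energy i (Ih g) \<le> integral {lo i..hi i} (\<lambda>y. (\<Lambda> * \<kappa> i / H)\<^sup>2)"
      unfolding energy_def by (rule integral_le) (use sq in \<open>auto intro!: integrable_continuous_real continuous_intros\<close>)
    also have "\<dots> = H * (\<Lambda> * \<kappa> i / H)\<^sup>2" using element_size[OF i] element_less[OF i] by simp
    also have "\<dots> = \<Lambda>\<^sup>2 / H * (\<kappa> i)\<^sup>2" using H_pos by (simp add: power2_eq_square)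
    finally show ?thesis .
  qed
  have "(ng (Ih g))\<^sup>2 \<le> (\<Sum>i=1..M. \<Lambda>\<^sup>2 / H * (\<kappa> i)\<^sup>2)"
    unfolding energy_sum[OF interp(1), symmetric] by (intro sum_mono e) simp
  also have "\<dots> \<le> \<Lambda>\<^sup>2 / H * (H * (L2_norm a b k)\<^sup>2)"
    unfolding sum_distrib_left[symmetric] \<kappa>_def
    using H_pos by (intro mult_left_mono element_integral_square_sum[OF k]) auto
  also have "\<dots> = (\<Lambda> * L2_norm a b k)\<^sup>2" using H_pos by (simp add: power_mult_distrib)
  finally show "(ng (Ih g))\<^sup>2 \<le> (\<Lambda> * L2_norm a b k)\<^sup>2" .
  show "0 \<le> \<Lambda> * L2_norm a b k" using \<Lambda> L2_norm_nonneg by simp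
qed

end

text \<open>\<open>g n\<close> stands for the n-th space derivative of the solution at a fixed time,
  and \<open>k\<close> majorizes the orders \<open>r + 1\<close> to \<open>r + 3\<close>. The
  highest of these may exist only weakly, so it is represented by increments of
  \<open>g (r + 2)\<close>.\<close>

locale smooth_on_mesh = lobatto_mesh +
  fixes g :: "nat \<Rightarrow> real \<Rightarrow> real" and k :: "real \<Rightarrow> real"
  assumes g_int: "\<And>n s t. n < r + 2 \<Longrightarrow> a \<le> s \<Longrightarrow> s \<le> t \<Longrightarrow> t \<le> b \<Longrightarrow> (g (Suc n) has_integral g n t - g n s) {s..t}"
    and k: "k \<in> L2_space a b"
    and g_top: "\<And>n s t. n \<in> {r, r + 1, r + 2} \<Longrightarrow> a \<le> s \<Longrightarrow> s \<le> t \<Longrightarrow> t \<le> b \<Longrightarrow> \<bar>g n t - g n s\<bar> \<le> integral {s..t} (\<lambda>y. \<bar>k y\<bar>)"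
begin

definition \<kappa> :: "nat \<Rightarrow> real" where "\<kappa> i = integral {lo i..hi i} (\<lambda>y. \<bar>k y\<bar>)"

lemma kappa_nonneg: "i \<in> {1..M} \<Longrightarrow> 0 \<le> \<kappa> i"
  unfolding \<kappa>_def by (rule Henstock_Kurzweil_Integration.integral_nonneg)
    (use element_bounds[of i] element_less[of i] in \<open>auto intro!: abs_integral_L2_le(4)[OF k]\<close>)

lemma kappa_sum: "(\<Sum>i=1..M. (\<kappa> i)\<^sup>2) \<le> (sqrt H * L2_norm a b k)\<^sup>2"
  using element_integral_square_sum[OF k] H_pos by (simp add: \<kappa>_def power_mult_distrib)

lemma taylor:
  assumes i: "i \<in> {1..M}" and m: "m \<in> {r, r + 1, r + 2}"
  obtains P where "degree P \<le> m" "\<And>n y. n \<le> m \<Longrightarrow> y \<in> {lo i..hi i} \<Longrightarrow> \<bar>g n y - poly ((pderiv ^^ n) P) y\<bar> \<le> \<kappa> i * H ^ (m - n)"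
proof -
  note eb = element_bounds[OF i] element_less[OF i]
  have "\<exists>P. degree P \<le> m \<and> (\<forall>n\<le>m. \<forall>y\<in>{lo i..hi i}. \<bar>g n y - poly ((pderiv ^^ n) P) y\<bar> \<le> \<kappa> i * (hi i - lo i) ^ (m - n))"
  proof (rule taylor_poly)
    show "(g (Suc n) has_integral g n y - g n (lo i)) {lo i..y}" if "n < m" "y \<in> {lo i..hi i}" for n y
      by (rule g_int) (use that m eb in auto)
    show "\<bar>g m y - g m (lo i)\<bar> \<le> \<kappa> i" if y: "y \<in> {lo i..hi i}" for y
    proof -
      have "\<bar>g m y - g m (lo i)\<bar> \<le> integral {lo i..y} (\<lambda>y. \<bar>k y\<bar>)"
        by (rule g_top[OF m]) (use y eb in auto)
      also have "\<dots> \<le> \<kappa> i" unfolding \<kappa>_def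
        by (rule integral_subset_le) (use y eb in \<open>auto intro!: abs_integral_L2_le(4)[OF k]\<close>)
      finally show ?thesis .
    qed
  qed (use eb in simp)
  then show ?thesis using that element_size[OF i] by auto
qed

lemma g0_continuous: "continuous_on {a..b} (g 0)"
proof -
  have "g 1 integrable_on {a..b}" using g_int[of 0 a b] ab by (auto simp: integrable_on_def)
  then have "continuous_on {a..b} (\<lambda>y. g 0 a + integral {a..y} (g 1))"
    by (intro continuous_intros indefinite_integral_continuous_1)
  moreover have "g 0 a + integral {a..y} (g 1) = g 0 y" if "y \<in> {a..b}" for y
    using g_int[of 0 a y] that by (simp add: integral_unique)
  ultimately show ?thesis by (metis (no_types, lifting) continuous_on_cong)
qed

lemma interp_piece:
  assumes i: "i \<in> {1..M}"
  shows "degree (piece (Ih f) i) \<le> r" "\<And>y. y \<in> {lo i..hi i} \<Longrightarrow> Ih f y = poly (piece (Ih f) i) y"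
    "\<And>j. j \<le> r \<Longrightarrow> poly (piece (Ih f) i) (node i j) = f (node i j)"
proof -
  have pw: "piecewise (Ih f)" using interp(1) fe_iff by simp
  note p = piece[OF pw i]
  show "degree (piece (Ih f) i) \<le> r" "\<And>y. y \<in> {lo i..hi i} \<Longrightarrow> Ih f y = poly (piece (Ih f) i) y" by (fact p)+
  show "poly (piece (Ih f) i) (node i j) = f (node i j)" if "j \<le> r" for j
    using p(2)[OF node_in[OF i that]] interp(2)[OF index_le[OF i that], of f] by (simp add: node_def)
qed

text \<open>Interpolation reproduces the Taylor polynomial of degree \<open>r\<close>, so the error
  on element \<open>i\<close> is at most \<open>(1 + \<Lambda>) * \<kappa> i * H ^ r\<close>. The
  missing power of \<open>H\<close> arrives in two halves: from the length of the element and from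
  \<open>kappa_sum\<close>.\<close>

lemma interp_error: "L2_norm a b (\<lambda>y. g 0 y - Ih (g 0) y) \<le> (1 + \<Lambda>) * L2_norm a b k * H ^ (r + 1)"
proof (rule power2_le_imp_le)
  have B: "\<bar>g 0 y - Ih (g 0) y\<bar> \<le> (1 + \<Lambda>) * \<kappa> i * H ^ r" if i: "i \<in> {1..M}" and y: "y \<in> {lo i..hi i}" for i y
  proof -
    obtain P where P: "degree P \<le> r" "\<And>n y. n \<le> r \<Longrightarrow> y \<in> {lo i..hi i} \<Longrightarrow> \<bar>g n y - poly ((pderiv ^^ n) P) y\<bar> \<le> \<kappa> i * H ^ (r - n)"
      by (rule taylor[OF i, of r]) auto
    note p = interp_piece[OF i, where f="g 0"]
    have g0: "\<bar>g 0 y - poly P y\<bar> \<le> \<kappa> i * H ^ r" if "y \<in> {lo i..hi i}" for y using P(2)[of 0 y] that by simp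
    have "degree (piece (Ih (g 0)) i - P) \<le> r" by (rule degree_diff_le) (use p P in auto)
    moreover have "\<bar>poly (piece (Ih (g 0)) i - P) (node i j)\<bar> \<le> \<kappa> i * H ^ r" if j: "j \<le> r" for j
      using g0[OF node_in[OF i j]] p(3)[OF j] by simp
    ultimately have "\<bar>poly (piece (Ih (g 0)) i - P) y\<bar> \<le> \<Lambda> * (\<kappa> i * H ^ r)"
      using interp_bound[OF element_less[OF i] element_GL[OF i] _ _ y] by blast
    then show ?thesis using g0[OF y] p(2)[OF y] by (simp add: algebra_simps abs_le_iff)
  qed
  have L: "(\<lambda>y. g 0 y - Ih (g 0) y) \<in> L2_space a b"
    by (intro L2_diff continuous_L2[OF g0_continuous] fe_L2 interp)
  have "(L2_norm a b (\<lambda>y. g 0 y - Ih (g 0) y))\<^sup>2 \<le> (\<Sum>i=1..M. H * ((1 + \<Lambda>) * \<kappa> i * H ^ r)\<^sup>2)"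
    by (rule L2_norm_le_of_elements[OF L B])
  also have "\<dots> = H * ((1 + \<Lambda>) * H ^ r)\<^sup>2 * (\<Sum>i=1..M. (\<kappa> i)\<^sup>2)"
    by (simp add: sum_distrib_left power_mult_distrib mult_ac)
  also have "\<dots> \<le> H * ((1 + \<Lambda>) * H ^ r)\<^sup>2 * (sqrt H * L2_norm a b k)\<^sup>2"
    using H_pos by (intro mult_left_mono kappa_sum) auto
  also have "\<dots> = ((1 + \<Lambda>) * L2_norm a b k * H ^ (r + 1))\<^sup>2"
    using H_pos by (simp add: power_mult_distrib power2_eq_square)
  finally show "(L2_norm a b (\<lambda>y. g 0 y - Ih (g 0) y))\<^sup>2 \<le> ((1 + \<Lambda>) * L2_norm a b k * H ^ (r + 1))\<^sup>2" .
  show "0 \<le> (1 + \<Lambda>) * L2_norm a b k * H ^ (r + 1)" using \<Lambda> H_pos L2_norm_nonneg by simp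
qed

text \<open>The source of the spatial order: up to degree \<open>r + 1\<close> the scheme is
  consistent without error on an element. \<open>P'' q\<close> is within the exactness of the rule,
  and \<open>p - P\<close> vanishes at the nodes, which makes its derivative orthogonal to
  \<open>q'\<close>.\<close>

lemma truncation_exact:
  assumes i: "i \<in> {1..M}" and P: "degree P \<le> r + 1" and q: "degree q \<le> r"
    and p: "degree p \<le> r" "\<And>j. j \<le> r \<Longrightarrow> poly p (node i j) = poly P (node i j)"
  shows "(\<Sum>j=0..r. \<omega> j * (poly (pderiv (pderiv P)) (node i j) * poly q (node i j)))
     + integral {lo i..hi i} (\<lambda>y. poly (pderiv p) y * poly (pderiv q) y)
     = poly (pderiv P) (hi i) * poly q (hi i) - poly (pderiv P) (lo i) * poly q (lo i)"
proof -
  have le: "lo i \<le> hi i" using element_less[OF i] by simp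
  have int: "poly u integrable_on {lo i..hi i}" for u :: "real poly" by (rule poly_integrable)
  have "degree (pderiv (pderiv P) * q) \<le> 2 * r - 1"
    by (rule order_trans[OF degree_mult_le]) (use P q r in \<open>simp add: degree_pderiv\<close>)
  then have 1: "(\<Sum>j=0..r. \<omega> j * (poly (pderiv (pderiv P)) (node i j) * poly q (node i j))) = integral {lo i..hi i} (poly (pderiv (pderiv P) * q))"
    using quadrature[OF i, of "pderiv (pderiv P) * q"] by simp
  have 2: "integral {lo i..hi i} (poly (pderiv (pderiv P) * q)) + integral {lo i..hi i} (poly (pderiv P * pderiv q)) =
     poly (pderiv P) (hi i) * poly q (hi i) - poly (pderiv P) (lo i) * poly q (lo i)"
  proof -
    have "integral {lo i..hi i} (poly (pderiv (pderiv P) * q)) + integral {lo i..hi i} (poly (pderiv P * pderiv q))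
      = integral {lo i..hi i} (\<lambda>y. poly (pderiv (pderiv P) * q) y + poly (pderiv P * pderiv q) y)"
      by (rule Henstock_Kurzweil_Integration.integral_add[OF int int, symmetric])
    also have "\<dots> = integral {lo i..hi i} (poly (pderiv (pderiv P * q)))"
      by (rule Henstock_Kurzweil_Integration.integral_cong) (simp add: pderiv_mult)
    finally show ?thesis using poly_FTC[OF le, of "pderiv P * q"] by (simp add: integral_unique)
  qed
  define d where "d = p - P"
  have d0: "poly d (node i j) = 0" if "j \<le> r" for j using p(2)[OF that] by (simp add: d_def)
  have d_ends: "poly d (lo i) = 0" "poly d (hi i) = 0"
    using d0[of 0] d0[of r] node_ends[OF i] by auto
  have dq: "integral {lo i..hi i} (poly (d * pderiv (pderiv q))) = 0"
  \<comment> \<open>For \<open>r = 1\<close> truncated subtraction spoils the degree count, but then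
    \<open>q''\<close> is zero; for larger \<open>r\<close> the degree is at most
    \<open>(r + 1) + (r - 2)\<close>.\<close>
  proof (cases "r = 1")
    case True
    have "degree (pderiv q) = 0" using q True by (simp add: degree_pderiv)
    then have "pderiv (pderiv q) = 0" by (simp add: pderiv_eq_0_iff)
    moreover have "poly 0 = (\<lambda>s::real. 0::real)" by auto
    ultimately show ?thesis by simp
  next
    case False
    have "degree d \<le> r + 1" unfolding d_def by (rule degree_diff_le) (use p P in auto)
    then have "degree (d * pderiv (pderiv q)) \<le> 2 * r - 1"
      by (intro order_trans[OF degree_mult_le]) (use q r False in \<open>simp add: degree_pderiv\<close>)
    then have "integral {lo i..hi i} (poly (d * pderiv (pderiv q))) = (\<Sum>j=0..r. \<omega> j * poly (d * pderiv (pderiv q)) (node i j))"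
      by (rule quadrature[OF i, symmetric])
    also have "\<dots> = 0" by (rule sum.neutral) (simp add: d0)
    finally show ?thesis .
  qed
  have 3: "integral {lo i..hi i} (poly (pderiv d * pderiv q)) = 0"
  proof -
    have "integral {lo i..hi i} (poly (pderiv d * pderiv q)) + integral {lo i..hi i} (poly (d * pderiv (pderiv q)))
      = integral {lo i..hi i} (\<lambda>y. poly (pderiv d * pderiv q) y + poly (d * pderiv (pderiv q)) y)"
      by (rule Henstock_Kurzweil_Integration.integral_add[OF int int, symmetric])
    also have "\<dots> = integral {lo i..hi i} (poly (pderiv (d * pderiv q)))"
      by (rule Henstock_Kurzweil_Integration.integral_cong) (simp add: pderiv_mult)
    finally show ?thesis using poly_FTC[OF le, of "d * pderiv q"] dq d_ends by (simp add: integral_unique)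
  qed
  have 4: "integral {lo i..hi i} (\<lambda>y. poly (pderiv p) y * poly (pderiv q) y) = integral {lo i..hi i} (poly (pderiv P * pderiv q))"
  proof -
    have "integral {lo i..hi i} (poly (pderiv d * pderiv q)) = integral {lo i..hi i} (\<lambda>y. poly (pderiv p * pderiv q) y - poly (pderiv P * pderiv q) y)"
      by (rule Henstock_Kurzweil_Integration.integral_cong) (simp add: d_def pderiv_diff algebra_simps)
    also have "\<dots> = integral {lo i..hi i} (poly (pderiv p * pderiv q)) - integral {lo i..hi i} (poly (pderiv P * pderiv q))"
      by (rule Henstock_Kurzweil_Integration.integral_diff[OF int int])
    moreover have "(\<lambda>y. poly (pderiv p) y * poly (pderiv q) y) = poly (pderiv p * pderiv q)" by auto
    ultimately show ?thesis using 3 by simp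
  qed
  show ?thesis using 1 2 4 by simp
qed

text \<open>The quadrature rule is exact for \<open>P'' q\<close> only up to degree \<open>2r - 1\<close>; splitting off the value
  \<open>w (lo i)\<close> gains the missing power of \<open>H\<close>.\<close>

lemma truncation_element:
  assumes w: "w \<in> S" and i: "i \<in> {1..M}"
  shows "\<bar>(\<Sum>j=0..r. \<omega> j * g 2 (node i j) * w (node i j))
      + integral {lo i..hi i} (\<lambda>y. poly (pderiv (piece (Ih (g 0)) i)) y * poly (pderiv (piece w i)) y)
      - (g 1 (hi i) * w (hi i) - g 1 (lo i) * w (lo i))\<bar>
    \<le> (2 + \<Lambda>) * H ^ r * sqrt H * (\<kappa> i * sqrt (energy i w)) + 3 * H ^ (r + 1) * (\<kappa> i * \<bar>w (lo i)\<bar>)"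
proof -
  note el = element_less[OF i]
  have le: "lo i \<in> {lo i..hi i}" "hi i \<in> {lo i..hi i}" using el by auto
  note pw = piece[OF w[unfolded fe_iff] i] and p = interp_piece[OF i, where f="g 0"]
  define w0 where "w0 = w (lo i)"
  define q where "q = piece w i - [:w0:]"
  define \<delta> where "\<delta> = sqrt H * sqrt (energy i w)"
  have \<delta>0: "0 \<le> \<delta>" using H_pos energy_nonneg by (simp add: \<delta>_def)
  note \<kappa>0 = kappa_nonneg[OF i]
  have wq: "w y = poly q y + w0" if "y \<in> {lo i..hi i}" for y using pw(2)[OF that] by (simp add: q_def)
  have dq: "degree q \<le> r" unfolding q_def by (rule degree_diff_le) (use pw in auto)
  have q': "pderiv q = pderiv (piece w i)" by (simp add: q_def pderiv_diff pderiv_pCons)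
  have q\<delta>: "\<bar>poly q y\<bar> \<le> \<delta>" if "y \<in> {lo i..hi i}" for y
    using energy_bounds(2)[OF w i that] pw(2)[OF le(1)] by (simp add: q_def w0_def \<delta>_def)
  have q'\<delta>: "integral {lo i..hi i} (\<lambda>y. \<bar>poly (pderiv q) y\<bar>) \<le> \<delta>"
    using energy_bounds(1)[OF w i] by (simp add: q' \<delta>_def)
  have ql: "poly q (lo i) = 0" using wq[OF le(1)] by (simp add: w0_def)
  have nj: "node i j \<in> {lo i..hi i}" if "j \<in> {0..r}" for j using node_in[OF i] that by simp
  have wsum: "\<bar>\<Sum>j=0..r. \<omega> j * f j\<bar> \<le> H * B" if f: "\<And>j. j \<le> r \<Longrightarrow> \<bar>f j\<bar> \<le> B" for f B
  proof -
    have "\<bar>\<Sum>j=0..r. \<omega> j * f j\<bar> \<le> (\<Sum>j=0..r. \<omega> j * B)"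
    proof (rule order_trans[OF sum_abs sum_mono])
      fix j assume j: "j \<in> {0..r}"
      then show "\<bar>\<omega> j * f j\<bar> \<le> \<omega> j * B" using f[of j] weight(2)[of j] by (simp add: abs_mult)
    qed
    then show ?thesis by (simp add: sum_distrib_right[symmetric] weight_sum)
  qed
  \<comment> \<open>\<open>P\<close> of degree \<open>r + 1\<close> serves for the part
    \<open>q\<close> of \<open>w\<close>, which is itself of size \<open>\<delta>\<close>. For the
    constant part \<open>w0\<close> one more degree is affordable: the rule is exact for
    \<open>R''\<close>, of degree at most \<open>r\<close>.\<close>
  obtain P where P: "degree P \<le> r + 1" "\<And>n y. n \<le> r + 1 \<Longrightarrow> y \<in> {lo i..hi i} \<Longrightarrow> \<bar>g n y - poly ((pderiv ^^ n) P) y\<bar> \<le> \<kappa> i * H ^ (r + 1 - n)"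
    by (rule taylor[OF i, of "r + 1"]) auto
  obtain p1 where p1: "degree p1 \<le> card {0..r} - 1" "\<And>j. j \<in> {0..r} \<Longrightarrow> poly p1 (node i j) = poly P (node i j)"
    by (rule interpolation_exists[OF finite_atLeastAtMost node_inj[OF i], of "\<lambda>j. poly P (node i j)"]) auto
  obtain R where R: "degree R \<le> r + 2" "\<And>n y. n \<le> r + 2 \<Longrightarrow> y \<in> {lo i..hi i} \<Longrightarrow> \<bar>g n y - poly ((pderiv ^^ n) R) y\<bar> \<le> \<kappa> i * H ^ (r + 2 - n)"
    by (rule taylor[OF i, of "r + 2"]) auto
  let ?D = "\<lambda>y. poly (pderiv (piece (Ih (g 0)) i)) y * poly (pderiv q) y"
  define A where "A = (\<Sum>j=0..r. \<omega> j * ((g 2 (node i j) - poly (pderiv (pderiv P)) (node i j)) * poly q (node i j)))"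
  define B where "B = integral {lo i..hi i} (\<lambda>y. poly (pderiv (piece (Ih (g 0)) i - p1)) y * poly (pderiv q) y)"
  define C where "C = (g 1 (hi i) - poly (pderiv P) (hi i)) * poly q (hi i)"
  define E where "E = (\<Sum>j=0..r. \<omega> j * (g 2 (node i j) - poly (pderiv (pderiv R)) (node i j)))"
  define F where "F = (g 1 (hi i) - poly (pderiv R) (hi i)) - (g 1 (lo i) - poly (pderiv R) (lo i))"
  have int: "(\<lambda>y. poly u y * poly v y) integrable_on {lo i..hi i}" for u v :: "real poly"
    by (intro integrable_continuous_real continuous_intros)
  \<comment> \<open>\<open>A\<close>, \<open>B\<close>, \<open>C\<close> are the errors of passing
    from \<open>g\<close> to \<open>P\<close> in the quadrature, the gradient term and the boundary
    term. \<open>E\<close> and \<open>F\<close> are those of passing to \<open>R\<close>; there is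
    no gradient term, since \<open>w0\<close> is constant.\<close>
  have split: "(\<Sum>j=0..r. \<omega> j * g 2 (node i j) * w (node i j)) + integral {lo i..hi i} ?D - (g 1 (hi i) * w (hi i) - g 1 (lo i) * w (lo i))
      = A + B - C + w0 * (E - F)"
  proof -
    have ex1: "(\<Sum>j=0..r. \<omega> j * (poly (pderiv (pderiv P)) (node i j) * poly q (node i j)))
      + integral {lo i..hi i} (\<lambda>y. poly (pderiv p1) y * poly (pderiv q) y) = poly (pderiv P) (hi i) * poly q (hi i)"
      using truncation_exact[OF i P(1) dq, of p1] p1 ql by simp
    have "degree (pderiv (pderiv R)) \<le> 2 * r - 1" using R(1) r by (simp add: degree_pderiv)
    then have ex2: "(\<Sum>j=0..r. \<omega> j * poly (pderiv (pderiv R)) (node i j)) = poly (pderiv R) (hi i) - poly (pderiv R) (lo i)"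
      using quadrature[OF i, of "pderiv (pderiv R)"] poly_FTC[of "lo i" "hi i" "pderiv R"] el by (simp add: integral_unique)
    have s1: "(\<Sum>j=0..r. \<omega> j * g 2 (node i j) * w (node i j)) = A + (\<Sum>j=0..r. \<omega> j * (poly (pderiv (pderiv P)) (node i j) * poly q (node i j)))
      + w0 * (E + (\<Sum>j=0..r. \<omega> j * poly (pderiv (pderiv R)) (node i j)))"
      unfolding A_def E_def sum_distrib_left sum.distrib[symmetric]
      by (rule sum.cong) (auto simp: wq[OF nj] algebra_simps)
    have s2: "integral {lo i..hi i} ?D = B + integral {lo i..hi i} (\<lambda>y. poly (pderiv p1) y * poly (pderiv q) y)"
      unfolding B_def Henstock_Kurzweil_Integration.integral_add[OF int int, symmetric]
      by (rule Henstock_Kurzweil_Integration.integral_cong) (simp add: pderiv_diff algebra_simps)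
    have ex2': "w0 * (\<Sum>j=0..r. \<omega> j * poly (pderiv (pderiv R)) (node i j)) = w0 * poly (pderiv R) (hi i) - w0 * poly (pderiv R) (lo i)"
      unfolding ex2 by (rule right_diff_distrib)
    show ?thesis unfolding s1 s2 using ex1 ex2' wq[OF le(1)] wq[OF le(2)] ql
      by (simp add: C_def F_def algebra_simps)
  qed
  have HH: "H * H ^ (r - 1) = H ^ r" using r by (cases r) auto
  have n2: "(pderiv ^^ 2) u = pderiv (pderiv u)" "(pderiv ^^ 1) u = pderiv u" for u :: "real poly"
    by (simp_all add: numeral_2_eq_2)
  have bA: "\<bar>A\<bar> \<le> \<kappa> i * H ^ r * \<delta>"
  proof -
    have "\<bar>A\<bar> \<le> H * (\<kappa> i * H ^ (r - 1) * \<delta>)" unfolding A_def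
    proof (rule wsum)
      fix j assume j: "j \<le> r"
      then have "node i j \<in> {lo i..hi i}" using nj by simp
      from P(2)[OF _ this, of 2] q\<delta>[OF this]
      show "\<bar>(g 2 (node i j) - poly (pderiv (pderiv P)) (node i j)) * poly q (node i j)\<bar> \<le> \<kappa> i * H ^ (r - 1) * \<delta>"
        unfolding abs_mult using r \<delta>0 \<kappa>0 H_pos by (intro mult_mono) (auto simp: n2)
    qed
    also have "\<dots> = \<kappa> i * (H * H ^ (r - 1)) * \<delta>" by (simp add: mult_ac)
    finally show ?thesis unfolding HH .
  qed
  have bB: "\<bar>B\<bar> \<le> \<Lambda> * (\<kappa> i * H ^ r) * \<delta>"
  proof -
    let ?u = "piece (Ih (g 0)) i - p1"
    have du: "degree ?u \<le> r" by (rule degree_diff_le) (use p p1 in auto)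
    have nu: "\<bar>poly ?u (node i j)\<bar> \<le> \<kappa> i * H ^ (r + 1)" if "j \<le> r" for j
      using P(2)[OF _ nj, of 0 j] p(3)[OF that] p1(2)[of j] that by simp
    have u': "\<bar>poly (pderiv ?u) y\<bar> \<le> \<Lambda> * (\<kappa> i * H ^ r)" if "y \<in> {lo i..hi i}" for y
      using interp_bound[OF el element_GL[OF i] du nu that] H_pos by (simp add: element_size[OF i])
    have "norm B \<le> integral {lo i..hi i} (\<lambda>y. \<Lambda> * (\<kappa> i * H ^ r) * \<bar>poly (pderiv q) y\<bar>)"
      unfolding B_def
    proof (rule integral_norm_bound_integral[OF int])
      show "(\<lambda>y. \<Lambda> * (\<kappa> i * H ^ r) * \<bar>poly (pderiv q) y\<bar>) integrable_on {lo i..hi i}"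
        by (intro integrable_continuous_real continuous_intros)
      show "norm (poly (pderiv ?u) y * poly (pderiv q) y) \<le> \<Lambda> * (\<kappa> i * H ^ r) * \<bar>poly (pderiv q) y\<bar>" if "y \<in> {lo i..hi i}" for y
        using u'[OF that] by (simp only: real_norm_def abs_mult) (rule mult_right_mono, auto)
    qed
    also have "\<dots> = \<Lambda> * (\<kappa> i * H ^ r) * integral {lo i..hi i} (\<lambda>y. \<bar>poly (pderiv q) y\<bar>)" by simp
    also have "\<dots> \<le> \<Lambda> * (\<kappa> i * H ^ r) * \<delta>"
      using q'\<delta> \<Lambda> \<kappa>0 H_pos by (intro mult_left_mono) auto
    finally show ?thesis by simp
  qed
  have bC: "\<bar>C\<bar> \<le> \<kappa> i * H ^ r * \<delta>"
    unfolding C_def abs_mult using P(2)[OF _ le(2), of 1] q\<delta>[OF le(2)] \<delta>0 \<kappa>0 H_pos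
    by (intro mult_mono) (auto simp: n2)
  have bE: "\<bar>E\<bar> \<le> \<kappa> i * H ^ (r + 1)"
  proof -
    have "\<bar>E\<bar> \<le> H * (\<kappa> i * H ^ r)" unfolding E_def
      by (rule wsum) (use R(2)[OF _ nj, of 2] in \<open>auto simp: n2\<close>)
    then show ?thesis by (simp add: mult_ac)
  qed
  have bF: "\<bar>F\<bar> \<le> 2 * (\<kappa> i * H ^ (r + 1))"
    unfolding F_def using R(2)[OF _ le(1), of 1] R(2)[OF _ le(2), of 1] by (simp add: n2)
  have "\<bar>w0 * (E - F)\<bar> \<le> \<bar>w0\<bar> * (3 * (\<kappa> i * H ^ (r + 1)))"
    unfolding abs_mult using bE bF by (intro mult_left_mono) auto
  then have "\<bar>A + B - C + w0 * (E - F)\<bar> \<le> \<kappa> i * H ^ r * \<delta> + \<Lambda> * (\<kappa> i * H ^ r) * \<delta> + \<kappa> i * H ^ r * \<delta> + \<bar>w0\<bar> * (3 * (\<kappa> i * H ^ (r + 1)))"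
    using bA bB bC by linarith
  also have "\<dots> = (2 + \<Lambda>) * H ^ r * sqrt H * (\<kappa> i * sqrt (energy i w)) + 3 * H ^ (r + 1) * (\<kappa> i * \<bar>w (lo i)\<bar>)"
    by (simp add: \<delta>_def w0_def algebra_simps)
  finally show ?thesis unfolding split[symmetric] q' .
qed

text \<open>The boundary terms of the elements telescope to the two ends of the interval, where the
  Neumann condition removes them.\<close>

lemma truncation:
  assumes w: "w \<in> S" and N: "g 1 a = 0" "g 1 b = 0"
  shows "\<bar>ip (g 2) w + gr (Ih (g 0)) w\<bar> \<le> (2 + \<Lambda> + 3 / sqrt c) * L2_norm a b k * H ^ (r + 1) * (nh w + ng w)"
proof -
  let ?G = "\<lambda>y. g 1 y * w y"
  let ?l = "\<lambda>i. (\<Sum>j=0..r. \<omega> j * g 2 (node i j) * w (node i j))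
      + integral {lo i..hi i} (\<lambda>y. poly (pderiv (piece (Ih (g 0)) i)) y * poly (pderiv (piece w i)) y)
      - (?G (hi i) - ?G (lo i))"
  have tel: "(\<Sum>i=1..n. ?G (hi i) - ?G (lo i)) = ?G (hi n) - ?G (lo 1)" if "n \<ge> 1" for n
    using that
  proof (induction n rule: nat_induct_at_least)
    case (Suc n)
    then show ?case using element_chain(3)[of n] by simp
  qed simp
  have "(\<Sum>i=1..M. ?G (hi i) - ?G (lo i)) = 0" using tel[OF M] N element_chain(1,2) by simp
  then have eq: "ip (g 2) w + gr (Ih (g 0)) w = (\<Sum>i=1..M. ?l i)"
    unfolding gr_eq[OF interp(1) w] ip_eq by (simp only: sum_subtractf sum.distrib)
  have "\<bar>\<Sum>i=1..M. ?l i\<bar> \<le> (\<Sum>i=1..M. (2 + \<Lambda>) * H ^ r * sqrt H * (\<kappa> i * sqrt (energy i w)) + 3 * H ^ (r + 1) * (\<kappa> i * \<bar>w (lo i)\<bar>))"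
    by (rule order_trans[OF sum_abs sum_mono]) (rule truncation_element[OF w])
  also have "\<dots> = (2 + \<Lambda>) * H ^ r * sqrt H * (\<Sum>i=1..M. \<kappa> i * sqrt (energy i w)) + 3 * H ^ (r + 1) * (\<Sum>i=1..M. \<kappa> i * \<bar>w (lo i)\<bar>)"
    by (simp add: sum.distrib sum_distrib_left)
  also have "\<dots> \<le> (2 + \<Lambda>) * H ^ r * sqrt H * (sqrt H * L2_norm a b k * ng w) + 3 * H ^ (r + 1) * (sqrt H * L2_norm a b k * (nh w / sqrt (c * H)))"
  proof (intro add_mono mult_left_mono)
    show "(\<Sum>i=1..M. \<kappa> i * sqrt (energy i w)) \<le> sqrt H * L2_norm a b k * ng w"
      by (rule sum_mult_le_sqrt[OF _ _ kappa_sum])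
        (use kappa_nonneg energy_nonneg energy_sum[OF w] H_pos L2_norm_nonneg ng_nonneg in auto)
    \<comment> \<open>Values at element ends cost a factor \<open>1 / sqrt (c * H)\<close> against
      the discrete norm; the \<open>sqrt H\<close> from \<open>kappa_sum\<close> compensates for
      it.\<close>
    show "(\<Sum>i=1..M. \<kappa> i * \<bar>w (lo i)\<bar>) \<le> sqrt H * L2_norm a b k * (nh w / sqrt (c * H))"
    proof (rule sum_mult_le_sqrt[OF _ _ kappa_sum])
      have "c * H * (\<Sum>i=1..M. \<bar>w (lo i)\<bar>\<^sup>2) \<le> ip w w"
        unfolding ip_eq sum_distrib_left
      proof (rule sum_mono)
        fix i assume i: "i \<in> {1..M}"
        have "c * H * \<bar>w (lo i)\<bar>\<^sup>2 \<le> \<omega> 0 * w (node i 0) * w (node i 0)"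
          using mult_right_mono[OF weight(1)[of 0], of "(w (lo i))\<^sup>2"] node_ends(1)[OF i] by (simp add: power2_eq_square mult.assoc)
        also have "\<dots> \<le> (\<Sum>j=0..r. \<omega> j * w (node i j) * w (node i j))"
          by (rule member_le_sum[where f="\<lambda>j. \<omega> j * w (node i j) * w (node i j)"])
            (use weight(2) in \<open>auto simp: mult.assoc less_imp_le\<close>)
        finally show "c * H * \<bar>w (lo i)\<bar>\<^sup>2 \<le> (\<Sum>j=0..r. \<omega> j * w (node i j) * w (node i j))" .
      qed
      then show "(\<Sum>i=1..M. \<bar>w (lo i)\<bar>\<^sup>2) \<le> (nh w / sqrt (c * H))\<^sup>2"
        using c H_pos by (simp add: power_divide nh_power2 field_simps)
    qed (use kappa_nonneg H_pos c L2_norm_nonneg nh_nonneg in auto)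
  qed (use \<Lambda> H_pos in auto)
  also have "\<dots> = L2_norm a b k * H ^ (r + 1) * ((2 + \<Lambda>) * ng w + 3 / sqrt c * nh w)"
  proof -
    have sq: "sqrt H * (sqrt H * z) = H * z" for z using H_pos by simp
    have "sqrt H * z / (sqrt c * sqrt H) = z / sqrt c" for z using H_pos by simp
    then have "sqrt H * L2_norm a b k * (nh w / sqrt (c * H)) = L2_norm a b k * nh w / sqrt c"
      by (simp add: real_sqrt_mult mult.assoc)
    then show ?thesis using sq by (simp only:) (simp add: sq algebra_simps)
  qed
  also have "\<dots> \<le> L2_norm a b k * H ^ (r + 1) * ((2 + \<Lambda> + 3 / sqrt c) * (nh w + ng w))"
  proof (intro mult_left_mono)
    have "0 \<le> (2 + \<Lambda>) * nh w" "0 \<le> 3 / sqrt c * ng w" using \<Lambda> c nh_nonneg ng_nonneg by auto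
    then show "(2 + \<Lambda>) * ng w + 3 / sqrt c * nh w \<le> (2 + \<Lambda> + 3 / sqrt c) * (nh w + ng w)"
      by (simp add: algebra_simps)
  qed (use H_pos L2_norm_nonneg in auto)
  finally show ?thesis unfolding eq by (simp add: mult_ac)
qed

end

section \<open>Consistency in time\<close>

lemma poly_coeff_sum:
  fixes p :: "real poly"
  assumes "degree p \<le> n" shows "poly p x = (\<Sum>i\<le>n. coeff p i * x ^ i)"
proof -
  have "(\<Sum>i\<le>n. coeff p i * x ^ i) = (\<Sum>i\<le>degree p. coeff p i * x ^ i)"
    by (rule sum.mono_neutral_right) (use assms in \<open>auto simp: coeff_eq_0\<close>)
  then show ?thesis by (simp add: poly_altdef)
qed

text \<open>One statement for two uses: a row of \<open>A\<close> with \<open>\<theta>\<close> the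
  corresponding quadrature point, and the weights with \<open>\<theta> = 1\<close>. The moment
  conditions integrate monomials up to degree \<open>q - 1\<close>, hence the derivative of
  \<open>P\<close>.\<close>

lemma collocation_exact:
  fixes d cc :: "'m::finite \<Rightarrow> real" and P :: "real poly"
  assumes d: "\<And>l. l \<in> {1..q} \<Longrightarrow> (\<Sum>j\<in>UNIV. d j * cc j ^ (l - 1)) = \<theta> ^ l / real l"
    and P: "degree P \<le> q" and \<tau>: "\<tau> \<noteq> 0"
  shows "poly P (t0 + \<tau> * \<theta>) - poly P t0 = \<tau> * (\<Sum>j\<in>UNIV. d j * poly (pderiv P) (t0 + \<tau> * cc j))"
proof -
  define R where "R = pcompose P [:t0, \<tau>:]"
  have R: "degree R \<le> q" "\<And>s. poly R s = poly P (t0 + \<tau> * s)" "\<And>s. poly (pderiv R) s = \<tau> * poly (pderiv P) (t0 + \<tau> * s)"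
    using P \<tau> by (auto simp: R_def pcompose_affine)
  have "poly R \<theta> - poly R 0 = (\<Sum>j\<in>UNIV. d j * poly (pderiv R) (cc j))"
  proof (cases q)
    case 0
    then have "degree R = 0" using R by simp
    then obtain v where "R = [:v:]" by (rule degree_eq_zeroE)
    then show ?thesis by (simp add: pderiv_pCons)
  next
    case (Suc n)
    have "degree (pderiv R) \<le> n" using R(1) Suc by (simp add: degree_pderiv)
    then have "(\<Sum>j\<in>UNIV. d j * poly (pderiv R) (cc j)) = (\<Sum>j\<in>UNIV. \<Sum>l\<le>n. coeff (pderiv R) l * (d j * cc j ^ l))"
      by (simp add: poly_coeff_sum[of "pderiv R" n] sum_distrib_left mult_ac)
    also have "\<dots> = (\<Sum>l\<le>n. coeff (pderiv R) l * (\<Sum>j\<in>UNIV. d j * cc j ^ l))"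
      by (subst sum.swap) (simp add: sum_distrib_left)
    also have "\<dots> = (\<Sum>l\<le>n. coeff R (Suc l) * \<theta> ^ Suc l)"
    proof (rule sum.cong[OF refl])
      fix l assume "l \<in> {..n}"
      then have "(\<Sum>j\<in>UNIV. d j * cc j ^ l) = \<theta> ^ Suc l / real (Suc l)" using d[of "Suc l"] Suc by simp
      then show "coeff (pderiv R) l * (\<Sum>j\<in>UNIV. d j * cc j ^ l) = coeff R (Suc l) * \<theta> ^ Suc l"
        by (simp add: coeff_pderiv del: of_nat_Suc)
    qed
    also have "\<dots> = poly R \<theta> - poly R 0"
      using R(1) Suc by (simp add: poly_coeff_sum[of R "Suc n"] sum.atMost_Suc_shift del: sum.atMost_Suc)
    finally show ?thesis by simp
  qed
  then show ?thesis by (simp add: R sum_distrib_left mult_ac)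
qed

lemma derivative_chain_taylor:
  fixes g :: "nat \<Rightarrow> real \<Rightarrow> real"
  assumes "lo < hi"
    and der: "\<And>n t. n \<le> q \<Longrightarrow> t \<in> {lo..hi} \<Longrightarrow> (g n has_real_derivative g (Suc n) t) (at t within {lo..hi})"
    and bnd: "\<And>t. t \<in> {lo..hi} \<Longrightarrow> \<bar>g (Suc q) t\<bar> \<le> G"
  obtains P where "degree P \<le> q"
    "\<And>n t. n \<le> q \<Longrightarrow> t \<in> {lo..hi} \<Longrightarrow> \<bar>g n t - poly ((pderiv ^^ n) P) t\<bar> \<le> G * (hi - lo) * (hi - lo) ^ (q - n)"
proof -
  have G: "0 \<le> G" using bnd[of lo] assms(1) by auto
  have "\<exists>P. degree P \<le> q \<and> (\<forall>n\<le>q. \<forall>t\<in>{lo..hi}. \<bar>g n t - poly ((pderiv ^^ n) P) t\<bar> \<le> (G * (hi - lo)) * (hi - lo) ^ (q - n))"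
  proof (rule taylor_poly)
    show "(g (Suc n) has_integral g n x - g n lo) {lo..x}" if "n < q" "x \<in> {lo..hi}" for n x
    proof (rule fundamental_theorem_of_calculus)
      show "(g n has_vector_derivative g (Suc n) t) (at t within {lo..x})" if t: "t \<in> {lo..x}" for t
        unfolding has_real_derivative_iff_has_vector_derivative[symmetric]
        by (rule DERIV_subset[OF der]) (use t \<open>x \<in> {lo..hi}\<close> \<open>n < q\<close> in auto)
    qed (use that in simp)
    show "\<bar>g q x - g q lo\<bar> \<le> G * (hi - lo)" if x: "x \<in> {lo..hi}" for x
    proof -
      have "norm (g q x - g q lo) \<le> G * norm (x - lo)"
        by (rule field_differentiable_bound[where S="{lo..hi}" and f'="g (Suc q)"])
          (use der bnd x in auto)
      also have "\<dots> \<le> G * (hi - lo)" using x G by (intro mult_left_mono) auto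
      finally show ?thesis by simp
    qed
  qed (use assms in simp)
  then show ?thesis using that by blast
qed

text \<open>The formula is exact for a Taylor polynomial, so only approximation errors remain: the 2
  counts those of the two values, the sum those of the derivatives.\<close>

lemma rk_defect:
  fixes d cc :: "'m::finite \<Rightarrow> real" and g :: "nat \<Rightarrow> real \<Rightarrow> real"
  assumes d: "\<And>l. l \<in> {1..q} \<Longrightarrow> (\<Sum>j\<in>UNIV. d j * cc j ^ (l - 1)) = \<theta> ^ l / real l"
    and cc: "\<And>j. cc j \<in> {0..1}" and \<theta>: "\<theta> \<in> {0..1}" and \<tau>: "\<tau> > 0"
    and der: "\<And>n t. n \<le> q \<Longrightarrow> t \<in> {t0..t0 + \<tau>} \<Longrightarrow> (g n has_real_derivative g (Suc n) t) (at t within {t0..t0 + \<tau>})"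
    and bnd: "\<And>t. t \<in> {t0..t0 + \<tau>} \<Longrightarrow> \<bar>g (Suc q) t\<bar> \<le> G"
  shows "\<bar>g 0 (t0 + \<tau> * \<theta>) - g 0 t0 - \<tau> * (\<Sum>j\<in>UNIV. d j * g 1 (t0 + \<tau> * cc j))\<bar> \<le> G * \<tau> ^ (q + 1) * (2 + (\<Sum>j\<in>UNIV. \<bar>d j\<bar>))"
proof -
  have G: "0 \<le> G" using bnd[of t0] \<tau> by auto
  obtain P where P: "degree P \<le> q"
    "\<And>n t. n \<le> q \<Longrightarrow> t \<in> {t0..t0 + \<tau>} \<Longrightarrow> \<bar>g n t - poly ((pderiv ^^ n) P) t\<bar> \<le> G * \<tau> * \<tau> ^ (q - n)"
    using derivative_chain_taylor[of t0 "t0 + \<tau>" q g G] der bnd \<tau> by auto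
  have in1: "t0 + \<tau> * s \<in> {t0..t0 + \<tau>}" if "s \<in> {0..1}" for s
    using that \<tau> mult_left_mono[of s 1 \<tau>] by auto
  have t0: "t0 \<in> {t0..t0 + \<tau>}" using \<tau> by simp
  have e0: "\<bar>g 0 t - poly P t\<bar> \<le> G * \<tau> ^ (q + 1)" if "t \<in> {t0..t0 + \<tau>}" for t
    using P(2)[of 0 t] that by (simp add: mult_ac)
  have e1: "\<bar>\<tau> * (g 1 t - poly (pderiv P) t)\<bar> \<le> G * \<tau> ^ (q + 1)" if t: "t \<in> {t0..t0 + \<tau>}" for t
  \<comment> \<open>For \<open>q = 0\<close> the Taylor estimate says nothing about derivatives, but
    \<open>P\<close> is constant and \<open>g 1\<close> is itself the function bounded by
    \<open>G\<close>.\<close>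
  proof (cases q)
    case 0
    then have "degree P = 0" using P by simp
    then have "pderiv P = 0" by (simp add: pderiv_eq_0_iff)
    then show ?thesis using bnd[OF t] 0 \<tau> by (simp add: abs_mult mult.commute)
  next
    case (Suc n)
    have "\<bar>g 1 t - poly (pderiv P) t\<bar> \<le> G * \<tau> * \<tau> ^ n" using P(2)[of 1 t] t Suc by simp
    then have "\<tau> * \<bar>g 1 t - poly (pderiv P) t\<bar> \<le> \<tau> * (G * \<tau> * \<tau> ^ n)" using \<tau> by (intro mult_left_mono) auto
    then show ?thesis using \<tau> Suc by (simp add: abs_mult mult_ac)
  qed
  note ex = collocation_exact[OF d P(1), of \<tau> t0]
  have "g 0 (t0 + \<tau> * \<theta>) - g 0 t0 - \<tau> * (\<Sum>j\<in>UNIV. d j * g 1 (t0 + \<tau> * cc j)) =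
    (g 0 (t0 + \<tau> * \<theta>) - poly P (t0 + \<tau> * \<theta>)) - (g 0 t0 - poly P t0)
     - (\<Sum>j\<in>UNIV. d j * (\<tau> * (g 1 (t0 + \<tau> * cc j) - poly (pderiv P) (t0 + \<tau> * cc j))))"
    using ex \<tau> by (simp add: sum_distrib_left sum_subtractf algebra_simps)
  moreover have "\<bar>\<Sum>j\<in>UNIV. d j * (\<tau> * (g 1 (t0 + \<tau> * cc j) - poly (pderiv P) (t0 + \<tau> * cc j)))\<bar> \<le> (\<Sum>j\<in>UNIV. \<bar>d j\<bar> * (G * \<tau> ^ (q + 1)))"
    by (rule order_trans[OF sum_abs sum_mono])
      (simp only: abs_mult[of "d _"], rule mult_left_mono[OF e1[OF in1[OF cc]] abs_ge_zero])
  ultimately have "\<bar>g 0 (t0 + \<tau> * \<theta>) - g 0 t0 - \<tau> * (\<Sum>j\<in>UNIV. d j * g 1 (t0 + \<tau> * cc j))\<bar>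
     \<le> G * \<tau> ^ (q + 1) + G * \<tau> ^ (q + 1) + (\<Sum>j\<in>UNIV. \<bar>d j\<bar> * (G * \<tau> ^ (q + 1)))"
    using e0[OF in1[OF \<theta>]] e0[OF t0] by linarith
  also have "\<dots> = G * \<tau> ^ (q + 1) * (2 + (\<Sum>j\<in>UNIV. \<bar>d j\<bar>))"
    by (simp add: sum_distrib_left algebra_simps)
  finally show ?thesis .
qed

text \<open>Every factor is at most \<open>k\<close>: distances to the nodes are at most
  \<open>k * \<tau>\<close>, and distinct nodes are at least \<open>\<tau>\<close> apart.\<close>

lemma lagrange_basis_bound:
  assumes \<tau>: "\<tau> > 0" and k: "1 \<le> k" "k \<le> n" and l: "l \<in> {1..k}"
    and s: "real (n - k) * \<tau> \<le> s" "s \<le> real n * \<tau>"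
  shows "\<bar>lagrange_basis k \<tau> n l s\<bar> \<le> real k ^ k"
proof -
  have "\<bar>lagrange_basis k \<tau> n l s\<bar> = (\<Prod>i\<in>{1..k} - {l}. \<bar>(s - real (n - i) * \<tau>) / (real (n - l) * \<tau> - real (n - i) * \<tau>)\<bar>)"
    by (simp only: lagrange_basis_def abs_prod)
  also have "\<dots> \<le> (\<Prod>i\<in>{1..k} - {l}. real k)"
  proof (rule prod_mono, intro conjI)
    fix i assume i: "i \<in> {1..k} - {l}"
    have le: "real (n - k) \<le> real (n - i)" "real (n - i) \<le> real n" and nk: "real n = real (n - k) + real k"
      using i k by (auto simp: of_nat_diff)
    have "real (n - k) * \<tau> \<le> real (n - i) * \<tau>" "real (n - i) * \<tau> \<le> real n * \<tau>"
      using mult_right_mono[OF le(1), of \<tau>] mult_right_mono[OF le(2), of \<tau>] \<tau> by simp_all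
    moreover have "real n * \<tau> = real (n - k) * \<tau> + real k * \<tau>"
      unfolding nk by (rule distrib_right)
    ultimately have num: "\<bar>s - real (n - i) * \<tau>\<bar> \<le> real k * \<tau>" using s by (auto simp: abs_le_iff)
    have "real (n - l) - real (n - i) = real i - real l" using i k l by (auto simp: of_nat_diff)
    then have "\<bar>real (n - l) - real (n - i)\<bar> \<ge> 1" using i by auto
    then have "\<bar>real (n - l) - real (n - i)\<bar> * \<tau> \<ge> 1 * \<tau>" using \<tau> by (intro mult_right_mono) auto
    then have den: "\<bar>real (n - l) * \<tau> - real (n - i) * \<tau>\<bar> \<ge> \<tau>"
      using \<tau> by (simp add: left_diff_distrib[symmetric] abs_mult)
    have "\<bar>s - real (n - i) * \<tau>\<bar> / \<bar>real (n - l) * \<tau> - real (n - i) * \<tau>\<bar> \<le> (real k * \<tau>) / \<tau>"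
      using num den \<tau> by (intro frac_le) auto
    then show "\<bar>(s - real (n - i) * \<tau>) / (real (n - l) * \<tau> - real (n - i) * \<tau>)\<bar> \<le> real k"
      using \<tau> by (simp add: abs_divide)
  qed simp
  also have "\<dots> = real k ^ card ({1..k} - {l})" by simp
  also have "\<dots> \<le> real k ^ k"
    using k l by (intro power_increasing) auto
  finally show ?thesis .
qed

text \<open>The nodes end one step before \<open>real n * \<tau>\<close>, so on the last step this
  is extrapolation, as required at the stage times. The Lagrange formula reproduces a Taylor
  polynomial, and \<open>real k * real k ^ k\<close> bounds the sum of the absolute basis
  values.\<close>

lemma lagrange_extrapolation:
  fixes g :: "nat \<Rightarrow> real \<Rightarrow> real"
  assumes \<tau>: "\<tau> > 0" and k: "1 \<le> k" "k \<le> n"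
    and s: "real (n - k) * \<tau> \<le> s" "s \<le> real n * \<tau>"
    and der: "\<And>m t. m < k \<Longrightarrow> t \<in> {real (n - k) * \<tau>..real n * \<tau>} \<Longrightarrow>
       (g m has_real_derivative g (Suc m) t) (at t within {real (n - k) * \<tau>..real n * \<tau>})"
    and bnd: "\<And>t. t \<in> {real (n - k) * \<tau>..real n * \<tau>} \<Longrightarrow> \<bar>g k t\<bar> \<le> G"
  shows "\<bar>g 0 s - (\<Sum>l=1..k. lagrange_basis k \<tau> n l s * g 0 (real (n - l) * \<tau>))\<bar> \<le> G * (real k * \<tau>) ^ k * (1 + real k * real k ^ k)"
proof -
  let ?lo = "real (n - k) * \<tau>" and ?hi = "real n * \<tau>"
  have H: "?hi - ?lo = real k * \<tau>" using k by (simp add: of_nat_diff algebra_simps)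
  have lohi: "?lo < ?hi" using H k \<tau> by (smt (verit) mult_pos_pos of_nat_0_less_iff zero_less_one less_le_trans)
  obtain q where q: "k = Suc q" using k by (cases k) auto
  obtain P where P: "degree P \<le> q" "\<And>m t. m \<le> q \<Longrightarrow> t \<in> {?lo..?hi} \<Longrightarrow> \<bar>g m t - poly ((pderiv ^^ m) P) t\<bar> \<le> G * (?hi - ?lo) * (?hi - ?lo) ^ (q - m)"
    by (rule derivative_chain_taylor[OF lohi, of q g G]) (use der bnd q in auto)
  have e: "\<bar>g 0 t - poly P t\<bar> \<le> G * (real k * \<tau>) ^ k" if "t \<in> {?lo..?hi}" for t
    using P(2)[of 0 t] that unfolding H by (simp add: q mult_ac)
  let ?L = "\<lambda>l. lagrange_basis k \<tau> n l s"
  have node: "real (n - l) * \<tau> \<in> {?lo..?hi}" if "l \<in> {1..k}" for l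
    using that k \<tau> by (auto intro!: mult_right_mono)
  have inj: "inj_on (\<lambda>i. real (n - i) * \<tau>) {1..k}"
    using \<tau> k by (auto simp: inj_on_def)
  have Peq: "P = (\<Sum>j\<in>{1..k}. smult (poly P (real (n - j) * \<tau>)) (lagrange_poly {1..k} (\<lambda>i. real (n - i) * \<tau>) j))"
    by (rule lagrange_reproduction[OF _ inj]) (use P q in auto)
  have "poly P s = (\<Sum>l=1..k. poly P (real (n - l) * \<tau>) * ?L l)"
    by (rule trans[OF arg_cong[OF Peq, of "\<lambda>p. poly p s"]])
      (simp add: poly_sum poly_lagrange_poly lagrange_basis_def)
  then have "g 0 s - (\<Sum>l=1..k. ?L l * g 0 (real (n - l) * \<tau>)) =
     (g 0 s - poly P s) - (\<Sum>l=1..k. ?L l * (g 0 (real (n - l) * \<tau>) - poly P (real (n - l) * \<tau>)))"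
    by (simp add: sum_subtractf algebra_simps)
  moreover have "\<bar>\<Sum>l=1..k. ?L l * (g 0 (real (n - l) * \<tau>) - poly P (real (n - l) * \<tau>))\<bar> \<le> (\<Sum>l=1..k. real k ^ k * (G * (real k * \<tau>) ^ k))"
  proof (rule order_trans[OF sum_abs sum_mono])
    fix l assume l: "l \<in> {1..k}"
    show "\<bar>?L l * (g 0 (real (n - l) * \<tau>) - poly P (real (n - l) * \<tau>))\<bar> \<le> real k ^ k * (G * (real k * \<tau>) ^ k)"
      unfolding abs_mult using lagrange_basis_bound[OF \<tau> k l s] e[OF node[OF l]] by (intro mult_mono) auto
  qed
  ultimately have "\<bar>g 0 s - (\<Sum>l=1..k. ?L l * g 0 (real (n - l) * \<tau>))\<bar> \<le> G * (real k * \<tau>) ^ k + (\<Sum>l=1..k. real k ^ k * (G * (real k * \<tau>) ^ k))"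
    using e[of s] s by simp
  also have "\<dots> = G * (real k * \<tau>) ^ k * (1 + real k * real k ^ k)"
    by (simp add: algebra_simps)
  finally show ?thesis .
qed

section \<open>Stability of the cut-off scheme\<close>

text \<open>The Burrage--Butcher computation in scalar form, to be applied at each node. Expanding
  the square leaves \<open>\<tau> * \<tau> * (s * s)\<close>, and semidefiniteness of the stability
  matrix says exactly that \<open>s * s <= 2 * X\<close>.\<close>

lemma algebraic_stability_step:
  fixes A :: "real^'m^'m" and \<beta> :: "real^'m" and E D \<eta> :: "'m \<Rightarrow> real"
  assumes stab: "algebraically_stable A \<beta>"
    and E: "\<And>i. E i = e + \<tau> * (\<Sum>j\<in>UNIV. A $ i $ j * D j) + \<eta> i"
  shows "(e + \<tau> * (\<Sum>i\<in>UNIV. \<beta> $ i * D i))\<^sup>2 \<le> e\<^sup>2 + 2 * \<tau> * (\<Sum>i\<in>UNIV. \<beta> $ i * (D i * (E i - \<eta> i)))"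
proof -
  define s where "s = (\<Sum>i\<in>UNIV. \<beta> $ i * D i)"
  define X where "X = (\<Sum>i\<in>UNIV. \<Sum>j\<in>UNIV. \<beta> $ i * A $ i $ j * D i * D j)"
  have "0 \<le> (\<chi> i. D i) \<bullet> ((\<chi> i j. \<beta> $ i * A $ i $ j + \<beta> $ j * A $ j $ i - \<beta> $ i * \<beta> $ j) *v (\<chi> i. D i))"
    using stab by (simp add: algebraically_stable_def)
  also have "\<dots> = (\<Sum>i\<in>UNIV. \<Sum>j\<in>UNIV. \<beta> $ i * A $ i $ j * D i * D j + \<beta> $ j * A $ j $ i * D i * D j - (\<beta> $ i * D i) * (\<beta> $ j * D j))"
    by (simp add: inner_vec_def matrix_vector_mult_def sum_distrib_left algebra_simps)
  also have "\<dots> = X + (\<Sum>i\<in>UNIV. \<Sum>j\<in>UNIV. \<beta> $ j * A $ j $ i * D i * D j) - s * s"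
    by (simp add: X_def s_def sum_subtractf sum.distrib sum_product)
  also have "(\<Sum>i\<in>UNIV. \<Sum>j\<in>UNIV. \<beta> $ j * A $ j $ i * D i * D j) = X"
    unfolding X_def by (subst sum.swap) (simp add: mult_ac)
  finally have s2: "s * s \<le> 2 * X" by simp
  have "(\<Sum>i\<in>UNIV. \<beta> $ i * (D i * (E i - \<eta> i))) = (\<Sum>i\<in>UNIV. e * (\<beta> $ i * D i) + \<tau> * (\<Sum>j\<in>UNIV. \<beta> $ i * A $ i $ j * D i * D j))"
    by (rule sum.cong) (simp_all add: E sum_distrib_left algebra_simps)
  also have "\<dots> = e * s + \<tau> * X" by (simp add: s_def X_def sum.distrib sum_distrib_left)
  finally have eq: "(\<Sum>i\<in>UNIV. \<beta> $ i * (D i * (E i - \<eta> i))) = e * s + \<tau> * X" .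
  have "\<tau> * \<tau> * (s * s) \<le> \<tau> * \<tau> * (2 * X)" by (rule mult_left_mono[OF s2]) simp
  then show ?thesis unfolding eq s_def[symmetric] by (simp add: power2_eq_square algebra_simps)
qed

text \<open>Only earlier values occur on the right, so growth by the factor \<open>q\<close> per
  step holds for every \<open>\<tau>\<close>. The term \<open>\<epsilon>\<close> is treated as one
  more summand, whence \<open>k + 1\<close>.\<close>

lemma discrete_gronwall:
  fixes y :: "nat \<Rightarrow> real"
  assumes k: "1 \<le> k" and B: "0 \<le> B" and \<tau>: "0 \<le> \<tau>" and \<epsilon>: "0 \<le> \<epsilon>" and y: "\<And>n. 0 \<le> y n"
    and step: "\<And>n. n \<in> {k..N} \<Longrightarrow> y n \<le> y (n - 1) + B * \<tau> * ((\<Sum>l=1..k. y (n - l)) + \<epsilon>)"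
    and n: "n \<le> N"
  shows "y n \<le> exp (B * real (k + 1) * (\<tau> * real N)) * ((\<Sum>l<k. y l) + \<epsilon>)"
proof -
  define q where "q = 1 + B * real (k + 1) * \<tau>"
  define Y where "Y = (\<Sum>l<k. y l) + \<epsilon>"
  have q: "1 \<le> q" using B \<tau> by (simp add: q_def)
  have Y: "0 \<le> Y" "\<epsilon> \<le> Y" using y \<epsilon> by (auto simp: Y_def sum_nonneg)
  have "n \<le> N \<Longrightarrow> y n \<le> q ^ n * Y" for n
  proof (induction n rule: less_induct)
    case (less n)
    show ?case
    proof (cases "n < k")
      case True
      have "y n \<le> (\<Sum>l<k. y l)" using True y by (intro member_le_sum) auto
      also have "\<dots> \<le> 1 * Y" using \<epsilon> by (simp add: Y_def)
      also have "\<dots> \<le> q ^ n * Y" using q Y by (intro mult_right_mono one_le_power) auto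
      finally show ?thesis .
    next
      case False
      then obtain m where m: "n = Suc m" using k by (cases n) auto
      have prev: "y (n - l) \<le> q ^ m * Y" if l: "l \<in> {1..k}" for l
      proof -
        have "y (n - l) \<le> q ^ (n - l) * Y" using l False less.prems by (intro less.IH) auto
        also have "\<dots> \<le> q ^ m * Y" using q Y l m by (intro mult_right_mono power_increasing) auto
        finally show ?thesis .
      qed
      have "\<epsilon> \<le> q ^ m * Y" using Y q mult_right_mono[of 1 "q ^ m" Y] by (simp add: one_le_power)
      then have "(\<Sum>l=1..k. y (n - l)) + \<epsilon> \<le> (\<Sum>l=1..k. q ^ m * Y) + q ^ m * Y"
        by (intro add_mono sum_mono prev) auto
      also have "\<dots> = real (k + 1) * (q ^ m * Y)" by (simp add: algebra_simps)
      finally have "B * \<tau> * ((\<Sum>l=1..k. y (n - l)) + \<epsilon>) \<le> B * \<tau> * (real (k + 1) * (q ^ m * Y))"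
        using B \<tau> by (intro mult_left_mono) auto
      then have "y n \<le> q ^ m * Y + B * \<tau> * (real (k + 1) * (q ^ m * Y))"
        using step[of n] less.prems False prev[of 1] k by simp
      also have "\<dots> = q ^ n * Y" by (simp add: m q_def algebra_simps)
      finally show ?thesis .
    qed
  qed
  then have "y n \<le> q ^ n * Y" using n by simp
  also have "\<dots> \<le> q ^ N * Y" using q Y n by (intro mult_right_mono power_increasing) auto
  also have "\<dots> \<le> exp (B * real (k + 1) * \<tau>) ^ N * Y"
    using q Y exp_ge_add_one_self[of "B * real (k + 1) * \<tau>"] by (intro mult_right_mono power_mono) (auto simp: q_def)
  also have "exp (B * real (k + 1) * \<tau>) ^ N = exp (B * real (k + 1) * (\<tau> * real N))"
    by (simp add: exp_of_nat_mult[symmetric] mult_ac)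
  finally show ?thesis by (simp add: Y_def)
qed

context lobatto_mesh
begin

lemma nh_triangle: "nh (\<lambda>y. v y + w y) \<le> nh v + nh w"
proof (rule power2_le_imp_le)
  have "(nh (\<lambda>y. v y + w y))\<^sup>2 = ip v v + 2 * ip v w + ip w w"
    unfolding nh_power2 by (simp add: ip_eq sum.distrib sum_distrib_left algebra_simps)
  also have "\<dots> \<le> (nh v)\<^sup>2 + 2 * (nh v * nh w) + (nh w)\<^sup>2"
    using ip_le[of v w] by (simp add: nh_power2)
  also have "\<dots> = (nh v + nh w)\<^sup>2" by (simp add: power2_eq_square algebra_simps)
  finally show "(nh (\<lambda>y. v y + w y))\<^sup>2 \<le> (nh v + nh w)\<^sup>2" .
qed (use nh_nonneg[of v] nh_nonneg[of w] in simp)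

lemma nh_scale: "nh (\<lambda>y. s * v y) = \<bar>s\<bar> * nh v"
proof -
  have "ip (\<lambda>y. s * v y) (\<lambda>y. s * v y) = s\<^sup>2 * ip v v"
    by (simp add: ip_eq sum_distrib_left power2_eq_square mult_ac)
  then show ?thesis by (simp add: nh_def real_sqrt_mult)
qed

lemma nh_diff: "nh (\<lambda>y. v y - w y) \<le> nh v + nh w"
  using nh_triangle[of v "\<lambda>y. - 1 * w y"] nh_scale[of "- 1" w] by simp

lemma nh_sum: "nh (\<lambda>y. \<Sum>i\<in>I. f i y) \<le> (\<Sum>i\<in>I. nh (f i))"
proof (induction I rule: infinite_finite_induct)
  case (insert i I)
  then show ?case using nh_triangle[of "f i" "\<lambda>y. \<Sum>i\<in>I. f i y"] by simp
qed (auto simp: nh_def ip_eq)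

lemma nh_mono: "(\<And>j. j \<le> M * r \<Longrightarrow> \<bar>v (x j)\<bar> \<le> \<bar>w (x j)\<bar>) \<Longrightarrow> nh v \<le> nh w"
  unfolding nh_def by (intro real_sqrt_le_mono ip_mono) (use abs_le_square_iff in \<open>auto simp: power2_eq_square\<close>)

lemma nh_le_sup:
  assumes "\<And>j. j \<le> M * r \<Longrightarrow> \<bar>v (x j)\<bar> \<le> B"
  shows "nh v \<le> B * sqrt (b - a)"
proof -
  have "0 \<le> B" using assms[of 0] by auto
  then have "nh v \<le> nh (\<lambda>y. B * 1)" using assms by (intro nh_mono) auto
  then show ?thesis using \<open>0 \<le> B\<close> unfolding nh_scale by (simp add: nh_def ip_one)
qed

lemma nh_one: "nh (\<lambda>y. 1) = sqrt (b - a)"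
  by (simp add: nh_def ip_one)

lemma ng_const: "ng (\<lambda>y. s) = 0"
  unfolding ng_def by (simp add: gr_const[OF fe_const, simplified])

lemma ng_diff:
  assumes "v \<in> S" "w \<in> S" shows "ng (\<lambda>y. v y - w y) \<le> ng v + ng w"
proof (rule power2_le_imp_le)
  have vw: "(\<lambda>y. 1 * v y + (- 1) * w y) \<in> S" by (rule fe_linear[OF assms])
  have "(ng (\<lambda>y. 1 * v y + (- 1) * w y))\<^sup>2 = gr v v - 2 * gr v w + gr w w"
    unfolding ng_power2 gr_linear[OF assms vw] gr_commute[of v "\<lambda>y. 1 * v y + (- 1) * w y"]
      gr_commute[of w "\<lambda>y. 1 * v y + (- 1) * w y"] gr_linear[OF assms assms(1)] gr_linear[OF assms assms(2)]
    using gr_commute[of w v] by (simp add: algebra_simps)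
  also have "\<dots> \<le> (ng v)\<^sup>2 + 2 * (ng v * ng w) + (ng w)\<^sup>2"
    using gr_le[OF assms] by (simp add: ng_power2)
  also have "\<dots> = (ng v + ng w)\<^sup>2" by (simp add: power2_eq_square algebra_simps)
  finally show "(ng (\<lambda>y. v y - w y))\<^sup>2 \<le> (ng v + ng w)\<^sup>2" by simp
qed (use ng_nonneg[of v] ng_nonneg[of w] in simp)

end

text \<open>The closed form shows that the constant depends only on the length of the interval, the
  final time and the method. \<open>c3\<close> and \<open>sqrt 2 * L\<close> are the factors in
  \<open>stage_bound\<close>, \<open>c4\<close> results from Young's inequality, and the outer layer
  accounts for the defect of the final update.\<close>

definition step_const :: "real \<Rightarrow> real \<Rightarrow> real^'m^'m \<Rightarrow> real^'m \<Rightarrow> real" where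
  "step_const L T A \<beta> =
    (let c3 = sqrt 2 * (1 + T * (\<Sum>i\<in>UNIV. \<Sum>j\<in>UNIV. \<bar>A $ i $ j\<bar>));
         c4 = (sqrt 2 * L + 1)\<^sup>2 + 3 * c3 + 2
     in 1 + (1 + T) * (2 * (\<Sum>i\<in>UNIV. \<beta> $ i) * c4 + 1))"

text \<open>Each of the two products that contain \<open>g\<close> is charged a quarter of the
  gradient term; the remaining half is dropped. In the application \<open>g\<close> is
  \<open>ng (E i)\<close>, \<open>N\<close> is \<open>nh e\<close>, and \<open>K\<close> bounds the
  residual of the stage equation.\<close>

lemma young_stage:
  fixes g K \<delta> N c2 c3 :: real
  assumes "0 \<le> g" "0 \<le> K" "0 \<le> \<delta>" "0 \<le> N" "0 \<le> c2" "0 \<le> c3"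
  shows "- (g\<^sup>2) + g * \<delta> + K * ((c3 * (N + K + \<delta>) + c2 * g + \<delta>) + (g + \<delta>))
    \<le> ((c2 + 1)\<^sup>2 + 3 * c3 + 2) * (K\<^sup>2 + \<delta>\<^sup>2 + N\<^sup>2)"
proof -
  have y: "p * q \<le> p\<^sup>2 + q\<^sup>2" "2 * (p * q) \<le> p\<^sup>2 + q\<^sup>2" for p q :: real
  proof -
    show "2 * (p * q) \<le> p\<^sup>2 + q\<^sup>2" using zero_le_power2[of "p - q"] by (simp add: power2_eq_square algebra_simps)
    moreover have "0 \<le> (p + q)\<^sup>2" by simp
    ultimately show "p * q \<le> p\<^sup>2 + q\<^sup>2" by (simp add: power2_eq_square algebra_simps)
  qed
  have 1: "g * \<delta> \<le> g\<^sup>2 / 4 + \<delta>\<^sup>2" using y(2)[of "g / 2" \<delta>] by (simp add: power_divide)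
  have "K * (m * g) \<le> g\<^sup>2 / 4 + m\<^sup>2 * K\<^sup>2" for m
    using y(2)[of "g / 2" "m * K"] by (simp add: power_divide power_mult_distrib mult_ac)
  from this[of "c2 + 1"] have 2: "K * ((c2 + 1) * g) \<le> g\<^sup>2 / 4 + (c2 + 1)\<^sup>2 * K\<^sup>2" .
  have 3: "K * (c3 * (N + K + \<delta>)) \<le> c3 * (3 * K\<^sup>2 + N\<^sup>2 + \<delta>\<^sup>2)"
  proof -
    have "K * (N + K + \<delta>) \<le> 3 * K\<^sup>2 + N\<^sup>2 + \<delta>\<^sup>2" using y(1)[of K N] y(1)[of K \<delta>]
      by (simp add: distrib_left power2_eq_square)
    then have "c3 * (K * (N + K + \<delta>)) \<le> c3 * (3 * K\<^sup>2 + N\<^sup>2 + \<delta>\<^sup>2)" using assms(6) by (rule mult_left_mono)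
    then show ?thesis by (simp add: mult_ac)
  qed
  have 4: "2 * (K * \<delta>) \<le> K\<^sup>2 + \<delta>\<^sup>2" by (rule y)
  have "- (g\<^sup>2) + g * \<delta> + K * ((c3 * (N + K + \<delta>) + c2 * g + \<delta>) + (g + \<delta>))
     = - (g\<^sup>2) + g * \<delta> + K * ((c2 + 1) * g) + K * (c3 * (N + K + \<delta>)) + 2 * (K * \<delta>)"
    by (simp add: algebra_simps)
  also have "\<dots> \<le> - (g\<^sup>2 / 2) + ((c2 + 1)\<^sup>2 * K\<^sup>2 + c3 * (3 * K\<^sup>2 + N\<^sup>2 + \<delta>\<^sup>2) + (K\<^sup>2 + 2 * \<delta>\<^sup>2))"
    using 1 2 3 4 by linarith
  also have "\<dots> \<le> (c2 + 1)\<^sup>2 * K\<^sup>2 + c3 * (3 * K\<^sup>2 + N\<^sup>2 + \<delta>\<^sup>2) + (K\<^sup>2 + 2 * \<delta>\<^sup>2)" by simp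
  also have "\<dots> \<le> (c2 + 1)\<^sup>2 * (K\<^sup>2 + \<delta>\<^sup>2 + N\<^sup>2) + 3 * c3 * (K\<^sup>2 + \<delta>\<^sup>2 + N\<^sup>2) + 2 * (K\<^sup>2 + \<delta>\<^sup>2 + N\<^sup>2)"
  proof (intro add_mono)
    show "(c2 + 1)\<^sup>2 * K\<^sup>2 \<le> (c2 + 1)\<^sup>2 * (K\<^sup>2 + \<delta>\<^sup>2 + N\<^sup>2)" by (intro mult_left_mono) auto
    have "c3 * (3 * K\<^sup>2 + N\<^sup>2 + \<delta>\<^sup>2) \<le> c3 * (3 * (K\<^sup>2 + \<delta>\<^sup>2 + N\<^sup>2))" using assms(6) by (intro mult_left_mono) auto
    then show "c3 * (3 * K\<^sup>2 + N\<^sup>2 + \<delta>\<^sup>2) \<le> 3 * c3 * (K\<^sup>2 + \<delta>\<^sup>2 + N\<^sup>2)" by (simp add: algebra_simps)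
  qed auto
  finally show ?thesis by (simp add: algebra_simps)
qed

context lobatto_mesh
begin

text \<open>Testing the stage equations with the constant \<open>1\<close> annihilates the gradient term, so the means
  of the stages are controlled directly and Poincare's inequality bounds the stages themselves.\<close>

lemma stage_bound:
  fixes A :: "real^'m^'m" and E D \<eta> :: "'m \<Rightarrow> real \<Rightarrow> real"
  assumes \<tau>: "0 < \<tau>" "\<tau> \<le> T" and K: "0 \<le> K" and \<delta>: "0 \<le> \<delta>"
    and S: "\<And>i. E i \<in> S"
    and E: "\<And>i j. j \<le> M * r \<Longrightarrow> E i (x j) = e (x j) + \<tau> * (\<Sum>l\<in>UNIV. A $ i $ l * D l (x j)) + \<eta> i (x j)"
    and weak: "\<And>i w. w \<in> S \<Longrightarrow> \<bar>ip (D i) w + gr (E i) w\<bar> \<le> K * (nh w + ng w)"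
    and \<eta>: "\<And>i. nh (\<eta> i) \<le> \<delta>"
  shows "nh (E i) \<le> sqrt 2 * (1 + T * (\<Sum>i\<in>UNIV. \<Sum>j\<in>UNIV. \<bar>A $ i $ j\<bar>)) * (nh e + K + \<delta>) + sqrt 2 * (b - a) * ng (E i)"
proof -
  let ?L = "b - a" and ?s = "\<Sum>i\<in>UNIV. \<Sum>j\<in>UNIV. \<bar>A $ i $ j\<bar>"
  have L: "?L > 0" using ab by simp
  have m1: "\<bar>ip v (\<lambda>y. 1)\<bar> \<le> sqrt ?L * nh v" for v
    using ip_le[of v "\<lambda>y. 1"] by (simp add: nh_one mult.commute)
  have D1: "\<bar>ip (D l) (\<lambda>y. 1)\<bar> \<le> sqrt ?L * K" for l
    using weak[OF fe_const[of 1], of l] gr_const[OF S, of l 1] by (simp add: nh_one ng_const mult.commute)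
  have "ip (E i) (\<lambda>y. 1) = ip (\<lambda>y. 1 * (1 * e y + \<tau> * (\<Sum>l\<in>UNIV. A $ i $ l * D l y)) + 1 * \<eta> i y) (\<lambda>y. 1)"
    by (rule ip_cong) (auto simp: E)
  also have "\<dots> = ip e (\<lambda>y. 1) + \<tau> * (\<Sum>l\<in>UNIV. A $ i $ l * ip (D l) (\<lambda>y. 1)) + ip (\<eta> i) (\<lambda>y. 1)"
    unfolding ip_linear ip_sum by simp
  finally have eq: "ip (E i) (\<lambda>y. 1) = ip e (\<lambda>y. 1) + \<tau> * (\<Sum>l\<in>UNIV. A $ i $ l * ip (D l) (\<lambda>y. 1)) + ip (\<eta> i) (\<lambda>y. 1)" .
  have "\<bar>\<Sum>l\<in>UNIV. A $ i $ l * ip (D l) (\<lambda>y. 1)\<bar> \<le> (\<Sum>l\<in>UNIV. \<bar>A $ i $ l\<bar> * (sqrt ?L * K))"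
    by (rule order_trans[OF sum_abs sum_mono]) (simp only: abs_mult, rule mult_left_mono[OF D1 abs_ge_zero])
  also have "\<dots> = (\<Sum>l\<in>UNIV. \<bar>A $ i $ l\<bar>) * (sqrt ?L * K)" by (simp add: sum_distrib_right)
  also have "\<dots> \<le> ?s * (sqrt ?L * K)"
    using K L by (intro mult_right_mono member_le_sum[where f="\<lambda>i. \<Sum>j\<in>UNIV. \<bar>A $ i $ j\<bar>"]) (auto intro: sum_nonneg)
  finally have s: "\<bar>\<Sum>l\<in>UNIV. A $ i $ l * ip (D l) (\<lambda>y. 1)\<bar> \<le> ?s * (sqrt ?L * K)" .
  have s0: "0 \<le> ?s" by (intro sum_nonneg) auto
  have "\<bar>\<tau> * (\<Sum>l\<in>UNIV. A $ i $ l * ip (D l) (\<lambda>y. 1))\<bar> \<le> T * (?s * (sqrt ?L * K))"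
    unfolding abs_mult using \<tau> s by (intro mult_mono) auto
  moreover have "\<bar>ip (\<eta> i) (\<lambda>y. 1)\<bar> \<le> sqrt ?L * \<delta>"
    using m1[of "\<eta> i"] \<eta>[of i] L by (meson less_imp_le mult_left_mono order_trans real_sqrt_ge_zero)
  ultimately have "\<bar>ip (E i) (\<lambda>y. 1)\<bar> \<le> sqrt ?L * nh e + T * (?s * (sqrt ?L * K)) + sqrt ?L * \<delta>"
    unfolding eq using m1[of e] by linarith
  also have "\<dots> \<le> sqrt ?L * ((1 + T * ?s) * (nh e + K + \<delta>))"
  proof -
    have "0 \<le> T * ?s * (nh e + \<delta>)" "0 \<le> K" using \<tau> s0 nh_nonneg[of e] \<delta> K by auto
    then have "nh e + T * ?s * K + \<delta> \<le> (1 + T * ?s) * (nh e + K + \<delta>)" by (simp add: algebra_simps)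
    then have "sqrt ?L * (nh e + T * ?s * K + \<delta>) \<le> sqrt ?L * ((1 + T * ?s) * (nh e + K + \<delta>))"
      using L by (intro mult_left_mono) auto
    then show ?thesis by (simp add: algebra_simps)
  qed
  finally have "sqrt (2 / ?L) * \<bar>ip (E i) (\<lambda>y. 1)\<bar> \<le> sqrt (2 / ?L) * (sqrt ?L * ((1 + T * ?s) * (nh e + K + \<delta>)))"
    using L by (intro mult_left_mono) auto
  also have "\<dots> = sqrt 2 * (1 + T * ?s) * (nh e + K + \<delta>)"
    using L by (simp add: real_sqrt_divide)
  finally show ?thesis using poincare[OF S[of i]] by linarith
qed

text \<open>No space is prescribed for \<open>D i\<close>, because the exact time derivative is not
  a finite element function. It is seen only at the nodes and, tested with
  \<open>E i - \<eta> i\<close>, through the residual bound \<open>weak\<close>.\<close>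

lemma energy_step:
  fixes A :: "real^'m^'m" and \<beta> :: "real^'m" and E D \<eta> :: "'m \<Rightarrow> real \<Rightarrow> real"
  assumes stab: "algebraically_stable A \<beta>" and \<tau>: "0 < \<tau>" "\<tau> \<le> T" and K: "0 \<le> K" and \<delta>: "0 \<le> \<delta>"
    and S: "\<And>i. E i \<in> S" "\<And>i. \<eta> i \<in> S"
    and E: "\<And>i j. j \<le> M * r \<Longrightarrow> E i (x j) = e (x j) + \<tau> * (\<Sum>l\<in>UNIV. A $ i $ l * D l (x j)) + \<eta> i (x j)"
    and z: "\<And>j. j \<le> M * r \<Longrightarrow> z (x j) = e (x j) + \<tau> * (\<Sum>i\<in>UNIV. \<beta> $ i * D i (x j)) + \<eta>' (x j)"
    and weak: "\<And>i w. w \<in> S \<Longrightarrow> \<bar>ip (D i) w + gr (E i) w\<bar> \<le> K * (nh w + ng w)"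
    and \<eta>: "\<And>i. nh (\<eta> i) \<le> \<delta>" "\<And>i. ng (\<eta> i) \<le> \<delta>" and \<eta>': "nh \<eta>' \<le> \<tau> * \<delta>"
  shows "(nh z)\<^sup>2 \<le> (nh e)\<^sup>2 + step_const (b - a) T A \<beta> * \<tau> * (K\<^sup>2 + \<delta>\<^sup>2 + (nh e)\<^sup>2)"
proof -
  let ?L = "b - a" and ?s = "\<Sum>i\<in>UNIV. \<Sum>j\<in>UNIV. \<bar>A $ i $ j\<bar>"
  have L: "?L > 0" using ab by simp
  define c3 where "c3 = sqrt 2 * (1 + T * ?s)"
  define c2 where "c2 = sqrt 2 * ?L"
  define c4 where "c4 = (c2 + 1)\<^sup>2 + 3 * c3 + 2"
  have s0: "0 \<le> ?s" by (intro sum_nonneg) auto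
  have T: "0 < T" using \<tau> by simp
  have c: "0 \<le> c3" "0 \<le> c2" using T s0 L by (auto simp: c3_def c2_def)
  then have c4: "0 \<le> c4" by (simp add: c4_def)
  let ?Q = "K\<^sup>2 + \<delta>\<^sup>2 + (nh e)\<^sup>2"
  have stage: "ip (D i) (\<lambda>y. E i y - \<eta> i y) \<le> c4 * ?Q" for i
  proof -
    have wS: "(\<lambda>y. E i y - \<eta> i y) \<in> S" using fe_linear[OF S(1)[of i] S(2)[of i], of 1 "-1"] by simp
    let ?w = "\<lambda>y. E i y - \<eta> i y"
    let ?g = "ng (E i)"
    have "gr (E i) ?w = gr (\<lambda>y. 1 * E i y + (- 1) * \<eta> i y) (E i)" by (subst gr_commute) simp
    also have "\<dots> = gr (E i) (E i) - gr (\<eta> i) (E i)" by (subst gr_linear[OF S(1) S(2) S(1)]) simp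
    \<comment> \<open>The stage defect spoils coercivity by at most
      \<open>ng (E i) * \<delta>\<close>; this is why it must be small in the gradient norm
      too.\<close>
    finally have "gr (E i) ?w \<ge> ?g\<^sup>2 - ?g * \<delta>"
      using gr_le[OF S(2) S(1), of i i] mult_right_mono[OF \<eta>(2)[of i] ng_nonneg[of "E i"]] by (simp add: ng_power2 mult.commute)
    moreover have "ip (D i) ?w + gr (E i) ?w \<le> K * (nh ?w + ng ?w)" using weak[OF wS, of i] by simp
    moreover have "K * (nh ?w + ng ?w) \<le> K * ((c3 * (nh e + K + \<delta>) + c2 * ?g + \<delta>) + (?g + \<delta>))"
    proof (intro mult_left_mono add_mono)
      have "nh (E i) \<le> c3 * (nh e + K + \<delta>) + c2 * ?g"
        unfolding c3_def c2_def by (rule stage_bound[OF \<tau> K \<delta> S(1) E weak \<eta>(1)])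
      then show "nh ?w \<le> c3 * (nh e + K + \<delta>) + c2 * ?g + \<delta>"
        using nh_diff[of "E i" "\<eta> i"] \<eta>(1)[of i] by linarith
      show "ng ?w \<le> ?g + \<delta>" using ng_diff[OF S(1) S(2), of i i] \<eta>(2)[of i] by linarith
    qed (rule K)
    ultimately have "ip (D i) ?w \<le> - (?g\<^sup>2) + ?g * \<delta> + K * ((c3 * (nh e + K + \<delta>) + c2 * ?g + \<delta>) + (?g + \<delta>))"
      by linarith
    also have "\<dots> \<le> c4 * ?Q"
      unfolding c4_def by (rule young_stage) (use ng_nonneg nh_nonneg K \<delta> c in auto)
    finally show ?thesis .
  qed
  define v where "v y = e y + \<tau> * (\<Sum>i\<in>UNIV. \<beta> $ i * D i y)" for y
  \<comment> \<open>The nodal inequality is summed with the positive weights by testing a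
    combination of nodal products with the constant 1.\<close>
  have "ip v v \<le> ip (\<lambda>y. 1 * (e y * e y) + (2 * \<tau>) * (\<Sum>i\<in>UNIV. \<beta> $ i * (D i y * (E i y - \<eta> i y)))) (\<lambda>y. 1)"
  proof (rule ip_mono)
    fix j assume j: "j \<le> M * r"
    show "v (x j) * v (x j) \<le> (1 * (e (x j) * e (x j)) + (2 * \<tau>) * (\<Sum>i\<in>UNIV. \<beta> $ i * (D i (x j) * (E i (x j) - \<eta> i (x j))))) * 1"
      using algebraic_stability_step[OF stab E[OF j]] by (simp add: v_def power2_eq_square)
  qed
  also have "\<dots> = ip e e + (2 * \<tau>) * (\<Sum>i\<in>UNIV. \<beta> $ i * ip (D i) (\<lambda>y. E i y - \<eta> i y))"
  proof -
    have p: "ip (\<lambda>y. p y * q y) (\<lambda>y. 1) = ip p q" for p q by (simp add: ip_eq mult.assoc)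
    show ?thesis unfolding ip_linear ip_sum p by simp
  qed
  also have "\<dots> \<le> ip e e + (2 * \<tau>) * (\<Sum>i\<in>UNIV. \<beta> $ i * (c4 * ?Q))"
    using \<tau> stab stage by (intro add_left_mono mult_left_mono sum_mono) (auto simp: algebraically_stable_def less_imp_le)
  also have "\<dots> = (nh e)\<^sup>2 + \<tau> * (2 * (\<Sum>i\<in>UNIV. \<beta> $ i) * c4 * ?Q)"
    by (simp add: nh_power2 sum_distrib_left sum_distrib_right mult_ac)
  finally have v: "(nh v)\<^sup>2 \<le> (nh e)\<^sup>2 + \<tau> * (2 * (\<Sum>i\<in>UNIV. \<beta> $ i) * c4 * ?Q)" by (simp add: nh_power2)
  define c5 where "c5 = 2 * (\<Sum>i\<in>UNIV. \<beta> $ i) * c4"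
  have c5: "0 \<le> c5" unfolding c5_def using stab c4
    by (intro mult_nonneg_nonneg sum_nonneg) (auto simp: algebraically_stable_def less_imp_le)
  have "nh z \<le> nh (\<lambda>y. v y + \<eta>' y)" by (rule nh_mono) (simp add: z v_def)
  also have "\<dots> \<le> nh v + \<tau> * \<delta>" using nh_triangle[of v \<eta>'] \<eta>' by linarith
  finally have "(nh z)\<^sup>2 \<le> (nh v + \<tau> * \<delta>)\<^sup>2" using nh_nonneg by (intro power_mono)
  \<comment> \<open>The mixed term \<open>2 * \<tau> * nh v * \<delta>\<close> is split into two
    squares, each still carrying the factor \<open>\<tau>\<close>, as the recursion
    requires.\<close>
  also have "\<dots> \<le> (1 + \<tau>) * (nh v)\<^sup>2 + (1 + T) * \<tau> * \<delta>\<^sup>2"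
  proof -
    have "0 \<le> \<tau> * (nh v - \<delta>)\<^sup>2" "\<tau> * \<tau> * \<delta>\<^sup>2 \<le> T * \<tau> * \<delta>\<^sup>2" using \<tau> by (auto intro!: mult_right_mono)
    then show ?thesis by (simp add: power2_eq_square algebra_simps)
  qed
  also have "\<dots> \<le> (1 + \<tau>) * ((nh e)\<^sup>2 + \<tau> * (c5 * ?Q)) + (1 + T) * \<tau> * \<delta>\<^sup>2"
    using v \<tau> by (intro add_right_mono mult_left_mono) (auto simp: c5_def)
  also have "\<dots> \<le> (nh e)\<^sup>2 + (1 + (1 + T) * (c5 + 1)) * \<tau> * ?Q"
  proof -
    have "\<tau> * (\<tau> * (c5 * ?Q)) \<le> T * (\<tau> * (c5 * ?Q))"
      using \<tau> c5 by (intro mult_right_mono) auto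
    moreover have "\<tau> * (nh e)\<^sup>2 \<le> \<tau> * ?Q" using \<tau> by (intro mult_left_mono) auto
    moreover have "(1 + T) * \<tau> * \<delta>\<^sup>2 \<le> (1 + T) * \<tau> * ?Q" using \<tau> T by (intro mult_left_mono) auto
    ultimately show ?thesis by (simp add: algebra_simps)
  qed
  also have "1 + (1 + T) * (c5 + 1) = step_const ?L T A \<beta>"
    by (simp add: step_const_def c5_def c4_def c3_def c2_def Let_def)
  finally show ?thesis .
qed

end

section \<open>Error estimate for a sufficiently regular solution\<close>

lemma L2_sum: "(\<And>i. i \<in> I \<Longrightarrow> f i \<in> L2_space a b) \<Longrightarrow> (\<lambda>y. \<Sum>i\<in>I. s i * f i y) \<in> L2_space a b"
proof (induction I rule: infinite_finite_induct)
  case (insert i I)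
  then have "(\<lambda>y. s i * f i y + 1 * (\<Sum>i\<in>I. s i * f i y)) \<in> L2_space a b" by (intro L2_linear) auto
  then show ?case using insert by simp
qed (auto intro: continuous_L2)

lemma L2_inner_sum:
  assumes "\<And>i. i \<in> I \<Longrightarrow> f i \<in> L2_space a b" "z \<in> L2_space a b" "finite I"
  shows "L2_inner a b (\<lambda>y. \<Sum>i\<in>I. s i * f i y) z = (\<Sum>i\<in>I. s i * L2_inner a b (f i) z)"
  using assms(3,1)
proof (induction I rule: finite_induct)
  case empty
  then show ?case by (simp add: L2_inner_def)
next
  case (insert i I)
  have "L2_inner a b (\<lambda>y. s i * f i y + 1 * (\<Sum>i\<in>I. s i * f i y)) z = s i * L2_inner a b (f i) z + 1 * L2_inner a b (\<lambda>y. \<Sum>i\<in>I. s i * f i y) z"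
    by (intro L2_inner_linear L2_sum assms(2)) (use insert in auto)
  then show ?case using insert by simp
qed

text \<open>\<open>Ut n\<close> is the \<open>n\<close>-th time derivative of \<open>u\<close> and \<open>Wt n\<close> its weak space derivative, \<open>g t n\<close> is the
  \<open>n\<close>-th space derivative of \<open>u t\<close>, \<open>kk t\<close> bounds the derivatives of order \<open>r + 1\<close> to \<open>r + 3\<close>, and \<open>Ft n\<close>
  is the \<open>n\<close>-th time derivative of \<open>f(u)\<close>.\<close>

locale regular_solution =
  fixes a b T \<alpha> :: real and r k :: nat and A :: "real^'m^'m" and \<beta> cc :: "real^'m"
    and f :: "real \<Rightarrow> real" and u :: "real \<Rightarrow> real \<Rightarrow> real"
    and Ut Wt :: "nat \<Rightarrow> real \<Rightarrow> real \<Rightarrow> real" and g :: "real \<Rightarrow> nat \<Rightarrow> real \<Rightarrow> real"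
    and kk :: "real \<Rightarrow> real \<Rightarrow> real" and Ft :: "nat \<Rightarrow> real \<Rightarrow> real \<Rightarrow> real" and G Lf :: real
  assumes a_less_b: "a < b" and T: "T > 0" and k1: "k \<ge> 1" and G: "0 \<le> G" and Lf: "0 \<le> Lf"
    and stab: "algebraically_stable A \<beta>" and cc: "\<And>i. cc $ i \<in> {0..1}"
    and coll_b: "\<And>l. l \<in> {1..k} \<Longrightarrow> (\<Sum>j\<in>UNIV. \<beta> $ j * (cc $ j) ^ (l - 1)) = 1 ^ l / real l"
    and coll_a: "\<And>i l. l \<in> {1..k - 1} \<Longrightarrow> (\<Sum>j\<in>UNIV. A $ i $ j * (cc $ j) ^ (l - 1)) = (cc $ i) ^ l / real l"
    and Ut_deriv: "\<And>n t y. n \<le> k \<Longrightarrow> t \<in> {0..T} \<Longrightarrow> y \<in> {a..b} \<Longrightarrow> ((\<lambda>t. Ut n t y) has_real_derivative Ut (Suc n) t y) (at t within {0..T})"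
    and Ut_bound: "\<And>n t y. n \<in> {k, Suc k} \<Longrightarrow> t \<in> {0..T} \<Longrightarrow> y \<in> {a..b} \<Longrightarrow> \<bar>Ut n t y\<bar> \<le> G"
    and Ut_0: "\<And>t y. t \<in> {0..T} \<Longrightarrow> y \<in> {a..b} \<Longrightarrow> Ut 0 t y = u t y"
    and Wt_L2: "\<And>n t. n \<le> k \<Longrightarrow> t \<in> {0..T} \<Longrightarrow> Wt n t \<in> L2_space a b"
    and Wt_integral: "\<And>n t s y. n \<le> k \<Longrightarrow> t \<in> {0..T} \<Longrightarrow> a \<le> s \<Longrightarrow> s \<le> y \<Longrightarrow> y \<le> b \<Longrightarrow> (Wt n t has_integral Ut n t y - Ut n t s) {s..y}"
    and Wt_deriv: "\<And>n t q. n < k \<Longrightarrow> t \<in> {0..T} \<Longrightarrow> q \<in> L2_space a b \<Longrightarrow>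
       ((\<lambda>t. L2_inner a b (Wt n t) q) has_real_derivative L2_inner a b (Wt (Suc n) t) q) (at t within {0..T})"
    and Wt_bound: "\<And>t. t \<in> {0..T} \<Longrightarrow> L2_norm a b (Wt k t) \<le> G"
    and g_integral: "\<And>t n s y. t \<in> {0..T} \<Longrightarrow> n < r + 2 \<Longrightarrow> a \<le> s \<Longrightarrow> s \<le> y \<Longrightarrow> y \<le> b \<Longrightarrow> (g t (Suc n) has_integral g t n y - g t n s) {s..y}"
    and kk_L2: "\<And>t. t \<in> {0..T} \<Longrightarrow> kk t \<in> L2_space a b" and kk_bound: "\<And>t. t \<in> {0..T} \<Longrightarrow> L2_norm a b (kk t) \<le> G"
    and g_top_bound: "\<And>t n s y. t \<in> {0..T} \<Longrightarrow> n \<in> {r, r + 1, r + 2} \<Longrightarrow> a \<le> s \<Longrightarrow> s \<le> y \<Longrightarrow> y \<le> b \<Longrightarrow>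
       \<bar>g t n y - g t n s\<bar> \<le> integral {s..y} (\<lambda>y. \<bar>kk t y\<bar>)"
    and g_0: "\<And>t y. t \<in> {0..T} \<Longrightarrow> y \<in> {a..b} \<Longrightarrow> g t 0 y = u t y"
    and neumann: "\<And>t. t \<in> {0..T} \<Longrightarrow> g t 1 a = 0" "\<And>t. t \<in> {0..T} \<Longrightarrow> g t 1 b = 0"
    and pde: "\<And>t y. t \<in> {0..T} \<Longrightarrow> y \<in> {a..b} \<Longrightarrow> Ut 1 t y = g t 2 y + f (u t y)"
    and Ft_deriv: "\<And>n t y. n < k \<Longrightarrow> t \<in> {0..T} \<Longrightarrow> y \<in> {a..b} \<Longrightarrow> ((\<lambda>t. Ft n t y) has_real_derivative Ft (Suc n) t y) (at t within {0..T})"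
    and Ft_bound: "\<And>t y. t \<in> {0..T} \<Longrightarrow> y \<in> {a..b} \<Longrightarrow> \<bar>Ft k t y\<bar> \<le> G"
    and Ft_0: "\<And>t y. t \<in> {0..T} \<Longrightarrow> y \<in> {a..b} \<Longrightarrow> Ft 0 t y = f (u t y)"
    and u_bound: "\<And>t y. t \<in> {0..T} \<Longrightarrow> y \<in> {a..b} \<Longrightarrow> \<bar>u t y\<bar> \<le> \<alpha>"
    and f_lipschitz: "\<And>s s'. \<bar>s\<bar> \<le> \<alpha> \<Longrightarrow> \<bar>s'\<bar> \<le> \<alpha> \<Longrightarrow> \<bar>f s - f s'\<bar> \<le> Lf * \<bar>s - s'\<bar>"
begin

definition sA :: real where "sA = (\<Sum>i\<in>UNIV. \<Sum>j\<in>UNIV. \<bar>A $ i $ j\<bar>)"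
definition sb :: real where "sb = (\<Sum>j\<in>UNIV. \<bar>\<beta> $ j\<bar>)"

lemma sA_row: "(\<Sum>j\<in>UNIV. \<bar>A $ i $ j\<bar>) \<le> sA" and sA_nonneg: "0 \<le> sA" and sb_nonneg: "0 \<le> sb"
  unfolding sA_def sb_def
  by (intro member_le_sum[where f="\<lambda>i. \<Sum>j\<in>UNIV. \<bar>A $ i $ j\<bar>"] sum_nonneg, auto intro!: sum_nonneg)+

text \<open>Closed forms for the constants: \<open>CF\<close> for extrapolation, \<open>CK\<close>
  for the residual of the stage equation, \<open>CD\<close> for the defects, \<open>CS\<close> for
  the energy step, \<open>CG\<close> for the Gronwall rate. They are built from the data of this
  locale and from \<open>c\<close> and \<open>\<Lambda>\<close>, so none depends on the mesh or on
  the number of time steps.\<close>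

definition CF :: real where "CF = sqrt (b - a) * G * real k ^ k * (1 + real k * real k ^ k)"

definition CK :: "real \<Rightarrow> real \<Rightarrow> real" where
  "CK c \<Lambda> = (2 + \<Lambda> + 3 / sqrt c) * G + CF + real k ^ k * Lf"

definition CD :: "real \<Rightarrow> real" where "CD \<Lambda> = (\<Lambda> + sqrt (b - a)) * G * (2 + sA + sb)"

definition CS :: real where "CS = step_const (b - a) T A \<beta>"

definition CG :: "real \<Rightarrow> real \<Rightarrow> real" where
  "CG c \<Lambda> = CS * (2 * (CK c \<Lambda>)\<^sup>2 * real (k + 1) + (CD \<Lambda>)\<^sup>2 + 1)"

definition CE :: "real \<Rightarrow> real \<Rightarrow> real" where
  "CE c \<Lambda> = \<Lambda> / sqrt c * sqrt (exp (CG c \<Lambda> * real (k + 1) * T))"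

definition error_const :: "real \<Rightarrow> real \<Rightarrow> real" where
  "error_const c \<Lambda> = 1 + (1 + \<Lambda>) * G + CE c \<Lambda> * (sqrt (8 * \<Lambda>) + real k * sqrt (8 * \<Lambda>) * ((1 + \<Lambda>) * G) + 1)"

lemma CF_nonneg: "0 \<le> CF" using G a_less_b by (simp add: CF_def)

lemma CK_nonneg: "0 \<le> \<Lambda> \<Longrightarrow> 0 \<le> c \<Longrightarrow> 0 \<le> CK c \<Lambda>" and CD_nonneg: "0 \<le> \<Lambda> \<Longrightarrow> 0 \<le> CD \<Lambda>"
  using G a_less_b CF_nonneg Lf sA_nonneg sb_nonneg by (auto simp: CK_def CD_def)

lemma CS_nonneg: "0 \<le> CS"
proof -
  have "0 \<le> (\<Sum>i\<in>UNIV. \<beta> $ i)" using stab by (intro sum_nonneg) (auto simp: algebraically_stable_def less_imp_le)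
  then show ?thesis using T a_less_b sA_nonneg
    by (auto simp: CS_def step_const_def Let_def sA_def[symmetric] intro!: add_nonneg_nonneg mult_nonneg_nonneg)
qed

lemma CG_nonneg: "0 \<le> CG c \<Lambda>" unfolding CG_def using CS_nonneg by (intro mult_nonneg_nonneg add_nonneg_nonneg) auto

context
  fixes t0 \<tau> :: real
  assumes \<tau>: "\<tau> > 0" and t0: "0 \<le> t0" "t0 + \<tau> \<le> T"
begin

lemma time_subset: "{t0..t0 + \<tau>} \<subseteq> {0..T}" using t0 by auto

lemma stage_time: "t0 + \<tau> * cc $ i \<in> {t0..t0 + \<tau>}"
  using cc[of i] \<tau> mult_left_mono[of "cc $ i" 1 \<tau>] by auto

lemma stage_time_T: "t0 + \<tau> * cc $ i \<in> {0..T}" using stage_time time_subset by blast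

lemma t0_T: "t0 \<in> {0..T}" using t0 \<tau> by auto

definition stage_defect :: "'m \<Rightarrow> real \<Rightarrow> real" where
  "stage_defect i y = Ut 0 (t0 + \<tau> * cc $ i) y - Ut 0 t0 y - \<tau> * (\<Sum>j\<in>UNIV. A $ i $ j * Ut 1 (t0 + \<tau> * cc $ j) y)"

definition stage_defect_deriv :: "'m \<Rightarrow> real \<Rightarrow> real" where
  "stage_defect_deriv i y = Wt 0 (t0 + \<tau> * cc $ i) y - Wt 0 t0 y - \<tau> * (\<Sum>j\<in>UNIV. A $ i $ j * Wt 1 (t0 + \<tau> * cc $ j) y)"

text \<open>The stage relations are used up to degree \<open>k - 1\<close>, which leaves order
  \<open>k\<close>, one less than for the final update.\<close>

lemma stage_defect_bound:
  assumes y: "y \<in> {a..b}"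
  shows "\<bar>stage_defect i y\<bar> \<le> G * \<tau> ^ k * (2 + sA)"
proof -
  have "\<bar>stage_defect i y\<bar> \<le> G * \<tau> ^ (k - 1 + 1) * (2 + (\<Sum>j\<in>UNIV. \<bar>A $ i $ j\<bar>))"
    unfolding stage_defect_def
  proof (rule rk_defect[where g="\<lambda>n t. Ut n t y" and d="\<lambda>j. A $ i $ j" and cc="\<lambda>j. cc $ j" and \<theta>="cc $ i" and q="k - 1", OF coll_a cc cc \<tau>])
    show "((\<lambda>t. Ut n t y) has_real_derivative Ut (Suc n) t y) (at t within {t0..t0 + \<tau>})"
      if "n \<le> k - 1" "t \<in> {t0..t0 + \<tau>}" for n t
      by (rule DERIV_subset[OF Ut_deriv time_subset]) (use that time_subset y in auto)
    show "\<bar>Ut (Suc (k - 1)) t y\<bar> \<le> G" if "t \<in> {t0..t0 + \<tau>}" for t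
      using Ut_bound[of k t y] that time_subset y k1 by auto
  qed
  also have "\<dots> \<le> G * \<tau> ^ k * (2 + sA)"
    using k1 G \<tau> sA_row[of i] by (intro mult_mono) auto
  finally show ?thesis .
qed

lemma step_defect_bound:
  assumes y: "y \<in> {a..b}"
  shows "\<bar>Ut 0 (t0 + \<tau>) y - Ut 0 t0 y - \<tau> * (\<Sum>j\<in>UNIV. \<beta> $ j * Ut 1 (t0 + \<tau> * cc $ j) y)\<bar> \<le> G * \<tau> ^ (k + 1) * (2 + sb)"
proof -
  have "\<bar>Ut 0 (t0 + \<tau> * 1) y - Ut 0 t0 y - \<tau> * (\<Sum>j\<in>UNIV. \<beta> $ j * Ut 1 (t0 + \<tau> * cc $ j) y)\<bar> \<le> G * \<tau> ^ (k + 1) * (2 + (\<Sum>j\<in>UNIV. \<bar>\<beta> $ j\<bar>))"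
  proof (rule rk_defect[where g="\<lambda>n t. Ut n t y" and d="\<lambda>j. \<beta> $ j" and cc="\<lambda>j. cc $ j" and \<theta>=1 and q=k, OF coll_b cc _ \<tau>])
    show "((\<lambda>t. Ut n t y) has_real_derivative Ut (Suc n) t y) (at t within {t0..t0 + \<tau>})"
      if "n \<le> k" "t \<in> {t0..t0 + \<tau>}" for n t
      by (rule DERIV_subset[OF Ut_deriv time_subset]) (use that time_subset y in auto)
    show "\<bar>Ut (Suc k) t y\<bar> \<le> G" if "t \<in> {t0..t0 + \<tau>}" for t
      using Ut_bound[of "Suc k" t y] that time_subset y by auto
  qed auto
  then show ?thesis by (simp add: sb_def)
qed

text \<open>The norm is bounded by duality: the inner product with a fixed function is again a
  scalar Runge--Kutta defect, and testing with the derivative of the defect itself yields its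
  norm.\<close>

lemma stage_defect_deriv:
  shows "stage_defect_deriv i \<in> L2_space a b"
    and "L2_norm a b (stage_defect_deriv i) \<le> G * \<tau> ^ k * (2 + sA)"
    and "a \<le> s \<Longrightarrow> s \<le> y \<Longrightarrow> y \<le> b \<Longrightarrow> \<bar>stage_defect i y - stage_defect i s\<bar> \<le> integral {s..y} (\<lambda>y. \<bar>stage_defect_deriv i y\<bar>)"
proof -
  let ?t = "\<lambda>i. t0 + \<tau> * cc $ i"
  let ?d = "stage_defect_deriv i"
  have W0: "Wt 0 (?t i) \<in> L2_space a b" "Wt 0 t0 \<in> L2_space a b"
    using Wt_L2[OF _ stage_time_T] Wt_L2[OF _ t0_T] by auto
  have W1: "Wt 1 (?t j) \<in> L2_space a b" for j using Wt_L2[OF k1 stage_time_T] .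
  have sum: "(\<lambda>y. \<Sum>j\<in>UNIV. A $ i $ j * Wt 1 (?t j) y) \<in> L2_space a b" by (rule L2_sum) (rule W1)
  have d_eq: "?d = (\<lambda>y. 1 * (1 * Wt 0 (?t i) y + (- 1) * Wt 0 t0 y) + (- \<tau>) * (\<Sum>j\<in>UNIV. A $ i $ j * Wt 1 (?t j) y))"
    by (simp add: fun_eq_iff stage_defect_deriv_def)
  show dL: "?d \<in> L2_space a b"
    unfolding d_eq by (intro L2_linear[OF L2_linear[OF W0] sum])
  have inner: "L2_inner a b ?d q = L2_inner a b (Wt 0 (?t i)) q - L2_inner a b (Wt 0 t0) q - \<tau> * (\<Sum>j\<in>UNIV. A $ i $ j * L2_inner a b (Wt 1 (?t j)) q)"
    if q: "q \<in> L2_space a b" for q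
    unfolding d_eq L2_inner_linear[OF L2_linear[OF W0] sum q] L2_inner_linear[OF W0 q] L2_inner_sum[OF W1 q finite] by simp
  have "\<bar>L2_inner a b ?d ?d\<bar> \<le> (G * L2_norm a b ?d) * \<tau> ^ (k - 1 + 1) * (2 + (\<Sum>j\<in>UNIV. \<bar>A $ i $ j\<bar>))"
    unfolding inner[OF dL]
  proof (rule rk_defect[where g="\<lambda>n t. L2_inner a b (Wt n t) ?d" and d="\<lambda>j. A $ i $ j" and cc="\<lambda>j. cc $ j" and \<theta>="cc $ i" and q="k - 1", OF coll_a cc cc \<tau>])
    show "((\<lambda>t. L2_inner a b (Wt n t) ?d) has_real_derivative L2_inner a b (Wt (Suc n) t) ?d) (at t within {t0..t0 + \<tau>})"
      if "n \<le> k - 1" "t \<in> {t0..t0 + \<tau>}" for n t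
      by (rule DERIV_subset[OF Wt_deriv[OF _ _ dL] time_subset]) (use that time_subset k1 in auto)
    show "\<bar>L2_inner a b (Wt (Suc (k - 1)) t) ?d\<bar> \<le> G * L2_norm a b ?d" if "t \<in> {t0..t0 + \<tau>}" for t
    proof -
      have t: "t \<in> {0..T}" using that time_subset by auto
      have "\<bar>L2_inner a b (Wt k t) ?d\<bar> \<le> L2_norm a b (Wt k t) * L2_norm a b ?d"
        by (rule L2_Cauchy_Schwarz[OF Wt_L2[OF order_refl t] dL])
      also have "\<dots> \<le> G * L2_norm a b ?d" using Wt_bound[OF t] L2_norm_nonneg by (intro mult_right_mono) auto
      finally show ?thesis using k1 by simp
    qed
  qed
  also have "\<dots> \<le> (G * L2_norm a b ?d) * \<tau> ^ k * (2 + sA)"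
    using k1 G \<tau> sA_row[of i] L2_norm_nonneg by (intro mult_mono) auto
  finally have "L2_norm a b ?d * L2_norm a b ?d \<le> (G * \<tau> ^ k * (2 + sA)) * L2_norm a b ?d"
    by (simp add: L2_norm_power2[symmetric] power2_eq_square mult_ac)
  moreover have "0 \<le> G * \<tau> ^ k * (2 + sA)" using G \<tau> sA_nonneg by simp
  ultimately show "L2_norm a b ?d \<le> G * \<tau> ^ k * (2 + sA)"
    using L2_norm_nonneg[of a b ?d] by (cases "L2_norm a b ?d = 0") (auto dest: mult_right_le_imp_le)
  show "\<bar>stage_defect i y - stage_defect i s\<bar> \<le> integral {s..y} (\<lambda>y. \<bar>?d y\<bar>)" if sy: "a \<le> s" "s \<le> y" "y \<le> b"
  proof -
    have "(?d has_integral (Ut 0 (?t i) y - Ut 0 (?t i) s) - (Ut 0 t0 y - Ut 0 t0 s)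
       - \<tau> * (\<Sum>j\<in>UNIV. A $ i $ j * (Ut 1 (?t j) y - Ut 1 (?t j) s))) {s..y}"
      unfolding stage_defect_deriv_def
      by (intro has_integral_diff has_integral_mult_right has_integral_sum Wt_integral stage_time_T t0_T sy k1) auto
    also have "(Ut 0 (?t i) y - Ut 0 (?t i) s) - (Ut 0 t0 y - Ut 0 t0 s)
       - \<tau> * (\<Sum>j\<in>UNIV. A $ i $ j * (Ut 1 (?t j) y - Ut 1 (?t j) s)) = stage_defect i y - stage_defect i s"
      by (simp add: stage_defect_def right_diff_distrib sum_subtractf)
    finally have "integral {s..y} ?d = stage_defect i y - stage_defect i s" by (rule integral_unique)
    then show ?thesis using abs_integral_L2_le(2)[OF dL sy] by simp
  qed
qed

end

end

section \<open>The error recursion of the cut-off scheme\<close>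

lemma cutoff_contraction:
  fixes p q \<alpha> :: real
  assumes "\<bar>p\<bar> \<le> \<alpha>" shows "\<bar>p - min (max q (- \<alpha>)) \<alpha>\<bar> \<le> \<bar>p - q\<bar>"
  using assms unfolding min_def max_def by (smt (verit))

text \<open>Equality holds at every real argument, because equal nodal data give the choice operator
  the same predicate.\<close>

lemma (in lobatto_mesh) interp_cong: "(\<And>j. j \<le> M * r \<Longrightarrow> v (x j) = w (x j)) \<Longrightarrow> Ih v = Ih w"
  unfolding lagrange_interp_def by (rule arg_cong[where f=Eps]) (auto simp: fun_eq_iff)

locale cutoff_scheme = regular_solution a b T \<alpha> r k A \<beta> cc f u Ut Wt g kk Ft G Lf + lobatto_mesh r c \<Lambda> a b M x \<omega>
  for a b T \<alpha> r k and A :: "real^'m^'m" and \<beta> cc f u Ut Wt g kk Ft G Lf c \<Lambda> M x \<omega> +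
  fixes N :: nat and U :: "nat \<Rightarrow> real \<Rightarrow> real"
  assumes N: "N \<ge> 1"
    and start: "\<And>l. l < k \<Longrightarrow> U l \<in> S" "\<And>l j. l < k \<Longrightarrow> j \<le> M * r \<Longrightarrow> \<bar>U l (x j)\<bar> \<le> \<alpha>"
    and scheme: "cutoff_rk_scheme a b r M x \<omega> \<alpha> f A \<beta> cc k (T / real N) N U"
begin

definition \<tau> :: real where "\<tau> = T / real N"

definition e :: "nat \<Rightarrow> real \<Rightarrow> real" where "e n y = Ih (u (real n * \<tau>)) y - U n y"

lemma \<tau>: "\<tau> > 0" "\<tau> \<le> T" "\<tau> * real N = T"
proof -
  show "\<tau> > 0" "\<tau> * real N = T" using T N by (auto simp: \<tau>_def)
  have "\<tau> * 1 \<le> \<tau> * real N" using \<open>\<tau> > 0\<close> N by (intro mult_left_mono) auto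
  then show "\<tau> \<le> T" using \<open>\<tau> * real N = T\<close> by simp
qed

lemma time_in: "n \<le> N \<Longrightarrow> real n * \<tau> \<in> {0..T}"
  using \<tau> mult_left_mono[of "real n" "real N" \<tau>] by (auto simp: mult.commute)

lemma alpha_nonneg: "0 \<le> \<alpha>" using u_bound[of 0 a] T ab by auto

lemma U: "n \<le> N \<Longrightarrow> U n \<in> S" "n \<le> N \<Longrightarrow> j \<le> M * r \<Longrightarrow> \<bar>U n (x j)\<bar> \<le> \<alpha>"
proof -
  have *: "U n \<in> S \<and> (\<forall>j\<le>M * r. \<bar>U n (x j)\<bar> \<le> \<alpha>)" if "n \<le> N" for n
  proof (cases "n < k")
    case True
    then show ?thesis using start by auto
  next
    case False
    then have "n \<in> {k..N}" using that by simp
    then have "U n \<in> S \<and> (\<exists>z. \<forall>j\<le>M * r. U n (x j) = min (max (z (x j)) (- \<alpha>)) \<alpha>)"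
      using scheme unfolding cutoff_rk_scheme_def by fast
    then show ?thesis using alpha_nonneg by (auto simp: abs_le_iff min_def max_def)
  qed
  then show "n \<le> N \<Longrightarrow> U n \<in> S" "n \<le> N \<Longrightarrow> j \<le> M * r \<Longrightarrow> \<bar>U n (x j)\<bar> \<le> \<alpha>" by auto
qed

lemma e_S: "n \<le> N \<Longrightarrow> e n \<in> S"
  using fe_linear[OF interp(1) U(1), of n 1 "u (real n * \<tau>)" "-1"] by (simp add: e_def[abs_def])

lemma e_node: "j \<le> M * r \<Longrightarrow> e n (x j) = u (real n * \<tau>) (x j) - U n (x j)"
  by (simp add: e_def interp(2))

lemma regular: "t \<in> {0..T} \<Longrightarrow> smooth_on_mesh r c \<Lambda> a b M x \<omega> (g t) (kk t)"
  by unfold_locales (use g_integral kk_L2 g_top_bound in auto)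

lemma interp_u: "t \<in> {0..T} \<Longrightarrow> Ih (g t 0) = Ih (u t)"
  by (rule interp_cong) (use g_0 x_in in auto)

lemma interp_error_u:
  assumes t: "t \<in> {0..T}"
  shows "L2_norm a b (\<lambda>y. u t y - Ih (u t) y) \<le> (1 + \<Lambda>) * G * H ^ (r + 1)" "u t \<in> L2_space a b"
proof -
  interpret R: smooth_on_mesh r c \<Lambda> a b M x \<omega> "g t" "kk t" by (rule regular[OF t])
  have uc: "continuous_on {a..b} (u t)"
    using R.g0_continuous g_0[OF t] by (metis (no_types, lifting) continuous_on_cong)
  then show "u t \<in> L2_space a b" by (rule continuous_L2)
  have "L2_norm a b (\<lambda>y. u t y - Ih (u t) y) = L2_norm a b (\<lambda>y. g t 0 y - Ih (g t 0) y)"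
    unfolding L2_norm_def L2_inner_def interp_u[OF t]
    by (rule arg_cong[where f=sqrt], rule Bochner_Integration.integral_cong) (use g_0[OF t] in auto)
  also have "\<dots> \<le> (1 + \<Lambda>) * L2_norm a b (kk t) * H ^ (r + 1)" by (rule R.interp_error)
  also have "\<dots> \<le> (1 + \<Lambda>) * G * H ^ (r + 1)"
    using \<Lambda> H_pos kk_bound[OF t] by (intro mult_right_mono mult_left_mono) auto
  finally show "L2_norm a b (\<lambda>y. u t y - Ih (u t) y) \<le> (1 + \<Lambda>) * G * H ^ (r + 1)" .
qed

lemma truncation_u:
  assumes t: "t \<in> {0..T}" and w: "w \<in> S"
  shows "\<bar>ip (g t 2) w + gr (Ih (u t)) w\<bar> \<le> (2 + \<Lambda> + 3 / sqrt c) * G * H ^ (r + 1) * (nh w + ng w)"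
proof -
  interpret R: smooth_on_mesh r c \<Lambda> a b M x \<omega> "g t" "kk t" by (rule regular[OF t])
  have "\<bar>ip (g t 2) w + gr (Ih (u t)) w\<bar> \<le> (2 + \<Lambda> + 3 / sqrt c) * L2_norm a b (kk t) * H ^ (r + 1) * (nh w + ng w)"
    using R.truncation[OF w neumann[OF t]] by (simp add: interp_u[OF t])
  also have "\<dots> \<le> (2 + \<Lambda> + 3 / sqrt c) * G * H ^ (r + 1) * (nh w + ng w)"
    using \<Lambda> c H_pos kk_bound[OF t] nh_nonneg ng_nonneg by (intro mult_right_mono mult_left_mono) auto
  finally show ?thesis .
qed

text \<open>The cut-off keeps all nodal values of \<open>U\<close> between \<open>- \<alpha>\<close>
  and \<open>\<alpha>\<close>, where one Lipschitz constant of \<open>f\<close> is valid; past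
  errors then enter linearly, through bounded Lagrange weights.\<close>

lemma nonlinearity:
  assumes n: "n \<in> {k..N}" and s: "s \<in> {real (n - 1) * \<tau>..real n * \<tau>}"
  shows "nh (\<lambda>y. f (u s y) - (\<Sum>l=1..k. lagrange_basis k \<tau> n l s * f (U (n - l) y)))
    \<le> CF * \<tau> ^ k + real k ^ k * Lf * (\<Sum>l=1..k. nh (e (n - l)))"
proof -
  let ?L = "\<lambda>l. lagrange_basis k \<tau> n l s"
  let ?t = "\<lambda>l. real (n - l) * \<tau>"
  have kn: "k \<le> n" using n by simp
  have "real (n - k) * \<tau> \<le> real (n - 1) * \<tau>" using k1 \<tau> by (intro mult_right_mono) auto
  then have s': "real (n - k) * \<tau> \<le> s" "s \<le> real n * \<tau>" using s by auto
  have sub: "{real (n - k) * \<tau>..real n * \<tau>} \<subseteq> {0..T}" using time_in[of "n - k"] time_in[of n] n by auto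
  have sT: "s \<in> {0..T}" using s' sub by auto
  have tT: "?t l \<in> {0..T}" for l using time_in[of "n - l"] n by auto
  \<comment> \<open>\<open>q1\<close> is the extrapolation error along the exact solution;
    \<open>q2\<close> is a nodal majorant for the effect of past errors.\<close>
  define q1 where "q1 y = f (u s y) - (\<Sum>l=1..k. ?L l * f (u (?t l) y))" for y
  define q2 where "q2 y = (\<Sum>l=1..k. (real k ^ k * Lf) * \<bar>e (n - l) y\<bar>)" for y
  have q1: "nh q1 \<le> CF * \<tau> ^ k"
  proof -
    have "nh q1 \<le> (G * (real k * \<tau>) ^ k * (1 + real k * real k ^ k)) * sqrt (b - a)"
    proof (rule nh_le_sup)
      fix j assume "j \<le> M * r"
      then have y: "x j \<in> {a..b}" by (rule x_in)
      have "q1 (x j) = Ft 0 s (x j) - (\<Sum>l=1..k. ?L l * Ft 0 (?t l) (x j))"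
        by (simp add: q1_def Ft_0[OF sT y] Ft_0[OF tT y])
      also have "\<bar>\<dots>\<bar> \<le> G * (real k * \<tau>) ^ k * (1 + real k * real k ^ k)"
      proof (rule lagrange_extrapolation[where g="\<lambda>n t. Ft n t (x j)", OF \<tau>(1) k1 kn s'])
        show "((\<lambda>t. Ft m t (x j)) has_real_derivative Ft (Suc m) t (x j)) (at t within {real (n - k) * \<tau>..real n * \<tau>})"
          if "m < k" "t \<in> {real (n - k) * \<tau>..real n * \<tau>}" for m t
          by (rule DERIV_subset[OF Ft_deriv sub]) (use that sub y in auto)
        show "\<bar>Ft k t (x j)\<bar> \<le> G" if "t \<in> {real (n - k) * \<tau>..real n * \<tau>}" for t
          using Ft_bound[of t "x j"] that sub y by auto
      qed
      finally show "\<bar>q1 (x j)\<bar> \<le> G * (real k * \<tau>) ^ k * (1 + real k * real k ^ k)" .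
    qed
    also have "\<dots> = CF * \<tau> ^ k" by (simp add: CF_def power_mult_distrib mult_ac)
    finally show ?thesis .
  qed
  have "nh (\<lambda>y. f (u s y) - (\<Sum>l=1..k. ?L l * f (U (n - l) y)) - q1 y) \<le> nh q2"
  proof (rule nh_mono)
    fix j assume j: "j \<le> M * r"
    have y: "x j \<in> {a..b}" using j by (rule x_in)
    have "f (u s (x j)) - (\<Sum>l=1..k. ?L l * f (U (n - l) (x j))) - q1 (x j) = (\<Sum>l=1..k. ?L l * (f (u (?t l) (x j)) - f (U (n - l) (x j))))"
      by (simp add: q1_def right_diff_distrib sum_subtractf)
    also have "\<bar>\<dots>\<bar> \<le> q2 (x j)" unfolding q2_def
    proof (rule order_trans[OF sum_abs sum_mono])
      fix l assume l: "l \<in> {1..k}"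
      have "\<bar>f (u (?t l) (x j)) - f (U (n - l) (x j))\<bar> \<le> Lf * \<bar>e (n - l) (x j)\<bar>"
        unfolding e_node[OF j] using n by (intro f_lipschitz u_bound[OF tT y] U(2)[OF _ j]) auto
      then have "\<bar>?L l\<bar> * \<bar>f (u (?t l) (x j)) - f (U (n - l) (x j))\<bar> \<le> real k ^ k * (Lf * \<bar>e (n - l) (x j)\<bar>)"
        using lagrange_basis_bound[OF \<tau>(1) k1 kn l s'] by (intro mult_mono) auto
      then show "\<bar>?L l * (f (u (?t l) (x j)) - f (U (n - l) (x j)))\<bar> \<le> (real k ^ k * Lf) * \<bar>e (n - l) (x j)\<bar>"
        by (simp add: abs_mult mult.assoc)
    qed
    finally show "\<bar>f (u s (x j)) - (\<Sum>l=1..k. ?L l * f (U (n - l) (x j))) - q1 (x j)\<bar> \<le> \<bar>q2 (x j)\<bar>" by simp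
  qed
  also have "nh q2 \<le> (\<Sum>l=1..k. nh (\<lambda>y. (real k ^ k * Lf) * \<bar>e (n - l) y\<bar>))"
    unfolding q2_def by (rule nh_sum)
  also have "\<dots> \<le> (\<Sum>l=1..k. (real k ^ k * Lf) * nh (e (n - l)))"
    unfolding nh_scale using Lf by (intro sum_mono) (auto intro!: mult_left_mono nh_mono)
  finally have q2: "nh (\<lambda>y. f (u s y) - (\<Sum>l=1..k. ?L l * f (U (n - l) y)) - q1 y) \<le> real k ^ k * Lf * (\<Sum>l=1..k. nh (e (n - l)))"
    by (simp add: sum_distrib_left)
  show ?thesis
    using nh_triangle[of "\<lambda>y. f (u s y) - (\<Sum>l=1..k. ?L l * f (U (n - l) y)) - q1 y" q1] q1 q2 by simp
qed

lemma one_step: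
  assumes n: "n \<in> {k..N}"
  shows "(nh (e n))\<^sup>2 \<le> (nh (e (n - 1)))\<^sup>2 + CS * \<tau> *
    (((CK c \<Lambda>) * (H ^ (r + 1) + \<tau> ^ k + (\<Sum>l=1..k. nh (e (n - l)))))\<^sup>2 + ((CD \<Lambda>) * \<tau> ^ k)\<^sup>2 + (nh (e (n - 1)))\<^sup>2)"
proof -
  define t0 where "t0 = real (n - 1) * \<tau>"
  have n1: "1 \<le> n" using n k1 by simp
  have t0S: "real (n - Suc 0) * \<tau> = t0" by (simp add: t0_def)
  have t1: "t0 + \<tau> = real n * \<tau>" using n1 by (simp add: t0_def of_nat_diff algebra_simps)
  have t0: "0 \<le> t0" "t0 + \<tau> \<le> T" using time_in[of n] n \<tau> unfolding t1 by (auto simp: t0_def)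
  note ctx = \<tau>(1) t0
  let ?t = "\<lambda>i. t0 + \<tau> * cc $ i"
  have tT: "?t i \<in> {0..T}" for i by (rule stage_time_T[OF ctx])
  have t0T: "t0 \<in> {0..T}" by (rule t0_T[OF ctx])
  have t1T: "t0 + \<tau> \<in> {0..T}" using t0 \<tau> by auto
  obtain V W :: "'m \<Rightarrow> real \<Rightarrow> real" and z where VW: "\<And>i. V i \<in> S" and z: "z \<in> S"
    and W: "\<And>i y. y \<in> {a..b} \<Longrightarrow> W i y = Lap (V i) y + (\<Sum>l=1..k. lagrange_basis k \<tau> n l (real (n - 1) * \<tau> + cc $ i * \<tau>) * Ih (\<lambda>s. f (U (n - l) s)) y)"
    and V: "\<And>i y. y \<in> {a..b} \<Longrightarrow> V i y = U (n - 1) y + \<tau> * (\<Sum>j\<in>UNIV. A $ i $ j * W j y)"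
    and zz: "\<And>y. y \<in> {a..b} \<Longrightarrow> z y = U (n - 1) y + \<tau> * (\<Sum>i\<in>UNIV. \<beta> $ i * W i y)"
    and cut: "\<And>j. j \<le> M * r \<Longrightarrow> U n (x j) = min (max (z (x j)) (- \<alpha>)) \<alpha>"
    using scheme[unfolded cutoff_rk_scheme_def, folded \<tau>_def, rule_format, OF n] by blast
  define E where "E i y = Ih (u (?t i)) y - V i y" for i y
  \<comment> \<open>The exact time derivative is not interpolated, since only its nodal values enter
    the discrete inner product.\<close>
  define D where "D i y = Ut 1 (?t i) y - W i y" for i y
  define \<eta> where "\<eta> i = Ih (stage_defect t0 \<tau> i)" for i
  define \<eta>' where "\<eta>' y = Ut 0 (t0 + \<tau>) y - Ut 0 t0 y - \<tau> * (\<Sum>j\<in>UNIV. \<beta> $ j * Ut 1 (?t j) y)" for y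
  define Z where "Z y = Ih (u (real n * \<tau>)) y - z y" for y
  define K where "K = (CK c \<Lambda>) * (H ^ (r + 1) + \<tau> ^ k + (\<Sum>l=1..k. nh (e (n - l))))"
  define \<delta> where "\<delta> = (CD \<Lambda>) * \<tau> ^ k"
  have se: "0 \<le> (\<Sum>l=1..k. nh (e (n - l)))" by (intro sum_nonneg nh_nonneg)
  have K0: "0 \<le> K" using CK_nonneg[of \<Lambda> c] \<Lambda> c H_pos \<tau> se by (simp add: K_def)
  have \<delta>0: "0 \<le> \<delta>" using CD_nonneg[of \<Lambda>] \<Lambda> \<tau> by (simp add: \<delta>_def)
  have ES: "E i \<in> S" for i
    using fe_linear[OF interp(1) VW[of i], of 1 "u (?t i)" "-1"] by (simp add: E_def[abs_def])
  have \<eta>S: "\<eta> i \<in> S" for i unfolding \<eta>_def by (rule interp)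
  have dfac: "\<Lambda> * (G * \<tau> ^ k * (2 + sA)) \<le> \<delta>" "G * \<tau> ^ k * (2 + sA) * sqrt (b - a) \<le> \<delta>" "G * \<tau> ^ k * (2 + sb) * sqrt (b - a) \<le> \<delta>"
  proof -
    have "\<Lambda> * (2 + sA) \<le> (\<Lambda> + sqrt (b - a)) * (2 + sA + sb)" "sqrt (b - a) * (2 + sA) \<le> (\<Lambda> + sqrt (b - a)) * (2 + sA + sb)"
      "sqrt (b - a) * (2 + sb) \<le> (\<Lambda> + sqrt (b - a)) * (2 + sA + sb)"
      using \<Lambda> ab sA_nonneg sb_nonneg by (intro mult_mono; simp)+
    from this[THEN mult_left_mono, of "G * \<tau> ^ k"] show "\<Lambda> * (G * \<tau> ^ k * (2 + sA)) \<le> \<delta>"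
      "G * \<tau> ^ k * (2 + sA) * sqrt (b - a) \<le> \<delta>" "G * \<tau> ^ k * (2 + sb) * sqrt (b - a) \<le> \<delta>"
      using G \<tau> by (simp_all add: \<delta>_def CD_def mult_ac)
  qed
  have Enode: "E i (x j) = e (n - 1) (x j) + \<tau> * (\<Sum>l\<in>UNIV. A $ i $ l * D l (x j)) + \<eta> i (x j)" if j: "j \<le> M * r" for i j
    using V[OF x_in[OF j], of i] Ut_0[OF tT x_in[OF j], of i] Ut_0[OF t0T x_in[OF j]]
    by (simp add: E_def D_def \<eta>_def interp(2)[OF j] e_node[OF j] stage_defect_def[OF ctx] t0S right_diff_distrib sum_subtractf)
  have Znode: "Z (x j) = e (n - 1) (x j) + \<tau> * (\<Sum>i\<in>UNIV. \<beta> $ i * D i (x j)) + \<eta>' (x j)" if j: "j \<le> M * r" for j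
    using zz[OF x_in[OF j]] Ut_0[OF t1T x_in[OF j]] Ut_0[OF t0T x_in[OF j]]
    by (simp add: Z_def D_def \<eta>'_def interp(2)[OF j] e_node[OF j] t0S t1 right_diff_distrib sum_subtractf)
  \<comment> \<open>Tested with \<open>w\<close>, the discrete Laplacian contributes
    \<open>gr (V i) w\<close>, which cancels against the same term in \<open>gr (E i) w\<close>.
    What remains is the spatial truncation error and the nonlinear residual
    \<open>q\<close>.\<close>
  have weak: "\<bar>ip (D i) w + gr (E i) w\<bar> \<le> K * (nh w + ng w)" if w: "w \<in> S" for i w
  proof -
    define q where "q y = f (u (?t i) y) - (\<Sum>l=1..k. lagrange_basis k \<tau> n l (?t i) * f (U (n - l) y))" for y
    have "ip (D i) w = ip (\<lambda>y. 1 * (1 * g (?t i) 2 y + (- 1) * Lap (V i) y) + 1 * q y) w"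
    proof (rule ip_cong)
      fix j assume j: "j \<le> M * r"
      show "D i (x j) = 1 * (1 * g (?t i) 2 (x j) + (- 1) * Lap (V i) (x j)) + 1 * q (x j)"
        unfolding D_def W[OF x_in[OF j]] pde[OF tT x_in[OF j]] by (simp add: q_def interp(2)[OF j] t0_def mult.commute)
    qed simp
    also have "\<dots> = ip (g (?t i) 2) w + gr (V i) w + ip q w"
      unfolding ip_linear using discrete_laplacian(2)[OF VW w] by simp
    finally have 1: "ip (D i) w = ip (g (?t i) 2) w + gr (V i) w + ip q w" .
    have "gr (E i) w = gr (\<lambda>y. 1 * Ih (u (?t i)) y + (- 1) * V i y) w" by (simp add: E_def[abs_def])
    also have "\<dots> = gr (Ih (u (?t i))) w - gr (V i) w" unfolding gr_linear[OF interp(1) VW w] by simp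
    finally have "ip (D i) w + gr (E i) w = (ip (g (?t i) 2) w + gr (Ih (u (?t i))) w) + ip q w" using 1 by simp
    moreover have "\<bar>ip (g (?t i) 2) w + gr (Ih (u (?t i))) w\<bar> \<le> (2 + \<Lambda> + 3 / sqrt c) * G * H ^ (r + 1) * (nh w + ng w)"
      by (rule truncation_u[OF tT w])
    moreover have "\<bar>ip q w\<bar> \<le> (CF * \<tau> ^ k + real k ^ k * Lf * (\<Sum>l=1..k. nh (e (n - l)))) * (nh w + ng w)"
    proof -
      have "nh q \<le> CF * \<tau> ^ k + real k ^ k * Lf * (\<Sum>l=1..k. nh (e (n - l)))"
        unfolding q_def using stage_time[OF ctx, of i] by (intro nonlinearity n) (simp add: t1 t0S)
      moreover have "0 \<le> nh q" by (rule nh_nonneg)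
      ultimately have "nh q * nh w \<le> (CF * \<tau> ^ k + real k ^ k * Lf * (\<Sum>l=1..k. nh (e (n - l)))) * (nh w + ng w)"
        using nh_nonneg[of w] ng_nonneg[of w] by (intro mult_mono) auto
      then show ?thesis using ip_le[of q w] by linarith
    qed
    ultimately have "\<bar>ip (D i) w + gr (E i) w\<bar> \<le> ((2 + \<Lambda> + 3 / sqrt c) * G * H ^ (r + 1) + (CF * \<tau> ^ k + real k ^ k * Lf * (\<Sum>l=1..k. nh (e (n - l))))) * (nh w + ng w)"
      by (simp only: distrib_right)
    also have "\<dots> \<le> K * (nh w + ng w)"
    proof (intro mult_right_mono)
      let ?C1 = "(2 + \<Lambda> + 3 / sqrt c) * G" and ?C3 = "real k ^ k * Lf"
      have c: "0 \<le> ?C1" "0 \<le> CF" "0 \<le> ?C3" using \<Lambda> c G Lf CF_nonneg by auto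
      have "?C1 * H ^ (r + 1) \<le> (CK c \<Lambda>) * H ^ (r + 1)" "CF * \<tau> ^ k \<le> (CK c \<Lambda>) * \<tau> ^ k"
        "?C3 * (\<Sum>l=1..k. nh (e (n - l))) \<le> (CK c \<Lambda>) * (\<Sum>l=1..k. nh (e (n - l)))"
        using c H_pos \<tau> se by (intro mult_right_mono; simp add: CK_def)+
      then show "?C1 * H ^ (r + 1) + (CF * \<tau> ^ k + ?C3 * (\<Sum>l=1..k. nh (e (n - l)))) \<le> K"
        by (simp only: K_def distrib_left)
    qed (use nh_nonneg ng_nonneg in simp)
    finally show ?thesis .
  qed
  have \<eta>1: "nh (\<eta> i) \<le> \<delta>" for i
  proof -
    have "nh (\<eta> i) \<le> (G * \<tau> ^ k * (2 + sA)) * sqrt (b - a)"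
    proof (rule nh_le_sup)
      fix j assume j: "j \<le> M * r"
      show "\<bar>\<eta> i (x j)\<bar> \<le> G * \<tau> ^ k * (2 + sA)"
        using stage_defect_bound[OF ctx x_in[OF j]] by (simp add: \<eta>_def interp(2)[OF j])
    qed
    then show ?thesis using dfac by linarith
  qed
  have \<eta>2: "ng (\<eta> i) \<le> \<delta>" for i
  proof -
    have "ng (\<eta> i) \<le> \<Lambda> * L2_norm a b (stage_defect_deriv t0 \<tau> i)"
      unfolding \<eta>_def by (rule interp_stability[OF stage_defect_deriv(1,3)[OF ctx]])
    also have "\<dots> \<le> \<Lambda> * (G * \<tau> ^ k * (2 + sA))"
      using \<Lambda> by (intro mult_left_mono stage_defect_deriv(2)[OF ctx]) auto
    finally show ?thesis using dfac by linarith
  qed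
  have \<eta>'1: "nh \<eta>' \<le> \<tau> * \<delta>"
  proof -
    have "nh \<eta>' \<le> (G * \<tau> ^ (k + 1) * (2 + sb)) * sqrt (b - a)"
      by (rule nh_le_sup) (use step_defect_bound[OF ctx x_in] in \<open>simp add: \<eta>'_def\<close>)
    also have "\<dots> = \<tau> * (G * \<tau> ^ k * (2 + sb) * sqrt (b - a))" by simp
    also have "\<dots> \<le> \<tau> * \<delta>" using \<tau> dfac by (intro mult_left_mono) auto
    finally show ?thesis .
  qed
  have "(nh Z)\<^sup>2 \<le> (nh (e (n - 1)))\<^sup>2 + CS * \<tau> * (K\<^sup>2 + \<delta>\<^sup>2 + (nh (e (n - 1)))\<^sup>2)"
    unfolding CS_def by (rule energy_step[OF stab \<tau>(1,2) K0 \<delta>0 ES \<eta>S Enode Znode weak \<eta>1 \<eta>2 \<eta>'1])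
  moreover have "nh (e n) \<le> nh Z"
  proof (rule nh_mono)
    fix j assume j: "j \<le> M * r"
    have "\<bar>u (real n * \<tau>) (x j)\<bar> \<le> \<alpha>" using n by (intro u_bound time_in x_in j) auto
    then show "\<bar>e n (x j)\<bar> \<le> \<bar>Z (x j)\<bar>"
      unfolding e_node[OF j] cut[OF j] Z_def interp(2)[OF j] by (rule cutoff_contraction)
  qed
  then have "(nh (e n))\<^sup>2 \<le> (nh Z)\<^sup>2" using nh_nonneg by (intro power_mono)
  ultimately show ?thesis unfolding K_def \<delta>_def by linarith
qed

lemma discrete_error:
  assumes n: "n \<le> N"
  shows "nh (e n) \<le> sqrt (exp (CG c \<Lambda> * real (k + 1) * T)) * ((\<Sum>l<k. nh (e l)) + (H ^ (r + 1) + \<tau> ^ k))"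
proof -
  define h where "h = H ^ (r + 1) + \<tau> ^ k"
  have h: "0 \<le> h" "\<tau> ^ k \<le> h" using H_pos \<tau> by (auto simp: h_def)
  define y where "y n = (nh (e n))\<^sup>2" for n
  have step: "y n \<le> y (n - 1) + CG c \<Lambda> * \<tau> * ((\<Sum>l=1..k. y (n - l)) + h\<^sup>2)" if n: "n \<in> {k..N}" for n
  proof -
    define s where "s = (\<Sum>l=1..k. nh (e (n - l)))"
    define Y where "Y = (\<Sum>l=1..k. y (n - l))"
    let ?K = "CK c \<Lambda>" and ?D = "CD \<Lambda>"
    \<comment> \<open>The recursion is linear in squared norms; passing from the square of the sum
      of past norms to their squares costs the factor \<open>k\<close>.\<close>
    have "s\<^sup>2 \<le> (\<Sum>l=1..k. (nh (e (n - l)))\<^sup>2) * card {1..k}"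
      unfolding s_def by (rule sum_squared_le_sum_of_squares)
    then have s2: "s\<^sup>2 \<le> real k * Y" by (simp add: Y_def y_def mult.commute)
    have "0 \<le> (h - s)\<^sup>2" by simp
    then have "(h + s)\<^sup>2 \<le> 2 * h\<^sup>2 + 2 * s\<^sup>2" by (simp add: power2_eq_square algebra_simps)
    then have "(h + s)\<^sup>2 \<le> 2 * h\<^sup>2 + 2 * (real k * Y)" using s2 by linarith
    then have "?K\<^sup>2 * (h + s)\<^sup>2 \<le> ?K\<^sup>2 * (2 * h\<^sup>2 + 2 * (real k * Y))" by (rule mult_left_mono) simp
    then have 1: "(?K * (h + s))\<^sup>2 \<le> 2 * ?K\<^sup>2 * h\<^sup>2 + 2 * ?K\<^sup>2 * real k * Y"
      by (subst power_mult_distrib) (simp add: distrib_left mult_ac)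
    have "(\<tau> ^ k)\<^sup>2 \<le> h\<^sup>2" using h \<tau> by (intro power_mono) auto
    then have 2: "(?D * \<tau> ^ k)\<^sup>2 \<le> ?D\<^sup>2 * h\<^sup>2" unfolding power_mult_distrib by (rule mult_left_mono) simp
    have 3: "y (n - 1) \<le> Y" unfolding Y_def
      by (rule member_le_sum[where f="\<lambda>l. y (n - l)"]) (use k1 in \<open>auto simp: y_def\<close>)
    have Y0: "0 \<le> Y" unfolding Y_def by (intro sum_nonneg) (simp add: y_def)
    have "(?K * (h + s))\<^sup>2 + (?D * \<tau> ^ k)\<^sup>2 + y (n - 1) \<le> (2 * ?K\<^sup>2 * real (k + 1) + ?D\<^sup>2 + 1) * (Y + h\<^sup>2)"
    proof -
      have "0 \<le> ?K\<^sup>2 * Y" "0 \<le> ?D\<^sup>2 * Y" "0 \<le> ?K\<^sup>2 * real k * h\<^sup>2" "0 \<le> h\<^sup>2" using Y0 by auto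
      moreover have "(2 * ?K\<^sup>2 * real (k + 1) + ?D\<^sup>2 + 1) * (Y + h\<^sup>2) = 2 * ?K\<^sup>2 * h\<^sup>2 + 2 * ?K\<^sup>2 * real k * Y + ?D\<^sup>2 * h\<^sup>2 + Y
         + (2 * (?K\<^sup>2 * Y) + ?D\<^sup>2 * Y + 2 * (?K\<^sup>2 * real k * h\<^sup>2) + h\<^sup>2)"
        by (simp add: algebra_simps)
      ultimately show ?thesis using 1 2 3 by linarith
    qed
    then have "CS * \<tau> * ((?K * (h + s))\<^sup>2 + (?D * \<tau> ^ k)\<^sup>2 + y (n - 1)) \<le> CS * \<tau> * ((2 * ?K\<^sup>2 * real (k + 1) + ?D\<^sup>2 + 1) * (Y + h\<^sup>2))"
      using CS_nonneg \<tau> by (intro mult_left_mono) auto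
    moreover have "y n \<le> y (n - 1) + CS * \<tau> * ((?K * (h + s))\<^sup>2 + (?D * \<tau> ^ k)\<^sup>2 + y (n - 1))"
      using one_step[OF n] by (simp add: y_def h_def s_def add.assoc)
    ultimately show ?thesis unfolding Y_def CG_def by (simp add: mult_ac)
  qed
  have y: "y n \<le> exp (CG c \<Lambda> * real (k + 1) * (\<tau> * real N)) * ((\<Sum>l<k. y l) + h\<^sup>2)"
    by (rule discrete_gronwall[OF k1 CG_nonneg less_imp_le[OF \<tau>(1)] _ _ step n]) (auto simp: y_def)
  define s where "s = (\<Sum>l<k. nh (e l))"
  have s0: "0 \<le> s" unfolding s_def by (intro sum_nonneg nh_nonneg)
  have "L2_set (\<lambda>l. nh (e l)) {..<k} \<le> s" unfolding s_def by (rule L2_set_le_sum) (rule nh_nonneg)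
  then have "(L2_set (\<lambda>l. nh (e l)) {..<k})\<^sup>2 \<le> s\<^sup>2" by (rule power_mono) (rule L2_set_nonneg)
  then have "(\<Sum>l<k. y l) \<le> s\<^sup>2" by (simp add: L2_set_def y_def sum_nonneg)
  \<comment> \<open>Combining the starting terms and \<open>h\<close> into one square lets the final
    square root return a sum of norms.\<close>
  then have "(\<Sum>l<k. y l) + h\<^sup>2 \<le> (s + h)\<^sup>2"
    using mult_nonneg_nonneg[OF s0 h(1)] by (simp add: power2_eq_square algebra_simps)
  then have "exp (CG c \<Lambda> * real (k + 1) * T) * ((\<Sum>l<k. y l) + h\<^sup>2) \<le> exp (CG c \<Lambda> * real (k + 1) * T) * (s + h)\<^sup>2"
    by (intro mult_left_mono) auto
  then have "y n \<le> exp (CG c \<Lambda> * real (k + 1) * T) * (s + h)\<^sup>2" using y unfolding \<tau>(3) by linarith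
  then have "sqrt (y n) \<le> sqrt (exp (CG c \<Lambda> * real (k + 1) * T) * (s + h)\<^sup>2)" by (rule real_sqrt_le_mono)
  then show ?thesis using s0 h nh_nonneg[of "e n"] by (simp add: y_def real_sqrt_mult h_def s_def)
qed

text \<open>Two changes of norm frame the discrete estimate: \<open>L2_le_nh\<close> for the error
  at step \<open>n\<close>, \<open>nh_le_L2\<close> for the starting errors. The interpolation error
  is added each time.\<close>

lemma error_bound:
  assumes n: "n \<in> {k..N}"
  shows "L2_norm a b (\<lambda>y. u (real n * \<tau>) y - U n y) \<le> error_const c \<Lambda> * (\<tau> ^ k + H ^ (r + 1))
    + error_const c \<Lambda> * (\<Sum>l=0..k - 1. L2_norm a b (\<lambda>y. u (real l * \<tau>) y - U l y))"
proof -
  define h where "h = H ^ (r + 1) + \<tau> ^ k"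
  have h: "0 \<le> h" "H ^ (r + 1) \<le> h" using H_pos \<tau> by (auto simp: h_def)
  define CI where "CI = (1 + \<Lambda>) * G"
  define s8 where "s8 = sqrt (8 * \<Lambda>)"
  let ?err = "\<lambda>l. L2_norm a b (\<lambda>y. u (real l * \<tau>) y - U l y)"
  define R where "R = (\<Sum>l<k. ?err l)"
  have nn: "0 \<le> CI" "0 \<le> s8" "0 \<le> CE c \<Lambda>" "0 \<le> R"
    using \<Lambda> G c by (auto simp: CI_def s8_def CE_def R_def intro!: sum_nonneg L2_norm_nonneg)
  have I: "L2_norm a b (\<lambda>y. u (real l * \<tau>) y - Ih (u (real l * \<tau>)) y) \<le> CI * h" if "l \<le> N" for l
  proof -
    have "L2_norm a b (\<lambda>y. u (real l * \<tau>) y - Ih (u (real l * \<tau>)) y) \<le> CI * H ^ (r + 1)"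
      unfolding CI_def by (rule interp_error_u(1)[OF time_in[OF that]])
    also have "\<dots> \<le> CI * h" using nn h by (intro mult_left_mono) auto
    finally show ?thesis .
  qed
  have uL: "u (real l * \<tau>) \<in> L2_space a b" "(\<lambda>y. u (real l * \<tau>) y - Ih (u (real l * \<tau>)) y) \<in> L2_space a b"
    "(\<lambda>y. u (real l * \<tau>) y - U l y) \<in> L2_space a b" if "l \<le> N" for l
    using interp_error_u(2)[OF time_in[OF that]] fe_L2[OF interp(1)] fe_L2[OF U(1)[OF that]] by (auto intro!: L2_diff)
  have el: "nh (e l) \<le> s8 * (?err l + CI * h)" if l: "l \<le> N" for l
  proof -
    have "e l = (\<lambda>y. (u (real l * \<tau>) y - U l y) + (- 1) * (u (real l * \<tau>) y - Ih (u (real l * \<tau>)) y))"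
      by (simp add: fun_eq_iff e_def)
    moreover have "(\<lambda>y. (- 1) * (u (real l * \<tau>) y - Ih (u (real l * \<tau>)) y)) \<in> L2_space a b"
      using L2_linear[OF uL(2)[OF l] uL(2)[OF l], of "-1" 0] by simp
    ultimately have "L2_norm a b (e l) \<le> ?err l + L2_norm a b (\<lambda>y. (- 1) * (u (real l * \<tau>) y - Ih (u (real l * \<tau>)) y))"
      using L2_norm_triangle[OF uL(3)[OF l]] by metis
    also have "\<dots> \<le> ?err l + CI * h" using I[OF l] unfolding L2_norm_scale by simp
    finally have "s8 * L2_norm a b (e l) \<le> s8 * (?err l + CI * h)" using nn by (intro mult_left_mono)
    then show ?thesis using nh_le_L2[OF e_S[OF l]] by (simp add: s8_def)
  qed
  have nN: "n \<le> N" "k \<le> N" using n by auto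
  have "(\<Sum>l<k. nh (e l)) \<le> (\<Sum>l<k. s8 * (?err l + CI * h))" by (intro sum_mono el) (use nN in auto)
  also have "\<dots> = s8 * R + real k * s8 * CI * h"
    by (simp add: R_def sum.distrib sum_distrib_left distrib_left mult_ac)
  finally have sum: "(\<Sum>l<k. nh (e l)) \<le> s8 * R + real k * s8 * CI * h" .
  have "L2_norm a b (e n) \<le> \<Lambda> / sqrt c * nh (e n)" by (rule L2_le_nh[OF e_S[OF nN(1)]])
  also have "\<dots> \<le> \<Lambda> / sqrt c * (sqrt (exp (CG c \<Lambda> * real (k + 1) * T)) * ((\<Sum>l<k. nh (e l)) + h))"
    using \<Lambda> c by (intro mult_left_mono discrete_error[OF nN(1), folded h_def]) auto
  also have "\<dots> = CE c \<Lambda> * ((\<Sum>l<k. nh (e l)) + h)" by (simp add: CE_def)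
  also have "\<dots> \<le> CE c \<Lambda> * ((s8 * R + real k * s8 * CI * h) + h)" using nn sum by (intro mult_left_mono add_mono) auto
  finally have en: "L2_norm a b (e n) \<le> CE c \<Lambda> * ((s8 * R + real k * s8 * CI * h) + h)" .
  have "(\<lambda>y. u (real n * \<tau>) y - U n y) = (\<lambda>y. (u (real n * \<tau>) y - Ih (u (real n * \<tau>)) y) + e n y)"
    by (simp add: fun_eq_iff e_def)
  then have "?err n \<le> CI * h + CE c \<Lambda> * ((s8 * R + real k * s8 * CI * h) + h)"
    using L2_norm_triangle[OF uL(2)[OF nN(1)] fe_L2[OF e_S[OF nN(1)]]] I[OF nN(1)] en by simp
  also have "\<dots> \<le> error_const c \<Lambda> * h + error_const c \<Lambda> * R"
  proof -
    have ec: "error_const c \<Lambda> = 1 + CI + CE c \<Lambda> * (s8 + real k * s8 * CI + 1)"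
      by (simp only: error_const_def CI_def s8_def)
    \<comment> \<open>The slack in the constant is written out as a sum of nonnegative
      terms.\<close>
    have "error_const c \<Lambda> * h + error_const c \<Lambda> * R - (CI * h + CE c \<Lambda> * ((s8 * R + real k * s8 * CI * h) + h))
       = h + CE c \<Lambda> * s8 * h + R + CI * R + CE c \<Lambda> * (real k * s8 * CI) * R + CE c \<Lambda> * R"
      unfolding ec by (simp add: algebra_simps)
    also have "\<dots> \<ge> 0" using nn h by (intro add_nonneg_nonneg mult_nonneg_nonneg) auto
    finally show ?thesis by simp
  qed
  also have "{..<k} = {0..k - 1}" using k1 by auto
  then have "R = (\<Sum>l=0..k - 1. ?err l)" by (simp add: R_def)
  finally show ?thesis by (simp add: h_def add.commute)
qed

end

context regular_solution
begin

text \<open>The constant is exhibited first; only afterwards are mesh and numerical solution fixed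
  and \<open>cutoff_scheme\<close> interpreted for them.\<close>

lemma error_estimate:
  assumes L: "lobatto r c \<Lambda>"
  shows "\<exists>C>0. \<forall>M N x \<omega> U. M \<ge> 1 \<longrightarrow> N \<ge> 1 \<longrightarrow>
        gauss_lobatto_mesh a b r M x \<omega> \<longrightarrow>
        (\<forall>l<k. U l \<in> fe_space a b r M x \<and> (\<forall>j\<le>M * r. \<bar>U l (x j)\<bar> \<le> \<alpha>)) \<longrightarrow>
        cutoff_rk_scheme a b r M x \<omega> \<alpha> f A \<beta> cc k (T / real N) N U \<longrightarrow>
        (\<forall>n\<in>{k..N}.
           L2_norm a b (\<lambda>y. u (real n * (T / real N)) y - U n y)
             \<le> C * ((T / real N) ^ k + ((b - a) / real M) ^ (r + 1))
               + C * (\<Sum>l=0..k - 1. L2_norm a b (\<lambda>y. u (real l * (T / real N)) y - U l y)))"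
proof (intro exI[of _ "error_const c \<Lambda>"] conjI allI impI ballI)
  interpret lobatto r c \<Lambda> by (rule L)
  show "0 < error_const c \<Lambda>"
    unfolding error_const_def CE_def using \<Lambda> c G
    by (intro add_pos_nonneg mult_nonneg_nonneg add_nonneg_nonneg) auto
  fix M N :: nat and x \<omega> :: "nat \<Rightarrow> real" and U :: "nat \<Rightarrow> real \<Rightarrow> real" and n
  assume *: "1 \<le> M" "1 \<le> N" "gauss_lobatto_mesh a b r M x \<omega>"
    "\<forall>l<k. U l \<in> fe_space a b r M x \<and> (\<forall>j\<le>M * r. \<bar>U l (x j)\<bar> \<le> \<alpha>)"
    "cutoff_rk_scheme a b r M x \<omega> \<alpha> f A \<beta> cc k (T / real N) N U" and n: "n \<in> {k..N}"
  interpret C: cutoff_scheme a b T \<alpha> r k A \<beta> cc f u Ut Wt g kk Ft G Lf c \<Lambda> M x \<omega> N U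
    by unfold_locales (use * a_less_b in auto)
  show "L2_norm a b (\<lambda>y. u (real n * (T / real N)) y - U n y)
      \<le> error_const c \<Lambda> * ((T / real N) ^ k + ((b - a) / real M) ^ (r + 1))
        + error_const c \<Lambda> * (\<Sum>l=0..k - 1. L2_norm a b (\<lambda>y. u (real l * (T / real N)) y - U l y))"
    using C.error_bound[OF n] unfolding C.\<tau>_def C.H_def .
qed

end

section \<open>Consequences of the regularity assumptions\<close>

text \<open>Compactness of the interval, through the time-dependent notion
  \<open>local_lipschitz\<close> with a single dummy time.\<close>

lemma locally_lipschitz_imp_lipschitz_on_interval:
  assumes "locally_lipschitz f"
  obtains L where "0 \<le> L" "\<And>s s'. \<bar>s\<bar> \<le> \<alpha> \<Longrightarrow> \<bar>s'\<bar> \<le> \<alpha> \<Longrightarrow> \<bar>f s - f s'\<bar> \<le> L * \<bar>s - s'\<bar>"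
proof -
  have ll: "local_lipschitz {0::real} {- \<alpha>..\<alpha>} (\<lambda>_. f)"
  proof (rule local_lipschitzI)
    fix t x :: real
    obtain \<epsilon> L where "\<epsilon> > 0" "L-lipschitz_on (cball x \<epsilon>) f" using assms unfolding locally_lipschitz_def by blast
    then have "\<epsilon> > 0" "\<forall>t\<in>cball t \<epsilon> \<inter> {0::real}. L-lipschitz_on (cball x \<epsilon> \<inter> {- \<alpha>..\<alpha>}) f"
      by (auto intro: lipschitz_on_subset)
    then show "\<exists>u>0. \<exists>L. \<forall>t\<in>cball t u \<inter> {0::real}. L-lipschitz_on (cball x u \<inter> {- \<alpha>..\<alpha>}) f" by blast
  qed
  obtain L where L: "\<And>t. t \<in> {0::real} \<Longrightarrow> L-lipschitz_on {- \<alpha>..\<alpha>} f"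
    by (rule local_lipschitz_compact_implies_lipschitz[OF ll]) auto
  then have L: "L-lipschitz_on {- \<alpha>..\<alpha>} f" by simp
  show ?thesis
  proof (rule that[of L])
    show "0 \<le> L" using L by (rule lipschitz_on_nonneg)
    show "\<bar>f s - f s'\<bar> \<le> L * \<bar>s - s'\<bar>" if "\<bar>s\<bar> \<le> \<alpha>" "\<bar>s'\<bar> \<le> \<alpha>" for s s'
    proof -
      have "s \<in> {- \<alpha>..\<alpha>}" "s' \<in> {- \<alpha>..\<alpha>}" using that by (auto simp: abs_le_iff)
      from lipschitz_onD[OF L this] show ?thesis by (simp add: dist_real_def)
    qed
  qed
qed

text \<open>The witness of \<open>Ck_sobolev\<close> becomes a parameter, because different orders
  in time and space are used side by side.\<close>

locale time_regular =
  fixes a b T :: real and j s :: nat and D :: "nat \<Rightarrow> real \<Rightarrow> real \<Rightarrow> real"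
  assumes ab: "a < b"
    and D: "\<And>i t. i \<le> j \<Longrightarrow> t \<in> {0..T} \<Longrightarrow> D i t \<in> sobolev_space a b s"
    and D_deriv: "\<And>i t. i < j \<Longrightarrow> t \<in> {0..T} \<Longrightarrow>
       ((\<lambda>\<sigma>. sobolev_norm a b s (\<lambda>x. (D i \<sigma> x - D i t x) / (\<sigma> - t) - D (Suc i) t x)) \<longlongrightarrow> 0) (at t within {0..T})"
    and D_cont: "\<And>t. t \<in> {0..T} \<Longrightarrow> ((\<lambda>\<sigma>. sobolev_norm a b s (\<lambda>x. D j \<sigma> x - D j t x)) \<longlongrightarrow> 0) (at t within {0..T})"
begin

lemma norm_bounded: "i \<le> j \<Longrightarrow> \<exists>G>0. \<forall>t\<in>{0..T}. sobolev_norm a b s (D i t) \<le> G"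
proof -
  assume i: "i \<le> j"
  have lim: "((\<lambda>\<sigma>. sobolev_norm a b s (\<lambda>x. D i \<sigma> x - D i t x)) \<longlongrightarrow> 0) (at t within {0..T})" if t: "t \<in> {0..T}" for t
  proof (cases "i = j")
    case True
    then show ?thesis using D_cont[OF t] by simp
  next
    case False
    then have ij: "i < j" using i by simp
    show ?thesis
      by (rule sobolev_differentiable_imp_continuous[where E="D (Suc i) t", OF D[OF i] D[OF Suc_leI[OF ij] t] D_deriv[OF ij t] t])
  qed
  from sobolev_norm_bounded[where D="D i" and T=T, OF D[OF i] lim]
  obtain G where "G > 0" "\<And>t. t \<in> {0..T} \<Longrightarrow> sobolev_norm a b s (D i t) \<le> G" by blast
  then show ?thesis by blast
qed

lemma cderiv_time_deriv:
  assumes "i < j" "n < s" "t \<in> {0..T}" "y \<in> {a..b}"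
  shows "((\<lambda>t. cderiv a b n (D i t) y) has_real_derivative cderiv a b n (D (Suc i) t) y) (at t within {0..T})"
proof (rule sobolev_functional_deriv[where D="D i" and \<Phi>="\<lambda>v. cderiv a b n v y"])
  show "cderiv a b n (\<lambda>x. p * v x + q * w x) y = p * cderiv a b n v y + q * cderiv a b n w y"
    if "v \<in> sobolev_space a b s" "w \<in> sobolev_space a b s" for v w p q
    by (rule cderiv_linear[OF that assms(2) ab assms(4)])
  show "\<bar>cderiv a b n v y\<bar> \<le> (sqrt (b - a) * (2 + 1 / (b - a))) * sobolev_norm a b s v"
    if "v \<in> sobolev_space a b s" for v
    by (rule cderiv_bound[OF ab that assms(2,4)])
qed (use assms D D_deriv in auto)

text \<open>Inner products with a fixed function take the place of point values: at the top order
  \<open>n = s\<close> the weak derivative may lack a continuous representative.\<close>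

lemma weak_deriv_time_deriv:
  assumes "i < j" "n \<le> s" "t \<in> {0..T}" and q: "q \<in> L2_space a b"
  shows "((\<lambda>t. L2_inner a b (weak_deriv a b n (D i t)) q) has_real_derivative L2_inner a b (weak_deriv a b n (D (Suc i) t)) q) (at t within {0..T})"
proof (rule sobolev_functional_deriv[where D="D i" and \<Phi>="\<lambda>v. L2_inner a b (weak_deriv a b n v) q"])
  show "L2_inner a b (weak_deriv a b n (\<lambda>x. c * v x + d * w x)) q = c * L2_inner a b (weak_deriv a b n v) q + d * L2_inner a b (weak_deriv a b n w) q"
    if v: "v \<in> sobolev_space a b s" and w: "w \<in> sobolev_space a b s" for v w c d
  proof -
    note L = weak_deriv(2)[OF v assms(2)] weak_deriv(2)[OF w assms(2)]
    have "L2_inner a b (weak_deriv a b n (\<lambda>x. c * v x + d * w x)) q = L2_inner a b (\<lambda>x. c * weak_deriv a b n v x + d * weak_deriv a b n w x) q"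
      by (rule L2_inner_cong_AE[OF weak_deriv_linear[OF v w assms(2)]])
        (use q in \<open>auto intro: L2_linear L weak_deriv(2)[OF sobolev_space_linear[OF v w] assms(2)]\<close>)
    then show ?thesis using L2_inner_linear[OF L q] by simp
  qed
  show "\<bar>L2_inner a b (weak_deriv a b n v) q\<bar> \<le> L2_norm a b q * sobolev_norm a b s v"
    if v: "v \<in> sobolev_space a b s" for v
  proof -
    have "\<bar>L2_inner a b (weak_deriv a b n v) q\<bar> \<le> L2_norm a b (weak_deriv a b n v) * L2_norm a b q"
      by (rule L2_Cauchy_Schwarz[OF weak_deriv(2)[OF v assms(2)] q])
    also have "\<dots> \<le> sobolev_norm a b s v * L2_norm a b q"
      by (intro mult_right_mono weak_deriv_norm_le[OF ab v assms(2)] L2_norm_nonneg)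
    finally show ?thesis by (simp add: mult.commute)
  qed
qed (use assms D D_deriv in auto)

lemma cderiv_bounded:
  assumes "i \<le> j" "n < s"
  shows "\<exists>G>0. \<forall>t\<in>{0..T}. \<forall>y\<in>{a..b}. \<bar>cderiv a b n (D i t) y\<bar> \<le> G"
proof -
  let ?C = "sqrt (b - a) * (2 + 1 / (b - a))"
  obtain G where G: "G > 0" "\<forall>t\<in>{0..T}. sobolev_norm a b s (D i t) \<le> G" using norm_bounded[OF assms(1)] by blast
  have C: "?C > 0" using ab by (intro mult_pos_pos add_pos_pos) auto
  have "\<bar>cderiv a b n (D i t) y\<bar> \<le> ?C * G" if "t \<in> {0..T}" "y \<in> {a..b}" for t y
    using cderiv_bound[OF ab D[OF assms(1) that(1)] assms(2) that(2)] mult_left_mono[of "sobolev_norm a b s (D i t)" G ?C] G C that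
    by fastforce
  then show ?thesis using C G by (intro exI[of _ "?C * G"]) auto
qed

end

lemma Ck_sobolevE:
  assumes "Ck_sobolev a b T j s v" "a < b"
  obtains D where "time_regular a b T j s D" "\<And>t. t \<in> {0..T} \<Longrightarrow> D 0 t = v t"
proof -
  obtain D where D: "\<forall>t\<in>{0..T}. D 0 t = v t" "\<forall>i\<le>j. \<forall>t\<in>{0..T}. D i t \<in> sobolev_space a b s"
    "\<forall>i<j. \<forall>t\<in>{0..T}. ((\<lambda>\<sigma>. sobolev_norm a b s (\<lambda>x. (D i \<sigma> x - D i t x) / (\<sigma> - t) - D (Suc i) t x)) \<longlongrightarrow> 0) (at t within {0..T})"
    "\<forall>t\<in>{0..T}. ((\<lambda>\<sigma>. sobolev_norm a b s (\<lambda>x. D j \<sigma> x - D j t x)) \<longlongrightarrow> 0) (at t within {0..T})"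
    using assms(1) unfolding Ck_sobolev_def by blast
  show ?thesis
  proof (rule that[of D])
    show "time_regular a b T j s D" by (rule time_regular.intro) (use assms(2) D in simp_all)
  qed (use D in simp)
qed

text \<open>The equation is given in the open space-time rectangle and the boundary condition at
  open times; continuity extends both. Time derivatives come from the witness \<open>D\<close>,
  which is of high order in time but only in \<open>H^1\<close>; continuity in time of the space
  derivatives comes from \<open>D'\<close>.\<close>

lemma regular_imp_classical:
  assumes u: "Ck_sobolev a b T 1 s u" and s: "3 < s" and ab: "a < b" and T: "T > 0"
    and f: "continuous_on UNIV f" and sol: "allen_cahn_solution a b T f u0 u"
    and D: "time_regular a b T m 1 D" "1 < m" "\<And>t. t \<in> {0..T} \<Longrightarrow> D 0 t = u t"
    and t: "t \<in> {0..T}"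
  shows "cderiv a b 1 (u t) a = 0" "cderiv a b 1 (u t) b = 0"
    and "y \<in> {a..b} \<Longrightarrow> cderiv a b 0 (D 1 t) y = cderiv a b 2 (u t) y + f (u t y)"
proof -
  obtain D' where D': "time_regular a b T 1 s D'" "\<And>t. t \<in> {0..T} \<Longrightarrow> D' 0 t = u t"
    using Ck_sobolevE[OF u ab] by blast
  interpret D: time_regular a b T m 1 D by (rule D(1))
  interpret D': time_regular a b T 1 s D' by (rule D'(1))
  have uS: "u t \<in> sobolev_space a b s" if "t \<in> {0..T}" for t using D'.D[of 0 t] D'(2) that by simp
  have uc: "continuous_on {a..b} (u t)" if "t \<in> {0..T}" for t
  proof -
    have "continuous_on ({0..T} \<times> {a..b}) (\<lambda>(t, x). u t x)" using sol by (simp add: allen_cahn_solution_def)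
    then have "continuous_on {a..b} (\<lambda>x. (\<lambda>(t, x). u t x) (t, x))"
      by (rule continuous_on_compose2) (use that in \<open>auto intro!: continuous_intros\<close>)
    then show ?thesis by simp
  qed
  have u0: "cderiv a b 0 (u t) y = u t y" if "t \<in> {0..T}" "y \<in> {a..b}" for t y
    by (rule cderiv_0[OF ab uS _ uc]) (use that s in auto)
  have Du0: "cderiv a b 0 (D 0 t) y = u t y" if "t \<in> {0..T}" "y \<in> {a..b}" for t y
    unfolding D(3)[OF that(1)] by (rule cderiv_0[OF ab D.D[of 0 t, unfolded D(3)[OF that(1)]] _ uc]) (use that in auto)
  have space_deriv: "(u t has_real_derivative cderiv a b 1 (u t) y) (at y within {a..b})" if "t \<in> {0..T}" "y \<in> {a..b}" for t y
  proof -
    have "(cderiv a b 0 (u t) has_real_derivative cderiv a b 1 (u t) y) (at y within {a..b})"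
      using cderiv_has_derivative[OF ab uS[OF that(1)], of 0 y] s that by simp
    then show ?thesis unfolding has_field_derivative_def
      by (rule has_derivative_transform[OF that(2), rotated]) (use u0 that in auto)
  qed
  have cont_t: "continuous_on {0..T} (\<lambda>t. cderiv a b n (u t) y)" if "n < s" "y \<in> {a..b}" for n y
  proof -
    have "continuous_on {0..T} (\<lambda>t. cderiv a b n (D' 0 t) y)"
      unfolding continuous_on_eq_continuous_within
      by (intro ballI, rule DERIV_continuous, rule D'.cderiv_time_deriv) (use that in auto)
    then show ?thesis by (rule continuous_on_eq) (simp add: D'(2))
  qed
  have clo: "closure {0<..<T} = {0..T}" "closure {a<..<b} = {a..b}" using T ab by auto
  \<comment> \<open>The one-sided derivative at an end point is unique, so the Neumann condition
    carries over to \<open>cderiv\<close>.\<close>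
  have neu: "cderiv a b 1 (u t) y = 0" if t: "t \<in> {0<..<T}" and y: "y \<in> {a, b}" for t y
  proof -
    have "(u t has_real_derivative 0) (at y within {a..b})" using sol t y unfolding allen_cahn_solution_def by blast
    moreover have "(u t has_real_derivative cderiv a b 1 (u t) y) (at y within {a..b})"
      by (rule space_deriv) (use t y ab in auto)
    ultimately show ?thesis
      using vector_derivative_unique_within_closed_interval[OF ab, of y "u t" 0 "cderiv a b 1 (u t) y"] y ab
      by (auto simp: has_real_derivative_iff_has_vector_derivative)
  qed
  have "cderiv a b 1 (u t) y = 0" if y: "y \<in> {a, b}" for y
  proof -
    have "continuous_on {0..T} (\<lambda>t. cderiv a b 1 (u t) y)" by (rule cont_t) (use y ab s in auto)
    from continuous_constant_on_closure[where S="{0<..<T}", unfolded clo, OF this neu[OF _ y] t] show ?thesis .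
  qed
  then show "cderiv a b 1 (u t) a = 0" "cderiv a b 1 (u t) b = 0" by auto
  \<comment> \<open>The residual of the equation. Continuity in each variable separately suffices,
    since the closure is taken first in space and then in time.\<close>
  define h where "h t y = cderiv a b 0 (D 1 t) y - (cderiv a b 2 (u t) y + f (u t y))" for t y
  have h0: "h t y = 0" if t: "t \<in> {0<..<T}" and y: "y \<in> {a<..<b}" for t y
  proof -
    have tT: "t \<in> {0..T}" and yab: "y \<in> {a..b}" using t y by auto
    have d1: "deriv (u t) z = cderiv a b 1 (u t) z" if z: "z \<in> {a<..<b}" for z
    proof -
      have "at z within {a..b} = at z" using z by (intro at_within_interior) simp
      then show ?thesis using space_deriv[OF tT, of z] z by (intro DERIV_imp_deriv) auto
    qed
    have "(cderiv a b 1 (u t) has_real_derivative cderiv a b 2 (u t) y) (at y within {a..b})"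
      using cderiv_has_derivative[OF ab uS[OF tT], of 1 y] s yab by (simp add: numeral_2_eq_2)
    moreover have "at y within {a..b} = at y" using y by (intro at_within_interior) simp
    ultimately have d2: "(cderiv a b 1 (u t) has_real_derivative cderiv a b 2 (u t) y) (at y)" by simp
    have "\<forall>\<^sub>F z in nhds y. z \<in> {a<..<b}" using y by (intro eventually_nhds_in_open) auto
    then have ev: "\<forall>\<^sub>F z in nhds y. deriv (u t) z = cderiv a b 1 (u t) z" by eventually_elim (rule d1)
    have dd: "deriv (deriv (u t)) y = cderiv a b 2 (u t) y"
      using DERIV_cong_ev[OF refl ev refl] d2 DERIV_imp_deriv by blast
    have "((\<lambda>s. u s y) has_real_derivative deriv (deriv (u t)) y + f (u t y)) (at t)"
      using sol t y unfolding allen_cahn_solution_def by blast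
    then have 1: "((\<lambda>s. u s y) has_real_derivative cderiv a b 2 (u t) y + f (u t y)) (at t)"
      unfolding dd .
    have "((\<lambda>t. cderiv a b 0 (D 0 t) y) has_real_derivative cderiv a b 0 (D (Suc 0) t) y) (at t within {0..T})"
      by (rule D.cderiv_time_deriv) (use D(2) tT yab in auto)
    then have "((\<lambda>t. u t y) has_real_derivative cderiv a b 0 (D (Suc 0) t) y) (at t within {0..T})"
      unfolding has_field_derivative_def
      by (rule has_derivative_transform[OF tT, rotated]) (use Du0 yab in auto)
    moreover have "at t within {0..T} = at t" using t by (intro at_within_interior) simp
    ultimately have "((\<lambda>t. u t y) has_real_derivative cderiv a b 0 (D (Suc 0) t) y) (at t)" by simp
    \<comment> \<open>At an interior time, uniqueness of the derivative identifies the one taken in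
      the Sobolev norm with the one in the differential equation.\<close>
    then have "cderiv a b 0 (D (Suc 0) t) y = cderiv a b 2 (u t) y + f (u t y)" using 1 by (rule DERIV_unique)
    then show ?thesis by (simp add: h_def)
  qed
  have h1: "h t y = 0" if t: "t \<in> {0<..<T}" and y: "y \<in> {a..b}" for t y
  proof -
    have tT: "t \<in> {0..T}" using t by auto
    have "continuous_on {a..b} (\<lambda>y. h t y)" unfolding h_def
      by (intro continuous_intros cderiv_continuous[OF ab D.D] cderiv_continuous[OF ab uS[OF tT]] continuous_on_compose2[OF f uc[OF tT]])
        (use D(2) tT s in auto)
    from continuous_constant_on_closure[where S="{a<..<b}", unfolded clo, OF this h0[OF t] y] show ?thesis .
  qed
  show "cderiv a b 0 (D 1 t) y = cderiv a b 2 (u t) y + f (u t y)" if y: "y \<in> {a..b}"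
  proof -
    have cD: "continuous_on {0..T} (\<lambda>t. cderiv a b 0 (D i t) y)" if "i < m" for i
      unfolding continuous_on_eq_continuous_within
      by (intro ballI, rule DERIV_continuous, rule D.cderiv_time_deriv[OF that]) (use y in auto)
    have "continuous_on {0..T} (\<lambda>t. u t y)"
      by (rule continuous_on_eq[OF cD[of 0]]) (use D(2) Du0 y in auto)
    then have "continuous_on {0..T} (\<lambda>t. h t y)" unfolding h_def
      by (intro continuous_intros cD cont_t continuous_on_compose2[OF f]) (use D(2) s y in auto)
    from continuous_constant_on_closure[where S="{0<..<T}", unfolded clo, OF this h1[OF _ y] t] have "h t y = 0" .
    then show ?thesis by (simp add: h_def)
  qed
qed

lemma lobatto_exists:
  assumes "r \<ge> 1" shows "\<exists>c \<Lambda>. lobatto r c \<Lambda>"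
proof (rule gauss_lobatto_constants[OF assms])
  fix c \<Lambda> :: real
  assume A: "c > 0" "\<Lambda> \<ge> 1"
    "\<And>lo hi y \<omega> j. lo < hi \<Longrightarrow> gauss_lobatto r lo hi y \<omega> \<Longrightarrow> j \<le> r \<Longrightarrow> c * (hi - lo) \<le> \<omega> j"
    and B: "\<And>lo hi y \<omega> q B s. lo < hi \<Longrightarrow> gauss_lobatto r lo hi y \<omega> \<Longrightarrow> degree q \<le> r \<Longrightarrow>
       (\<And>j. j \<le> r \<Longrightarrow> \<bar>poly q (y j)\<bar> \<le> B) \<Longrightarrow> s \<in> {lo..hi} \<Longrightarrow>
       \<bar>poly q s\<bar> \<le> \<Lambda> * B \<and> \<bar>poly (pderiv q) s\<bar> \<le> \<Lambda> * B / (hi - lo)"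
  have "lobatto r c \<Lambda>"
  proof (rule lobatto.intro)
    show "c * (hi - lo) \<le> \<omega> j" if "lo < hi" "gauss_lobatto r lo hi y \<omega>" "j \<le> r" for lo hi y \<omega> j
      by (rule A(3)[OF that])
    show "\<bar>poly q s\<bar> \<le> \<Lambda> * B \<and> \<bar>poly (pderiv q) s\<bar> \<le> \<Lambda> * B / (hi - lo)"
      if "lo < hi" "gauss_lobatto r lo hi y \<omega>" "degree q \<le> r" "\<And>j. j \<le> r \<Longrightarrow> \<bar>poly q (y j)\<bar> \<le> B" "s \<in> {lo..hi}"
      for lo hi y \<omega> q B s
      by (rule B[OF that])
  qed (fact assms A(1) A(2))+
  then show ?thesis by blast
qed

theorem theorem3p3:
  fixes a b T \<alpha> :: real
    and f F u0 :: "real \<Rightarrow> real"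
    and u :: "real \<Rightarrow> real \<Rightarrow> real"
    and A :: "real^'m^'m" and \<beta> c :: "real^'m"
    and r p k :: nat
  assumes "a < b" and "T > 0" and "\<alpha> > 0"
    and potential: "double_well \<alpha> F" "\<And>s. (F has_real_derivative - f s) (at s)"
    and solution: "allen_cahn_solution a b T f u0 u"
    and "r \<ge> 1"
    and nodes: "inj (\<lambda>i. c $ i)" "\<And>i. c $ i \<in> {0..1}"
    and P5: "algebraically_stable A \<beta>"
    and collocation: "collocation_relations p A \<beta> c"
    and p: "p \<ge> CARD('m)"
    and k: "k = min p (CARD('m) + 1)"
    and initial_bound: "\<And>x. x \<in> {a..b} \<Longrightarrow> \<bar>u0 x\<bar> \<le> \<alpha>"
    and maximum_principle: "\<And>t x. t \<in> {0<..T} \<Longrightarrow> x \<in> {a..b} \<Longrightarrow> \<bar>u t x\<bar> \<le> \<alpha>"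
  shows
    "(\<forall>M N x \<omega> U. M \<ge> 1 \<longrightarrow> N \<ge> 1 \<longrightarrow>
        gauss_lobatto_mesh a b r M x \<omega> \<longrightarrow>
        (\<forall>l<k. U l \<in> fe_space a b r M x \<and> (\<forall>j\<le>M * r. \<bar>U l (x j)\<bar> \<le> \<alpha>)) \<longrightarrow>
        cutoff_rk_scheme a b r M x \<omega> \<alpha> f A \<beta> c k (T / real N) N U \<longrightarrow>
        (\<forall>n\<in>{k..N}. \<forall>j\<le>M * r. \<bar>U n (x j)\<bar> \<le> \<alpha>))
     \<and>
     (Ck_sobolev a b T (k + 1) 1 u \<and> Ck_sobolev a b T 1 (2 * r + 2) u \<and>
      locally_lipschitz f \<and>
      Ck_sobolev a b T k 1 (\<lambda>t x. f (u t x)) \<and>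
      Ck_sobolev a b T 0 (2 * r + 2) (\<lambda>t x. f (u t x)) \<longrightarrow>
      (\<exists>C>0. \<forall>M N x \<omega> U. M \<ge> 1 \<longrightarrow> N \<ge> 1 \<longrightarrow>
        gauss_lobatto_mesh a b r M x \<omega> \<longrightarrow>
        (\<forall>l<k. U l \<in> fe_space a b r M x \<and> (\<forall>j\<le>M * r. \<bar>U l (x j)\<bar> \<le> \<alpha>)) \<longrightarrow>
        cutoff_rk_scheme a b r M x \<omega> \<alpha> f A \<beta> c k (T / real N) N U \<longrightarrow>
        (\<forall>n\<in>{k..N}.
           L2_norm a b (\<lambda>y. u (real n * (T / real N)) y - U n y)
             \<le> C * ((T / real N) ^ k + ((b - a) / real M) ^ (r + 1))
               + C * (\<Sum>l=0..k - 1. L2_norm a b (\<lambda>y. u (real l * (T / real N)) y - U l y)))))"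
proof (rule conjI, goal_cases)
  case 1
  show ?case
  proof (intro allI impI ballI)
    fix M N x \<omega> U n j
    assume S: "cutoff_rk_scheme a b r M x \<omega> \<alpha> f A \<beta> c k (T / real N) N U" and "n \<in> {k..N}" "j \<le> M * r"
    then have "\<exists>z. U n (x j) = min (max (z (x j)) (- \<alpha>)) \<alpha>"
      unfolding cutoff_rk_scheme_def by fast
    then show "\<bar>U n (x j)\<bar> \<le> \<alpha>" using \<open>\<alpha> > 0\<close> by (auto simp: abs_le_iff min_def max_def)
  qed
next
  case 2
  show ?case (is "_ \<longrightarrow> ?Estimate")
  proof (intro impI, elim conjE)
    assume u1: "Ck_sobolev a b T (k + 1) 1 u" and u2: "Ck_sobolev a b T 1 (2 * r + 2) u"
      and lip: "locally_lipschitz f" and f1: "Ck_sobolev a b T k 1 (\<lambda>t x. f (u t x))"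
    note ab = \<open>a < b\<close>
    have "1 \<le> CARD('m)" using zero_less_card_finite[where 'a='m] by linarith
    \<comment> \<open>\<open>k \<le> p\<close> makes the weights exact up to degree
      \<open>k\<close>, and \<open>k - 1 \<le> CARD('m)\<close> supplies the stage relations up to
      degree \<open>k - 1\<close>.\<close>
    then have k1: "1 \<le> k" "k \<le> p" "k - 1 \<le> CARD('m)" using p unfolding k by linarith+
    obtain D where D: "time_regular a b T (k + 1) 1 D" "\<And>t. t \<in> {0..T} \<Longrightarrow> D 0 t = u t"
      using Ck_sobolevE[OF u1 ab] by blast
    obtain D' where D': "time_regular a b T 1 (2 * r + 2) D'" "\<And>t. t \<in> {0..T} \<Longrightarrow> D' 0 t = u t"
      using Ck_sobolevE[OF u2 ab] by blast
    obtain E where E: "time_regular a b T k 1 E" "\<And>t. t \<in> {0..T} \<Longrightarrow> E 0 t = (\<lambda>x. f (u t x))"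
      using Ck_sobolevE[OF f1 ab] by blast
    interpret D: time_regular a b T "k + 1" 1 D by (rule D(1))
    interpret D': time_regular a b T 1 "2 * r + 2" D' by (rule D'(1))
    interpret E: time_regular a b T k 1 E by (rule E(1))
    obtain Lf where Lf: "0 \<le> Lf" "\<And>s s'. \<bar>s\<bar> \<le> \<alpha> \<Longrightarrow> \<bar>s'\<bar> \<le> \<alpha> \<Longrightarrow> \<bar>f s - f s'\<bar> \<le> Lf * \<bar>s - s'\<bar>"
      using locally_lipschitz_imp_lipschitz_on_interval[OF lip, of \<alpha>] by blast
    have fc: "continuous_on UNIV f"
    proof (rule continuous_at_imp_continuous_on, rule ballI)
      fix s
      obtain \<epsilon> L where \<epsilon>: "\<epsilon> > 0" "L-lipschitz_on (cball s \<epsilon>) f" using lip unfolding locally_lipschitz_def by blast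
      then have "continuous_on (cball s \<epsilon>) f" by (intro lipschitz_on_continuous_on)
      then have "continuous_on (ball s \<epsilon>) f" by (rule continuous_on_subset) auto
      then show "isCont f s" using \<epsilon>(1) by (simp add: continuous_on_eq_continuous_at)
    qed
    have uc: "continuous_on {a..b} (u t)" if "t \<in> {0..T}" for t
    proof -
      have "continuous_on ({0..T} \<times> {a..b}) (\<lambda>(t, x). u t x)" using solution by (simp add: allen_cahn_solution_def)
      then have "continuous_on {a..b} (\<lambda>x. (\<lambda>(t, x). u t x) (t, x))"
        by (rule continuous_on_compose2) (use that in \<open>auto intro!: continuous_intros\<close>)
      then show ?thesis by simp
    qed
    have uS: "u t \<in> sobolev_space a b (2 * r + 2)" if "t \<in> {0..T}" for t using D'.D[of 0 t] D'(2) that by simp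
    \<comment> \<open>These are the orders used by the mesh estimates; \<open>r + 3\<close> is at
      most \<open>2 * r + 2\<close> because \<open>r \<ge> 1\<close>. For \<open>r = 1\<close> the
      last of them is the top order and therefore only weak.\<close>
    define kk where "kk t y = \<bar>weak_deriv a b (r + 1) (u t) y\<bar> + \<bar>weak_deriv a b (r + 2) (u t) y\<bar> + \<bar>weak_deriv a b (r + 3) (u t) y\<bar>" for t y
    have wL: "weak_deriv a b n (u t) \<in> L2_space a b" if "n \<le> 2 * r + 2" "t \<in> {0..T}" for n t
      by (rule weak_deriv(2)[OF uS[OF that(2)] that(1)])
    have kkL: "kk t \<in> L2_space a b" if "t \<in> {0..T}" for t
      unfolding kk_def by (intro L2_add L2_abs wL that) (use \<open>r \<ge> 1\<close> in auto)
    obtain G1 where G1: "G1 > 0" "\<forall>t\<in>{0..T}. \<forall>y\<in>{a..b}. \<bar>cderiv a b 0 (D k t) y\<bar> \<le> G1"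
      using D.cderiv_bounded[of k 0] by auto
    obtain G2 where G2: "G2 > 0" "\<forall>t\<in>{0..T}. \<forall>y\<in>{a..b}. \<bar>cderiv a b 0 (D (k + 1) t) y\<bar> \<le> G2"
      using D.cderiv_bounded[of "k + 1" 0] by auto
    obtain G3 where G3: "G3 > 0" "\<forall>t\<in>{0..T}. sobolev_norm a b 1 (D k t) \<le> G3"
      using D.norm_bounded[of k] by auto
    obtain G4 where G4: "G4 > 0" "\<forall>t\<in>{0..T}. sobolev_norm a b (2 * r + 2) (D' 0 t) \<le> G4"
      using D'.norm_bounded[of 0] by auto
    obtain G5 where G5: "G5 > 0" "\<forall>t\<in>{0..T}. \<forall>y\<in>{a..b}. \<bar>cderiv a b 0 (E k t) y\<bar> \<le> G5"
      using E.cderiv_bounded[of k 0] by auto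
    \<comment> \<open>One bound for all the quantities above; three copies of \<open>G4\<close> pay
      for the three summands of \<open>kk\<close>.\<close>
    define G where "G = G1 + G2 + G3 + 3 * G4 + G5"
    have G: "0 \<le> G" "G1 \<le> G" "G2 \<le> G" "G3 \<le> G" "3 * G4 \<le> G" "G5 \<le> G"
      using G1(1) G2(1) G3(1) G4(1) G5(1) by (auto simp: G_def)
    have "0 < k + 1" "1 < k + 1" "3 < 2 * r + 2" using k1 \<open>r \<ge> 1\<close> by auto
    note cl = regular_imp_classical[OF u2 \<open>3 < 2 * r + 2\<close> ab \<open>T > 0\<close> fc solution D(1) \<open>1 < k + 1\<close> D(2)]
    have R: "regular_solution a b T \<alpha> r k A \<beta> c f u (\<lambda>n t. cderiv a b 0 (D n t)) (\<lambda>n t. weak_deriv a b 1 (D n t))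
      (\<lambda>t n. cderiv a b n (u t)) kk (\<lambda>n t. cderiv a b 0 (E n t)) G Lf"
    proof (rule regular_solution.intro)
      show "(\<Sum>j\<in>UNIV. \<beta> $ j * (c $ j) ^ (l - 1)) = 1 ^ l / real l" if "l \<in> {1..k}" for l
        using collocation that k1 unfolding collocation_relations_def by simp
      show "(\<Sum>j\<in>UNIV. A $ i $ j * (c $ j) ^ (l - 1)) = (c $ i) ^ l / real l" if "l \<in> {1..k - 1}" for i l
        using collocation that k1 unfolding collocation_relations_def by simp
      show "((\<lambda>t. cderiv a b 0 (D n t) y) has_real_derivative cderiv a b 0 (D (Suc n) t) y) (at t within {0..T})"
        if "n \<le> k" "t \<in> {0..T}" "y \<in> {a..b}" for n t y
        using D.cderiv_time_deriv[of n 0 t y] that by simp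
      show "\<bar>cderiv a b 0 (D n t) y\<bar> \<le> G" if "n \<in> {k, Suc k}" "t \<in> {0..T}" "y \<in> {a..b}" for n t y
        using that G1(2) G2(2) G(2,3) by fastforce
      show "cderiv a b 0 (D 0 t) y = u t y" if t: "t \<in> {0..T}" and y: "y \<in> {a..b}" for t y
        using cderiv_0[OF ab D.D[of 0 t] _ _ y] uc[OF t] D(2)[OF t] t by simp
      show "weak_deriv a b 1 (D n t) \<in> L2_space a b" if "n \<le> k" "t \<in> {0..T}" for n t
        using weak_deriv(2)[OF D.D[of n t]] that by simp
      show "(weak_deriv a b 1 (D n t) has_integral cderiv a b 0 (D n t) y - cderiv a b 0 (D n t) s) {s..y}"
        if "n \<le> k" "t \<in> {0..T}" "a \<le> s" "s \<le> y" "y \<le> b" for n t s y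
        using weak_deriv_has_integral[OF ab D.D[of n t], of 0 s y] that by simp
      show "((\<lambda>t. L2_inner a b (weak_deriv a b 1 (D n t)) q) has_real_derivative L2_inner a b (weak_deriv a b 1 (D (Suc n) t)) q) (at t within {0..T})"
        if "n < k" "t \<in> {0..T}" "q \<in> L2_space a b" for n t q
        by (rule D.weak_deriv_time_deriv) (use that in auto)
      show "L2_norm a b (weak_deriv a b 1 (D k t)) \<le> G" if t: "t \<in> {0..T}" for t
        using weak_deriv_norm_le[OF ab D.D[of k t], of 1] G3(2) G(4) t by fastforce
      show "(cderiv a b (Suc n) (u t) has_integral cderiv a b n (u t) y - cderiv a b n (u t) s) {s..y}"
        if "t \<in> {0..T}" "n < r + 2" "a \<le> s" "s \<le> y" "y \<le> b" for t n s y
        by (rule cderiv_has_integral[OF ab uS]) (use that \<open>r \<ge> 1\<close> in auto)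
      show "L2_norm a b (kk t) \<le> G" if t: "t \<in> {0..T}" for t
      proof -
        have w: "L2_norm a b (\<lambda>y. \<bar>weak_deriv a b n (u t) y\<bar>) \<le> G4" if n: "n \<le> 2 * r + 2" for n
        proof -
          have "L2_norm a b (\<lambda>y. \<bar>weak_deriv a b n (u t) y\<bar>) = L2_norm a b (weak_deriv a b n (u t))"
            by (simp add: L2_norm_def L2_inner_def)
          also have "\<dots> \<le> sobolev_norm a b (2 * r + 2) (u t)" by (rule weak_deriv_norm_le[OF ab uS[OF t] n])
          also have "\<dots> \<le> G4" using bspec[OF G4(2) t] unfolding D'(2)[OF t] .
          finally show ?thesis .
        qed
        have n: "r + 1 \<le> 2 * r + 2" "r + 2 \<le> 2 * r + 2" "r + 3 \<le> 2 * r + 2" using \<open>r \<ge> 1\<close> by auto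
        note L = L2_abs[OF wL[OF n(1) t]] L2_abs[OF wL[OF n(2) t]] L2_abs[OF wL[OF n(3) t]]
        have "L2_norm a b (kk t) \<le> G4 + G4 + G4"
          using L2_norm_triangle[OF L2_add[OF L(1,2)] L(3)] L2_norm_triangle[OF L(1,2)] w[OF n(1)] w[OF n(2)] w[OF n(3)]
          unfolding kk_def[abs_def] by linarith
        then show ?thesis using G(5) by simp
      qed
      show "\<bar>cderiv a b n (u t) y - cderiv a b n (u t) s\<bar> \<le> integral {s..y} (\<lambda>y. \<bar>kk t y\<bar>)"
        if t: "t \<in> {0..T}" and n: "n \<in> {r, r + 1, r + 2}" and sy: "a \<le> s" "s \<le> y" "y \<le> b" for t n s y
      proof -
        have n': "Suc n \<le> 2 * r + 2" using n \<open>r \<ge> 1\<close> by auto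
        have "cderiv a b n (u t) y - cderiv a b n (u t) s = integral {s..y} (weak_deriv a b (Suc n) (u t))"
          using weak_deriv_has_integral[OF ab uS[OF t], of n s y] n' sy by (simp add: integral_unique)
        also have "\<bar>\<dots>\<bar> \<le> integral {s..y} (\<lambda>y. \<bar>weak_deriv a b (Suc n) (u t) y\<bar>)"
          by (rule abs_integral_L2_le(2)[OF wL[OF n' t] sy])
        also have "\<dots> \<le> integral {s..y} (\<lambda>y. \<bar>kk t y\<bar>)"
        proof (rule integral_le)
          show "(\<lambda>y. \<bar>weak_deriv a b (Suc n) (u t) y\<bar>) integrable_on {s..y}" by (rule abs_integral_L2_le(4)[OF wL[OF n' t] sy])
          show "(\<lambda>y. \<bar>kk t y\<bar>) integrable_on {s..y}" by (rule abs_integral_L2_le(4)[OF kkL[OF t] sy])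
          have "Suc n \<in> {r + 1, r + 2, r + 3}" using n by auto
          then show "\<bar>weak_deriv a b (Suc n) (u t) y\<bar> \<le> \<bar>kk t y\<bar>" for y unfolding kk_def by (auto simp: numeral_3_eq_3)
        qed
        finally show ?thesis .
      qed
      show "cderiv a b 0 (u t) y = u t y" if "t \<in> {0..T}" "y \<in> {a..b}" for t y
        by (rule cderiv_0[OF ab uS _ uc]) (use that in auto)
      show "cderiv a b 1 (u t) a = 0" "cderiv a b 1 (u t) b = 0" if "t \<in> {0..T}" for t
        using cl(1,2)[OF _ that] by auto
      show "cderiv a b 0 (D 1 t) y = cderiv a b 2 (u t) y + f (u t y)" if "t \<in> {0..T}" "y \<in> {a..b}" for t y
        using cl(3)[OF _ that] by auto
      show "((\<lambda>t. cderiv a b 0 (E n t) y) has_real_derivative cderiv a b 0 (E (Suc n) t) y) (at t within {0..T})"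
        if "n < k" "t \<in> {0..T}" "y \<in> {a..b}" for n t y
        using E.cderiv_time_deriv[of n 0 t y] that by simp
      show "\<bar>cderiv a b 0 (E k t) y\<bar> \<le> G" if "t \<in> {0..T}" "y \<in> {a..b}" for t y
        using that G5(2) G(6) by fastforce
      show "cderiv a b 0 (E 0 t) y = f (u t y)" if t: "t \<in> {0..T}" and y: "y \<in> {a..b}" for t y
      proof -
        have "continuous_on {a..b} (\<lambda>x. f (u t x))" by (rule continuous_on_compose2[OF fc uc[OF t]]) auto
        then show ?thesis using cderiv_0[OF ab E.D[of 0 t] _ _ y] E(2)[OF t] t by simp
      qed
      show "\<bar>u t y\<bar> \<le> \<alpha>" if t: "t \<in> {0..T}" and y: "y \<in> {a..b}" for t y
      proof (cases "t = 0")
        case True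
        then show ?thesis using solution initial_bound[OF y] y by (simp add: allen_cahn_solution_def)
      next
        case False
        then show ?thesis using maximum_principle t y by auto
      qed
      show "kk t \<in> L2_space a b" if "t \<in> {0..T}" for t by (rule kkL[OF that])
      show "c $ i \<in> {0..1}" for i by (rule nodes(2))
      show "\<bar>f s - f s'\<bar> \<le> Lf * \<bar>s - s'\<bar>" if "\<bar>s\<bar> \<le> \<alpha>" "\<bar>s'\<bar> \<le> \<alpha>" for s s' by (rule Lf(2)[OF that])
    qed (fact ab \<open>T > 0\<close> k1(1) G(1) Lf(1) P5)+
    obtain c0 \<Lambda> where "lobatto r c0 \<Lambda>" using lobatto_exists[OF \<open>r \<ge> 1\<close>] by blast
    from regular_solution.error_estimate[OF R this] show ?Estimate .
  qed
qed

end
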